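(* Let $k$ be an arbitrary field and let $a,b$ be integers with $3\leq a\leq b$. Let $\kappa_{p,1}$ denote the entries of the first row of the graded Betti table of $\mathbb{P}^1\times\mathbb{P}^1$ over $k$, embedded in $\mathbb{P}^{(a+1)(b+1)-1}$ via the line bundle $\mathcal{O}(a)\otimes\mathcal{O}(b)$. Then: (i) for all integers $p\geq ab+a$ we have $\kappa_{p,1}=p\binom{(a+1)b}{p+1}$; (ii) for $p=ab+a-1$ we have $\kappa_{p,1}=p\binom{(a+1)b}{p+1}+p$.
   Context: Put $N=(a+1)(b+1)$. The embedding is $$\mathbb{P}^1\times\mathbb{P}^1\to\mathbb{P}^{N-1},\quad ((x:y),(z:w))\mapsto (x^{a-i}y^{i}z^{b-j}w^{j})_{0\leq i\leq a,\,0\leq j\leq b}.$$ Let $S$ be the polynomial ring over $k$ in $N$ variables (each of degree one), indexed by the pairs $(i,j)$ with $0\le i\le a$, $0\le j\le b$. The homogeneous coordinate ring is the graded $S$-module $R=\bigoplus_{n\geq 0}R_n$, where $R_n$ has $k$-basis $b_{n,i,j}$ ($0\leq i\leq na$, $0\leq j\leq nb$), with multiplication $b_{n,i,j}\,b_{m,i',j'}=b_{n+m,i+i',j+j'}$, and $S$ acts by sending its variable $(i,j)$ to $b_{1,i,j}$. Let $0\to F_d\to\dots\to F_1\to F_0\to R$ be a minimal graded free resolution of $R$ over $S$ and write $F_p=\bigoplus_j S(-p-i_j)$, where $S(-m)$ is $S$ with its generator placed in degree $m$. Then $\kappa_{p,q}$ is the number of $j$ with $i_j=q$; equivalently $\kappa_{p,q}=\dim_k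 \mathrm{Tor}^S_p(R,k)_{p+q}$. Binomial coefficients $\binom{m}{n}$ with $n>m\geq 0$ are zero. *)

theory Defs
  imports "HOL-Algebra.Algebra" "HOL-Library.Poly_Mapping" "HOL-Library.Product_Plus"
begin

section \<open>Graded modules over a polynomial ring\<close>

text \<open>
  The polynomial ring over the field \<open>'k\<close> in the variables \<open>V\<close>: a monomial is a finitely
  supported exponent function, a polynomial a finitely supported function from monomials
  to coefficients.
\<close>

definition poly_ring :: "'v set \<Rightarrow> (('v \<Rightarrow>\<^sub>0 nat) \<Rightarrow>\<^sub>0 'k::field) ring" where
  "poly_ring V =
     \<lparr>carrier = {f. \<forall>m \<in> Poly_Mapping.keys f. Poly_Mapping.keys m \<subseteq> V},
      monoid.mult = (*), one = 1, ring.zero = 0, ring.add = (+)\<rparr>"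

definition mono_degree :: "('v \<Rightarrow>\<^sub>0 nat) \<Rightarrow> nat" where
  "mono_degree m = (\<Sum>v \<in> Poly_Mapping.keys m. Poly_Mapping.lookup m v)"

definition poly_component :: "'v set \<Rightarrow> int \<Rightarrow> (('v \<Rightarrow>\<^sub>0 nat) \<Rightarrow>\<^sub>0 'k::field) set" where
  "poly_component V n =
     {f \<in> carrier (poly_ring V). \<forall>m \<in> Poly_Mapping.keys f. int (mono_degree m) = n}"

definition irrelevant_ideal :: "'v set \<Rightarrow> (('v \<Rightarrow>\<^sub>0 nat) \<Rightarrow>\<^sub>0 'k::field) set" where
  "irrelevant_ideal V = {f \<in> carrier (poly_ring V). Poly_Mapping.lookup f 0 = 0}"

text \<open>
  As for \<^typ>\<open>('a, 'b) module\<close>, the multiplicative fields inherited from rings are irrelevant.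
\<close>

record ('a, 'b) graded_module = "('a, 'b) module" +
  component :: "int \<Rightarrow> 'b set"

definition graded_hom ::
  "('a, 'r) ring_scheme \<Rightarrow> ('a, 'b) graded_module \<Rightarrow> ('a, 'c) graded_module \<Rightarrow> ('b \<Rightarrow> 'c) set"
where
  "graded_hom R M N =
     {h \<in> carrier M \<rightarrow> carrier N.
        (\<forall>x \<in> carrier M. \<forall>y \<in> carrier M. h (x \<oplus>\<^bsub>M\<^esub> y) = h x \<oplus>\<^bsub>N\<^esub> h y) \<and>
        (\<forall>r \<in> carrier R. \<forall>x \<in> carrier M. h (r \<odot>\<^bsub>M\<^esub> x) = r \<odot>\<^bsub>N\<^esub> h x) \<and>
        (\<forall>n. h ` component M n \<subseteq> component N n)}"

text \<open>
  For a list \<open>e = [m\<^sub>0, \<dots>, m\<^sub>r]\<close> of integers, \<open>free_module V e\<close> is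
  \<open>S(-m\<^sub>0) \<oplus> \<dots> \<oplus> S(-m\<^sub>r)\<close> where \<open>S = poly_ring V\<close>, so generator number \<open>j\<close> has degree
  \<open>e ! j\<close>. Its elements are coordinate functions, vanishing outside the index range.
\<close>

definition free_module ::
  "'v set \<Rightarrow> int list
    \<Rightarrow> (('v \<Rightarrow>\<^sub>0 nat) \<Rightarrow>\<^sub>0 'k::field, nat \<Rightarrow> ('v \<Rightarrow>\<^sub>0 nat) \<Rightarrow>\<^sub>0 'k) graded_module"
where
  "free_module V e =
     \<lparr>carrier = {x. (\<forall>j < length e. x j \<in> carrier (poly_ring V)) \<and> (\<forall>j \<ge> length e. x j = 0)},
      monoid.mult = undefined, one = undefined,
      ring.zero = (\<lambda>j. 0), ring.add = (\<lambda>x y j. x j + y j),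
      smult = (\<lambda>f x j. f * x j),
      component = (\<lambda>n. {x. (\<forall>j < length e. x j \<in> poly_component V (n - e ! j)) \<and>
                           (\<forall>j \<ge> length e. x j = 0)})\<rparr>"

text \<open>
  A minimal graded free resolution of finite length of a graded module \<open>M\<close>, with free modules
  \<open>F\<^sub>p = free_module V (e p)\<close>, differentials \<open>d p : F\<^sub>p\<^sub>+\<^sub>1 \<rightarrow> F\<^sub>p\<close> and augmentation \<open>F\<^sub>0 \<rightarrow> M\<close>.
  Minimality says that the image of each differential lies in \<open>\<mm>F\<^sub>p\<close>.
\<close>

definition minimal_graded_free_resolution ::
  "'v set \<Rightarrow> (('v \<Rightarrow>\<^sub>0 nat) \<Rightarrow>\<^sub>0 'k::field, 'b) graded_module
    \<Rightarrow> (nat \<Rightarrow> int list)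
    \<Rightarrow> (nat \<Rightarrow> (nat \<Rightarrow> ('v \<Rightarrow>\<^sub>0 nat) \<Rightarrow>\<^sub>0 'k) \<Rightarrow> (nat \<Rightarrow> ('v \<Rightarrow>\<^sub>0 nat) \<Rightarrow>\<^sub>0 'k))
    \<Rightarrow> ((nat \<Rightarrow> ('v \<Rightarrow>\<^sub>0 nat) \<Rightarrow>\<^sub>0 'k) \<Rightarrow> 'b) \<Rightarrow> bool"
where
  "minimal_graded_free_resolution V M e d aug \<longleftrightarrow>
     (let S = poly_ring V; F = (\<lambda>p. free_module V (e p)) in
      (\<exists>l. \<forall>p > l. e p = []) \<and>
      aug \<in> graded_hom S (F 0) M \<and>
      (\<forall>p. d p \<in> graded_hom S (F (Suc p)) (F p)) \<and>
      aug ` carrier (F 0) = carrier M \<and>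
      d 0 ` carrier (F 1) = a_kernel (F 0) M aug \<and>
      (\<forall>p. d (Suc p) ` carrier (F (Suc (Suc p))) = a_kernel (F (Suc p)) (F p) (d p)) \<and>
      (\<forall>p. \<forall>x \<in> carrier (F (Suc p)). \<forall>j < length (e p). d p x j \<in> irrelevant_ideal V))"

text \<open>
  The entry \<open>\<kappa>\<^sub>p\<^sub>,\<^sub>q\<close> of the Betti table read off from the generator degrees of a minimal
  resolution: if \<open>F\<^sub>p = \<Oplus>\<^sub>j S(-p-i\<^sub>j)\<close>, then \<open>e p ! j = p + i\<^sub>j\<close>, and \<open>\<kappa>\<^sub>p\<^sub>,\<^sub>q\<close> counts
  the \<open>j\<close> with \<open>i\<^sub>j = q\<close>.
\<close>

definition betti_entry :: "(nat \<Rightarrow> int list) \<Rightarrow> nat \<Rightarrow> int \<Rightarrow> nat" where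
  "betti_entry e p q = card {j. j < length (e p) \<and> e p ! j - int p = q}"


section \<open>The homogeneous coordinate ring of \<open>\<P>\<^sup>1 \<times> \<P>\<^sup>1\<close> embedded by \<open>\<O>(a) \<otimes> \<O>(b)\<close>\<close>

definition grid :: "nat \<Rightarrow> nat \<Rightarrow> (nat \<times> nat) set" where
  "grid a b = {0..a} \<times> {0..b}"

text \<open>
  The basis element \<open>b\<^sub>n\<^sub>,\<^sub>i\<^sub>,\<^sub>j\<close> is the indicator of \<open>(n, i, j)\<close>; multiplication of
  finitely supported functions is convolution, so that
  \<open>b\<^sub>n\<^sub>,\<^sub>i\<^sub>,\<^sub>j * b\<^sub>m\<^sub>,\<^sub>i\<^sub>'\<^sub>,\<^sub>j\<^sub>' = b\<^sub>n\<^sub>+\<^sub>m\<^sub>,\<^sub>i\<^sub>+\<^sub>i\<^sub>'\<^sub>,\<^sub>j\<^sub>+\<^sub>j\<^sub>'\<close>.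
\<close>

definition coord_basis :: "nat \<Rightarrow> nat \<Rightarrow> nat \<Rightarrow> (nat \<times> nat \<times> nat) \<Rightarrow>\<^sub>0 'k::field" where
  "coord_basis n i j = Poly_Mapping.single (n, i, j) 1"

text \<open>
  The \<open>'k\<close>-algebra homomorphism from the polynomial ring sending the variable \<open>(i, j)\<close> to
  \<open>b\<^sub>1\<^sub>,\<^sub>i\<^sub>,\<^sub>j\<close>.
\<close>

definition coord_eval ::
  "((nat \<times> nat \<Rightarrow>\<^sub>0 nat) \<Rightarrow>\<^sub>0 'k::field) \<Rightarrow> ((nat \<times> nat \<times> nat) \<Rightarrow>\<^sub>0 'k)" where
  "coord_eval f =
     (\<Sum>m \<in> Poly_Mapping.keys f. Poly_Mapping.single 0 (Poly_Mapping.lookup f m) *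
        (\<Prod>v \<in> Poly_Mapping.keys m. coord_basis 1 (fst v) (snd v) ^ Poly_Mapping.lookup m v))"

definition coord_ring ::
  "nat \<Rightarrow> nat
    \<Rightarrow> ((nat \<times> nat \<Rightarrow>\<^sub>0 nat) \<Rightarrow>\<^sub>0 'k::field, (nat \<times> nat \<times> nat) \<Rightarrow>\<^sub>0 'k) graded_module"
where
  "coord_ring a b =
     (let R = {r. \<forall>(n, i, j) \<in> Poly_Mapping.keys r. i \<le> n * a \<and> j \<le> n * b} in
      \<lparr>carrier = R, monoid.mult = (*), one = 1, ring.zero = 0, ring.add = (+),
       smult = (\<lambda>f r. coord_eval f * r),
       component = (\<lambda>n. {r \<in> R. \<forall>(m, i, j) \<in> Poly_Mapping.keys r. int m = n})\<rparr>)"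

end

theory Submission
  imports Defs "HOL-Computational_Algebra.Polynomial" "HOL-Computational_Algebra.Fraction_Field"
    "HOL-Library.Product_Lexorder"
begin

text \<open>
  The generators of degree \<open>p + 1\<close> in step \<open>p\<close> of the resolution are, up to isomorphism, the
  Koszul cycles in \<open>\<And>\<^sup>p V \<otimes> V\<close> modulo \<open>\<And>\<^sup>p\<^sup>+\<^sup>1 V\<close>. A cycle is a polynomial function
  \<open>g(Q, P\<^sub>1, \<dots>, P\<^sub>p)\<close> of points of the plane that is alternating in \<open>P\<^sub>1, \<dots>, P\<^sub>p\<close> and vanishes for
  \<open>Q = P\<^sub>1\<close>; it is trivial iff its defect \<open>g(Q, P, A) + g(P, Q, A)\<close> vanishes.

  Lower bound: the Eagon--Northcott syzygies of the scroll of degree \<open>(a + 1) b\<close> containing the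
  surface are, as functions, products of an elementary symmetric polynomial in the second
  coordinates of \<open>P\<^sub>1, \<dots>, P\<^sub>p\<close> and an alternating function of all \<open>p + 1\<close> points. They are
  linearly independent modulo trivial cycles. For \<open>p = a b + a - 1\<close> the second scroll, of degree
  \<open>a (b + 1) = p + 1\<close>, contributes \<open>p\<close> further ones.

  Upper bound: a cycle whose defect vanishes on a suitable set of as many test configurations
  is trivial. On a line of a ruling the defect is a polynomial of small degree with
  known zeros, so that vanishing propagates from configurations of points of a linear section
  of the scroll to all configurations.
\<close>

section \<open>Alternating functions on lists\<close>

text \<open>The size and the characteristic of the field shape the proof. In characteristic 2 a sign
  rule says nothing about equal arguments, so each alternation carries its own vanishing clause, and
  second-order zeros on a diagonal are obtained by factorisation, not from symmetry. A finite field
  \<open>k\<close> is replaced by \<open>k(t)\<close> for evaluations, and the relation found there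
  is brought back to \<open>k\<close>. The constants arise as follows. For a fixed set of p + 1
  nodes the defect satisfies a three-term identity, so that p of its values determine the others;
  this is the factor p before the binomial coefficient. If a line carries m + 1 of the p + 1 points,
  the defect has degree (m + 1) b in the position of the line and one zero for each of the p - m
  remaining points. This count succeeds for all m < a exactly if p + 1 > a b + a; at p + 1 = a b + a
  it lacks one zero for m = a - 1. That zero costs p further tests, one for each value that can be
  omitted from p given ones.\<close>

definition alternating :: "('a list \<Rightarrow> 'r::ab_group_add) \<Rightarrow> bool" where
  "alternating f \<longleftrightarrow>
     (\<forall>xs u v ys. f (xs @ u # v # ys) = - f (xs @ v # u # ys)) \<and>
     (\<forall>xs u ys. f (xs @ u # u # ys) = 0)"

lemma alternatingI:
  assumes "\<And>xs u v ys. f (xs @ u # v # ys) = - f (xs @ v # u # ys)"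
    and "\<And>xs u ys. f (xs @ u # u # ys) = 0"
  shows "alternating f"
  unfolding alternating_def by (intro conjI allI assms)

lemma alternating_swap: "alternating f \<Longrightarrow> f (xs @ u # v # ys) = - f (xs @ v # u # ys)"
  unfolding alternating_def by iprover

lemma alternating_same: "alternating f \<Longrightarrow> f (xs @ u # u # ys) = 0"
  unfolding alternating_def by iprover

lemma alternating_swap0: "alternating f \<Longrightarrow> f (u # v # ys) = - f (v # u # ys)"
  using alternating_swap[of f "[]" u v ys] by (simp only: append_Nil)

lemma alternating_same0: "alternating f \<Longrightarrow> f (u # u # ys) = 0"
  using alternating_same[of f "[]" u ys] by (simp only: append_Nil)

lemma alternating_append:
  assumes "alternating f"
  shows "alternating (\<lambda>xs. f (us @ xs))"
proof (rule alternatingI)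
  fix xs u v ys
  show "f (us @ xs @ u # v # ys) = - f (us @ xs @ v # u # ys)"
    using alternating_swap[OF assms, of "us @ xs" u v ys] by (simp only: append_assoc)
  show "f (us @ xs @ u # u # ys) = 0"
    using alternating_same[OF assms, of "us @ xs" u ys] by (simp only: append_assoc)
qed

lemma alternating_Cons: "alternating f \<Longrightarrow> alternating (\<lambda>xs. f (u # xs))"
  using alternating_append[of f "[u]"] by (simp only: append_Cons append_Nil)

lemma alternating_move:
  fixes f :: "'a list \<Rightarrow> 'r::comm_ring_1"
  assumes "alternating f"
  shows "f (us @ xs @ u # ys) = (- 1) ^ length xs * f (us @ u # xs @ ys)"
proof (induction xs arbitrary: us)
  case (Cons x xs)
  have "f (us @ (x # xs) @ u # ys) = f ((us @ [x]) @ xs @ u # ys)" by simp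
  also have "\<dots> = (- 1) ^ length xs * f (us @ x # u # xs @ ys)" by (subst Cons.IH) simp
  also have "f (us @ x # u # xs @ ys) = - f (us @ u # x # xs @ ys)"
    by (rule alternating_swap[OF assms])
  finally show ?case by simp
qed simp

lemma alternating_move0:
  fixes f :: "'a list \<Rightarrow> 'r::comm_ring_1"
  assumes "alternating f"
  shows "f (xs @ u # ys) = (- 1) ^ length xs * f (u # xs @ ys)"
  using alternating_move[OF assms, of "[]" xs u ys] by (simp only: append_Nil)

lemma alternating_not_distinct:
  fixes f :: "'a list \<Rightarrow> 'r::comm_ring_1"
  assumes "alternating f" "\<not> distinct l"
  shows "f l = 0"
proof -
  obtain xs ys zs u where l: "l = xs @ [u] @ ys @ [u] @ zs"
    using not_distinct_decomp[OF assms(2)] by blast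
  have "f ((xs @ [u]) @ ys @ u # zs) = (- 1) ^ length ys * f (xs @ u # u # ys @ zs)"
    using alternating_move[OF assms(1), of "xs @ [u]" ys u zs]
    by (simp only: append_assoc append_Cons append_Nil)
  then show ?thesis using l alternating_same[OF assms(1), of xs u "ys @ zs"] by simp
qed

text \<open>Adjacent transpositions generate all permutations. A predicate takes the place of an
  alternating function because later uses carry along side conditions, such as distinctness, that
  every intermediate list has to satisfy.\<close>

lemma adjacent_swaps_perm:
  assumes swap: "\<And>xs u v ys. P (xs @ u # v # ys) \<Longrightarrow> P (xs @ v # u # ys)"
    and "mset l = mset l'" and "P l"
  shows "P l'"
proof -
  have move: "P (pre @ u # l1 @ l2)" if "P (pre @ l1 @ u # l2)" for pre l1 l2 u
    using that
  proof (induction l1 arbitrary: pre)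
    case (Cons x l1)
    have "P (pre @ x # u # l1 @ l2)" using Cons.IH[of "pre @ [x]"] Cons.prems by simp
    then show ?case using swap[of pre x u "l1 @ l2"] by simp
  qed simp
  have "P (pre @ l) \<Longrightarrow> mset l = mset l' \<Longrightarrow> P (pre @ l')" for pre
  proof (induction l' arbitrary: pre l)
    case (Cons x l')
    have "x \<in> set l" using Cons.prems(2) by (metis list.set_intros(1) set_mset_mset)
    then obtain l1 l2 where l: "l = l1 @ x # l2" by (meson split_list)
    have "P ((pre @ [x]) @ l1 @ l2)" using move[of pre l1 x l2] Cons.prems(1) l by simp
    moreover have "mset (l1 @ l2) = mset l'" using Cons.prems(2) l by simp
    ultimately show ?case using Cons.IH[of "pre @ [x]" "l1 @ l2"] by simp
  qed simp
  from this[of "[]"] show ?thesis using assms(2,3) by simp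
qed

lemma alternating_perm_zero:
  assumes "alternating f" "mset l = mset l'" "f l = 0"
  shows "f l' = 0"
proof (rule adjacent_swaps_perm[of "\<lambda>l. f l = 0", OF _ assms(2,3)])
  fix xs u v ys
  show "f (xs @ u # v # ys) = 0 \<Longrightarrow> f (xs @ v # u # ys) = 0"
    using alternating_swap[OF assms(1), of xs u v ys] by simp
qed

text \<open>Exchanging the two sums would only show that twice the sum is zero. The induction
  cancels the terms of \<open>(u, v)\<close> and \<open>(v, u)\<close> against each other, which is
  valid in characteristic 2.\<close>

lemma sum_alternating_pairs:
  fixes h :: "'a \<Rightarrow> 'a \<Rightarrow> 'r::ab_group_add"
  assumes "finite G" "\<And>u v. u \<in> G \<Longrightarrow> v \<in> G \<Longrightarrow> h u v = - h v u" "\<And>u. u \<in> G \<Longrightarrow> h u u = 0"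
  shows "(\<Sum>u\<in>G. \<Sum>v\<in>G. h u v) = 0"
  using assms
proof (induction G rule: finite_induct)
  case (insert x F)
  have IH: "(\<Sum>u\<in>F. \<Sum>v\<in>F. h u v) = 0"
    by (rule insert.IH) (rule insert.prems; simp)+
  have "(\<Sum>u\<in>insert x F. \<Sum>v\<in>insert x F. h u v)
      = h x x + (\<Sum>v\<in>F. h x v) + ((\<Sum>u\<in>F. h u x) + (\<Sum>u\<in>F. \<Sum>v\<in>F. h u v))"
    using insert.hyps by (simp add: sum.distrib)
  also have "(\<Sum>u\<in>F. h u x) = - (\<Sum>u\<in>F. h x u)"
    unfolding sum_negf[symmetric] by (intro sum.cong refl insert.prems(1)) auto
  finally show ?case using IH insert.prems(2)[of x] by simp
qed simp

section \<open>Evaluation of coefficient arrays\<close>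

text \<open>Any commutative ring is allowed, so that pairs of polynomials can be substituted for
  points (\<open>poly_ev\<close>); this is how degree bounds along curves are obtained
  (\<open>degree_ev\<close>).\<close>

fun ev :: "(nat \<times> nat) set \<Rightarrow> ((nat \<times> nat) list \<Rightarrow> 'r::comm_ring_1) \<Rightarrow> ('r \<times> 'r) list \<Rightarrow> 'r" where
  "ev G c [] = c []"
| "ev G c (q # ps) = (\<Sum>v\<in>G. fst q ^ fst v * snd q ^ snd v * ev G (\<lambda>is. c (v # is)) ps)"

lemma ev_cong:
  assumes "\<And>is. set is \<subseteq> G \<Longrightarrow> length is = length ps \<Longrightarrow> c is = c' is"
  shows "ev G c ps = ev G c' ps"
  using assms
proof (induction ps arbitrary: c c')
  case (Cons q ps)
  have "ev G (\<lambda>is. c (v # is)) ps = ev G (\<lambda>is. c' (v # is)) ps" if "v \<in> G" for v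
    using that Cons.prems by (intro Cons.IH) auto
  then show ?case by simp
qed simp

lemma ev_zero [simp]: "ev G (\<lambda>_. 0) ps = 0"
  by (induction ps) auto

lemma ev_add: "ev G (\<lambda>is. c is + c' is) ps = ev G c ps + ev G c' ps"
  by (induction ps arbitrary: c c') (auto simp: algebra_simps sum.distrib)

lemma ev_smult: "ev G (\<lambda>is. r * c is) ps = r * ev G c ps"
  by (induction ps arbitrary: c) (auto simp: algebra_simps sum_distrib_left)

lemma ev_uminus: "ev G (\<lambda>is. - c is) ps = - ev G c ps"
  using ev_smult[of G "-1" c ps] by simp

lemma ev_sum: "ev G (\<lambda>is. \<Sum>x\<in>A. c x is) ps = (\<Sum>x\<in>A. ev G (c x) ps)"
  by (induction A rule: infinite_finite_induct) (auto simp: ev_add)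

lemma ev_append: "ev G c (xs @ ys) = ev G (\<lambda>is. ev G (\<lambda>js. c (is @ js)) ys) xs"
  by (induction xs arbitrary: c) auto

lemma alternating_ev:
  assumes "finite G" "alternating c"
  shows "alternating (ev G c)"
proof -
  have e2: "ev G c' (P # Q # ys) = (\<Sum>u\<in>G. \<Sum>v\<in>G.
      (fst P ^ fst u * snd P ^ snd u) * (fst Q ^ fst v * snd Q ^ snd v) * ev G (\<lambda>is. c' (u # v # is)) ys)"
    for c' P Q ys by (simp add: sum_distrib_left mult.assoc)
  have sw: "ev G (\<lambda>is. c' (u # v # is)) ys = - ev G (\<lambda>is. c' (v # u # is)) ys"
    if "alternating c'" for c' ys u v
    unfolding ev_uminus[symmetric]
    by (rule arg_cong[where f = "\<lambda>c. ev G c ys"]) (rule ext, rule alternating_swap0[OF that])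
  have swap: "ev G c' (P # Q # ys) = - ev G c' (Q # P # ys)" if alt: "alternating c'" for c' P Q ys
  proof -
    have "ev G c' (P # Q # ys) = (\<Sum>v\<in>G. \<Sum>u\<in>G.
        (fst P ^ fst u * snd P ^ snd u) * (fst Q ^ fst v * snd Q ^ snd v) * ev G (\<lambda>is. c' (u # v # is)) ys)"
      unfolding e2 by (rule sum.swap)
    also have "\<dots> = (\<Sum>v\<in>G. \<Sum>u\<in>G.
        - ((fst Q ^ fst v * snd Q ^ snd v) * (fst P ^ fst u * snd P ^ snd u) * ev G (\<lambda>is. c' (v # u # is)) ys))"
      by (intro sum.cong refl, subst sw[OF alt]) (simp add: mult.commute)
    finally show ?thesis unfolding e2 by (simp only: sum_negf)
  qed
  have same: "ev G c' (P # P # ys) = 0" if alt: "alternating c'" for c' P ys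
    unfolding e2
  proof (rule sum_alternating_pairs[OF assms(1)])
    fix u v
    show "fst P ^ fst u * snd P ^ snd u * (fst P ^ fst v * snd P ^ snd v) *
           ev G (\<lambda>is. c' (u # v # is)) ys =
           - (fst P ^ fst v * snd P ^ snd v * (fst P ^ fst u * snd P ^ snd u) *
              ev G (\<lambda>is. c' (v # u # is)) ys)"
      by (subst sw[OF alt]) (simp add: mult.commute)
    show "fst P ^ fst u * snd P ^ snd u * (fst P ^ fst u * snd P ^ snd u) *
         ev G (\<lambda>is. c' (u # u # is)) ys = 0"
      by (simp add: alternating_same0[OF alt])
  qed
  show ?thesis
  proof (rule alternatingI)
    fix xs P Q ys
    have "ev G c (xs @ P # Q # ys) = ev G (\<lambda>is. ev G (\<lambda>js. c (is @ js)) (P # Q # ys)) xs"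
      by (rule ev_append)
    also have "\<dots> = ev G (\<lambda>is. - ev G (\<lambda>js. c (is @ js)) (Q # P # ys)) xs"
      by (rule ev_cong) (rule swap[OF alternating_append[OF assms(2)]])
    also have "\<dots> = - ev G c (xs @ Q # P # ys)"
      by (simp only: ev_uminus ev_append[of G c xs])
    finally show "ev G c (xs @ P # Q # ys) = - ev G c (xs @ Q # P # ys)" .
    have "ev G c (xs @ P # P # ys) = ev G (\<lambda>is. ev G (\<lambda>js. c (is @ js)) (P # P # ys)) xs"
      by (rule ev_append)
    also have "\<dots> = ev G (\<lambda>is. 0) xs"
      by (rule ev_cong) (rule same[OF alternating_append[OF assms(2)]])
    finally show "ev G c (xs @ P # P # ys) = 0" by simp
  qed
qed

lemma poly_ev:
  "poly (ev G (\<lambda>is. [:c is:]) qs) t = ev G c (map (\<lambda>q. (poly (fst q) t, poly (snd q) t)) qs)"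
proof (induction qs arbitrary: c)
  case (Cons q qs)
  show ?case by (simp only: ev.simps list.map poly_sum poly_mult poly_power Cons.IH fst_conv snd_conv)
qed simp

lemma degree_ev:
  fixes c :: "(nat \<times> nat) list \<Rightarrow> 'r::idom"
  assumes "finite G" "\<And>v. v \<in> G \<Longrightarrow> fst v \<le> a \<and> snd v \<le> b"
  shows "degree (ev G (\<lambda>is. [:c is:]) qs)
    \<le> sum_list (map (\<lambda>q. a * degree (fst q) + b * degree (snd q)) qs)"
proof (induction qs arbitrary: c)
  case (Cons q qs)
  show ?case unfolding ev.simps
  proof (rule degree_sum_le[OF assms(1)])
    fix v assume v: "v \<in> G"
    have "degree (fst q ^ fst v) \<le> a * degree (fst q)"
      using order.trans[OF degree_power_le[of "fst q" "fst v"] mult_le_mono2] assms(2)[OF v]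
      by (simp add: mult.commute)
    moreover have "degree (snd q ^ snd v) \<le> b * degree (snd q)"
      using order.trans[OF degree_power_le[of "snd q" "snd v"] mult_le_mono2] assms(2)[OF v]
      by (simp add: mult.commute)
    ultimately show "degree (fst q ^ fst v * snd q ^ snd v * ev G (\<lambda>is. [:c (v # is):]) qs)
        \<le> sum_list (map (\<lambda>q. a * degree (fst q) + b * degree (snd q)) (q # qs))"
      using Cons.IH[of "\<lambda>is. c (v # is)"]
        degree_mult_le[of "fst q ^ fst v * snd q ^ snd v" "ev G (\<lambda>is. [:c (v # is):]) qs"]
        degree_mult_le[of "fst q ^ fst v" "snd q ^ snd v"]
      by simp
  qed
qed simp

section \<open>Polynomial functions of bounded degree\<close>

text \<open>A property of functions, so that a degree bound in one variable of a longer expression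
  can be stated without naming the polynomial.\<close>

definition polyfun :: "nat \<Rightarrow> ('a::field \<Rightarrow> 'a) \<Rightarrow> bool" where
  "polyfun n f \<longleftrightarrow> (\<exists>q. degree q \<le> n \<and> (\<forall>x. f x = poly q x))"

lemma polyfun_poly: "degree q \<le> n \<Longrightarrow> polyfun n (poly q)"
  unfolding polyfun_def by blast

lemma polyfun_const [simp]: "polyfun n (\<lambda>_. c)"
  unfolding polyfun_def by (rule exI[of _ "[:c:]"]) simp

lemma polyfun_mono: "polyfun n f \<Longrightarrow> n \<le> m \<Longrightarrow> polyfun m f"
  unfolding polyfun_def using le_trans by blast

lemma polyfun_add: "polyfun n f \<Longrightarrow> polyfun n g \<Longrightarrow> polyfun n (\<lambda>x. f x + g x)"
  unfolding polyfun_def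
proof (elim exE conjE)
  fix p q assume "degree p \<le> n" "degree q \<le> n" "\<forall>x. f x = poly p x" "\<forall>x. g x = poly q x"
  then show "\<exists>q. degree q \<le> n \<and> (\<forall>x. f x + g x = poly q x)"
    by (intro exI[of _ "p + q"]) (auto intro: degree_add_le)
qed

lemma polyfun_mult: "polyfun n f \<Longrightarrow> polyfun m g \<Longrightarrow> polyfun (n + m) (\<lambda>x. f x * g x)"
  unfolding polyfun_def
proof (elim exE conjE)
  fix p q assume "degree p \<le> n" "degree q \<le> m" "\<forall>x. f x = poly p x" "\<forall>x. g x = poly q x"
  then show "\<exists>q. degree q \<le> n + m \<and> (\<forall>x. f x * g x = poly q x)"
    using degree_mult_le[of p q] by (intro exI[of _ "p * q"]) auto
qed

lemma polyfun_cmult: "polyfun n f \<Longrightarrow> polyfun n (\<lambda>x. c * f x)"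
  using polyfun_mult[OF polyfun_const[of 0 c]] by simp

lemma polyfun_uminus: "polyfun n f \<Longrightarrow> polyfun n (\<lambda>x. - f x)"
  using polyfun_cmult[of n f "-1"] by simp

lemma polyfun_diff: "polyfun n f \<Longrightarrow> polyfun n g \<Longrightarrow> polyfun n (\<lambda>x. f x - g x)"
  using polyfun_add[OF _ polyfun_uminus] by fastforce

lemma polyfun_sum: "(\<And>i. i \<in> I \<Longrightarrow> polyfun n (f i)) \<Longrightarrow> polyfun n (\<lambda>x. \<Sum>i\<in>I. f i x)"
  by (induction I rule: infinite_finite_induct) (auto intro: polyfun_add)

lemma polyfun_id: "polyfun 1 (\<lambda>x. x)"
  unfolding polyfun_def by (rule exI[of _ "[:0, 1:]"]) simp

lemma poly_zero_roots:
  fixes q :: "'a::idom poly"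
  assumes "\<And>x. x \<in> S \<Longrightarrow> poly q x = 0" "degree q < card S"
  shows "q = 0"
proof (rule ccontr)
  assume "q \<noteq> 0"
  then have "card S \<le> card {x. poly q x = 0}"
    using assms(1) by (intro card_mono poly_roots_finite) auto
  also have "\<dots> \<le> degree q" using \<open>q \<noteq> 0\<close> by (rule card_poly_roots_bound)
  finally show False using assms(2) by simp
qed

lemma polyfun_roots:
  assumes "polyfun n f" "\<And>x. x \<in> S \<Longrightarrow> f x = 0" "n < card S"
  shows "f x = 0"
proof -
  obtain q where q: "degree q \<le> n" "\<And>x. f x = poly q x" using assms(1) unfolding polyfun_def by blast
  have "q = 0" by (rule poly_zero_roots[of S]) (use assms q in auto)
  then show ?thesis using q(2) by simp
qed

lemma polyfun_roots_list:
  assumes "polyfun n f" "\<And>x. x \<in> set l \<Longrightarrow> f x = 0" "distinct l" "n < length l"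
  shows "f x = 0"
  using polyfun_roots[OF assms(1), of "set l"] assms(2-4) distinct_card by metis

lemma polyfun_cofinite:
  fixes f :: "'a::field \<Rightarrow> 'a"
  assumes "infinite (UNIV :: 'a set)" "polyfun n f" "finite S" "\<And>x. x \<notin> S \<Longrightarrow> f x = 0"
  shows "f x = 0"
proof -
  have "infinite (UNIV - S)" using assms by (simp add: Diff_infinite_finite)
  then obtain R where "R \<subseteq> UNIV - S" "finite R" "card R = Suc n"
    using infinite_arbitrarily_large by blast
  then show ?thesis using polyfun_roots[OF assms(2), of R] assms(4) by auto
qed

lemma polyfun_div_root:
  assumes "polyfun n f" "f r = 0"
  shows "\<exists>g. polyfun (n - 1) g \<and> (\<forall>x. f x = (x - r) * g x)"
proof -
  obtain q where q: "degree q \<le> n" "\<And>x. f x = poly q x" using assms(1) unfolding polyfun_def by blast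
  then have "[:- r, 1:] dvd q" using assms(2) poly_eq_0_iff_dvd by metis
  then obtain k where k: "q = [:- r, 1:] * k" by (auto simp: dvd_def)
  have "degree k \<le> n - 1"
  proof (cases "k = 0")
    case False
    then have "degree q = 1 + degree k" unfolding k by (subst degree_mult_eq) auto
    then show ?thesis using q(1) by simp
  qed simp
  moreover have "f x = (x - r) * poly k x" for x using q(2)[of x] k by (simp add: algebra_simps)
  ultimately show ?thesis using polyfun_poly by blast
qed

text \<open>With more than \<open>n\<close> roots the subtraction stops at 0; the claim stays true
  because \<open>f\<close> then vanishes and the quotient can be taken to be 0.\<close>

lemma polyfun_div_roots:
  assumes "polyfun n f" "distinct l" "\<And>r. r \<in> set l \<Longrightarrow> f r = 0"
  shows "\<exists>g. polyfun (n - length l) g \<and> (\<forall>x. f x = (\<Prod>r\<leftarrow>l. x - r) * g x)"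
  using assms(2,3)
proof (induction l)
  case Nil then show ?case using assms(1) by auto
next
  case (Cons r l)
  then obtain g where g: "polyfun (n - length l) g" "\<And>x. f x = (\<Prod>r\<leftarrow>l. x - r) * g x" by auto
  have "(\<Prod>r'\<leftarrow>l. r - r') \<noteq> 0" using Cons.prems(1) by (auto simp: prod_list_zero_iff)
  then have "g r = 0" using g(2)[of r] Cons.prems(2)[of r] by simp
  then obtain h where h: "polyfun (n - length l - 1) h" "\<And>x. g x = (x - r) * h x"
    using polyfun_div_root[OF g(1)] by blast
  have "f x = (\<Prod>r\<leftarrow>r # l. x - r) * h x" for x
    unfolding g(2) h(2) by (simp add: mult_ac)
  then show ?case using h(1) by (intro exI[of _ h]) simp
qed

lemma polyfun_affine:
  assumes "polyfun 1 f" "f u = 0" "f v = 0" "u \<noteq> v"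
  shows "f x = 0"
  using polyfun_roots[OF assms(1), of "{u, v}"] assms by auto

text \<open>Division by \<open>x - r\<close> determines the quotient except at \<open>r\<close>. The
  a priori bound \<open>m\<close> makes \<open>g\<close> polynomial, and over an infinite field its
  value at \<open>r\<close> is then forced, so that the good bound holds for \<open>g\<close>
  itself.\<close>

lemma polyfun_cancel_linear:
  fixes f g :: "'a::field \<Rightarrow> 'a"
  assumes inf: "infinite (UNIV :: 'a set)" and "polyfun n f" "polyfun m g" "\<And>x. f x = (x - r) * g x"
  shows "polyfun (n - 1) g"
proof -
  have "f r = 0" using assms(4) by simp
  then obtain h where h: "polyfun (n - 1) h" "\<And>x. f x = (x - r) * h x"
    using polyfun_div_root[OF assms(2)] by blast
  have "g x - h x = 0" for x
  proof (rule polyfun_cofinite[OF inf, of "max m (n - 1)" "\<lambda>x. g x - h x" "{r}"])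
    show "polyfun (max m (n - 1)) (\<lambda>x. g x - h x)"
      by (intro polyfun_diff polyfun_mono[OF assms(3)] polyfun_mono[OF h(1)]) auto
    show "g x - h x = 0" if "x \<notin> {r}" for x
      using assms(4)[of x] h(2)[of x] that by simp
  qed simp
  then have "g = h" by auto
  then show ?thesis using h(1) by simp
qed

text \<open>The sum is the coefficient of degree \<open>n - 1\<close> in the Lagrange interpolant of
  \<open>q\<close> at \<open>n\<close> nodes. The interpolant is \<open>q\<close>, whose degree is
  smaller.\<close>

lemma lagrange_sum:
  fixes x :: "nat \<Rightarrow> 'a::field"
  assumes inj: "inj_on x {..<n}" and deg: "degree q + 1 < n"
  shows "(\<Sum>i<n. poly q (x i) / (\<Prod>j\<in>{..<n} - {i}. x i - x j)) = 0"
proof -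
  define w where "w i = poly q (x i) / (\<Prod>j\<in>{..<n} - {i}. x i - x j)" for i
  define l where "l i = (\<Prod>j\<in>{..<n} - {i}. [:- x j, 1:])" for i
  have lnz: "(\<Prod>j\<in>{..<n} - {i}. x i - x j) \<noteq> 0" if "i < n" for i
    using that inj by (auto simp: inj_on_def)
  have degl: "degree (l i) = n - 1" if "i < n" for i
  proof -
    have "degree (l i) = (\<Sum>j\<in>{..<n} - {i}. degree [:- x j, 1:])"
      unfolding l_def by (rule degree_prod_eq_sum_degree) auto
    then show ?thesis using that by simp
  qed
  have lc: "coeff (l i) (n - 1) = 1" if "i < n" for i
  proof -
    have "lead_coeff (l i) = 1" unfolding l_def by (simp add: lead_coeff_prod)
    then show ?thesis using degl[OF that] by simp
  qed
  define P where "P = (\<Sum>i<n. smult (w i) (l i)) - q"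
  have "degree P \<le> n - 1"
    unfolding P_def using deg
    by (intro degree_diff_le degree_sum_le) (auto intro: order.trans[OF degree_smult_le] simp: degl)
  have "poly P (x k) = 0" if k: "k < n" for k
  proof -
    have "poly (l i) (x k) = 0" if "i < n" "i \<noteq> k" for i
      unfolding l_def poly_prod using k that by (auto intro!: prod_zero)
    then have "(\<Sum>i<n. w i * poly (l i) (x k)) = (\<Sum>i<n. if i = k then w k * poly (l k) (x k) else 0)"
      by (intro sum.cong) auto
    also have "\<dots> = poly q (x k)"
      using k lnz[OF k] by (simp add: w_def l_def poly_prod)
    finally show ?thesis unfolding P_def by (simp add: poly_sum)
  qed
  then have "P = 0"
    using \<open>degree P \<le> n - 1\<close> inj deg
    by (intro poly_zero_roots[of "x ` {..<n}"]) (auto simp: card_image)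
  then have "coeff P (n - 1) = 0" by simp
  then have "(\<Sum>i<n. w i * coeff (l i) (n - 1)) - coeff q (n - 1) = 0"
    unfolding P_def by (simp add: coeff_sum)
  moreover have "coeff q (n - 1) = 0" using deg by (intro coeff_eq_0) simp
  ultimately show ?thesis using lc by (simp add: w_def)
qed

text \<open>Polynomiality in each variable separately suffices over an infinite field.\<close>

lemma polyfun_diagonal:
  fixes \<phi> :: "'a::field \<Rightarrow> 'a \<Rightarrow> 'a"
  assumes inf: "infinite (UNIV :: 'a set)"
    and pw: "\<And>s. polyfun n (\<phi> s)" and ps: "\<And>w. polyfun n (\<lambda>s. \<phi> s w)"
    and diag: "\<And>s. \<phi> s s = 0"
  shows "\<exists>\<psi>. (\<forall>s w. \<phi> s w = (w - s) * \<psi> s w) \<and>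
    (\<forall>s. polyfun (n - 1) (\<psi> s)) \<and> (\<forall>w. polyfun (n - 1) (\<lambda>s. \<psi> s w))"
proof -
  obtain K :: "'a set" where K: "finite K" "card K = Suc n"
    using infinite_arbitrarily_large[OF inf] by blast
  define l where "l r = (\<Prod>u\<in>K - {r}. smult (1 / (r - u)) [:- u, 1:])" for r
  have degl: "degree (l r) \<le> n" if "r \<in> K" for r
  proof -
    have "degree (l r) \<le> (\<Sum>u\<in>K - {r}. degree (smult (1 / (r - u)) [:- u, 1:]))"
      unfolding l_def using degree_prod_sum_le[of "K - {r}" "\<lambda>u. smult (1 / (r - u)) [:- u, 1:]"] K(1)
      by (simp only: comp_def finite_Diff)
    also have "\<dots> \<le> (\<Sum>u\<in>K - {r}. 1)" by (rule sum_mono) simp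
    also have "\<dots> = n" using K that by simp
    finally show ?thesis .
  qed
  have l1: "poly (l r) r = 1" for r
    unfolding l_def poly_prod
    by (rule prod.neutral) (auto simp: diff_divide_distrib[symmetric] minus_divide_left[symmetric])
  have l0: "poly (l r) u = 0" if "u \<in> K" "u \<noteq> r" for r u
    unfolding l_def poly_prod using that K by (intro prod_zero) auto
  have interp: "f w = (\<Sum>r\<in>K. f r * poly (l r) w)" if "polyfun n f" for f w
  proof -
    have pf: "polyfun n (\<lambda>w. f w - (\<Sum>r\<in>K. f r * poly (l r) w))"
      by (intro polyfun_diff polyfun_sum polyfun_cmult polyfun_poly that degl)
    have "f u - (\<Sum>r\<in>K. f r * poly (l r) u) = 0" if "u \<in> K" for u
    proof -
      have "(\<Sum>r\<in>K. f r * poly (l r) u) = (\<Sum>r\<in>K. if r = u then f u else 0)"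
        using l0[OF that] l1 by (intro sum.cong) auto
      then show ?thesis using that K by simp
    qed
    then have "f w - (\<Sum>r\<in>K. f r * poly (l r) w) = 0"
      using polyfun_roots[OF pf, of K w] K by simp
    then show ?thesis by simp
  qed
  define m where "m p s w = (\<Sum>i\<le>n. coeff p i * (\<Sum>j<i. s ^ (i - Suc j) * w ^ j))" for p :: "'a poly" and s w
  have pow: "polyfun n (\<lambda>x. x ^ i)" if "i \<le> n" for i :: nat
    unfolding polyfun_def by (rule exI[of _ "monom 1 i"]) (simp add: poly_monom degree_monom_eq that)
  have m: "poly p w - poly p s = (w - s) * m p s w" if "degree p \<le> n" for p s w
  proof -
    have "poly p x = (\<Sum>i\<le>n. coeff p i * x ^ i)" for x
      by (subst (1) poly_as_sum_of_monoms'[OF that, symmetric]) (simp add: poly_sum poly_monom)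
    then have "poly p w - poly p s = (\<Sum>i\<le>n. coeff p i * (w ^ i - s ^ i))"
      by (simp add: sum_subtractf algebra_simps)
    also have "\<dots> = (w - s) * m p s w"
      unfolding m_def sum_distrib_left by (intro sum.cong refl) (simp add: power_diff_sumr2 mult_ac sum_distrib_left)
    finally show ?thesis .
  qed
  \<comment> \<open>\<open>\<phi> s w\<close> is interpolated in \<open>w\<close> and
    \<open>\<phi> s s = 0\<close> is subtracted; each basis polynomial \<open>l r\<close> then
    contributes its divided difference \<open>m (l r)\<close>. The degrees of this
    \<open>\<psi>\<close> come out too large at first and are corrected by
    \<open>polyfun_cancel_linear\<close>.\<close>
  define \<psi> where "\<psi> s w = (\<Sum>r\<in>K. \<phi> s r * m (l r) s w)" for s w
  have eq: "\<phi> s w = (w - s) * \<psi> s w" for s w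
  proof -
    have "\<phi> s w = (\<Sum>r\<in>K. \<phi> s r * poly (l r) w) - (\<Sum>r\<in>K. \<phi> s r * poly (l r) s)"
      using interp[OF pw, of s w] interp[OF pw, of s s] diag[of s] by simp
    also have "\<dots> = (\<Sum>r\<in>K. \<phi> s r * (poly (l r) w - poly (l r) s))"
      by (simp add: sum_subtractf algebra_simps)
    also have "\<dots> = (w - s) * \<psi> s w"
      unfolding \<psi>_def sum_distrib_left by (intro sum.cong refl) (simp add: m degl)
    finally show ?thesis .
  qed
  have mw: "polyfun n (m p s)" for p s
    unfolding m_def by (intro polyfun_sum polyfun_cmult pow) auto
  have ms: "polyfun n (\<lambda>s. m p s w)" for p w
  proof -
    have "polyfun n (\<lambda>s. \<Sum>i\<le>n. coeff p i * (\<Sum>j<i. w ^ j * s ^ (i - Suc j)))"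
      by (intro polyfun_sum polyfun_cmult pow) auto
    then show ?thesis unfolding m_def by (simp add: mult.commute)
  qed
  have "polyfun (n - 1) (\<psi> s)" for s
  proof (rule polyfun_cancel_linear[OF inf pw[of s]])
    show "polyfun n (\<psi> s)" unfolding \<psi>_def by (intro polyfun_sum polyfun_cmult mw)
  qed (rule eq)
  moreover have "polyfun (n - 1) (\<lambda>s. \<psi> s w)" for w
  proof (rule polyfun_cancel_linear[OF inf polyfun_uminus[OF ps[of w]]])
    show "polyfun (n + n) (\<lambda>s. \<psi> s w)" unfolding \<psi>_def by (intro polyfun_sum polyfun_mult ms ps)
    show "- \<phi> s w = (s - w) * \<psi> s w" for s using eq[of s w] by (simp add: algebra_simps)
  qed
  ultimately show ?thesis using eq by blast
qed

text \<open>The points are made arbitrary one at a time.\<close>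

lemma vanishing_generic:
  fixes h :: "('a::field \<times> 'a) list \<Rightarrow> 'a"
  assumes inf: "infinite (UNIV :: 'a set)" and fin: "finite S" "finite T"
    and pz: "\<And>xs x ys. length xs + length ys + 1 = n \<Longrightarrow> \<exists>N. polyfun N (\<lambda>z. h (xs @ (z, x) # ys))"
    and px: "\<And>xs z ys. length xs + length ys + 1 = n \<Longrightarrow> \<exists>N. polyfun N (\<lambda>x. h (xs @ (z, x) # ys))"
    and zero: "\<And>A. length A = n \<Longrightarrow> distinct (map fst A) \<Longrightarrow> distinct (map snd A) \<Longrightarrow>
      set (map fst A) \<inter> S = {} \<Longrightarrow> set (map snd A) \<inter> T = {} \<Longrightarrow> h A = 0"
    and len: "length A = n"
  shows "h A = 0"
proof -
  have "h (xs @ ys) = 0"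
    if "length xs + length ys = n" "distinct (map fst ys)" "distinct (map snd ys)"
      "set (map fst ys) \<inter> S = {}" "set (map snd ys) \<inter> T = {}" for xs ys
    using that
  proof (induction xs arbitrary: ys rule: rev_induct)
    case Nil then show ?case using zero by simp
  next
    case (snoc q xs)
    have len: "length xs + length ys + 1 = n" using snoc.prems(1) by simp
    have *: "h (xs @ (z, x) # ys) = 0"
      if "z \<notin> S \<union> set (map fst ys)" "x \<notin> T \<union> set (map snd ys)" for z x
      by (rule snoc.IH) (use that snoc.prems in auto)
    have **: "h (xs @ (z, x) # ys) = 0" if z: "z \<notin> S \<union> set (map fst ys)" for z x
    proof -
      obtain N where "polyfun N (\<lambda>x. h (xs @ (z, x) # ys))" using px[OF len] by blast
      from polyfun_cofinite[OF inf this, of "T \<union> set (map snd ys)"] * z fin show ?thesis by auto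
    qed
    obtain N where "polyfun N (\<lambda>z. h (xs @ (z, snd q) # ys))" using pz[OF len] by blast
    from polyfun_cofinite[OF inf this, of "S \<union> set (map fst ys)" "fst q"] ** fin
    show ?case by auto
  qed
  from this[of A "[]"] len show ?thesis by simp
qed

text \<open>The two coordinates of the first point are treated one after the other as the variable
  of a univariate polynomial with infinitely many zeros; the other points follow by
  induction.\<close>

lemma ev_eq_0_imp:
  fixes c :: "(nat \<times> nat) list \<Rightarrow> 'a::field"
  assumes inf: "infinite (UNIV :: 'a set)"
    and zero: "\<And>ps. length ps = n \<Longrightarrow> ev (grid a b) c ps = 0"
    and "length is = n" "set is \<subseteq> grid a b"
  shows "c is = 0"
  using zero assms(3,4)
proof (induction n arbitrary: c "is")
  case 0
  then show ?case using 0(1)[of "[]"] by simp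
next
  case (Suc n)
  obtain i j js where is_eq: "is = (i, j) # js" "(i, j) \<in> grid a b" "set js \<subseteq> grid a b" "length js = n"
    using Suc.prems by (cases "is") auto
  have fz: "p i = 0" if "\<And>z. (\<Sum>i\<le>m. p i * z ^ i) = 0" "i \<le> m" for p :: "nat \<Rightarrow> 'a" and m i
  proof -
    define q where "q = (\<Sum>i\<le>m. monom (p i) i)"
    have "poly q z = 0" for z unfolding q_def poly_sum poly_monom using that(1) by simp
    then have "q = 0"
      using inf poly_roots_finite[of q] by (metis (mono_tags, lifting) Collect_cong UNIV_def)
    then have "coeff q i = 0" by simp
    moreover have "coeff q i = (\<Sum>k\<le>m. if k = i then p k else 0)"
      unfolding q_def coeff_sum by simp
    ultimately show ?thesis using that(2) by simp
  qed
  have "ev (grid a b) (\<lambda>is. c ((i, j) # is)) ps = 0" if "length ps = n" for ps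
  proof -
    let ?e = "\<lambda>i j. ev (grid a b) (\<lambda>is. c ((i, j) # is)) ps"
    have s: "(\<Sum>i\<le>a. (\<Sum>j\<le>b. ?e i j * x ^ j) * z ^ i) = 0" for z x
    proof -
      have "(\<Sum>i\<le>a. (\<Sum>j\<le>b. ?e i j * x ^ j) * z ^ i) = ev (grid a b) c ((z, x) # ps)"
        unfolding ev.simps fst_conv snd_conv
        unfolding grid_def atLeast0AtMost[symmetric] sum_distrib_right
        by (subst sum.cartesian_product) (intro sum.cong, auto simp: mult_ac)
      then show ?thesis using Suc.prems(1)[of "(z, x) # ps"] that by simp
    qed
    have "(\<Sum>j\<le>b. ?e i j * x ^ j) = 0" for x
      by (rule fz[OF s]) (use is_eq(2) in \<open>simp add: grid_def\<close>)
    then show ?thesis by (rule fz) (use is_eq(2) in \<open>simp add: grid_def\<close>)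
  qed
  from Suc.IH[OF this is_eq(4,3)] show ?case using is_eq(1) by simp
qed

section \<open>Homogeneous linear systems\<close>

text \<open>The linear algebra behind both bounds: too many generators for the tests, or too many
  arrays for the generators, produce a nontrivial relation, which is then refuted. The proof is
  Gaussian elimination of one unknown.\<close>

lemma homogeneous_system:
  fixes A :: "'i \<Rightarrow> 'j \<Rightarrow> 'a::field"
  assumes "finite I" "finite J" "card I < card J"
  shows "\<exists>x. (\<exists>j\<in>J. x j \<noteq> 0) \<and> (\<forall>i\<in>I. (\<Sum>j\<in>J. A i j * x j) = 0)"
  using assms
proof (induction I arbitrary: J A rule: finite_induct)
  case empty
  then obtain j where "j \<in> J" by fastforce
  then show ?case by (intro exI[of _ "\<lambda>_. 1"]) auto
next
  case (insert i0 I)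
  show ?case
  proof (cases "\<forall>j\<in>J. A i0 j = 0")
    case True
    have "card I < card J" using insert.prems insert.hyps by simp
    then obtain x where x: "\<exists>j\<in>J. x j \<noteq> 0" "\<forall>i\<in>I. (\<Sum>j\<in>J. A i j * x j) = 0"
      using insert.IH[OF insert.prems(1), of A] by blast
    then show ?thesis using True by (intro exI[of _ x]) auto
  next
    case False
    then obtain j0 where j0: "j0 \<in> J" "A i0 j0 \<noteq> 0" by blast
    define J' where "J' = J - {j0}"
    have J': "finite J'" "card I < card J'" "J = insert j0 J'" "j0 \<notin> J'"
      using insert.prems insert.hyps j0 unfolding J'_def by auto
    define B where "B i j = A i j - A i j0 * A i0 j / A i0 j0" for i j
    obtain y where y: "\<exists>j\<in>J'. y j \<noteq> 0" "\<forall>i\<in>I. (\<Sum>j\<in>J'. B i j * y j) = 0"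
      using insert.IH[OF J'(1,2), of B] by blast
    define t where "t = - (\<Sum>j\<in>J'. A i0 j * y j) / A i0 j0"
    define x where "x j = (if j = j0 then t else y j)" for j
    have split: "(\<Sum>j\<in>J. A i j * x j) = A i j0 * t + (\<Sum>j\<in>J'. A i j * y j)" for i
    proof -
      have "(\<Sum>j\<in>J'. A i j * x j) = (\<Sum>j\<in>J'. A i j * y j)"
        using J'(4) by (intro sum.cong) (auto simp: x_def)
      then show ?thesis unfolding J'(3) using J'(1,4) by (simp add: x_def)
    qed
    have "(\<Sum>j\<in>J. A i j * x j) = 0" if "i \<in> insert i0 I" for i
    proof (cases "i = i0")
      case True
      then show ?thesis unfolding split t_def using j0 by simp
    next
      case False
      then have "(\<Sum>j\<in>J'. B i j * y j) = 0" using y(2) that by blast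
      moreover have "(\<Sum>j\<in>J'. B i j * y j)
          = (\<Sum>j\<in>J'. A i j * y j) - A i j0 / A i0 j0 * (\<Sum>j\<in>J'. A i0 j * y j)"
        unfolding B_def by (simp add: sum_subtractf sum_distrib_left algebra_simps)
      ultimately show ?thesis unfolding split t_def by simp
    qed
    moreover have "\<exists>j\<in>J. x j \<noteq> 0"
      using y(1) J'(3,4) unfolding x_def by auto
    ultimately show ?thesis by blast
  qed
qed

declare ev.simps(2) [simp del]

section \<open>Koszul cycles as polynomial functions\<close>

lemma alternating_sum_smult:
  fixes f :: "'i \<Rightarrow> 'a list \<Rightarrow> 'r::comm_ring_1"
  assumes "\<And>i. i \<in> I \<Longrightarrow> alternating (f i)"
  shows "alternating (\<lambda>xs. \<Sum>i\<in>I. k i * f i xs)"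
proof (rule alternatingI)
  fix xs u v ys
  have "k i * f i (xs @ u # v # ys) = - (k i * f i (xs @ v # u # ys))" if "i \<in> I" for i
    using alternating_swap[OF assms[OF that], of xs u v ys] by (simp only: mult_minus_right)
  then show "(\<Sum>i\<in>I. k i * f i (xs @ u # v # ys)) = - (\<Sum>i\<in>I. k i * f i (xs @ v # u # ys))"
    unfolding sum_negf[symmetric] by (intro sum.cong refl)
  show "(\<Sum>i\<in>I. k i * f i (xs @ u # u # ys)) = 0"
    by (intro sum.neutral ballI) (simp add: alternating_same[OF assms])
qed

lemma finite_grid [simp]: "finite (grid a b)"
  by (simp add: grid_def)

text \<open>Symmetrising \<open>(w - s) * \<psi> s w\<close> antisymmetrises \<open>\<psi>\<close>,
  and an explicit difference \<open>\<psi> s w - \<psi> w s\<close> is 0 for \<open>s = w\<close> in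
  every characteristic. Hence the symmetrised function vanishes to second order along the
  diagonal.\<close>

lemma polyfun_symmetrize_diagonal:
  fixes \<phi> :: "'a::field \<Rightarrow> 'a \<Rightarrow> 'a"
  assumes inf: "infinite (UNIV :: 'a set)"
    and pw: "\<And>s. polyfun n (\<phi> s)" and ps: "\<And>w. polyfun n (\<lambda>s. \<phi> s w)"
    and diag: "\<And>s. \<phi> s s = 0"
  obtains \<delta> where "\<And>s w. \<phi> s w + \<phi> w s = (w - s) * \<delta> s w" "\<And>s. polyfun (n - 1) (\<delta> s)"
    "\<And>s w. \<delta> w s = - \<delta> s w" "\<And>s. \<delta> s s = 0"
proof -
  obtain \<psi> where \<psi>: "\<And>s w. \<phi> s w = (w - s) * \<psi> s w" "\<And>s. polyfun (n - 1) (\<psi> s)"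
    "\<And>w. polyfun (n - 1) (\<lambda>s. \<psi> s w)"
    using polyfun_diagonal[OF assms] by blast
  show thesis
  proof (rule that[of "\<lambda>s w. \<psi> s w - \<psi> w s"])
    show "\<phi> s w + \<phi> w s = (w - s) * (\<psi> s w - \<psi> w s)" for s w
      using \<psi>(1)[of s w] \<psi>(1)[of w s] by (simp add: algebra_simps)
    show "polyfun (n - 1) (\<lambda>w. \<psi> s w - \<psi> w s)" for s
      by (rule polyfun_diff[OF \<psi>(2) \<psi>(3)])
  qed simp_all
qed

text \<open>A pair of polynomials is a point moving with the parameter \<open>t\<close>;
  \<open>const_point\<close> is a point at rest.\<close>

definition at_point :: "'a::field \<Rightarrow> 'a poly \<times> 'a poly \<Rightarrow> 'a \<times> 'a" where
  "at_point t q = (poly (fst q) t, poly (snd q) t)"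

definition const_point :: "'a::field \<times> 'a \<Rightarrow> 'a poly \<times> 'a poly" where
  "const_point q = ([:fst q:], [:snd q:])"

lemma at_const_point [simp]: "at_point t (const_point q) = q"
  by (simp add: at_point_def const_point_def)

lemma map_at_const_point [simp]: "map (at_point t) (map const_point A) = A"
  by (induction A) auto

lemma polyfun_ev:
  fixes c :: "(nat \<times> nat) list \<Rightarrow> 'a::field"
  shows "polyfun (sum_list (map (\<lambda>q. a * degree (fst q) + b * degree (snd q)) qs))
    (\<lambda>t. ev (grid a b) c (map (at_point t) qs))"
  unfolding polyfun_def
proof (intro exI conjI allI)
  show "degree (ev (grid a b) (\<lambda>is. [:c is:]) qs)
    \<le> sum_list (map (\<lambda>q. a * degree (fst q) + b * degree (snd q)) qs)"
    by (rule degree_ev) (auto simp: grid_def)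
  show "ev (grid a b) c (map (at_point t) qs) = poly (ev (grid a b) (\<lambda>is. [:c is:]) qs) t" for t
    unfolding poly_ev by (simp add: at_point_def[abs_def])
qed

lemma sum_list_const_points [simp]:
  "sum_list (map (\<lambda>q. a * degree (fst q) + b * degree (snd q)) (map const_point A)) = 0"
  by (induction A) (auto simp: const_point_def)

lemma polyfun_ev_z: "polyfun a (\<lambda>z. ev (grid a b) c (xs @ (z, x) # ys))"
proof -
  have "polyfun a (\<lambda>t. ev (grid a b) c
      (map (at_point t) (map const_point xs @ ([:0, 1:], [:x:]) # map const_point ys)))"
    by (rule polyfun_mono[OF polyfun_ev[of a b]])
      (simp only: map_append sum_list_append list.map(2) sum_list_const_points sum_list.Cons, simp)
  then show ?thesis by (simp only: map_append list.map map_at_const_point) (simp add: at_point_def)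
qed

lemma polyfun_ev_x: "polyfun b (\<lambda>x. ev (grid a b) c (xs @ (z, x) # ys))"
proof -
  have "polyfun b (\<lambda>t. ev (grid a b) c
      (map (at_point t) (map const_point xs @ ([:z:], [:0, 1:]) # map const_point ys)))"
    by (rule polyfun_mono[OF polyfun_ev[of a b]])
      (simp only: map_append sum_list_append list.map(2) sum_list_const_points sum_list.Cons, simp)
  then show ?thesis by (simp only: map_append list.map map_at_const_point) (simp add: at_point_def)
qed

text \<open>All points of \<open>zs\<close> share the moving coordinate \<open>y\<close>, and each
  contributes degree \<open>b\<close>. Moving them together lets the line sweep over further
  points.\<close>

lemma polyfun_ev_line:
  "polyfun (length zs * b) (\<lambda>y. ev (grid a b) c (map (\<lambda>v. (v, y)) zs @ A))"
proof -
  let ?q = "\<lambda>v. ([:v:], [:0, 1:]) :: 'a poly \<times> 'a poly"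
  have "sum_list (map (\<lambda>q. a * degree (fst q) + b * degree (snd q)) (map ?q zs)) = length zs * b"
    by (induction zs) (auto simp: algebra_simps)
  then have "sum_list (map (\<lambda>q. a * degree (fst q) + b * degree (snd q))
      (map ?q zs @ map const_point A)) \<le> length zs * b"
    by (simp only: map_append sum_list_append sum_list_const_points)
  then have "polyfun (length zs * b) (\<lambda>t. ev (grid a b) c
      (map (at_point t) (map ?q zs @ map const_point A)))"
    by (rule polyfun_mono[OF polyfun_ev])
  moreover have "map (at_point t) (map ?q zs) = map (\<lambda>v. (v, t)) zs" for t
    by (simp add: at_point_def)
  ultimately show ?thesis by (simp only: map_append map_at_const_point)
qed

text \<open>The function \<open>g\<close> takes the points \<open>Q, P\<^sub>1, \<dots>, P\<^sub>p\<close>; the pair \<open>(z, x)\<close> stands for the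
  covector that evaluates the monomial of index \<open>(i, j)\<close> to \<open>z\<^sup>i x\<^sup>j\<close>.
  It represents an element of \<open>\<And>\<^sup>p V \<otimes> V\<close>, and \<open>cycle\<close> says that its Koszul differential vanishes
  in \<open>\<And>\<^sup>p\<^sup>-\<^sup>1 V \<otimes> R\<^sub>2\<close>. The defect \<open>Df\<close> vanishes identically iff the class in Koszul cohomology is
  trivial.\<close>

locale koszul_cycle =
  fixes a b p :: nat and c :: "(nat \<times> nat) list \<Rightarrow> 'l::field"
  assumes inf: "infinite (UNIV :: 'l set)"
    and a_pos: "0 < a" and b_pos: "0 < b" and p_pos: "0 < p"
    and alt: "\<And>w. alternating (\<lambda>is. c (w # is))"
    and cycle: "\<And>P A. length A + 1 = p \<Longrightarrow> ev (grid a b) c (P # P # A) = 0"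
begin

abbreviation g :: "('l \<times> 'l) list \<Rightarrow> 'l" where "g \<equiv> ev (grid a b) c"

definition Df :: "'l \<times> 'l \<Rightarrow> 'l \<times> 'l \<Rightarrow> ('l \<times> 'l) list \<Rightarrow> 'l" where
  "Df P Q A = g (Q # P # A) + g (P # Q # A)"

lemma g_alt: "alternating (\<lambda>A. g (Q # A))"
  unfolding ev.simps by (rule alternating_sum_smult) (rule alternating_ev[OF finite_grid alt])

lemma g_swap: "g (Q # P # R # A) = - g (Q # R # P # A)"
  by (rule alternating_swap0[OF g_alt])

lemma g_zero:
  assumes "length A = p" "\<not> distinct (Q # A)"
  shows "g (Q # A) = 0"
proof (cases "Q \<in> set A")
  case True
  then obtain xs ys where A: "A = xs @ Q # ys" by (meson split_list)
  have "g (Q # Q # xs @ ys) = 0" using assms(1) A by (intro cycle) simp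
  then show ?thesis unfolding A by (subst alternating_move0[OF g_alt]) simp
next
  case False
  then show ?thesis using assms(2) alternating_not_distinct[OF g_alt] by auto
qed

lemma Df_sym: "Df P Q A = Df Q P A"
  by (simp add: Df_def)

lemma Df_alt: "alternating (Df P Q)"
proof -
  have 1: "alternating (\<lambda>A. g (Q # P # A))" for P Q
    using alternating_Cons[OF g_alt] .
  show ?thesis
  proof (rule alternatingI)
    fix xs u v ys
    show "Df P Q (xs @ u # v # ys) = - Df P Q (xs @ v # u # ys)"
      using alternating_swap[OF 1[of P Q], of xs u v ys] alternating_swap[OF 1[of Q P], of xs u v ys]
      unfolding Df_def by simp
    show "Df P Q (xs @ u # u # ys) = 0"
      using alternating_same[OF 1[of P Q], of xs u ys] alternating_same[OF 1[of Q P], of xs u ys]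
      unfolding Df_def by simp
  qed
qed

lemma Df_zero:
  assumes "length A + 1 = p" "\<not> distinct (P # Q # A)"
  shows "Df P Q A = 0"
  using g_zero[of "P # A" Q] g_zero[of "Q # A" P] assms unfolding Df_def by auto

text \<open>The six terms cancel in pairs because \<open>g\<close> alternates in all arguments but
  the first. The identity is the means to bring a point from the tail of the defect to its
  front.\<close>

lemma Df_cyclic: "Df P Q (M # A) + Df P M (Q # A) + Df Q M (P # A) = 0"
  using g_swap[of M P Q A] g_swap[of P M Q A] g_swap[of Q M P A]
  unfolding Df_def by simp

lemma polyfun_Df_z1: "polyfun a (\<lambda>z. Df (z, x) Q A)"
  unfolding Df_def using polyfun_ev_z[of a b c "[Q]" x A] polyfun_ev_z[of a b c "[]" x "Q # A"]
  by (intro polyfun_add) simp_all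

lemma polyfun_Df_x1: "polyfun b (\<lambda>x. Df (z, x) Q A)"
  unfolding Df_def using polyfun_ev_x[of b a c "[Q]" z A] polyfun_ev_x[of b a c "[]" z "Q # A"]
  by (intro polyfun_add) simp_all

lemma polyfun_Df_z: "polyfun a (\<lambda>z. Df P Q (xs @ (z, x) # ys))"
  unfolding Df_def
  using polyfun_ev_z[of a b c "Q # P # xs" x ys] polyfun_ev_z[of a b c "P # Q # xs" x ys]
  by (intro polyfun_add) simp_all

lemma polyfun_Df_x: "polyfun b (\<lambda>x. Df P Q (xs @ (z, x) # ys))"
  unfolding Df_def
  using polyfun_ev_x[of b a c "Q # P # xs" z ys] polyfun_ev_x[of b a c "P # Q # xs" z ys]
  by (intro polyfun_add) simp_all

lemma polyfun_Df_line:
  "polyfun ((length zs + 2) * b) (\<lambda>y. Df (z, y) (w, y) (map (\<lambda>v. (v, y)) zs @ A))"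
  unfolding Df_def
  using polyfun_ev_line[of "w # z # zs" b a c A] polyfun_ev_line[of "z # w # zs" b a c A]
  by (intro polyfun_add) (simp_all add: algebra_simps)

lemma Df_diagonal_z:
  assumes "length B + 1 = p"
  obtains \<delta> where "\<And>s w. Df (s, y) (w, y) B = (w - s) * \<delta> s w" "\<And>s. polyfun (a - 1) (\<delta> s)"
    "\<And>s w. \<delta> w s = - \<delta> s w" "\<And>s. \<delta> s s = 0"
proof -
  let ?\<phi> = "\<lambda>s w. g ((w, y) # (s, y) # B)"
  have "polyfun a (\<lambda>w. ?\<phi> s w)" for s using polyfun_ev_z[of a b c "[]" y "(s, y) # B"] by simp
  moreover have "polyfun a (\<lambda>s. ?\<phi> s w)" for w using polyfun_ev_z[of a b c "[(w, y)]" y B] by simp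
  moreover have "?\<phi> s s = 0" for s by (rule cycle[OF assms])
  ultimately obtain \<delta> where \<delta>: "\<And>s w. ?\<phi> s w + ?\<phi> w s = (w - s) * \<delta> s w"
    "\<And>s. polyfun (a - 1) (\<delta> s)" "\<And>s w. \<delta> w s = - \<delta> s w" "\<And>s. \<delta> s s = 0"
    by (rule polyfun_symmetrize_diagonal[OF inf, of a ?\<phi>]) (rule that; assumption)
  show thesis
    by (rule that[of \<delta>]) (unfold Df_def, (rule \<delta>)+)
qed

lemma Df_diagonal_x:
  assumes "length B + 1 = p"
  obtains \<delta> where "\<And>s w. Df (z, s) (z, w) B = (w - s) * \<delta> s w" "\<And>s. polyfun (b - 1) (\<delta> s)"
    "\<And>s w. \<delta> w s = - \<delta> s w" "\<And>s. \<delta> s s = 0"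
proof -
  let ?\<phi> = "\<lambda>s w. g ((z, w) # (z, s) # B)"
  have "polyfun b (\<lambda>w. ?\<phi> s w)" for s using polyfun_ev_x[of b a c "[]" z "(z, s) # B"] by simp
  moreover have "polyfun b (\<lambda>s. ?\<phi> s w)" for w using polyfun_ev_x[of b a c "[(z, w)]" z B] by simp
  moreover have "?\<phi> s s = 0" for s by (rule cycle[OF assms])
  ultimately obtain \<delta> where \<delta>: "\<And>s w. ?\<phi> s w + ?\<phi> w s = (w - s) * \<delta> s w"
    "\<And>s. polyfun (b - 1) (\<delta> s)" "\<And>s w. \<delta> w s = - \<delta> s w" "\<And>s. \<delta> s s = 0"
    by (rule polyfun_symmetrize_diagonal[OF inf, of b ?\<phi>]) (rule that; assumption)
  show thesis
    by (rule that[of \<delta>]) (unfold Df_def, (rule \<delta>)+)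
qed

section \<open>The defect on a line of the first scroll\<close>

text \<open>The line \<open>x = y\<close> carries \<open>a + 1\<close> of the points. The cofactor
  \<open>\<delta> z\<close> has degree at most \<open>a - 1\<close> but \<open>a\<close> zeros: the
  entries of \<open>zs\<close>, and \<open>z\<close> itself because of the second-order zero on the
  diagonal.\<close>

lemma Df_line_full:
  assumes "length zs + 1 = a" "length zs + length A + 1 = p"
  shows "Df (z, y) (w, y) (map (\<lambda>v. (v, y)) zs @ A) = 0"
proof (cases "distinct (z # w # zs)")
  case False
  then have "\<not> distinct ((z, y) # (w, y) # map (\<lambda>v. (v, y)) zs @ A)"
    by (auto simp: distinct_map inj_on_def)
  then show ?thesis using assms by (intro Df_zero) auto
next
  case True
  let ?B = "map (\<lambda>v. (v, y)) zs @ A"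
  have len: "length ?B + 1 = p" using assms by simp
  obtain \<delta> where \<delta>: "\<And>s w. Df (s, y) (w, y) ?B = (w - s) * \<delta> s w" "\<And>s. polyfun (a - 1) (\<delta> s)"
    "\<And>s. \<delta> s s = 0"
    by (rule Df_diagonal_z[OF len, of y]) (rule that; assumption)
  have "\<delta> z w = 0"
  proof (rule polyfun_roots_list[OF \<delta>(2)])
    show "\<delta> z v = 0" if "v \<in> set (z # zs)" for v
    proof (cases "v = z")
      case False
      have "Df (z, y) (v, y) ?B = 0" using that False len by (intro Df_zero) auto
      then show ?thesis using \<delta>(1)[of z v] False by simp
    qed (simp add: \<delta>(3))
    show "distinct (z # zs)" using True by simp
    show "a - 1 < length (z # zs)" using assms by simp
  qed
  then show ?thesis using \<delta>(1) by simp
qed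

text \<open>The line carries \<open>m + 1\<close> of the \<open>p + 1\<close> points and the others
  are generic. \<open>S\<close> and \<open>T\<close> hold coordinates that generic points have to
  avoid; they are nonempty only in the boundary case \<open>p + 1 = a b + a\<close>.\<close>

definition line_vanish :: "'l set \<Rightarrow> 'l set \<Rightarrow> nat \<Rightarrow> bool" where
  "line_vanish S T m \<longleftrightarrow> (\<forall>zs z w y A. length zs + 1 = m \<longrightarrow> length A + m = p \<longrightarrow>
     distinct (z # w # zs @ map fst A) \<longrightarrow> distinct (map snd A) \<longrightarrow> set (map snd A) \<inter> T = {} \<longrightarrow>
     set (zs @ map fst A) \<inter> S = {} \<longrightarrow> Df (z, y) (w, y) (map (\<lambda>v. (v, y)) zs @ A) = 0)"

lemma line_vanish_full: "line_vanish S T a"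
  unfolding line_vanish_def using Df_line_full by auto

text \<open>As a polynomial in \<open>y\<close> the defect has degree at most \<open>(m + 1) b\<close>, and it vanishes at the
  \<open>p - m\<close> second coordinates of \<open>A\<close>.\<close>

lemma line_vanish_step:
  assumes "line_vanish S T (Suc m)" "(m + 1) * b < p - m" "0 < m"
  shows "line_vanish S T m"
  unfolding line_vanish_def
proof (intro allI impI)
  fix zs :: "'l list" and z w y :: 'l and A
  assume len: "length zs + 1 = m" "length A + m = p" and d: "distinct (z # w # zs @ map fst A)"
    and dA: "distinct (map snd A)" "set (map snd A) \<inter> T = {}" "set (zs @ map fst A) \<inter> S = {}"
  show "Df (z, y) (w, y) (map (\<lambda>v. (v, y)) zs @ A) = 0"
  proof (rule polyfun_roots_list[OF polyfun_Df_line, where l = "map snd A"])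
    fix x assume "x \<in> set (map snd A)"
    then obtain v where "(v, x) \<in> set A" by auto
    then obtain xs ys where A: "A = xs @ (v, x) # ys" by (meson split_list)
    \<comment> \<open>At \<open>y = x\<close> the point \<open>(v, x)\<close> of \<open>A\<close>
      joins the line, which leads to the case \<open>Suc m\<close>.\<close>
    have "Df (z, x) (w, x) (map (\<lambda>v. (v, x)) (v # zs) @ xs @ ys) = 0"
      by (rule assms(1)[unfolded line_vanish_def, rule_format]) (use A len d dA in auto)
    then show "Df (z, x) (w, x) (map (\<lambda>v. (v, x)) zs @ A) = 0"
      by (rule alternating_perm_zero[OF Df_alt, rotated]) (simp add: A)
  qed (use len assms dA in auto)
qed

lemma line_vanish_down:
  assumes "line_vanish S T k" "\<And>m. 0 < m \<Longrightarrow> m < k \<Longrightarrow> (m + 1) * b < p - m" "0 < m" "m \<le> k"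
  shows "line_vanish S T m"
  using assms(4,3)
proof (induction rule: inc_induct)
  case base then show ?case using assms(1) by simp
next
  case (step n)
  then show ?case using line_vanish_step[of S T n] assms(2)[of n] by simp
qed

text \<open>For fixed \<open>A\<close> the defect is the polarisation of a quadric that vanishes on
  the surface. The condition makes this quadric vanish on the span of every line
  \<open>x = y\<close>; these spans sweep out the first scroll.\<close>

definition scroll_cycle :: bool where
  "scroll_cycle \<longleftrightarrow> (\<forall>z w y A. length A + 1 = p \<longrightarrow> Df (z, y) (w, y) A = 0)"

lemma scroll_cycleI:
  assumes "line_vanish S T 1" "finite S" "finite T"
  shows scroll_cycle
  unfolding scroll_cycle_def
proof (intro allI impI)
  fix z w y :: 'l and A :: "('l \<times> 'l) list" assume len: "length A + 1 = p"
  show "Df (z, y) (w, y) A = 0"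
  proof (cases "z = w")
    case True then show ?thesis using Df_zero[OF len, of "(z, y)" "(w, y)"] by simp
  next
    case False
    show ?thesis
    proof (rule vanishing_generic[OF inf, where S = "insert z (insert w S)" and T = T and n = "p - 1"])
      fix B assume "length B = p - 1" "distinct (map fst B)" "distinct (map snd B)"
        "set (map fst B) \<inter> insert z (insert w S) = {}" "set (map snd B) \<inter> T = {}"
      then show "Df (z, y) (w, y) B = 0"
        using assms(1)[unfolded line_vanish_def, rule_format, of "[]" B z w y] p_pos False by auto
    next
      show "\<exists>N. polyfun N (\<lambda>v. Df (z, y) (w, y) (xs @ (v, x) # ys))" for xs x ys
        by (rule exI) (rule polyfun_Df_z)
      show "\<exists>N. polyfun N (\<lambda>x. Df (z, y) (w, y) (xs @ (v, x) # ys))" for xs v ys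
        by (rule exI) (rule polyfun_Df_x)
    qed (use assms(2,3) len in auto)
  qed
qed

end

context koszul_cycle begin

section \<open>Cycles of the first scroll\<close>

text \<open>The scroll has degree \<open>(a + 1) b\<close>; the points \<open>node n\<close> with \<open>n < (a + 1) b\<close> form a linear
  section of it. In the stage \<open>j\<close> the lines \<open>z = \<zeta>\<^sub>i\<close> with \<open>i < j\<close> are cut down to nodes.\<close>

definition node :: "(nat \<Rightarrow> 'l) \<Rightarrow> nat \<Rightarrow> 'l \<times> 'l" where
  "node \<xi> n = (\<xi> (n div b), \<xi> n)"

definition staged :: "(nat \<Rightarrow> 'l) \<Rightarrow> nat \<Rightarrow> ('l \<times> 'l) set" where
  "staged \<xi> j = {(\<xi> i, x) |i x. j \<le> i \<and> i \<le> a} \<union> {(\<xi> i, \<xi> (i * b + s)) |i s. i < j \<and> i \<le> a \<and> s < b}"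

lemma inj_nodes: "inj \<xi> \<Longrightarrow> n * b + s = m * b + t \<Longrightarrow> s < b \<Longrightarrow> t < b \<Longrightarrow> n = m"
  by (metis b_pos div_mult_self3 div_less add_0_right less_numeral_extra(3) not_less_zero)

lemma staged_Suc:
  assumes "P \<in> staged \<xi> j" "P \<notin> staged \<xi> (Suc j)"
  obtains x where "P = (\<xi> j, x)"
proof -
  consider i x where "P = (\<xi> i, x)" "j \<le> i" "i \<le> a"
    | i s where "P = (\<xi> i, \<xi> (i * b + s))" "i < j" "i \<le> a" "s < b"
    using assms(1) unfolding staged_def by blast
  then show thesis
  proof cases
    case 1
    have "i = j"
    proof (rule ccontr)
      assume "i \<noteq> j"
      then have "Suc j \<le> i" using 1 by simp
      then show False using assms(2) 1 unfolding staged_def by blast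
    qed
    then show thesis using 1 that by blast
  next
    case 2
    then have "i < Suc j" by simp
    then show thesis using assms(2) 2 unfolding staged_def by blast
  qed
qed

lemma staged_line: "j \<le> a \<Longrightarrow> (\<xi> j, x) \<in> staged \<xi> j"
  unfolding staged_def by blast

lemma staged_node: "j \<le> a \<Longrightarrow> s < b \<Longrightarrow> (\<xi> j, \<xi> (j * b + s)) \<in> staged \<xi> (Suc j)"
  unfolding staged_def by blast

text \<open>Here the line \<open>z = \<xi> j\<close> is filled in from its \<open>b\<close> nodes.
  The defect has degree \<open>b\<close> in a second coordinate, so one zero beyond the nodes is
  needed. It comes from \<open>scroll_cycle\<close>, where the two front points have equal second
  coordinates, or from the coincidence of two points.\<close>

lemma Df_staged_step:
  assumes inj: "inj \<xi>" and scr: scroll_cycle and j: "j \<le> a"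
    and IH: "\<And>P Q A. length A + 1 = p \<Longrightarrow> set (P # Q # A) \<subseteq> staged \<xi> (Suc j) \<Longrightarrow> Df P Q A = 0"
    and len: "length A + 1 = p" and sub: "set (P # Q # A) \<subseteq> staged \<xi> j"
  shows "Df P Q A = 0"
proof -
  let ?S = "staged \<xi> (Suc j)"
  define K where "K = (\<lambda>s. \<xi> (j * b + s)) ` {..<b}"
  have cX: "card K = b"
    unfolding K_def by (subst card_image) (auto intro!: inj_onI dest: injD[OF inj])
  have KS: "(\<xi> j, x) \<in> ?S" if "x \<in> K" for x
    using that staged_node[OF j] unfolding K_def by auto
  have new: "\<exists>x. R = (\<xi> j, x)" if "R \<in> staged \<xi> j" "R \<notin> ?S" for R
    using staged_Suc[OF that] by blast
  have roots: "f x = 0" if "polyfun b f" "\<And>x. x \<in> K \<Longrightarrow> f x = 0" "f u = 0" "u \<notin> K" for f and u x :: 'l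
  proof (rule polyfun_roots[OF that(1), of "insert u K"])
    show "b < card (insert u K)" using that(4) cX b_pos by (simp add: card_ge_0_finite)
  qed (use that in auto)
  text \<open>One new point, in front.\<close>
  have head: "Df (\<xi> j, x) Q A = 0" if Q: "Q \<in> ?S" and A: "set A \<subseteq> ?S" "length A + 1 = p" for x Q A
  proof -
    have z: "Df (\<xi> j, x) Q A = 0" if "x \<in> K" for x
      using that KS Q A by (intro IH) auto
    obtain i x' where Qi: "Q = (\<xi> i, x')" "i \<le> a" and Q': "j < i \<or> (\<exists>s<b. x' = \<xi> (i * b + s))"
      using Q unfolding staged_def by auto
    show ?thesis
    proof (cases "i = j")
      case False
      \<comment> \<open>The extra zero is \<open>x = x'\<close>, where both front points lie on one
        line of the scroll; it is a new zero only if \<open>x'\<close> does not belong to a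
        node.\<close>
      have *: "Df (\<xi> j, x) (\<xi> i, x') A = 0" if "x' \<notin> K" "\<And>x. x \<in> K \<Longrightarrow> Df (\<xi> j, x) (\<xi> i, x') A = 0" for x x'
        by (rule roots[OF polyfun_Df_x1, of _ _ _ x'])
          (use that scr A(2) in \<open>auto simp: scroll_cycle_def\<close>)
      show ?thesis
      proof (cases "j < i")
        case True
        \<comment> \<open>The line with index \<open>i\<close> is still complete, so
          \<open>x'\<close> may vary: values outside \<open>K\<close> are settled by the extra zero,
          and the others follow because the defect is polynomial in \<open>x'\<close>.\<close>
        have "(\<xi> i, x') \<in> ?S" for x' using True Qi(2) unfolding staged_def by auto
        then have **: "Df (\<xi> j, x) (\<xi> i, x') A = 0" if "x' \<notin> K" for x'
          using * that IH KS A by simp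
        have "Df (\<xi> i, x') (\<xi> j, x) A = 0"
        proof (rule polyfun_cofinite[OF inf polyfun_Df_x1, of K])
          show "finite K" by (simp add: K_def)
          show "Df (\<xi> i, x') (\<xi> j, x) A = 0" if "x' \<notin> K" for x'
            by (subst Df_sym) (rule **[OF that])
        qed
        then show ?thesis unfolding Qi(1) by (subst Df_sym)
      next
        case f: False
        then obtain s where s: "s < b" "x' = \<xi> (i * b + s)" using Q' by blast
        have "x' \<notin> K" using s False inj_nodes[OF inj, of i s j] inj unfolding K_def by (auto dest: injD)
        then show ?thesis using * z unfolding Qi(1) by blast
      qed
    next
      case True
      then obtain s where "s < b" "x' = \<xi> (j * b + s)" using Q' by auto
      then have x': "x' \<in> K" unfolding K_def by auto
      obtain \<delta> where \<delta>: "\<And>s w. Df (\<xi> j, s) (\<xi> j, w) A = (w - s) * \<delta> s w" "\<And>s. polyfun (b - 1) (\<delta> s)"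
          "\<And>s w. \<delta> w s = - \<delta> s w" "\<And>s. \<delta> s s = 0"
        by (rule Df_diagonal_x[OF A(2), of "\<xi> j"]) (rule that; assumption)
      have XX: "\<delta> u v = 0" if "u \<in> K" "v \<in> K" for u v
      proof (cases "u = v")
        case False
        have "Df (\<xi> j, u) (\<xi> j, v) A = 0" using that KS A by (intro IH) auto
        then show ?thesis using \<delta>(1)[of u v] False by simp
      qed (simp add: \<delta>(4))
      \<comment> \<open>Within one line the cofactor has degree \<open>b - 1\<close> only, and the
        \<open>b\<close> nodes suffice.\<close>
      have "\<delta> u v = 0" if "u \<in> K" for u v
        by (rule polyfun_roots[OF \<delta>(2), of K]) (use that XX cX b_pos in auto)
      then have "\<delta> x' x = 0" using x' by blast
      then have "\<delta> x x' = 0" using \<delta>(3)[of x x'] by simp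
      then show ?thesis unfolding Qi(1) True \<delta>(1) by simp
    qed
  qed
  have one: "Df P Q (R # A) = 0"
    if prems: "P \<in> ?S" "Q \<in> ?S" "R \<in> staged \<xi> j" "set A \<subseteq> ?S" "length (R # A) + 1 = p" for P Q R A
  proof (cases "R \<in> ?S")
    case True then show ?thesis using prems by (intro IH) auto
  next
    case False
    then obtain x where R: "R = (\<xi> j, x)" using new prems(3) by blast
    have "Df P R (Q # A) = 0" "Df Q R (P # A) = 0"
      unfolding R using prems by (subst Df_sym, intro head; simp)+
    then show ?thesis using Df_cyclic[of P Q R A] by simp
  qed
  text \<open>Induction on the number of new points: with two of them, the defect vanishes
    when one of them is a node and when both coincide.\<close>
  have main: "\<forall>P Q A. length A + 1 = p \<longrightarrow> set (P # Q # A) \<subseteq> staged \<xi> j \<longrightarrow>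
      length (filter (\<lambda>R. R \<notin> ?S) (P # Q # A)) = k \<longrightarrow> Df P Q A = 0" for k
  proof (induction k rule: less_induct)
    case (less k)
    show ?case
    proof (intro allI impI)
      fix P Q A
      assume len: "length A + 1 = p" and sub: "set (P # Q # A) \<subseteq> staged \<xi> j"
        and k: "length (filter (\<lambda>R. R \<notin> ?S) (P # Q # A)) = k"
      \<comment> \<open>The common argument of the cases below: one new point moves as
        \<open>x\<close> while the new point \<open>w\<close> stays. For \<open>x\<close> in
        \<open>K\<close> the number of new points drops, and at \<open>x = w\<close> two points
        coincide. The multiset \<open>M\<close> holds the other points, whatever slots they
        occupy.\<close>
      have two: "Df P' Q' A' = 0"
        if f: "polyfun b (\<lambda>x. Df (P2 x) (Q2 x) (A2 x))" and e: "Df P' Q' A' = Df (P2 u) (Q2 u) (A2 u)"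
          and d: "\<not> distinct (P2 w # Q2 w # A2 w)"
          and m: "\<And>x. mset (P2 x # Q2 x # A2 x) = add_mset (\<xi> j, x) (add_mset (\<xi> j, w) M)"
          and M: "mset (P # Q # A) = add_mset (\<xi> j, u) (add_mset (\<xi> j, w) M)" and uS: "(\<xi> j, u) \<notin> ?S" and wS: "(\<xi> j, w) \<notin> ?S"
        for P' Q' A' P2 Q2 A2 u w M
      proof -
        have szeq: "length (A2 x) = length A" for x
        proof -
          have "size (mset (P2 x # Q2 x # A2 x)) = size (mset (P # Q # A))"
            unfolding m M by simp
          then show ?thesis by simp
        qed
        have kM: "k = 2 + size (filter_mset (\<lambda>R. R \<notin> ?S) M)"
        proof -
          have "k = size (filter_mset (\<lambda>R. R \<notin> ?S) (mset (P # Q # A)))"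
            using k by (metis mset_filter size_mset)
          then show ?thesis unfolding M using uS wS by simp
        qed
        have setM: "set_mset M \<subseteq> staged \<xi> j"
          using sub arg_cong[OF M, of set_mset] by auto
        have sets: "set (P2 x # Q2 x # A2 x) \<subseteq> staged \<xi> j" for x
          unfolding set_mset_mset[symmetric] m using setM staged_line[OF j] by auto
        have "Df (P2 x) (Q2 x) (A2 x) = 0" if "x \<in> K" for x
        proof -
          have "length (filter (\<lambda>R. R \<notin> ?S) (P2 x # Q2 x # A2 x))
              = size (filter_mset (\<lambda>R. R \<notin> ?S) (mset (P2 x # Q2 x # A2 x)))"
            by (metis mset_filter size_mset)
          also have "\<dots> < k" unfolding m kM using wS KS[OF that] by simp
          finally have lt: "length (filter (\<lambda>R. R \<notin> ?S) (P2 x # Q2 x # A2 x)) < k" .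
          have "length (A2 x) + 1 = p" using szeq[of x] len by simp
          from less.IH[OF lt, rule_format, OF this sets refl] show ?thesis .
        qed
        then have z: "\<And>x. x \<in> K \<Longrightarrow> Df (P2 x) (Q2 x) (A2 x) = 0" .
        have "w \<notin> K" using wS KS by blast
        have "Df (P2 w) (Q2 w) (A2 w) = 0"
          using d szeq len by (intro Df_zero) auto
        from roots[OF f z this \<open>w \<notin> K\<close>] have "Df (P2 u) (Q2 u) (A2 u) = 0" .
        then show ?thesis using e by simp
      qed
      show "Df P Q A = 0"
      proof (cases "P \<in> ?S")
        case PS: False
        then obtain u where P: "P = (\<xi> j, u)" using new[of P] sub by (meson list.set_intros(1) subsetD)
        show ?thesis
        proof (cases "set (Q # A) \<subseteq> ?S")
          case True then show ?thesis unfolding P using head len by auto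
        next
          case False
          show ?thesis
          proof (cases "Q \<in> ?S")
            case True
            then obtain R where "R \<in> set A" "R \<notin> ?S" using False by auto
            then obtain w xs ys where A: "A = xs @ (\<xi> j, w) # ys" "(\<xi> j, w) \<notin> ?S"
              using new sub split_list by (metis list.set_intros(2) subsetD)
            show ?thesis
              by (rule two[where ?P2.0 = "\<lambda>x. (\<xi> j, x)" and ?Q2.0 = "\<lambda>_. Q" and ?A2.0 = "\<lambda>_. A" and u = u and w = w
                    and M = "add_mset Q (mset xs + mset ys)"])
                (use A PS in \<open>auto simp: P polyfun_Df_x1\<close>)
          next
            case False
            then obtain w where Q: "Q = (\<xi> j, w)" using new[of Q] sub by (meson list.set_intros subsetD)
            show ?thesis
              by (rule two[where ?P2.0 = "\<lambda>x. (\<xi> j, x)" and ?Q2.0 = "\<lambda>_. Q" and ?A2.0 = "\<lambda>_. A" and u = u and w = w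
                    and M = "mset A"])
                (use False PS in \<open>auto simp: P Q polyfun_Df_x1\<close>)
          qed
        qed
      next
        case PS: True
        show ?thesis
        proof (cases "Q \<in> ?S")
          case QS: False
          then obtain u where Q: "Q = (\<xi> j, u)" using new[of Q] sub by (meson list.set_intros subsetD)
          show ?thesis
          proof (cases "set A \<subseteq> ?S")
            case True then show ?thesis unfolding Q using len by (subst Df_sym) (intro head[OF PS]; simp)
          next
            case False
            then obtain R where "R \<in> set A" "R \<notin> ?S" by auto
            then obtain w xs ys where A: "A = xs @ (\<xi> j, w) # ys" "(\<xi> j, w) \<notin> ?S"
              using new sub split_list by (metis list.set_intros(2) subsetD)
            show ?thesis
              by (rule two[where ?P2.0 = "\<lambda>x. (\<xi> j, x)" and ?Q2.0 = "\<lambda>_. P" and ?A2.0 = "\<lambda>_. A" and u = u and w = w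
                    and M = "add_mset P (mset xs + mset ys)"])
                (use A QS Df_sym[of P Q A] in \<open>auto simp: Q polyfun_Df_x1\<close>)
          qed
        next
          case QS: True
          show ?thesis
          proof (cases "set A \<subseteq> ?S")
            case True then show ?thesis using PS QS len by (intro IH) auto
          next
            case False
            then obtain R where R: "R \<in> set A" "R \<notin> ?S" by auto
            then obtain u A' where A: "mset A = mset ((\<xi> j, u) # A')" and uS: "(\<xi> j, u) \<notin> ?S"
              using new sub by (metis ex_mset insert_DiffM list.set_intros(2) mset.simps(2) set_mset_mset subsetD)
            have len': "length A' + 2 = p" using len arg_cong[OF A, of size] by simp
            have "set ((\<xi> j, u) # A') = set A" using arg_cong[OF A, of set_mset] by simp
            then have sub': "set A' \<subseteq> staged \<xi> j" using sub by auto
            have "Df P Q ((\<xi> j, u) # A') = 0"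
            proof (cases "set A' \<subseteq> ?S")
              case True
              then show ?thesis using one[OF PS QS] len' staged_line[OF j] by simp
            next
              case False
              then obtain R where "R \<in> set A'" "R \<notin> ?S" by auto
              then obtain w xs ys where A': "A' = xs @ (\<xi> j, w) # ys" "(\<xi> j, w) \<notin> ?S"
                using new sub' split_list by (metis subsetD)
              show ?thesis
                by (rule two[where ?P2.0 = "\<lambda>_. P" and ?Q2.0 = "\<lambda>_. Q" and ?A2.0 = "\<lambda>x. (\<xi> j, x) # A'" and u = u and w = w
                    and M = "add_mset P (add_mset Q (mset xs + mset ys))"])
                  (use A A' uS polyfun_Df_x[of P Q "[]"] in auto)
            qed
            then show ?thesis by (rule alternating_perm_zero[OF Df_alt, rotated]) (simp add: A)
          qed
        qed
      qed
    qed
  qed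
  then show ?thesis using len sub by blast
qed

text \<open>Stage \<open>a + 1\<close> consists of nodes and stage 0 of the full lines
  \<open>z = \<xi> i\<close> with \<open>i \<le> a\<close>. The defect has degree \<open>a\<close>
  in every first coordinate, so vanishing on these \<open>a + 1\<close> lines forces vanishing
  everywhere.\<close>

lemma Df_all_zero:
  assumes inj: "inj \<xi>" and scr: scroll_cycle
    and nodes: "\<And>P Q A. length A + 1 = p \<Longrightarrow> set (P # Q # A) \<subseteq> node \<xi> ` {..<(a + 1) * b} \<Longrightarrow> Df P Q A = 0"
    and len: "length A + 1 = p"
  shows "Df P Q A = 0"
proof -
  have nds: "staged \<xi> (Suc a) \<subseteq> node \<xi> ` {..<(a + 1) * b}"
  proof
    fix P assume "P \<in> staged \<xi> (Suc a)"
    then obtain i s where P: "P = (\<xi> i, \<xi> (i * b + s))" "i \<le> a" "s < b" unfolding staged_def by auto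
    have "i * b + s < (i + 1) * b" using P(3) by simp
    also have "\<dots> \<le> (a + 1) * b" using P(2) by (intro mult_le_mono1) simp
    finally have "i * b + s < (a + 1) * b" .
    moreover have "node \<xi> (i * b + s) = P" unfolding P(1) node_def using P(3) by simp
    ultimately show "P \<in> node \<xi> ` {..<(a + 1) * b}" by blast
  qed
  have down: "\<forall>P Q A. length A + 1 = p \<longrightarrow> set (P # Q # A) \<subseteq> staged \<xi> j \<longrightarrow> Df P Q A = 0" if "j \<le> Suc a" for j
    using that
  proof (induction rule: inc_induct)
    case base
    show ?case by (intro allI impI, rule nodes, assumption) (rule order.trans[OF _ nds])
  next
    case (step j)
    have "j \<le> a" using step.hyps by simp
    show ?case
    proof (intro allI impI)
      fix P Q A assume *: "length A + 1 = p" "set (P # Q # A) \<subseteq> staged \<xi> j"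
      show "Df P Q A = 0"
      proof (rule Df_staged_step[OF inj scr \<open>j \<le> a\<close> _ *])
        fix P Q A assume "length A + 1 = p" "set (P # Q # A) \<subseteq> staged \<xi> (Suc j)"
        then show "Df P Q A = 0" using step.IH by blast
      qed
    qed
  qed
  have s0: "(\<xi> i, x) \<in> staged \<xi> 0" if "i \<le> a" for i x using that unfolding staged_def by auto
  let ?Z = "\<xi> ` {..a}"
  have cZ: "a < card ?Z" by (subst card_image) (auto intro!: inj_onI dest: injD[OF inj])
  have z0: "Df P Q A = 0" if "length A + 1 = p" "set (map fst (P # Q # A)) \<subseteq> ?Z" for P Q A
  proof -
    have "set (P # Q # A) \<subseteq> staged \<xi> 0"
    proof
      fix R assume "R \<in> set (P # Q # A)"
      then have "fst R \<in> ?Z" using that(2) by (metis (no_types) image_subset_iff list.set_map)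
      then obtain i where i: "i \<le> a" "fst R = \<xi> i" by auto
      from s0[OF i(1), of "snd R"] i(2) show "R \<in> staged \<xi> 0" by (metis prod.collapse)
    qed
    then show ?thesis using down[of 0] that(1) by blast
  qed
  have tail: "Df P Q (xs @ ys) = 0"
    if "length (xs @ ys) + 1 = p" "set (map fst (P # Q # ys)) \<subseteq> ?Z" for P Q xs ys
    using that
  proof (induction xs arbitrary: ys rule: rev_induct)
    case Nil then show ?case using z0 by simp
  next
    case (snoc q xs)
    have "Df P Q (xs @ (z, snd q) # ys) = 0" for z
      by (rule polyfun_roots[OF polyfun_Df_z _ cZ]) (use snoc.IH snoc.prems in auto)
    from this[of "fst q"] show ?case by simp
  qed
  have *: "Df (z, x) Q A = 0" if "length A + 1 = p" "fst Q \<in> ?Z" for z x Q A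
    by (rule polyfun_roots[OF polyfun_Df_z1 _ cZ]) (use tail[of A "[]"] that in auto)
  have "Df (z, x) P A = 0" if "length A + 1 = p" for z x P A
  proof -
    have "Df (v, snd P) (z, x) A = 0" if "v \<in> ?Z" for v
      by (subst Df_sym) (use *[of A "(v, snd P)" z x] \<open>length A + 1 = p\<close> that in simp)
    then have "Df (fst P, snd P) (z, x) A = 0" by (rule polyfun_roots[OF polyfun_Df_z1 _ cZ])
    then show ?thesis by (subst Df_sym) simp
  qed
  from this[OF len, of "fst P" "snd P"] show ?thesis by simp
qed

end

section \<open>Reduction from tuples of nodes to the test configurations\<close>

context koszul_cycle begin

text \<open>If neither front point is the largest node, \<open>Df_cyclic\<close> moves that node
  from the tail to the front. So each set of \<open>p + 1\<close> nodes needs only the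
  \<open>p\<close> tests that pair another node with the largest one.\<close>

lemma Df_nodes_zero:
  assumes inj: "inj \<xi>"
    and func: "\<And>B n. B \<subseteq> {..<(a + 1) * b} \<Longrightarrow> card B = p + 1 \<Longrightarrow> n \<in> B \<Longrightarrow> n \<noteq> Max B \<Longrightarrow>
      Df (node \<xi> n) (node \<xi> (Max B)) (map (node \<xi>) (sorted_list_of_set (B - {n, Max B}))) = 0"
    and len: "length A + 1 = p" and sub: "set (P # Q # A) \<subseteq> node \<xi> ` {..<(a + 1) * b}"
  shows "Df P Q A = 0"
proof (cases "distinct (P # Q # A)")
  case False then show ?thesis using Df_zero len by blast
next
  case True
  obtain ns where ns: "P # Q # A = map (node \<xi>) ns" "set ns \<subseteq> {..<(a + 1) * b}"
  proof -
    have "\<forall>R\<in>set (P # Q # A). \<exists>n. n < (a + 1) * b \<and> node \<xi> n = R" using sub by blast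
    from bchoice[OF this] obtain h where
      h: "\<And>R. R \<in> set (P # Q # A) \<Longrightarrow> h R < (a + 1) * b \<and> node \<xi> (h R) = R" by blast
    show thesis
    proof (rule that)
      show "P # Q # A = map (node \<xi>) (map h (P # Q # A))"
        unfolding map_map by (rule map_idI[symmetric]) (simp only: comp_def h)
      show "set (map h (P # Q # A)) \<subseteq> {..<(a + 1) * b}"
        unfolding set_map unfolding image_subset_iff lessThan_iff using h by blast
    qed
  qed
  then obtain n m ks where nmk: "ns = n # m # ks" by (auto simp: map_eq_Cons_conv Cons_eq_map_conv)
  have PQA: "P = node \<xi> n" "Q = node \<xi> m" "A = map (node \<xi>) ks" using ns(1) nmk by auto
  have dn: "distinct ns" using True unfolding ns(1) by (simp add: distinct_map)
  define B where "B = set ns"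
  have B: "B \<subseteq> {..<(a + 1) * b}" "card B = p + 1"
    unfolding B_def distinct_card[OF dn] using ns(2) nmk len PQA by auto
  have MB: "Max B \<in> B" unfolding B_def nmk by (rule Max_in) auto
  have key: "Df (node \<xi> n') (node \<xi> (Max B)) (map (node \<xi>) ks') = 0"
    if m: "mset (n' # Max B # ks') = mset ns" for n' ks'
  proof -
    have d: "distinct (n' # Max B # ks')" using m dn by (metis mset_eq_imp_distinct_iff)
    have s: "set (n' # Max B # ks') = B" using mset_eq_setD[OF m] by (simp only: B_def[symmetric])
    have "mset (sorted_list_of_set (B - {n', Max B})) = mset ks'"
    proof (rule iffD1[OF set_eq_iff_mset_eq_distinct])
      have "finite B" unfolding B_def by simp
      then show "set (sorted_list_of_set (B - {n', Max B})) = set ks'"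
        using d s by (simp del: insert_iff) auto
    qed (use d in auto)
    moreover have "Df (node \<xi> n') (node \<xi> (Max B)) (map (node \<xi>) (sorted_list_of_set (B - {n', Max B}))) = 0"
      by (rule func[OF B]) (use d s in auto)
    ultimately show ?thesis by (intro alternating_perm_zero[OF Df_alt _ \<open>Df _ _ _ = 0\<close>]) simp
  qed
  consider "m = Max B" | "n = Max B" | "Max B \<in> set ks"
    using MB unfolding B_def nmk by auto
  then show ?thesis
  proof cases
    case 1 then show ?thesis using key[of n ks] unfolding PQA nmk by simp
  next
    case 2 then show ?thesis using key[of m ks] unfolding PQA nmk
      by (subst Df_sym) (simp add: add_mset_commute)
  next
    case 3
    then obtain xs ys where ks: "ks = xs @ Max B # ys" by (meson split_list)
    let ?r = "map (node \<xi>) (xs @ ys)" and ?M = "node \<xi> (Max B)"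
    have "Df P ?M (Q # ?r) = 0" "Df Q ?M (P # ?r) = 0"
      using key[of n "m # xs @ ys"] key[of m "n # xs @ ys"] unfolding PQA nmk ks by (auto simp: add_mset_commute)
    then have "Df P Q (?M # ?r) = 0" using Df_cyclic[of P Q ?M ?r] by simp
    then show ?thesis by (rule alternating_perm_zero[OF Df_alt, rotated]) (simp add: PQA ks)
  qed
qed

end

section \<open>Antisymmetrised sums over a list\<close>

text \<open>The signed sum over all ways to split off one entry, as in an exterior product with a
  one-form. The recursion suits inductions along \<open>xs @ s x # ys\<close>; the explicit signs
  are in \<open>wed_eq_sum\<close>.\<close>

fun wed :: "('a \<Rightarrow> 'a list \<Rightarrow> 'r::ab_group_add) \<Rightarrow> 'a list \<Rightarrow> 'r" where
  "wed h [] = 0"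
| "wed h (v # B) = h v B - wed (\<lambda>x A. h x (v # A)) B"

lemma wed_eq_sum:
  fixes h :: "'a \<Rightarrow> 'a list \<Rightarrow> 'r::comm_ring_1"
  shows "wed h C = (\<Sum>i<length C. (- 1) ^ i * h (C ! i) (take i C @ drop (Suc i) C))"
proof (induction C arbitrary: h)
  case (Cons v B)
  show ?case
    by (simp add: Cons.IH sum.lessThan_Suc_shift sum_negf del: sum.lessThan_Suc)
qed simp

lemma polyfun_wed_const:
  fixes G :: "'l::field \<Rightarrow> 'q \<Rightarrow> 'q list \<Rightarrow> 'l"
  assumes "\<And>q A. polyfun N (\<lambda>x. G x q A)"
  shows "polyfun N (\<lambda>x. wed (G x) C)"
  using assms
proof (induction C arbitrary: G)
  case (Cons v B)
  have "polyfun N (\<lambda>x. wed (\<lambda>q A. G x q (v # A)) B)"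
    by (rule Cons.IH) (rule Cons.prems)
  then show ?case unfolding wed.simps by (intro polyfun_diff Cons.prems)
qed simp

lemma polyfun_wed:
  fixes F :: "'q \<Rightarrow> 'q list \<Rightarrow> 'l::field"
  assumes "\<And>A. polyfun N (\<lambda>x. F (s x) A)" "\<And>q xs ys. polyfun N (\<lambda>x. F q (xs @ s x # ys))"
  shows "polyfun N (\<lambda>x. wed F (xs @ s x # ys))"
  using assms
proof (induction xs arbitrary: F)
  case Nil
  have "polyfun N (\<lambda>x. wed (\<lambda>q A. F q (s x # A)) ys)"
    by (rule polyfun_wed_const) (use Nil.prems(2)[of _ "[]"] in simp)
  then show ?case unfolding append_Nil wed.simps by (intro polyfun_diff Nil.prems)
next
  case (Cons v xs)
  have "polyfun N (\<lambda>x. wed (\<lambda>q A. F q (v # A)) (xs @ s x # ys))"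
  proof (rule Cons.IH)
    show "polyfun N (\<lambda>x. F q (v # xs' @ s x # ys'))" for q xs' ys'
      using Cons.prems(2)[of q "v # xs'" ys'] by simp
  qed (rule Cons.prems)
  then show ?case unfolding append_Cons wed.simps by (intro polyfun_diff Cons.prems)
qed

section \<open>Products of differences\<close>

definition rprod :: "'l::field list \<Rightarrow> 'l \<Rightarrow> 'l" where
  "rprod vs t = (\<Prod>v\<leftarrow>vs. t - v)"

fun vand :: "'l::field list \<Rightarrow> 'l" where
  "vand [] = 1"
| "vand (v # vs) = rprod vs v * vand vs"

lemma rprod_simps [simp]: "rprod [] t = 1" "rprod (v # vs) t = (t - v) * rprod vs t"
  by (simp_all add: rprod_def)

lemma rprod_append [simp]: "rprod (xs @ ys) t = rprod xs t * rprod ys t"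
  by (simp add: rprod_def)

lemma rprod_eq_0_iff [simp]: "rprod vs t = 0 \<longleftrightarrow> t \<in> set vs"
  by (induction vs) auto

lemma rprod_mset: "mset xs = mset ys \<Longrightarrow> rprod xs t = rprod ys t"
  unfolding rprod_def prod_mset_prod_list[symmetric] by simp

lemma vand_eq_0_iff [simp]: "vand vs = 0 \<longleftrightarrow> \<not> distinct vs"
  by (induction vs) auto

lemma vand_swap: "vand (xs @ u # v # ys) = - vand (xs @ v # u # ys)"
proof (induction xs)
  case Nil then show ?case by (simp add: algebra_simps)
next
  case (Cons x xs)
  have "rprod (xs @ u # v # ys) x = rprod (xs @ v # u # ys) x" by (rule rprod_mset) simp
  then show ?case using Cons.IH by simp
qed

section \<open>The last step on the first scroll\<close>

text \<open>Here \<open>p = a b + a - 1\<close>, and the degree argument fails for the defect on lines with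
  \<open>a\<close> points. The lines \<open>x = \<omega> l\<close> are used, with \<open>l = 0\<close> for the line carrying the two special
  points.\<close>

locale koszul_cycle_top = koszul_cycle a b p c
  for a b p :: nat and c :: "(nat \<times> nat) list \<Rightarrow> 'l::field" +
  fixes \<omega> :: "nat \<Rightarrow> 'l"
  assumes inj_lines: "inj \<omega>" and a3: "3 \<le> a" and p_eq: "p + 1 = a * b + a"
begin

definition dd :: "'l \<Rightarrow> 'l \<Rightarrow> 'l list \<Rightarrow> ('l \<times> 'l) list \<Rightarrow> 'l" where
  "dd t u vs A = Df (t, \<omega> 0) (u, \<omega> 0) (map (\<lambda>v. (v, \<omega> 0)) vs @ A)"

lemma dd_len: "length vs + 2 = a \<Longrightarrow> length A = a * b \<Longrightarrow> length (map (\<lambda>v. (v, \<omega> 0)) vs @ A) + 1 = p"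
  using p_eq by simp

lemma dd_alt_A: "alternating (dd t u vs)"
  unfolding dd_def[abs_def] by (rule alternating_append[OF Df_alt])

lemma dd_alt_vs: "alternating (\<lambda>vs. dd t u vs A)"
proof (rule alternatingI)
  fix xs v w ys
  let ?m = "map (\<lambda>v. (v, \<omega> 0))"
  show "dd t u (xs @ v # w # ys) A = - dd t u (xs @ w # v # ys) A"
    using alternating_swap[OF Df_alt, of "(t, \<omega> 0)" "(u, \<omega> 0)" "?m xs" "(v, \<omega> 0)" "(w, \<omega> 0)" "?m ys @ A"]
    unfolding dd_def by (simp only: map_append list.map append_assoc append_Cons)
  show "dd t u (xs @ v # v # ys) A = 0"
    using alternating_same[OF Df_alt, of "(t, \<omega> 0)" "(u, \<omega> 0)" "?m xs" "(v, \<omega> 0)" "?m ys @ A"]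
    unfolding dd_def by (simp only: map_append list.map append_assoc append_Cons)
qed

lemma dd_zero:
  assumes "length vs + 2 = a" "length A = a * b" "\<not> distinct (t # u # vs)"
  shows "dd t u vs A = 0"
  unfolding dd_def
  by (rule Df_zero[OF dd_len[OF assms(1,2)]]) (use assms(3) in \<open>auto simp: distinct_map inj_on_def\<close>)

lemma dd_line0:
  assumes "length vs + 2 = a" "length A = a * b" "(v, \<omega> 0) \<in> set A"
  shows "dd t u vs A = 0"
proof -
  obtain xs ys where A: "A = xs @ (v, \<omega> 0) # ys" using assms(3) by (meson split_list)
  have "Df (t, \<omega> 0) (u, \<omega> 0) (map (\<lambda>v. (v, \<omega> 0)) (v # vs) @ xs @ ys) = 0"
    using assms A p_eq by (intro Df_line_full) auto
  then show ?thesis unfolding dd_def by (rule alternating_perm_zero[OF Df_alt, rotated]) (simp add: A)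
qed

lemma polyfun_dd_vs: "polyfun a (\<lambda>z. dd t u (xs @ z # ys) A)"
  unfolding dd_def using polyfun_Df_z[of "(t, \<omega> 0)" "(u, \<omega> 0)" "map (\<lambda>v. (v, \<omega> 0)) xs" "\<omega> 0" "map (\<lambda>v. (v, \<omega> 0)) ys @ A"]
  by simp

lemma polyfun_dd_z: "polyfun a (\<lambda>z. dd t u vs (xs @ (z, x) # ys))"
  unfolding dd_def using polyfun_Df_z[of _ _ "map (\<lambda>v. (v, \<omega> 0)) vs @ xs" x ys] by simp

lemma polyfun_dd_x: "polyfun b (\<lambda>x. dd t u vs (xs @ (z, x) # ys))"
  unfolding dd_def using polyfun_Df_x[of _ _ "map (\<lambda>v. (v, \<omega> 0)) vs @ xs" z ys] by simp

text \<open>The dependence on \<open>t\<close> and \<open>u\<close>: the double zero along \<open>t = u\<close> comes from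
  \<open>Df_diagonal_z\<close> and is what makes this work in characteristic 2.\<close>

lemma dd_factor:
  assumes len: "length vs + 2 = a" "length A = a * b" and d: "distinct vs"
  shows "\<exists>\<chi>. \<forall>t u. dd t u vs A = \<chi> * vand vs * rprod vs t * rprod vs u * (u - t) ^ 2"
proof -
  obtain \<delta> where \<delta>: "\<And>s w. Df (s, \<omega> 0) (w, \<omega> 0) (map (\<lambda>v. (v, \<omega> 0)) vs @ A) = (w - s) * \<delta> s w"
    "\<And>s. polyfun (a - 1) (\<delta> s)" "\<And>s w. \<delta> w s = - \<delta> s w" "\<And>s. \<delta> s s = 0"
    by (rule Df_diagonal_z[OF dd_len[OF len], of "\<omega> 0"]) (rule that; assumption)
  have dd: "dd s w vs A = (w - s) * \<delta> s w" for s w unfolding dd_def by (rule \<delta>(1))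
  \<comment> \<open>The \<open>a - 1\<close> zeros in \<open>vs\<close> and \<open>s\<close> exhaust
    the degree of \<open>\<delta> s\<close>, so the remaining factor is a constant.\<close>
  have "\<exists>k. \<forall>w. \<delta> s w = rprod vs w * (w - s) * k" if s: "s \<notin> set vs" for s
  proof -
    have "\<delta> s v = 0" if "v \<in> set (vs @ [s])" for v
    proof (cases "v = s")
      case False
      then have "dd s v vs A = 0" using that by (intro dd_zero[OF len]) auto
      then show ?thesis using dd[of s v] False by simp
    qed (simp add: \<delta>(4))
    then obtain g where g: "polyfun (a - 1 - length (vs @ [s])) g" "\<And>x. \<delta> s x = (\<Prod>r\<leftarrow>vs @ [s]. x - r) * g x"
      using polyfun_div_roots[OF \<delta>(2)[of s], of "vs @ [s]"] d s by auto
    have "polyfun 0 g" using g(1) len by simp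
    then obtain k where "\<And>x. g x = k" unfolding polyfun_def by (auto elim!: degree_eq_zeroE)
    then show ?thesis using g(2) by (intro exI[of _ k]) (simp add: rprod_def mult_ac)
  qed
  then obtain k where k: "\<And>s w. s \<notin> set vs \<Longrightarrow> \<delta> s w = rprod vs w * (w - s) * k s" by metis
  obtain w0 where w0: "w0 \<notin> set vs" using ex_new_if_finite[OF inf, of "set vs"] by auto
  define \<chi> where "\<chi> = k w0 / rprod vs w0"
  \<comment> \<open>By antisymmetry of \<open>\<delta>\<close> the factor \<open>k s\<close> depends
    on \<open>s\<close> in the way the other factor depends on \<open>w\<close>.\<close>
  have ks: "k s = \<chi> * rprod vs s" if s: "s \<notin> set vs" for s
  proof (cases "s = w0")
    case False
    have "rprod vs w0 * (w0 - s) * k s = rprod vs s * (w0 - s) * k w0"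
      using k[OF s, of w0] k[OF w0, of s] \<delta>(3)[of s w0] by (simp add: algebra_simps)
    then have "(w0 - s) * (k s * rprod vs w0) = (w0 - s) * (k w0 * rprod vs s)"
      by (simp only: mult_ac)
    then have "k s * rprod vs w0 = k w0 * rprod vs s" using False by simp
    then show ?thesis unfolding \<chi>_def using w0 by (simp add: field_simps)
  qed (use w0 in \<open>simp add: \<chi>_def\<close>)
  have "dd t u vs A = \<chi> * rprod vs t * rprod vs u * (u - t) ^ 2" for t u
  proof (cases "t \<in> set vs")
    case True
    then have "dd t u vs A = 0" by (intro dd_zero[OF len]) auto
    then show ?thesis using True by simp
  next
    case False
    then show ?thesis unfolding dd k[OF False] ks[OF False] by (simp add: power2_eq_square)
  qed
  then show ?thesis using d by (intro exI[of _ "\<chi> / vand vs"]) simp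
qed

text \<open>What is left of \<open>dd\<close> once its known zeros are divided out. It does not
  depend on \<open>t\<close> and \<open>u\<close>, is symmetric in \<open>vs\<close>
  (\<open>chi_perm\<close>) and affine in each entry of \<open>vs\<close>
  (\<open>chi_affine\<close>).\<close>

definition chi :: "'l list \<Rightarrow> ('l \<times> 'l) list \<Rightarrow> 'l" where
  "chi vs A = (SOME \<chi>. \<forall>t u. dd t u vs A = \<chi> * vand vs * rprod vs t * rprod vs u * (u - t) ^ 2)"

lemma dd_chi:
  assumes "length vs + 2 = a" "length A = a * b" "distinct vs"
  shows "dd t u vs A = chi vs A * vand vs * rprod vs t * rprod vs u * (u - t) ^ 2"
  using someI_ex[OF dd_factor[OF assms]] unfolding chi_def by blast

lemma ex_two_new:
  assumes "finite E"
  obtains t u :: 'l where "t \<noteq> u" "t \<notin> E" "u \<notin> E"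
proof -
  obtain t where t: "t \<notin> E" using ex_new_if_finite[OF inf assms] by blast
  obtain u where "u \<notin> insert t E" using ex_new_if_finite[OF inf, of "insert t E"] assms by auto
  then show thesis using t that by auto
qed

lemma dd_zero_chi:
  assumes "length vs + 2 = a" "length A = a * b" "distinct (t # u # vs)" "dd t u vs A = 0"
  shows "chi vs A = 0"
  using dd_chi[OF assms(1,2), of t u] assms(3,4) by auto

lemma chi_perm:
  assumes "length vs + 2 = a" "length A = a * b" "distinct vs" "mset vs = mset ws"
  shows "chi ws A = chi vs A"
proof -
  define P where "P l \<longleftrightarrow> mset l = mset vs \<and> chi l A = chi vs A" for l
  have "P ws"
  proof (rule adjacent_swaps_perm[of P, OF _ assms(4)])
    fix xs u v ys
    assume P: "P (xs @ u # v # ys)"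
    let ?l = "xs @ u # v # ys" and ?l' = "xs @ v # u # ys"
    have m: "mset ?l = mset vs" using P unfolding P_def by blast
    have "mset ?l' = mset ?l" by simp
    then have m': "mset ?l' = mset vs" using m by (rule trans)
    have len: "length ?l + 2 = a" "length ?l' + 2 = a"
      using assms(1) mset_eq_length[OF m] mset_eq_length[OF m'] by simp_all
    have d: "distinct ?l" "distinct ?l'"
      using assms(3) mset_eq_imp_distinct_iff[OF m] mset_eq_imp_distinct_iff[OF m'] by blast+
    obtain s t where st: "s \<noteq> t" "s \<notin> set ?l" "t \<notin> set ?l"
      using ex_two_new[of "set ?l"] by auto
    have r: "rprod ?l' z = rprod ?l z" for z by (rule rprod_mset) simp
    have "chi ?l' A * vand ?l' * rprod ?l s * rprod ?l t * (t - s) ^ 2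
        = - (chi ?l A * vand ?l * rprod ?l s * rprod ?l t * (t - s) ^ 2)"
      using dd_chi[OF len(1) assms(2) d(1), of s t] dd_chi[OF len(2) assms(2) d(2), of s t]
        alternating_swap[OF dd_alt_vs[of s t A], of xs v u ys] unfolding r by simp
    then have "(chi ?l' A - chi ?l A) * (vand ?l * rprod ?l s * rprod ?l t * (t - s) ^ 2) = 0"
      unfolding vand_swap[of xs v u ys] by (simp add: algebra_simps)
    moreover have "vand ?l * rprod ?l s * rprod ?l t * (t - s) ^ 2 \<noteq> 0"
      using st d(1) by (simp only: mult_eq_0_iff vand_eq_0_iff rprod_eq_0_iff power_eq_0_iff) auto
    ultimately have "chi ?l' A = chi ?l A" by simp
    then show "P ?l'" using P m' unfolding P_def by simp
  qed (simp add: P_def)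
  then show ?thesis by (simp add: P_def)
qed

text \<open>In the new entry \<open>v\<close> the function \<open>dd\<close> has degree
  \<open>a\<close> and the \<open>a - 1\<close> zeros \<open>vs\<close>, \<open>t\<close> and
  \<open>u\<close>. The auxiliary \<open>t\<close> and \<open>u\<close> must differ from
  \<open>v\<close>; this is why one \<open>f\<close> serves a finite set \<open>E\<close>
  only.\<close>

lemma chi_affine:
  assumes len: "length vs + 3 = a" "length A = a * b" and d: "distinct vs" and E: "finite E"
  obtains f where "polyfun 1 f" "\<And>v. v \<in> E \<Longrightarrow> v \<notin> set vs \<Longrightarrow> chi (v # vs) A = f v"
proof -
  obtain t u where tu: "t \<noteq> u" "t \<notin> E \<union> set vs" "u \<notin> E \<union> set vs"
    using ex_two_new[of "E \<union> set vs"] E by auto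
  have "dd t u (v # vs) A = 0" if "v \<in> set (vs @ [t, u])" for v
    by (rule dd_zero) (use that len in auto)
  then obtain g where g: "polyfun (a - length (vs @ [t, u])) g"
      "\<And>v. dd t u (v # vs) A = rprod (vs @ [t, u]) v * g v"
    using polyfun_div_roots[OF polyfun_dd_vs[of t u "[]" vs A], of "vs @ [t, u]"] d tu
    unfolding rprod_def by auto
  define K where "K = vand vs * rprod vs t * rprod vs u * (u - t) ^ 2"
  have K: "K \<noteq> 0" unfolding K_def using d tu by simp
  show thesis
  proof (rule that[of "\<lambda>v. (1 / K) * g v"])
    have "polyfun 1 g" by (rule polyfun_mono[OF g(1)]) (use len in simp)
    then show "polyfun 1 (\<lambda>v. (1 / K) * g v)" by (rule polyfun_cmult)
    fix v assume v: "v \<in> E" "v \<notin> set vs"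
    have "v \<noteq> t" "v \<noteq> u" using v tu by auto
    have "chi (v # vs) A * vand (v # vs) * rprod (v # vs) t * rprod (v # vs) u * (u - t) ^ 2
        = rprod (vs @ [t, u]) v * g v"
      using dd_chi[of "v # vs" A t u] g(2)[of v] len d v by simp
    then have "chi (v # vs) A * K * (rprod vs v * (v - t) * (v - u)) = (rprod vs v * (v - t) * (v - u)) * g v"
      unfolding K_def by (simp add: algebra_simps)
    moreover have "rprod vs v * (v - t) * (v - u) \<noteq> 0" using v \<open>v \<noteq> t\<close> \<open>v \<noteq> u\<close> by simp
    ultimately have "chi (v # vs) A * K = g v"
      by (metis (no_types, lifting) mult.commute mult_left_cancel)
    then show "chi (v # vs) A = (1 / K) * g v" using K by (simp add: field_simps)
  qed
qed

text \<open>The defect with one special line point less has degree at most \<open>(a - 1) b\<close> in the second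
  coordinate of the special line, while its values at the \<open>a b + 1\<close> remaining points are given by
  \<open>dd\<close>; Lagrange interpolation yields \<open>b\<close> linear relations.\<close>

lemma dd_relation_generic:
  assumes vs: "length vs + 3 = a" and C: "length C = a * b + 1" "distinct (map snd C)" "\<omega> 0 \<notin> set (map snd C)"
    and \<kappa>: "degree \<kappa> < b"
  shows "wed (\<lambda>q A. poly \<kappa> (snd q) * (\<omega> 0 - snd q) * dd t u (fst q # vs) A) C = 0"
proof -
  let ?n = "a * b + 1" and ?y = "\<omega> 0"
  define x z where "x i = snd (C ! i)" and "z i = fst (C ! i)" for i
  define R where "R i = take i C @ drop (Suc i) C" for i
  have inj: "inj_on x {..<?n}"
    using C(1,2) unfolding x_def by (intro inj_onI) (auto simp: distinct_conv_nth)
  have Rlen: "length (R i) = a * b" if "i < ?n" for i using that C(1) unfolding R_def by simp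
  have Csplit: "C = take i C @ (z i, x i) # drop (Suc i) C" if "i < ?n" for i
    using that C(1) unfolding z_def x_def by (simp add: id_take_nth_drop)
  \<comment> \<open>In \<open>D i\<close> the point number \<open>i\<close> is moved to the line,
    while \<open>G\<close> below leaves all of \<open>C\<close> in place. At \<open>y = x i\<close>
    the two agree up to sign.\<close>
  define D where "D i y = Df (t, y) (u, y) (map (\<lambda>v. (v, y)) (z i # vs) @ R i)" for i y
  have len1: "length (z i # vs) + 2 = a" for i using vs by simp
  have roots: "D i (x j) = 0" if ij: "i < ?n" "j < ?n" "j \<noteq> i" for i j
  proof -
    have "C ! j \<in> set (R i)"
    proof (cases "j < i")
      case True
      then have "take i C ! j = C ! j" by simp
      moreover have "j < length (take i C)" using True ij C(1) by simp
      ultimately show ?thesis unfolding R_def by (metis Un_iff nth_mem set_append)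
    next
      case False
      then have "drop (Suc i) C ! (j - Suc i) = C ! j" "j - Suc i < length (drop (Suc i) C)"
        using ij C(1) by auto
      then show ?thesis unfolding R_def by (metis Un_iff nth_mem set_append)
    qed
    then have "(z j, x j) \<in> set (R i)" unfolding z_def x_def by simp
    then obtain as bs where Ri: "R i = as @ (z j, x j) # bs" by (meson split_list)
    have "Df (t, x j) (u, x j) (map (\<lambda>v. (v, x j)) (z j # z i # vs) @ as @ bs) = 0"
      using Ri Rlen[OF ij(1)] vs p_eq by (intro Df_line_full) auto
    then show ?thesis unfolding D_def by (rule alternating_perm_zero[OF Df_alt, rotated]) (simp add: Ri)
  qed
  \<comment> \<open>Degree \<open>a b\<close> against the \<open>a b\<close> zeros
    \<open>x j\<close>, at each of which the line carries \<open>a + 1\<close> points.\<close>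
  have "\<exists>k. \<forall>y. D i y = (\<Prod>j\<in>{..<?n} - {i}. y - x j) * k" if i: "i < ?n" for i
  proof -
    have pf: "polyfun (a * b) (D i)"
      unfolding D_def using polyfun_Df_line[of "z i # vs" t u "R i"] unfolding len1 .
    define js where "js = filter (\<lambda>j. j \<noteq> i) [0..<?n]"
    have sl: "set js = {..<?n} - {i}" and djs: "distinct js" unfolding js_def by auto
    let ?l = "map x js"
    have dl: "distinct ?l"
      unfolding distinct_map sl by (intro conjI inj_on_subset[OF inj] djs) blast
    have "length ?l = card (set js)"
      unfolding length_map by (rule distinct_card[symmetric]) (rule djs)
    also have "\<dots> = a * b" unfolding sl using i by simp
    finally have ll: "length ?l = a * b" .
    have "D i r = 0" if r: "r \<in> set ?l" for r
    proof -
      obtain j where "j \<in> {..<?n} - {i}" "r = x j" using r sl by auto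
      then show ?thesis using roots[OF i, of j] by simp
    qed
    then obtain g where g: "polyfun (a * b - length ?l) g" "\<And>y. D i y = (\<Prod>r\<leftarrow>?l. y - r) * g y"
      using polyfun_div_roots[OF pf dl] by blast
    then obtain k where k: "\<And>y. g y = k" unfolding ll polyfun_def by (auto elim!: degree_eq_zeroE)
    have "(\<Prod>r\<leftarrow>?l. y - r) = (\<Prod>j\<in>{..<?n} - {i}. y - x j)" for y
      unfolding sl[symmetric] prod.distinct_set_conv_list[OF djs] by (simp add: comp_def)
    then show ?thesis using g(2) k by auto
  qed
  then obtain k where k: "\<And>i y. i < ?n \<Longrightarrow> D i y = (\<Prod>j\<in>{..<?n} - {i}. y - x j) * k i" by metis
  define G where "G y = Df (t, y) (u, y) (map (\<lambda>v. (v, y)) vs @ C)" for y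
  have "polyfun ((length vs + 2) * b) G" unfolding G_def by (rule polyfun_Df_line)
  then obtain \<gamma> where \<gamma>: "degree \<gamma> \<le> (length vs + 2) * b" "\<And>y. G y = poly \<gamma> y" unfolding polyfun_def by blast
  have Gx: "G (x i) = (- 1) ^ (length vs + i) * D i (x i)" if i: "i < ?n" for i
  proof -
    have "G (x i) = Df (t, x i) (u, x i) ((map (\<lambda>v. (v, x i)) vs @ take i C) @ (z i, x i) # drop (Suc i) C)"
      unfolding G_def using Csplit[OF i] by simp
    also have "\<dots> = (- 1) ^ (length vs + i) * Df (t, x i) (u, x i)
        ((z i, x i) # (map (\<lambda>v. (v, x i)) vs @ take i C) @ drop (Suc i) C)"
      by (subst alternating_move0[OF Df_alt]) (use i C(1) in simp)
    finally show ?thesis unfolding D_def R_def by simp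
  qed
  \<comment> \<open>\<open>G\<close> has degree at most \<open>(a - 1) b\<close> and there are
    \<open>a b + 1\<close> nodes, which leaves room for a multiplier \<open>\<kappa>\<close> of
    degree below \<open>b\<close>.\<close>
  have "degree (\<kappa> * \<gamma>) + 1 < ?n"
  proof -
    have "degree (\<kappa> * \<gamma>) \<le> degree \<kappa> + (length vs + 2) * b"
      using degree_mult_le[of \<kappa> \<gamma>] \<gamma>(1) by linarith
    also have "\<dots> < b + (length vs + 2) * b" using \<kappa> by simp
    also have "\<dots> = a * b" using vs by (simp add: algebra_simps flip: vs)
    finally show ?thesis by simp
  qed
  from lagrange_sum[OF inj this]
  have L: "(\<Sum>i<?n. poly \<kappa> (x i) * G (x i) / (\<Prod>j\<in>{..<?n} - {i}. x i - x j)) = 0"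
    by (simp add: \<gamma>(2))
  have tm: "poly \<kappa> (x i) * G (x i) / (\<Prod>j\<in>{..<?n} - {i}. x i - x j)
      = (- 1) ^ length vs * ((- 1) ^ i * poly \<kappa> (x i) * k i)" if i: "i < ?n" for i
  proof -
    have "(\<Prod>j\<in>{..<?n} - {i}. x i - x j) \<noteq> 0" using inj i by (auto simp: inj_on_def)
    then show ?thesis unfolding Gx[OF i] k[OF i] by (simp add: power_add)
  qed
  have "(- 1) ^ length vs * (\<Sum>i<?n. (- 1) ^ i * poly \<kappa> (x i) * k i) = 0"
    unfolding sum_distrib_left using L tm by (metis (no_types, lifting) lessThan_iff sum.cong)
  then have S: "(\<Sum>i<?n. (- 1) ^ i * poly \<kappa> (x i) * k i) = 0" by simp
  have "wed (\<lambda>q A. poly \<kappa> (snd q) * (?y - snd q) * dd t u (fst q # vs) A) C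
      = (\<Sum>i<?n. (- 1) ^ i * (poly \<kappa> (x i) * (?y - x i) * D i ?y))"
    unfolding wed_eq_sum C(1) by (simp add: x_def z_def R_def D_def dd_def)
  also have "\<dots> = (\<Sum>i<?n. (\<Prod>j<?n. ?y - x j) * ((- 1) ^ i * poly \<kappa> (x i) * k i))"
  proof (rule sum.cong)
    fix i assume "i \<in> {..<?n}"
    then have i: "i < ?n" by simp
    \<comment> \<open>The factor \<open>?y - x i\<close> in the relation completes the product,
      which then is the same for all \<open>i\<close>.\<close>
    have "(\<Prod>j<?n. ?y - x j) = (?y - x i) * (\<Prod>j\<in>{..<?n} - {i}. ?y - x j)"
      using i by (subst prod.remove[of _ i]) auto
    then show "(- 1) ^ i * (poly \<kappa> (x i) * (?y - x i) * D i ?y)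
        = (\<Prod>j<?n. ?y - x j) * ((- 1) ^ i * poly \<kappa> (x i) * k i)"
      unfolding k[OF i] by simp
  qed simp
  also have "\<dots> = 0" unfolding sum_distrib_left[symmetric] S by simp
  finally show ?thesis .
qed

lemma dd_relation:
  assumes vs: "length vs + 3 = a" and C: "length C = a * b + 1" and \<kappa>: "degree \<kappa> < b"
  shows "wed (\<lambda>q A. poly \<kappa> (snd q) * (\<omega> 0 - snd q) * dd t u (fst q # vs) A) C = 0"
proof (rule vanishing_generic[OF inf, where S = "{}" and T = "{\<omega> 0}", OF _ _ _ _ _ C])
  let ?F = "\<lambda>q A. poly \<kappa> (snd q) * (\<omega> 0 - snd q) * dd t u (fst q # vs) A"
  show "\<exists>N. polyfun N (\<lambda>z. wed ?F (xs @ (z, x) # ys))" for xs x ys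
  proof (intro exI polyfun_wed)
    show "polyfun a (\<lambda>z. ?F (z, x) A)" for A
      using polyfun_cmult[OF polyfun_dd_vs[of t u "[]" vs A]] by simp
    show "polyfun a (\<lambda>z. ?F q (xs @ (z, x) # ys))" for q xs ys
      by (rule polyfun_cmult[OF polyfun_dd_z])
  qed
  show "\<exists>N. polyfun N (\<lambda>x. wed ?F (xs @ (z, x) # ys))" for xs z ys
  proof (intro exI polyfun_wed)
    have "polyfun (degree \<kappa> + 1 + (b + 0)) (\<lambda>x. poly \<kappa> x * (\<omega> 0 - x) * dd t u (z # vs) A)" for A
      by (intro polyfun_mult polyfun_diff polyfun_poly polyfun_id polyfun_const) simp
    then show "polyfun (degree \<kappa> + 1 + b) (\<lambda>x. ?F (z, x) A)" for A by simp
    show "polyfun (degree \<kappa> + 1 + b) (\<lambda>x. ?F q (xs @ (z, x) # ys))" for q xs ys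
      by (rule polyfun_cmult[OF polyfun_mono[OF polyfun_dd_x]]) simp
  qed
  show "wed ?F A = 0" if "length A = a * b + 1" "distinct (map snd A)" "set (map snd A) \<inter> {\<omega> 0} = {}" for A
    using that by (intro dd_relation_generic[OF vs _ _ _ \<kappa>]) auto
qed auto

end

section \<open>Relations on a single line and the exchange of values\<close>

context koszul_cycle_top begin

definition on_line :: "nat \<Rightarrow> 'l list \<Rightarrow> ('l \<times> 'l) list" where
  "on_line l qs = map (\<lambda>q. (q, \<omega> l)) qs"

definition off_line :: "nat \<Rightarrow> ('l \<times> 'l) list \<Rightarrow> bool" where
  "off_line l A \<longleftrightarrow> snd ` set A \<subseteq> \<omega> ` ({1..b} - {l})"

lemma length_on_line [simp]: "length (on_line l qs) = length qs"
  by (simp add: on_line_def)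

text \<open>Of the relations in \<open>dd_relation\<close> the one is taken whose
  \<open>\<kappa>\<close> vanishes on the other \<open>b - 1\<close> lines, so that only points of
  the line \<open>l\<close> are split off.\<close>

lemma line_relation:
  assumes l: "l \<in> {1..b}" and vs: "length vs + 3 = a" and len: "length qs + length A = a * b + 1"
    and A: "off_line l A"
  shows "(\<Sum>i<length qs. (- 1) ^ i * dd t u (qs ! i # vs) (on_line l (take i qs @ drop (Suc i) qs) @ A)) = 0"
proof -
  define \<kappa> where "\<kappa> = (\<Prod>m\<in>{1..b} - {l}. [:- \<omega> m, 1:])"
  have "degree \<kappa> \<le> (\<Sum>m\<in>{1..b} - {l}. degree [:- \<omega> m, 1:])"
    unfolding \<kappa>_def using degree_prod_sum_le[of "{1..b} - {l}" "\<lambda>m. [:- \<omega> m, 1:]"] by (simp add: comp_def)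
  also have "\<dots> = b - 1" using l by simp
  finally have deg: "degree \<kappa> < b" using b_pos by simp
  have k1: "poly \<kappa> (\<omega> l) \<noteq> 0" unfolding \<kappa>_def poly_prod using injD[OF inj_lines] by auto
  have k0: "poly \<kappa> x = 0" if "x \<in> \<omega> ` ({1..b} - {l})" for x
    unfolding \<kappa>_def poly_prod using that by (auto intro!: prod_zero)
  have l0: "\<omega> 0 - \<omega> l \<noteq> 0" using l injD[OF inj_lines, of 0 l] by auto
  let ?C = "on_line l qs @ A" and ?F = "\<lambda>q A. poly \<kappa> (snd q) * (\<omega> 0 - snd q) * dd t u (fst q # vs) A"
  have "0 = wed ?F ?C" by (rule dd_relation[OF vs _ deg, symmetric]) (use len in simp)
  also have "\<dots> = (\<Sum>i<length ?C. (- 1) ^ i * ?F (?C ! i) (take i ?C @ drop (Suc i) ?C))"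
    by (rule wed_eq_sum)
  also have "\<dots> = (\<Sum>i<length qs. (- 1) ^ i * ?F (?C ! i) (take i ?C @ drop (Suc i) ?C))"
  proof (rule sum.mono_neutral_right)
    show "\<forall>i\<in>{..<length ?C} - {..<length qs}. (- 1) ^ i * ?F (?C ! i) (take i ?C @ drop (Suc i) ?C) = 0"
    proof
      fix i assume i: "i \<in> {..<length ?C} - {..<length qs}"
      then have "?C ! i \<in> set A" by (auto simp: nth_append)
      then have "poly \<kappa> (snd (?C ! i)) = 0" using A unfolding off_line_def by (intro k0) auto
      then show "(- 1) ^ i * ?F (?C ! i) (take i ?C @ drop (Suc i) ?C) = 0" by simp
    qed
  qed auto
  also have "\<dots> = (\<Sum>i<length qs. poly \<kappa> (\<omega> l) * (\<omega> 0 - \<omega> l) *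
      ((- 1) ^ i * dd t u (qs ! i # vs) (on_line l (take i qs @ drop (Suc i) qs) @ A)))"
    by (intro sum.cong refl) (simp add: nth_append on_line_def take_map drop_map)
  finally show ?thesis unfolding sum_distrib_left[symmetric] using k1 l0 by auto
qed

text \<open>The sum of \<open>line_relation\<close> rewritten in terms of \<open>chi\<close>. The
  entry \<open>qs ! i\<close> enters the factors of \<open>dd_chi\<close> through
  \<open>rprod (vs @ [t, u])\<close>; this list of \<open>a - 1\<close> roots becomes the free
  parameter \<open>\<zeta>s\<close>.\<close>

definition T :: "nat \<Rightarrow> 'l list \<Rightarrow> ('l \<times> 'l) list \<Rightarrow> 'l list \<Rightarrow> 'l list \<Rightarrow> 'l" where
  "T l qs A \<zeta>s vs = (\<Sum>i<length qs. (- 1) ^ i * rprod \<zeta>s (qs ! i) *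
     chi (qs ! i # vs) (on_line l (take i qs @ drop (Suc i) qs) @ A))"

lemma T_diagonal:
  assumes l: "l \<in> {1..b}" and len: "length vs + 3 = a" "length qs + length A = a * b + 1"
    and A: "off_line l A" and d: "distinct (vs @ [t, u])" "set vs \<inter> set qs = {}"
  shows "T l qs A (vs @ [t, u]) vs = 0"
proof -
  define K where "K = vand vs * rprod vs t * rprod vs u * (u - t) ^ 2"
  have K: "K \<noteq> 0" using d(1) unfolding K_def by auto
  have "0 = (\<Sum>i<length qs. (- 1) ^ i * dd t u (qs ! i # vs) (on_line l (take i qs @ drop (Suc i) qs) @ A))"
    by (rule line_relation[OF l len A, symmetric])
  also have "\<dots> = (\<Sum>i<length qs. K * ((- 1) ^ i * rprod (vs @ [t, u]) (qs ! i) *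
     chi (qs ! i # vs) (on_line l (take i qs @ drop (Suc i) qs) @ A)))"
  proof (rule sum.cong)
    fix i assume "i \<in> {..<length qs}"
    then have i: "i < length qs" by simp
    then have "qs ! i \<notin> set vs" using d(2) nth_mem by blast
    then have "dd t u (qs ! i # vs) (on_line l (take i qs @ drop (Suc i) qs) @ A)
      = chi (qs ! i # vs) (on_line l (take i qs @ drop (Suc i) qs) @ A) * vand (qs ! i # vs)
        * rprod (qs ! i # vs) t * rprod (qs ! i # vs) u * (u - t) ^ 2"
      using len i d(1) by (intro dd_chi) auto
    moreover have "(t - qs ! i) * (u - qs ! i) = (qs ! i - t) * (qs ! i - u)" by (simp add: algebra_simps)
    ultimately show "(- 1) ^ i * dd t u (qs ! i # vs) (on_line l (take i qs @ drop (Suc i) qs) @ A)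
      = K * ((- 1) ^ i * rprod (vs @ [t, u]) (qs ! i) *
        chi (qs ! i # vs) (on_line l (take i qs @ drop (Suc i) qs) @ A))"
      unfolding K_def rprod_append rprod_simps vand.simps by simp
  qed simp
  finally show ?thesis unfolding T_def sum_distrib_left[symmetric] using K by auto
qed

text \<open>\<open>T\<close> is symmetric in \<open>\<zeta>s\<close> and affine in each entry of \<open>vs\<close>, so that the vanishing for \<open>vs\<close>
  contained in \<open>\<zeta>s\<close> propagates to arbitrary \<open>vs\<close>.\<close>

lemma T_generic:
  assumes l: "l \<in> {1..b}" and lenA: "length qs + length A = a * b + 1" and A: "off_line l A"
    and "length rs + length us + 3 = a" "length rs + length \<eta>s + 1 = a"
    and "distinct (rs @ \<eta>s @ us)" "set (rs @ \<eta>s @ us) \<inter> set qs = {}"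
  shows "T l qs A (rs @ \<eta>s) (rs @ us) = 0"
  using assms(4-7)
proof (induction us arbitrary: rs \<eta>s)
  case Nil
  then obtain t u where "\<eta>s = [t, u]" by (auto simp: length_Suc_conv numeral_eq_Suc)
  then show ?case using T_diagonal[OF l _ lenA A, of rs t u] Nil by auto
next
  case (Cons v us)
  then obtain \<eta>1 \<eta>2 \<eta>s' where \<eta>s: "\<eta>s = \<eta>1 # \<eta>2 # \<eta>s'"
    by (cases \<eta>s; cases "tl \<eta>s") auto
  \<comment> \<open>An affine function is determined by two values: the induction hypothesis
    supplies the zeros \<open>\<eta>1\<close> and \<open>\<eta>2\<close>, and the value at
    \<open>v\<close> is wanted.\<close>
  let ?E = "{v, \<eta>1, \<eta>2}" and ?A = "\<lambda>i. on_line l (take i qs @ drop (Suc i) qs) @ A"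
  have q: "qs ! i \<notin> set (rs @ \<eta>s @ v # us)" if "i < length qs" for i
    using Cons.prems(4) that nth_mem by blast
  have lenAi: "length (?A i) = a * b" if "i < length qs" for i using that lenA by simp
  have "\<exists>f. polyfun 1 f \<and> (\<forall>w\<in>?E. chi (w # qs ! i # rs @ us) (?A i) = f w)" if i: "i < length qs" for i
  proof -
    have "length (qs ! i # rs @ us) + 3 = a" using Cons.prems(1) by simp
    moreover have "distinct (qs ! i # rs @ us)" using Cons.prems(3) q[OF i] by auto
    ultimately obtain f where "polyfun 1 f"
        "\<And>w. w \<in> ?E \<Longrightarrow> w \<notin> set (qs ! i # rs @ us) \<Longrightarrow> chi (w # qs ! i # rs @ us) (?A i) = f w"
      using chi_affine[OF _ lenAi[OF i], of "qs ! i # rs @ us" ?E] by auto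
    moreover have "w \<notin> set (qs ! i # rs @ us)" if "w \<in> ?E" for w
      using that q[OF i] Cons.prems(3) unfolding \<eta>s by auto
    ultimately show ?thesis by blast
  qed
  then obtain f where f: "\<And>i. i < length qs \<Longrightarrow> polyfun 1 (f i)"
    "\<And>i w. i < length qs \<Longrightarrow> w \<in> ?E \<Longrightarrow> chi (w # qs ! i # rs @ us) (?A i) = f i w" by metis
  define F where "F w = (\<Sum>i<length qs. ((- 1) ^ i * rprod (rs @ \<eta>s) (qs ! i)) * f i w)" for w
  have F: "T l qs A (rs @ \<eta>s) (rs @ w # us) = F w" if w: "w \<in> ?E" for w
    unfolding T_def F_def
  proof (rule sum.cong)
    fix i assume "i \<in> {..<length qs}"
    then have i: "i < length qs" by simp
    have "chi (qs ! i # rs @ w # us) (?A i) = chi (w # qs ! i # rs @ us) (?A i)"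
    proof (rule chi_perm[OF _ lenAi[OF i]])
      show "length (w # qs ! i # rs @ us) + 2 = a" using Cons.prems(1) by simp
      show "distinct (w # qs ! i # rs @ us)" using w q[OF i] Cons.prems(3) unfolding \<eta>s by auto
    qed simp
    then show "(- 1) ^ i * rprod (rs @ \<eta>s) (qs ! i) * chi (qs ! i # rs @ w # us) (?A i)
      = (- 1) ^ i * rprod (rs @ \<eta>s) (qs ! i) * f i w" using f(2)[OF i w] by simp
  qed simp
  have "polyfun 1 F" unfolding F_def by (intro polyfun_sum polyfun_cmult f(1)) simp
  moreover have "F \<eta>1 = 0"
  proof -
    have "T l qs A ((rs @ [\<eta>1]) @ \<eta>2 # \<eta>s') ((rs @ [\<eta>1]) @ us) = 0"
      by (rule Cons.IH) (use Cons.prems \<eta>s in auto)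
    then show ?thesis using F[of \<eta>1] \<eta>s by simp
  qed
  moreover have "F \<eta>2 = 0"
  proof -
    have "T l qs A ((rs @ [\<eta>2]) @ \<eta>1 # \<eta>s') ((rs @ [\<eta>2]) @ us) = 0"
      by (rule Cons.IH) (use Cons.prems \<eta>s in auto)
    moreover have "rprod ((rs @ [\<eta>2]) @ \<eta>1 # \<eta>s') = rprod (rs @ \<eta>s)"
      by (rule ext, rule rprod_mset) (simp add: \<eta>s)
    ultimately have "T l qs A (rs @ \<eta>s) ((rs @ [\<eta>2]) @ us) = 0" unfolding T_def by (simp only:)
    then show ?thesis using F[of \<eta>2] by simp
  qed
  moreover have "\<eta>1 \<noteq> \<eta>2" using Cons.prems(3) \<eta>s by simp
  ultimately have "F v = 0" by (rule polyfun_affine)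
  then show ?case using F[of v] by simp
qed

text \<open>\<open>T\<close> is affine in each entry of \<open>\<zeta>s\<close> as well, so the
  roots can be placed anywhere, even on \<open>qs\<close>, where they annihilate chosen
  terms.\<close>

lemma T_zero:
  assumes l: "l \<in> {1..b}" and len: "length qs + length A = a * b + 1" and A: "off_line l A"
    and vs: "length vs + 3 = a" "distinct vs" "set vs \<inter> set qs = {}" and "length \<zeta>s + 1 = a"
  shows "T l qs A \<zeta>s vs = 0"
proof -
  have "T l qs A (xs @ ys) vs = 0"
    if "length (xs @ ys) + 1 = a" "distinct (ys @ vs)" "set ys \<inter> set qs = {}" for xs ys
    using that
  proof (induction xs arbitrary: ys rule: rev_induct)
    case Nil
    then show ?case using T_generic[OF l len A, of "[]" vs ys] vs by auto
  next
    case (snoc \<zeta> xs)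
    have pf: "polyfun 1 (\<lambda>\<zeta>. T l qs A (xs @ \<zeta> # ys) vs)"
    proof -
      let ?k = "\<lambda>i. (- 1) ^ i * rprod xs (qs ! i) * rprod ys (qs ! i) *
        chi (qs ! i # vs) (on_line l (take i qs @ drop (Suc i) qs) @ A)"
      have "polyfun 1 (\<lambda>\<zeta>. \<Sum>i<length qs. ?k i * (qs ! i - \<zeta>))"
        by (intro polyfun_sum polyfun_cmult polyfun_diff polyfun_id polyfun_const)
      moreover have "T l qs A (xs @ \<zeta> # ys) vs = (\<Sum>i<length qs. ?k i * (qs ! i - \<zeta>))" for \<zeta>
        unfolding T_def by (intro sum.cong refl) (simp add: algebra_simps)
      ultimately show ?thesis by simp
    qed
    have "T l qs A (xs @ \<zeta> # ys) vs = 0"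
    proof (rule polyfun_cofinite[OF inf pf, of "set ys \<union> set vs \<union> set qs"])
      fix \<zeta> assume "\<zeta> \<notin> set ys \<union> set vs \<union> set qs"
      then show "T l qs A (xs @ \<zeta> # ys) vs = 0" using snoc.IH[of "\<zeta> # ys"] snoc.prems by auto
    qed simp
    then show ?case by simp
  qed
  from this[of \<zeta>s "[]"] assms show ?thesis by simp
qed

text \<open>At most \<open>a - 1\<close> points on the line \<open>l\<close> can all be made roots
  in \<open>\<zeta>s\<close>. The term of \<open>T\<close> that survives is the one with
  \<open>q\<close> on the special line.\<close>

lemma dd_zero_few:
  assumes l: "l \<in> {1..b}" and vs: "length vs + 2 = a" "distinct vs" "set vs \<inter> set qs = {}"
    and qs: "length qs < a" and len: "length qs + length A = a * b" and A: "off_line l A"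
  shows "dd t u vs (on_line l qs @ A) = 0"
proof -
  obtain q vs' where v: "vs = q # vs'" using vs(1) a3 by (cases vs) auto
  obtain z where z: "z \<noteq> q" using ex_two_new[of "{q}"] by auto
  define \<zeta>s where "\<zeta>s = qs @ replicate (a - 1 - length qs) z"
  have "T l (q # qs) A \<zeta>s vs' = 0"
    by (rule T_zero[OF l _ A]) (use vs v qs len in \<open>auto simp: \<zeta>s_def\<close>)
  moreover have "T l (q # qs) A \<zeta>s vs' = rprod \<zeta>s q * chi vs (on_line l qs @ A)"
  proof -
    have "rprod \<zeta>s (qs ! i) = 0" if "i < length qs" for i using that unfolding \<zeta>s_def by simp
    then show ?thesis unfolding T_def v
      by (simp add: sum.lessThan_Suc_shift del: sum.lessThan_Suc rprod_simps rprod_eq_0_iff)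
  qed
  moreover have "rprod \<zeta>s q \<noteq> 0" using vs(3) v z unfolding \<zeta>s_def by auto
  ultimately have "chi vs (on_line l qs @ A) = 0" by simp
  then show ?thesis using dd_chi[of vs "on_line l qs @ A" t u] vs len by simp
qed

text \<open>With \<open>a\<close> points on the line \<open>l\<close>, the \<open>a - 1\<close>
  roots \<open>qs\<close> leave two terms of \<open>T\<close>, which differ by the exchange of
  \<open>q\<close> and \<open>r\<close>.\<close>

lemma dd_exchange:
  assumes l: "l \<in> {1..b}" and vs: "length vs + 3 = a" and qs: "length qs + 1 = a"
    and d: "distinct (t # u # q # r # qs @ vs)"
    and len: "a + length A = a * b" and A: "off_line l A"
    and zero: "dd t u (q # vs) (on_line l (r # qs) @ A) = 0"
  shows "dd t u (r # vs) (on_line l (q # qs) @ A) = 0"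
proof -
  have c0: "chi (q # vs) (on_line l (r # qs) @ A) = 0"
    by (rule dd_zero_chi[OF _ _ _ zero]) (use vs qs len d in auto)
  have "T l (q # r # qs) A qs vs = 0"
    by (rule T_zero[OF l _ A]) (use vs qs len d in auto)
  moreover have "T l (q # r # qs) A qs vs = - (rprod qs r * chi (r # vs) (on_line l (q # qs) @ A))"
  proof -
    have "rprod qs (qs ! i) = 0" if "i < length qs" for i using that by simp
    then show ?thesis unfolding T_def
      by (simp add: sum.lessThan_Suc_shift c0 del: sum.lessThan_Suc rprod_simps rprod_eq_0_iff)
  qed
  moreover have "rprod qs r \<noteq> 0" using d by simp
  ultimately have "chi (r # vs) (on_line l (q # qs) @ A) = 0" by simp
  then show ?thesis using dd_chi[of "r # vs" "on_line l (q # qs) @ A" t u] vs qs len d by simp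
qed

end

section \<open>Balanced configurations and the additional tests\<close>

context koszul_cycle_top begin

text \<open>A configuration is a list of values labelled with lines. It is balanced if the special line
  carries \<open>a - 2\<close> values and each of the other \<open>b\<close> lines carries \<open>a\<close> values.\<close>

definition conf :: "'l \<Rightarrow> 'l \<Rightarrow> ('l \<times> nat) list \<Rightarrow> 'l" where
  "conf t u E = dd t u (map fst (filter (\<lambda>e. snd e = 0) E))
     (map (\<lambda>e. (fst e, \<omega> (snd e))) (filter (\<lambda>e. snd e \<noteq> 0) E))"

definition labels :: "nat multiset" where
  "labels = replicate_mset (a - 2) 0 + (\<Sum>l\<in>{1..b}. replicate_mset a l)"

lemma count_labels: "count labels l = (if l = 0 then a - 2 else if l \<le> b then a else 0)"
proof -
  have "(\<Sum>m\<in>{1..b}. if m = l then a else 0) = (if 1 \<le> l \<and> l \<le> b then a else 0)"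
    by (simp add: sum.delta)
  then show ?thesis unfolding labels_def by (auto simp: count_sum)
qed

lemma size_labels: "size labels = p - 1"
proof -
  have "size labels = a - 2 + b * a" unfolding labels_def by (simp add: size_multiset_sum)
  then show ?thesis using p_eq a3 by (simp add: mult.commute)
qed

lemma length_filter_label: "length (filter (\<lambda>e. snd e = l) E) = count (mset (map snd E)) l"
  by (induction E) auto

lemma length_filter_nonzero:
  assumes "mset (map snd E) = labels"
  shows "length (filter (\<lambda>e. snd e \<noteq> 0) E) = a * b"
proof -
  have "length E = p - 1" using arg_cong[OF assms, of size] size_labels by simp
  moreover have "length (filter (\<lambda>e. snd e = 0) E) = a - 2"
    unfolding length_filter_label assms count_labels by simp
  ultimately show ?thesis
    using sum_length_filter_compl[of "\<lambda>e. snd e = 0" E] p_eq a3 by simp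
qed

lemma conf_perm:
  assumes "mset E = mset E'" "conf t u E = 0"
  shows "conf t u E' = 0"
proof -
  let ?v = "\<lambda>E. map fst (filter (\<lambda>e. snd e = 0) E)"
  let ?p = "\<lambda>E. map (\<lambda>e. (fst e, \<omega> (snd e))) (filter (\<lambda>e. snd e \<noteq> 0) E)"
  have "mset (?v E) = mset (?v E')" "mset (?p E) = mset (?p E')"
    using assms(1) by (simp_all add: mset_filter)
  then have "dd t u (?v E') (?p E) = 0"
    using alternating_perm_zero[OF dd_alt_vs] assms(2) unfolding conf_def by blast
  then show ?thesis
    using alternating_perm_zero[OF dd_alt_A \<open>mset (?p E) = mset (?p E')\<close>] unfolding conf_def by blast
qed

lemma conf_exchange0:
  assumes l: "l \<noteq> 0" and bal: "mset (map snd ((v, 0) # (w, l) # E)) = labels"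
    and d: "distinct (t # u # map fst ((v, 0) # (w, l) # E))" and zero: "conf t u ((v, 0) # (w, l) # E) = 0"
  shows "conf t u ((w, 0) # (v, l) # E) = 0"
proof -
  let ?F = "\<lambda>P. filter (\<lambda>e. P (snd e)) E" and ?pt = "\<lambda>e. (fst e, \<omega> (snd e))"
  define vs where "vs = map fst (?F (\<lambda>m. m = 0))"
  define qs where "qs = map fst (?F (\<lambda>m. m = l))"
  define A where "A = map ?pt (?F (\<lambda>m. m \<noteq> 0 \<and> m \<noteq> l))"
  have cnt: "count (mset (map snd E)) m + (if m = 0 then 1 else 0) + (if m = l then 1 else 0) = count labels m" for m
    unfolding bal[symmetric] by simp
  have lb: "l \<in> {1..b}" using cnt[of l] l by (auto simp: count_labels split: if_splits)
  have vs: "length vs + 3 = a" using cnt[of 0] l a3 unfolding vs_def length_map length_filter_label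
    by (simp add: count_labels)
  have qs: "length qs + 1 = a" using cnt[of l] l lb unfolding qs_def length_map length_filter_label
    by (simp add: count_labels)
  have split: "mset (map ?pt (?F (\<lambda>m. m \<noteq> 0))) = mset (on_line l qs @ A)" for l'
  proof -
    have "mset (?F (\<lambda>m. m \<noteq> 0)) = mset (?F (\<lambda>m. m = l)) + mset (?F (\<lambda>m. m \<noteq> 0 \<and> m \<noteq> l))"
      using l by (induction E) auto
    then have "mset (map ?pt (?F (\<lambda>m. m \<noteq> 0))) = mset (map ?pt (?F (\<lambda>m. m = l))) + mset A"
      unfolding A_def by (simp only: mset_map image_mset_union)
    moreover have "map ?pt (?F (\<lambda>m. m = l)) = on_line l qs"
      unfolding on_line_def qs_def by (auto simp: comp_def)
    ultimately show ?thesis by simp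
  qed
  have len: "a + length A = a * b"
  proof -
    have "length (filter (\<lambda>e. snd e \<noteq> 0) ((v, 0) # (w, l) # E)) = a * b"
      by (rule length_filter_nonzero[OF bal])
    moreover have "length (map ?pt (?F (\<lambda>m. m \<noteq> 0))) = length (on_line l qs @ A)"
      by (rule mset_eq_length[OF split])
    ultimately show ?thesis using l qs by simp
  qed
  have A: "off_line l A"
  proof -
    have "m \<in> {1..b} - {l}" if m: "m \<in> snd ` set E" "m \<noteq> 0" "m \<noteq> l" for m
    proof -
      have "m \<in># mset (map snd E)" using m(1) by simp
      then have "0 < count (mset (map snd E)) m" by (simp only: count_greater_zero_iff)
      then have "0 < count labels m" using cnt[of m] by linarith
      then show ?thesis using m unfolding count_labels by (auto split: if_splits)
    qed
    then show ?thesis unfolding off_line_def A_def by force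
  qed
  have "dd t u (v # vs) (on_line l (w # qs) @ A) = 0"
  proof (rule alternating_perm_zero[OF dd_alt_A])
    show "dd t u (v # vs) ((w, \<omega> l) # map ?pt (?F (\<lambda>m. m \<noteq> 0))) = 0"
      using zero l unfolding conf_def vs_def by simp
    show "mset ((w, \<omega> l) # map ?pt (?F (\<lambda>m. m \<noteq> 0))) = mset (on_line l (w # qs) @ A)"
      unfolding mset.simps(2) split by (simp add: on_line_def)
  qed
  moreover have "distinct (t # u # v # w # qs @ vs)"
  proof -
    have "distinct (map fst E)" using d by simp
    then have "distinct (map fst (?F (\<lambda>m. m = l)))" "distinct (map fst (?F (\<lambda>m. m = 0)))"
      by (auto simp: distinct_map intro: inj_on_subset)
    moreover have "set qs \<inter> set vs = {}"
    proof (rule ccontr)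
      assume "set qs \<inter> set vs \<noteq> {}"
      then obtain x where "(x, l) \<in> set E" "(x, 0) \<in> set E" unfolding qs_def vs_def by auto
      then show False using \<open>distinct (map fst E)\<close> l by (metis Pair_inject eq_key_imp_eq_value)
    qed
    moreover have "set qs \<subseteq> fst ` set E" "set vs \<subseteq> fst ` set E" unfolding qs_def vs_def by auto
    ultimately show ?thesis using d unfolding qs_def[symmetric] vs_def[symmetric] by auto
  qed
  ultimately have "dd t u (w # vs) (on_line l (v # qs) @ A) = 0"
    using dd_exchange[OF lb vs qs _ len A] by blast
  then have "dd t u (w # vs) ((v, \<omega> l) # map ?pt (?F (\<lambda>m. m \<noteq> 0))) = 0"
    by (rule alternating_perm_zero[OF dd_alt_A, rotated])
      (unfold mset.simps(2) split, simp add: on_line_def)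
  then show ?thesis using l unfolding conf_def vs_def by simp
qed

lemma conf_exchange:
  assumes bal: "mset (map snd ((v, l) # (w, m) # E)) = labels"
    and d: "distinct (t # u # map fst ((v, l) # (w, m) # E))" and zero: "conf t u ((v, l) # (w, m) # E) = 0"
  shows "conf t u ((w, l) # (v, m) # E) = 0"
proof -
  consider "l = m" | "l = 0" "m \<noteq> 0" | "l \<noteq> 0" "m = 0" | "l \<noteq> 0" "m \<noteq> 0" "l \<noteq> m"
    by (cases "l = 0"; cases "m = 0"; cases "l = m") auto
  then show ?thesis
  proof cases
    case 1 then show ?thesis using conf_perm[OF _ zero] by (simp add: add_mset_commute)
  next
    case 2 then show ?thesis using conf_exchange0[of m v w E] assms by blast
  next
    case 3
    have "conf t u ((w, 0) # (v, l) # E) = 0"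
      by (rule conf_perm[OF _ zero]) (simp add: 3 add_mset_commute)
    then have "conf t u ((v, 0) # (w, l) # E) = 0"
      by (rule conf_exchange0[rotated -1]) (use 3 bal d in \<open>auto simp: add_mset_commute\<close>)
    then show ?thesis by (rule conf_perm[rotated]) (simp add: 3 add_mset_commute)
  next
    case 4
    have "count (mset (map snd E)) 0 = a - 2"
      using arg_cong[OF bal, of "\<lambda>M. count M 0"] 4 by (simp add: count_labels)
    then have "0 < count (mset (map snd E)) 0" using a3 by linarith
    then have "0 \<in># mset (map snd E)" by (simp only: count_greater_zero_iff)
    \<comment> \<open>\<open>conf_exchange0\<close> exchanges only with the special line. A value
      \<open>x\<close> on that line, which exists because \<open>a \<ge> 3\<close>, is the
      intermediary between the lines \<open>l\<close> and \<open>m\<close> in three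
      exchanges.\<close>
    then obtain x where "(x, 0) \<in> set E" by auto
    then obtain E1 E2 where E: "E = E1 @ (x, 0) # E2" by (meson split_list)
    define E' where "E' = E1 @ E2"
    have mE: "mset E = add_mset (x, 0) (mset E')" unfolding E E'_def by simp
    have bal': "add_mset l (add_mset m (add_mset 0 (mset (map snd E')))) = labels"
      using bal unfolding E E'_def by simp
    have d': "distinct (t # u # v # w # x # map fst E')" using d unfolding E E'_def by auto
    have "conf t u ((x, 0) # (v, l) # (w, m) # E') = 0"
      by (rule conf_perm[OF _ zero]) (simp add: mE add_mset_commute)
    then have "conf t u ((v, 0) # (x, l) # (w, m) # E') = 0"
      by (rule conf_exchange0[rotated -1]) (use 4 bal' d' in \<open>auto simp: add_mset_commute\<close>)
    then have "conf t u ((v, 0) # (w, m) # (x, l) # E') = 0"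
      by (rule conf_perm[rotated]) (simp add: add_mset_commute)
    then have "conf t u ((w, 0) # (v, m) # (x, l) # E') = 0"
      by (rule conf_exchange0[rotated -1]) (use 4 bal' d' in \<open>auto simp: add_mset_commute\<close>)
    then have "conf t u ((w, 0) # (x, l) # (v, m) # E') = 0"
      by (rule conf_perm[rotated]) (simp add: add_mset_commute)
    then have "conf t u ((x, 0) # (w, l) # (v, m) # E') = 0"
      by (rule conf_exchange0[rotated -1]) (use 4 bal' d' in \<open>auto simp: add_mset_commute\<close>)
    then show ?thesis by (rule conf_perm[rotated]) (simp add: mE add_mset_commute)
  qed
qed

lemma conf_zip_swap:
  assumes L: "mset L = labels" and len: "length (xs @ v # w # ys) = length L"
    and d: "distinct (t # u # xs @ v # w # ys)" and zero: "conf t u (zip (xs @ v # w # ys) L) = 0"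
  shows "conf t u (zip (xs @ w # v # ys) L) = 0"
proof -
  obtain L1 l m L2 where LL: "L = L1 @ l # m # L2" "length L1 = length xs" "length L2 = length ys"
  proof -
    have "L = take (length xs) L @ L ! length xs # L ! Suc (length xs) # drop (Suc (Suc (length xs))) L"
      using len by (simp add: Cons_nth_drop_Suc)
    then show thesis using len by (intro that[of "take (length xs) L"]) auto
  qed
  have z: "zip (xs @ r # s # ys) L = zip xs L1 @ (r, l) # (s, m) # zip ys L2" for r s
    unfolding LL(1) using LL(2) by simp
  let ?E = "zip xs L1 @ zip ys L2"
  have "conf t u ((v, l) # (w, m) # ?E) = 0"
    by (rule conf_perm[OF _ zero[unfolded z]]) simp
  moreover have "mset (map snd ((v, l) # (w, m) # ?E)) = labels"
    using L LL by (simp add: map_snd_zip_take)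
  moreover have "distinct (t # u # map fst ((v, l) # (w, m) # ?E))"
    using d LL by auto
  ultimately have "conf t u ((w, l) # (v, m) # ?E) = 0" by (rule conf_exchange[rotated -1])
  then show ?thesis unfolding z by (rule conf_perm[rotated]) simp
qed

text \<open>A balanced configuration uses \<open>p - 1\<close> of the \<open>p\<close> values in
  \<open>\<nu>\<close>. Exchanges connect all arrangements of the same values, so only the omitted
  value matters, and there are \<open>p\<close> choices for it.\<close>

lemma conf_balanced_nodes:
  assumes L: "L = sorted_list_of_multiset labels" and nu: "length \<nu> = p" "distinct (t # u # \<nu>)"
    and zero: "\<And>n. n < p \<Longrightarrow> conf t u (zip (take n \<nu> @ drop (Suc n) \<nu>) L) = 0"
    and bal: "mset (map snd E) = labels" and d: "distinct (map fst E)" and sub: "set (map fst E) \<subseteq> set \<nu>"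
  shows "conf t u E = 0"
proof -
  define E' where "E' = sort_key snd E"
  define V where "V = map fst E'"
  have mE': "mset E' = mset E" unfolding E'_def by simp
  have mL: "mset L = labels" unfolding L by simp
  have "sorted (map snd E')" unfolding E'_def by simp
  moreover have "mset (map snd E') = labels" using bal mE' by (metis mset_map)
  ultimately have "map snd E' = L" unfolding L by (metis sorted_list_of_multiset_mset sorted_sort_id)
  then have zE': "zip V L = E'" unfolding V_def by (metis zip_map_fst_snd)
  have mV: "mset V = mset (map fst E)" unfolding V_def using mE' by (metis mset_map)
  have dV: "distinct V" "set V \<subseteq> set \<nu>"
    using mV d sub by (metis mset_eq_imp_distinct_iff) (use mV sub in \<open>metis mset_eq_setD\<close>)
  have lenL: "length L = p - 1" using arg_cong[OF mL, of size] size_labels by simp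
  have lenV: "length V = p - 1"
    using arg_cong[OF bal, of size] size_labels arg_cong[OF mV, of size] by simp
  have "card (set V) < card (set \<nu>)"
    using dV nu lenV p_pos by (simp add: distinct_card)
  then have "\<not> set \<nu> \<subseteq> set V" using card_mono[of "set V" "set \<nu>"] by auto
  then obtain n where n: "n < p" "\<nu> ! n \<notin> set V" using nu(1) by (auto simp: in_set_conv_nth subset_iff)
  let ?N = "take n \<nu> @ drop (Suc n) \<nu>"
  have nusplit: "\<nu> = take n \<nu> @ \<nu> ! n # drop (Suc n) \<nu>" using n(1) nu(1) by (simp add: id_take_nth_drop)
  have dN: "distinct (\<nu> ! n # ?N)"
    using nu(2) by (subst (asm) nusplit) auto
  have setN: "set \<nu> = insert (\<nu> ! n) (set ?N)" by (subst nusplit) auto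
  have "set V \<subseteq> set ?N" using dV(2) n(2) setN by auto
  moreover have "card (set V) = card (set ?N)"
    using dV(1) dN lenV n(1) nu(1) by (simp add: distinct_card del: set_append)
  ultimately have "set V = set ?N" by (simp add: card_subset_eq)
  moreover have "distinct ?N" using dN by (simp only: distinct.simps)
  ultimately have mN: "mset ?N = mset V" using dV(1) set_eq_iff_mset_eq_distinct by metis
  define P where "P W \<longleftrightarrow> mset W = mset V \<and> conf t u (zip W L) = 0" for W
  have tu: "distinct (t # u # V)" using nu(2) dV by auto
  have "P V"
  proof (rule adjacent_swaps_perm[of P, OF _ mN])
    show "P ?N" unfolding P_def using mN zero[OF n(1)] by simp
    fix xs v w ys assume P: "P (xs @ v # w # ys)"
    then have m: "mset (xs @ v # w # ys) = mset V" and z: "conf t u (zip (xs @ v # w # ys) L) = 0"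
      unfolding P_def by blast+
    have "distinct (t # u # xs @ v # w # ys)"
      using tu mset_eq_imp_distinct_iff[OF m] mset_eq_setD[OF m] by auto
    then have "conf t u (zip (xs @ w # v # ys) L) = 0"
      using conf_zip_swap[OF mL _ _ z] mset_eq_length[OF m] lenL lenV by simp
    moreover have "mset (xs @ w # v # ys) = mset (xs @ v # w # ys)" by simp
    ultimately show "P (xs @ w # v # ys)" unfolding P_def using m by metis
  qed
  then have "conf t u E' = 0" unfolding P_def zE' by blast
  then show ?thesis using conf_perm mE' by blast
qed

lemma conf_balanced:
  assumes L: "L = sorted_list_of_multiset labels" and nu: "length \<nu> = p" "distinct (t # u # \<nu>)"
    and zero: "\<And>n. n < p \<Longrightarrow> conf t u (zip (take n \<nu> @ drop (Suc n) \<nu>) L) = 0"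
    and "mset (map snd E) = labels" "distinct (t # u # map fst E)"
  shows "conf t u E = 0"
  using assms(5,6)
proof (induction "card (set (map fst E) - set \<nu>)" arbitrary: E rule: less_induct)
  case less
  show ?case
  proof (cases "set (map fst E) \<subseteq> set \<nu>")
    case True
    then show ?thesis using conf_balanced_nodes[OF L nu zero less.prems(1)] less.prems(2) by simp
  next
    case False
    then obtain v where "v \<in> set (map fst E)" and vn: "v \<notin> set \<nu>" by blast
    then obtain l where v: "(v, l) \<in> set E" "v \<notin> set \<nu>" by auto
    then obtain E1 E2 where E: "E = E1 @ (v, l) # E2" by (meson split_list)
    define E' where "E' = E1 @ E2"
    let ?W = "set (map fst E')"
    have bal: "mset (map snd ((z, l) # E')) = labels" for z using less.prems(1) unfolding E E'_def by simp
    have d: "distinct (t # u # v # map fst E')" using less.prems(2) unfolding E E'_def by auto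
    have lenE: "length E' + 2 = p"
      using arg_cong[OF bal[of v], of size] size_labels a3 p_eq b_pos by simp
    have sub: "conf t u ((z, l) # E') = 0" if z: "z \<in> set \<nu>" "z \<notin> ?W" for z
    proof (rule less.hyps)
      have "set (map fst ((z, l) # E')) - set \<nu> = ?W - set \<nu>" using z by auto
      moreover have "set (map fst E) - set \<nu> = insert v (?W - set \<nu>)" using v(2) unfolding E E'_def by auto
      moreover have "v \<notin> ?W" using d by auto
      ultimately show "card (set (map fst ((z, l) # E')) - set \<nu>) < card (set (map fst E) - set \<nu>)"
        by (simp add: card_insert_if)
      show "mset (map snd ((z, l) # E')) = labels" by (rule bal)
      show "distinct (t # u # map fst ((z, l) # E'))" using d z nu(2) by auto
    qed
    define K where "K = set \<nu> - ?W"
    have "card ?W \<le> p - 2" using card_length[of "map fst E'"] lenE by simp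
    moreover have "card (set \<nu>) = p" using nu by (simp add: distinct_card)
    moreover have "card (set \<nu>) - card ?W \<le> card K" unfolding K_def by (rule diff_card_le_card_Diff) simp
    \<comment> \<open>The other entries take at most \<open>p - 2\<close> of the \<open>p\<close>
      values of \<open>\<nu>\<close>, so at least two are free to replace \<open>v\<close>.\<close>
    ultimately have "2 \<le> card K" using lenE by linarith
    then obtain x y where xy: "x \<in> K" "y \<in> K" "x \<noteq> y"
      by (metis card_le_Suc_iff insertI1 insertCI numeral_2_eq_2 card_le_Suc0_iff_eq finite_Diff
          List.finite_set K_def not_less_eq_eq)
    have zx: "conf t u ((x, l) # E') = 0" "conf t u ((y, l) # E') = 0" using sub xy unfolding K_def by auto
    let ?pt = "\<lambda>e. (fst e, \<omega> (snd e))"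
    define vs where "vs = map fst (filter (\<lambda>e. snd e = 0) E')"
    define A where "A = map ?pt (filter (\<lambda>e. snd e \<noteq> 0) E')"
    have dE': "distinct (map fst E')" using d by simp
    have cnt: "count (mset (map snd E')) m + (if m = l then 1 else 0) = count labels m" for m
      unfolding bal[of v, symmetric] by simp
    have lenA: "length (filter (\<lambda>e. snd e \<noteq> 0) ((z, l) # E')) = a * b" for z
      by (rule length_filter_nonzero[OF bal])
    have "conf t u ((v, l) # E') = 0"
    proof (cases "l = 0")
      case True
      have c: "conf t u ((z, l) # E') = dd t u (z # vs) A" for z unfolding conf_def vs_def A_def using True by simp
      have lv: "length vs + 3 = a" using cnt[of 0] True a3
        unfolding vs_def length_map length_filter_label by (simp add: count_labels)
      have lA: "length A = a * b" using lenA[of v] True unfolding A_def by simp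
      have dvs: "distinct vs" unfolding vs_def using dE' by (auto simp: distinct_map intro: inj_on_subset)
      have svs: "set vs \<subseteq> ?W" unfolding vs_def by auto
      have "dd t u (v # vs) A = 0"
      \<comment> \<open>Degree \<open>a\<close> against \<open>a + 1\<close> zeros: the two free
        values, \<open>t\<close> and \<open>u\<close>, and the \<open>a - 3\<close> entries of
        \<open>vs\<close>.\<close>
      proof (rule polyfun_roots_list[where f = "\<lambda>v. dd t u (v # vs) A" and l = "x # y # t # u # vs"])
        show "polyfun a (\<lambda>v. dd t u (v # vs) A)" using polyfun_dd_vs[of t u "[]" vs A] by simp
        show "dd t u (z # vs) A = 0" if "z \<in> set (x # y # t # u # vs)" for z
        proof (cases "z = x \<or> z = y")
          case True then show ?thesis using zx c by auto
        next
          case False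
          then show ?thesis using that lv lA by (intro dd_zero) auto
        qed
        show "distinct (x # y # t # u # vs)" using xy dvs svs nu(2) d unfolding K_def by auto
      qed (use lv in simp)
      then show ?thesis using c by simp
    next
      case False
      have c: "conf t u ((z, l) # E') = dd t u vs ((z, \<omega> l) # A)" for z unfolding conf_def vs_def A_def using False by simp
      define qs where "qs = map fst (filter (\<lambda>e. snd e = l) E')"
      have lb: "l \<le> b" using cnt[of l] by (auto simp: count_labels split: if_splits)
      have lq: "length qs + 1 = a" using cnt[of l] False lb
        unfolding qs_def length_map length_filter_label by (simp add: count_labels)
      have lv: "length vs + 2 = a" using cnt[of 0] False a3
        unfolding vs_def length_map length_filter_label by (simp add: count_labels)
      have lA: "length A + 1 = a * b" using lenA[of v] False unfolding A_def by simp
      have dqs: "distinct qs" unfolding qs_def using dE' by (auto simp: distinct_map intro: inj_on_subset)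
      have sqs: "set qs \<subseteq> ?W" unfolding qs_def by auto
      have "dd t u vs ((v, \<omega> l) # A) = 0"
      \<comment> \<open>Again \<open>a + 1\<close> zeros: the two free values and the
        \<open>a - 1\<close> other values on the line \<open>l\<close>.\<close>
      proof (rule polyfun_roots_list[where f = "\<lambda>v. dd t u vs ((v, \<omega> l) # A)" and l = "x # y # qs"])
        show "polyfun a (\<lambda>v. dd t u vs ((v, \<omega> l) # A))" using polyfun_dd_z[of t u vs "[]" "\<omega> l" A] by simp
        show "dd t u vs ((z, \<omega> l) # A) = 0" if "z \<in> set (x # y # qs)" for z
        proof (cases "z = x \<or> z = y")
          case True then show ?thesis using zx c by auto
        next
          case f: False
          then have "z \<in> set qs" using that by auto
          then have "(z, \<omega> l) \<in> set A" unfolding qs_def A_def using False by force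
          then show ?thesis by (intro alternating_not_distinct[OF dd_alt_A]) simp
        qed
        show "distinct (x # y # qs)" using xy dqs sqs unfolding K_def by auto
      qed (use lq in simp)
      then show ?thesis using c by simp
    qed
    then show ?thesis by (rule conf_perm[rotated]) (simp add: E E'_def)
  qed
qed

lemma dd_all_zero:
  assumes L: "L = sorted_list_of_multiset labels" and nu: "length \<nu> = p" "distinct (t # u # \<nu>)"
    and zero: "\<And>n. n < p \<Longrightarrow> conf t u (zip (take n \<nu> @ drop (Suc n) \<nu>) L) = 0"
    and vs: "length vs + 2 = a" and len: "length A = a * b" and d: "distinct (t # u # vs @ map fst A)"
  shows "dd t u vs A = 0"
proof -
  have lines: "dd t u vs A = 0"
    if len: "length A = a * b" and d: "distinct (t # u # vs @ map fst A)"
      and on: "snd ` set A \<subseteq> \<omega> ` {1..b}" for A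
  proof -
    let ?n = "\<lambda>l. length (filter (\<lambda>q. snd q = \<omega> l) A)"
    have sum: "(\<Sum>l\<in>{1..b}. ?n l) = a * b"
    proof -
      have all: "(\<Sum>l\<in>{1..b}. length (filter (\<lambda>q. snd q = \<omega> l) B)) = length B" if "snd ` set B \<subseteq> \<omega> ` {1..b}" for B
        using that
      proof (induction B)
        case (Cons q B)
        then obtain m where m: "m \<in> {1..b}" "snd q = \<omega> m" by auto
        have "(\<Sum>l\<in>{1..b}. length (filter (\<lambda>r. snd r = \<omega> l) (q # B)))
            = (\<Sum>l\<in>{1..b}. (if l = m then 1 else 0) + length (filter (\<lambda>r. snd r = \<omega> l) B))"
          by (intro sum.cong refl) (use m(2) injD[OF inj_lines] in auto)
        also have "\<dots> = 1 + length B" using m(1) Cons by (simp add: sum.distrib)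
        finally show ?case by simp
      qed simp
      show ?thesis unfolding all[OF on] by (rule len)
    qed
    show ?thesis
    proof (cases "\<exists>l\<in>{1..b}. ?n l < a")
      case True
      then obtain l where l: "l \<in> {1..b}" "?n l < a" by blast
      define qs B where "qs = map fst (filter (\<lambda>q. snd q = \<omega> l) A)" and "B = filter (\<lambda>q. snd q \<noteq> \<omega> l) A"
      have ol: "on_line l qs = filter (\<lambda>q. snd q = \<omega> l) A"
      proof -
        have "map (\<lambda>q. (fst q, \<omega> l)) (filter (\<lambda>q. snd q = \<omega> l) A) = map id (filter (\<lambda>q. snd q = \<omega> l) A)"
          by (intro map_cong) (auto simp: prod_eq_iff)
        then show ?thesis unfolding on_line_def qs_def by (simp add: comp_def)
      qed
      have "dd t u vs (on_line l qs @ B) = 0"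
      proof (rule dd_zero_few[OF l(1) vs])
        show "length qs + length B = a * b"
          using sum_length_filter_compl[of "\<lambda>q. snd q = \<omega> l" A] len unfolding qs_def B_def by simp
        show "off_line l B" using on unfolding off_line_def B_def by auto
        show "set vs \<inter> set qs = {}" using d unfolding qs_def by auto
      qed (use d l(2) in \<open>auto simp: qs_def\<close>)
      then show ?thesis
        by (rule alternating_perm_zero[OF dd_alt_A, rotated]) (simp add: ol B_def mset_filter)
    next
      case False
      then have ge: "a \<le> ?n l" if "l \<in> {1..b}" for l using that by force
      have eq: "?n l = a" if "l \<in> {1..b}" for l
      proof (rule ccontr)
        assume "?n l \<noteq> a"
        then have "a < ?n l" using ge[OF that] by simp
        then have "(\<Sum>l\<in>{1..b}. a) < (\<Sum>l\<in>{1..b}. ?n l)"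
          using ge that by (intro sum_strict_mono_ex1) auto
        then show False using sum by (simp add: mult.commute)
      qed
      define \<iota> where "\<iota> = inv_into {1..b} \<omega>"
      have \<iota>: "\<iota> (snd q) \<in> {1..b}" "\<omega> (\<iota> (snd q)) = snd q" if "q \<in> set A" for q
      proof -
        have "snd q \<in> \<omega> ` {1..b}" using on that by auto
        then show "\<iota> (snd q) \<in> {1..b}" "\<omega> (\<iota> (snd q)) = snd q"
          unfolding \<iota>_def by (rule inv_into_into, rule f_inv_into_f)
      qed
      define E where "E = map (\<lambda>v. (v, 0)) vs @ map (\<lambda>q. (fst q, \<iota> (snd q))) A"
      have f1: "filter (\<lambda>e. snd e = 0) E = map (\<lambda>v. (v, 0)) vs"
        unfolding E_def using \<iota>(1) by (force simp: filter_map comp_def filter_empty_conv)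
      have f2: "filter (\<lambda>e. snd e \<noteq> 0) E = map (\<lambda>q. (fst q, \<iota> (snd q))) A"
      proof -
        have "\<iota> (snd q) \<noteq> 0" if "q \<in> set A" for q using \<iota>(1)[OF that] by simp
        then have "filter (\<lambda>q. \<iota> (snd q) \<noteq> 0) A = A" by (simp only: filter_id_conv) blast
        then show ?thesis unfolding E_def filter_append filter_map comp_def by simp
      qed
      have "map (\<lambda>e. (fst e, \<omega> (snd e))) (map (\<lambda>q. (fst q, \<iota> (snd q))) A) = A"
        using \<iota>(2) by (induction A) auto
      then have "conf t u E = dd t u vs A" unfolding conf_def f1 f2 by (simp add: comp_def)
      moreover have "mset (map snd E) = labels"
      proof (rule multiset_eqI)
        fix l
        have c0: "count (mset (map snd E)) l = length (filter (\<lambda>e. snd e = l) E)"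
          by (rule length_filter_label[symmetric])
        show "count (mset (map snd E)) l = count labels l"
        proof (cases "l = 0")
          case True
          then show ?thesis unfolding c0 count_labels using f1 vs by simp
        next
          case False
          have "filter (\<lambda>e. snd e = l) E = map (\<lambda>q. (fst q, \<iota> (snd q))) (filter (\<lambda>q. \<iota> (snd q) = l) A)"
            unfolding E_def using False by (simp add: filter_map comp_def)
          moreover have "filter (\<lambda>q. \<iota> (snd q) = l) A = filter (\<lambda>q. snd q = \<omega> l \<and> l \<in> {1..b}) A"
            by (intro filter_cong refl) (use \<iota> injD[OF inj_lines] in metis)
          ultimately show ?thesis unfolding c0 count_labels using False eq[of l]
            by (cases "l \<in> {1..b}") auto
        qed
      qed
      moreover have "distinct (t # u # map fst E)"
        using d unfolding E_def by (simp add: comp_def)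
      ultimately show ?thesis using conf_balanced[OF L nu zero] by metis
    qed
  qed
  have "dd t u vs (xs @ ys) = 0"
    if "length (xs @ ys) = a * b" "distinct (t # u # vs @ map fst (xs @ ys))" "snd ` set ys \<subseteq> \<omega> ` {1..b}" for xs ys
    using that
  proof (induction xs arbitrary: ys rule: rev_induct)
    case Nil then show ?case using lines by simp
  next
    case (snoc q xs)
    have "dd t u vs (xs @ (fst q, x) # ys) = 0" for x
    proof (rule polyfun_roots[OF polyfun_dd_x])
      show "b < card (\<omega> ` {0..b})" using inj_lines by (simp add: card_image inj_on_def inj_def)
      fix x assume "x \<in> \<omega> ` {0..b}"
      then obtain l where l: "x = \<omega> l" "l \<le> b" by auto
      show "dd t u vs (xs @ (fst q, x) # ys) = 0"
      proof (cases "l = 0")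
        case True
        then show ?thesis using l snoc.prems(1) by (intro dd_line0[OF vs]) auto
      next
        case False
        then show ?thesis using l snoc.prems by (intro snoc.IH) auto
      qed
    qed
    from this[of "snd q"] show ?case by simp
  qed
  from this[of A "[]"] len d show ?thesis by simp
qed

lemma scroll_cycle_top:
  assumes L: "L = sorted_list_of_multiset labels" and nu: "length \<nu> = p" "distinct (t # u # \<nu>)"
    and zero: "\<And>n. n < p \<Longrightarrow> conf t u (zip (take n \<nu> @ drop (Suc n) \<nu>) L) = 0"
  shows scroll_cycle
proof -
  have tu: "distinct [t, u]" using nu(2) by auto
  have dd0: "dd z w vs A = 0"
    if vs: "length vs + 2 = a" and len: "length A = a * b" and d: "distinct (t # u # vs @ map fst A)" for z w vs A
  proof -
    \<comment> \<open>The single pair \<open>t\<close>, \<open>u\<close> of the tests detects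
      \<open>chi vs A\<close>, which governs \<open>dd z w vs A\<close> for all \<open>z\<close> and
      \<open>w\<close>.\<close>
    have "chi vs A = 0"
      by (rule dd_zero_chi[OF vs len _ dd_all_zero[OF L nu zero vs len d]]) (use d in auto)
    then show ?thesis using dd_chi[OF vs len] d by simp
  qed
  have top: "line_vanish {t, u} {\<omega> 0} (a - 1)"
    unfolding line_vanish_def
  proof (intro allI impI)
    fix zs :: "'l list" and z w y :: 'l and A
    assume len: "length zs + 1 = a - 1" "length A + (a - 1) = p" and d: "distinct (z # w # zs @ map fst A)"
      and dA: "distinct (map snd A)" "set (map snd A) \<inter> {\<omega> 0} = {}" "set (zs @ map fst A) \<inter> {t, u} = {}"
    have lA: "length A = a * b" using len(2) p_eq a3 by simp
    show "Df (z, y) (w, y) (map (\<lambda>v. (v, y)) zs @ A) = 0"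
    \<comment> \<open>The degree is at most \<open>a b\<close>, and \<open>A\<close> supplies
      \<open>a b\<close> zeros; the special line \<open>\<omega> 0\<close> is the missing
      one.\<close>
    proof (rule polyfun_roots_list[OF polyfun_Df_line, where l = "\<omega> 0 # map snd A"])
      fix x assume x: "x \<in> set (\<omega> 0 # map snd A)"
      show "Df (z, x) (w, x) (map (\<lambda>v. (v, x)) zs @ A) = 0"
      proof (cases "x = \<omega> 0")
        case True
        have "dd z w zs A = 0" by (rule dd0[OF _ lA]) (use len d dA tu a3 in auto)
        then show ?thesis unfolding dd_def True .
      next
        case False
        then obtain v where "(v, x) \<in> set A" using x by auto
        then obtain xs ys where A: "A = xs @ (v, x) # ys" by (meson split_list)
        have "Df (z, x) (w, x) (map (\<lambda>v. (v, x)) (v # zs) @ xs @ ys) = 0"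
          by (rule Df_line_full) (use A len in auto)
        then show ?thesis by (rule alternating_perm_zero[OF Df_alt, rotated]) (simp add: A)
      qed
    next
      have "length zs + 2 = a" using len a3 by simp
      then show "(length zs + 2) * b < length (\<omega> 0 # map snd A)" using lA by simp
    qed (use dA in auto)
  qed
  have "line_vanish {t, u} {\<omega> 0} 1"
  proof (rule line_vanish_down[OF top])
    fix m assume m: "0 < m" "m < a - 1"
    have "(m + 1) * b \<le> a * b" using m by (intro mult_le_mono1) simp
    moreover have "a * b < p - m" using m p_eq by simp
    ultimately show "(m + 1) * b < p - m" by linarith
  qed (use a3 in auto)
  then show ?thesis by (rule scroll_cycleI) auto
qed

end

section \<open>The upper bound for Koszul cycles\<close>

text \<open>The cycle condition in terms of coefficients: for each weight \<open>s\<close> the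
  double sum is one coefficient in degree two of the coordinate ring. In this form it makes sense
  over a finite field and survives extension of scalars.\<close>

definition koszul_array :: "nat \<Rightarrow> nat \<Rightarrow> nat \<Rightarrow> ((nat \<times> nat) list \<Rightarrow> 'r::comm_ring_1) \<Rightarrow> bool" where
  "koszul_array a b p c \<longleftrightarrow> (\<forall>w. alternating (\<lambda>is. c (w # is))) \<and>
     (\<forall>s A. set A \<subseteq> grid a b \<longrightarrow> length A + 1 = p \<longrightarrow>
        (\<Sum>w\<in>grid a b. \<Sum>v\<in>grid a b. if w + v = s then c (w # v # A) else 0) = 0)"

lemma koszul_arrayD:
  "koszul_array a b p c \<Longrightarrow> set A \<subseteq> grid a b \<Longrightarrow> length A + 1 = p \<Longrightarrow>
    (\<Sum>w\<in>grid a b. \<Sum>v\<in>grid a b. if w + v = s then c (w # v # A) else 0) = 0"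
  unfolding koszul_array_def by blast

definition defect :: "nat \<Rightarrow> nat \<Rightarrow> ((nat \<times> nat) list \<Rightarrow> 'r::comm_ring_1) \<Rightarrow>
    ('r \<times> 'r) \<times> ('r \<times> 'r) \<times> ('r \<times> 'r) list \<Rightarrow> 'r" where
  "defect a b c = (\<lambda>(P, Q, A). ev (grid a b) c (Q # P # A) + ev (grid a b) c (P # Q # A))"

lemma defect_sum: "defect a b (\<lambda>is. \<Sum>j\<in>J. x j * c j is) \<tau> = (\<Sum>j\<in>J. defect a b (c j) \<tau> * x j)"
  unfolding defect_def by (cases \<tau>) (simp add: ev_sum ev_smult sum.distrib algebra_simps)

lemma ev_two:
  "ev G c (P # Q # A) = (\<Sum>u\<in>G. \<Sum>v\<in>G. (fst P ^ fst u * snd P ^ snd u) * (fst Q ^ fst v * snd Q ^ snd v) *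
     ev G (\<lambda>is. c (u # v # is)) A)"
  by (simp add: ev.simps sum_distrib_left mult.assoc)

text \<open>At equal points the monomials of \<open>w\<close> and \<open>v\<close> multiply to the
  one of \<open>w + v\<close>, so the terms can be collected by weight.\<close>

lemma koszul_array_cycle:
  assumes "koszul_array a b p c" "length A + 1 = p"
  shows "ev (grid a b) c (P # P # A) = 0"
proof -
  let ?G = "grid a b" and ?m = "\<lambda>s. fst P ^ fst s * snd P ^ snd s"
  let ?S = "(\<lambda>(w, v). w + v) ` (?G \<times> ?G)"
  have "ev ?G c (P # P # A) = (\<Sum>w\<in>?G. \<Sum>v\<in>?G. \<Sum>s\<in>?S.
      if w + v = s then ?m s * ev ?G (\<lambda>is. c (w # v # is)) A else 0)"
  proof -
    have "?m w * ?m v * e = (\<Sum>s\<in>?S. if w + v = s then ?m s * e else 0)" if "w \<in> ?G" "v \<in> ?G" for w v e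
    proof -
      have "w + v \<in> ?S" using that by force
      then have "(\<Sum>s\<in>?S. if w + v = s then ?m s * e else 0) = ?m (w + v) * e"
        by (simp add: sum.delta')
      then show ?thesis by (simp add: power_add algebra_simps)
    qed
    then show ?thesis unfolding ev_two by (intro sum.cong refl) blast
  qed
  also have "\<dots> = (\<Sum>s\<in>?S. \<Sum>w\<in>?G. \<Sum>v\<in>?G. if w + v = s then ?m s * ev ?G (\<lambda>is. c (w # v # is)) A else 0)"
    by (subst (2) sum.swap) (subst sum.swap, simp)
  also have "\<dots> = (\<Sum>s\<in>?S. ?m s * ev ?G (\<lambda>is. \<Sum>w\<in>?G. \<Sum>v\<in>?G. if w + v = s then c (w # v # is) else 0) A)"
  proof (rule sum.cong)
    fix s
    have "(if w + v = s then ?m s * ev ?G (\<lambda>is. c (w # v # is)) A else 0)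
        = ?m s * ev ?G (\<lambda>is. if w + v = s then c (w # v # is) else 0) A" for w v
      by simp
    then show "(\<Sum>w\<in>?G. \<Sum>v\<in>?G. if w + v = s then ?m s * ev ?G (\<lambda>is. c (w # v # is)) A else 0)
        = ?m s * ev ?G (\<lambda>is. \<Sum>w\<in>?G. \<Sum>v\<in>?G. if w + v = s then c (w # v # is) else 0) A"
      unfolding ev_sum sum_distrib_left by (intro sum.cong refl)
  qed simp
  also have "\<dots> = (\<Sum>s\<in>?S. ?m s * ev ?G (\<lambda>_. 0) A)"
  proof (rule sum.cong)
    fix s
    show "?m s * ev ?G (\<lambda>is. \<Sum>w\<in>?G. \<Sum>v\<in>?G. if w + v = s then c (w # v # is) else 0) A = ?m s * ev ?G (\<lambda>_. 0) A"
      by (rule arg_cong[where f = "(*) (?m s)"], rule ev_cong) (rule koszul_arrayD[OF assms(1)]; use assms(2) in simp)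
  qed simp
  finally show ?thesis by simp
qed

text \<open>Antisymmetry follows since the defect, as a polynomial function, determines its
  coefficients. The clause for equal entries comes from the cycle condition of weight
  \<open>u + u\<close>: its off-diagonal terms cancel in pairs, and \<open>w + w = u + u\<close>
  only for \<open>w = u\<close>.\<close>

lemma defect_zero_imp:
  fixes c :: "(nat \<times> nat) list \<Rightarrow> 'l::field"
  assumes inf: "infinite (UNIV :: 'l set)" and c: "koszul_array a b p c"
    and zero: "\<And>P Q A. length A + 1 = p \<Longrightarrow> defect a b c (P, Q, A) = 0"
    and A: "length A + 1 = p" "set A \<subseteq> grid a b" and uv: "u \<in> grid a b" "v \<in> grid a b"
  shows "c (u # v # A) + c (v # u # A) = 0" "c (u # u # A) = 0"
proof -
  let ?G = "grid a b"
  define d where "d is = (case is of u # v # A \<Rightarrow> c (v # u # A) + c (u # v # A) | _ \<Rightarrow> 0)" for "is"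
  have anti: "c (v # u # A) + c (u # v # A) = 0" if "u \<in> ?G" "v \<in> ?G" for u v
  proof -
    have "ev ?G d ps = 0" if len: "length ps = p + 1" for ps
    proof -
      obtain P Q B where ps: "ps = P # Q # B" "length B + 1 = p"
        using len A(1) by (cases ps; cases "tl ps") auto
      have e: "ev ?G (\<lambda>is. d (u # v # is)) B = ev ?G (\<lambda>is. c (v # u # is)) B + ev ?G (\<lambda>is. c (u # v # is)) B" for u v
        unfolding d_def by (simp add: ev_add)
      have "ev ?G d ps = ev ?G c (Q # P # B) + ev ?G c (P # Q # B)"
        unfolding ps(1) ev_two[of ?G d] e unfolding ev_two[of ?G c]
        by (subst (2) sum.swap) (simp add: algebra_simps sum.distrib)
      then show ?thesis using zero[OF ps(2), of P Q] unfolding defect_def by simp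
    qed
    from this have "d (u # v # A) = 0"
      by (rule ev_eq_0_imp[OF inf, where n = "p + 1"]) (use that A in auto)
    then show ?thesis unfolding d_def by simp
  qed
  then show "c (u # v # A) + c (v # u # A) = 0" using uv by simp
  let ?h = "\<lambda>w v. if w + v = u + u then c (w # v # A) else 0"
  have "(\<Sum>w\<in>?G. \<Sum>v\<in>?G. if w = v then 0 else ?h w v) = 0"
  proof (rule sum_alternating_pairs)
    fix w v assume "w \<in> ?G" "v \<in> ?G"
    then show "(if w = v then 0 else ?h w v) = - (if v = w then 0 else ?h v w)"
      using anti[of w v] by (auto simp: add.commute eq_neg_iff_add_eq_0)
  qed auto
  moreover have "(\<Sum>w\<in>?G. \<Sum>v\<in>?G. ?h w v) = 0"
    by (rule koszul_arrayD[OF c A(2,1)])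
  moreover have "(\<Sum>w\<in>?G. \<Sum>v\<in>?G. ?h w v)
      = (\<Sum>w\<in>?G. \<Sum>v\<in>?G. if w = v then 0 else ?h w v) + (\<Sum>w\<in>?G. ?h w w)"
  proof -
    have "(\<Sum>v\<in>?G. ?h w v) = (\<Sum>v\<in>?G. if w = v then 0 else ?h w v) + ?h w w" if w: "w \<in> ?G" for w
    proof -
      have "(\<Sum>v\<in>?G. ?h w v) = (\<Sum>v\<in>?G. (if w = v then 0 else ?h w v) + (if w = v then ?h w w else 0))"
        by (intro sum.cong) auto
      also have "\<dots> = (\<Sum>v\<in>?G. if w = v then 0 else ?h w v) + ?h w w"
        unfolding sum.distrib using w by (simp add: sum.delta)
      finally show ?thesis .
    qed
    then show ?thesis by (simp add: sum.distrib)
  qed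
  moreover have "(\<Sum>w\<in>?G. ?h w w) = c (u # u # A)"
  proof -
    have "w + w = u + u \<longleftrightarrow> w = u" for w by (cases w; cases u) auto
    then show ?thesis using uv by (simp add: sum.delta)
  qed
  ultimately show "c (u # u # A) = 0" by simp
qed

text \<open>\<open>Tr\<close> is fixed before \<open>c\<close> because its members become the
  equations of a linear system in \<open>upper_bound\<close>. The part \<open>\<tau>1\<close>
  consists of nodes of the scroll; the part \<open>\<tau>2\<close> is present only for
  \<open>p + 1 = a b + a\<close>.\<close>

lemma test_points:
  assumes inf: "infinite (UNIV :: 'l::field set)" and a3: "3 \<le> a" and b: "0 < b" and p: "a * b + a \<le> p + 1"
  shows "\<exists>Tr :: (('l \<times> 'l) \<times> ('l \<times> 'l) \<times> ('l \<times> 'l) list) set.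
    finite Tr \<and> card Tr \<le> p * (((a + 1) * b) choose (p + 1)) + (if p + 1 = a * b + a then p else 0) \<and>
    (\<forall>c. koszul_array a b p c \<longrightarrow> (\<forall>\<tau>\<in>Tr. defect a b c \<tau> = 0) \<longrightarrow>
      (\<forall>P Q A. length A + 1 = p \<longrightarrow> defect a b c (P, Q, A) = 0))"
proof -
  obtain \<xi> :: "nat \<Rightarrow> 'l" where inj: "inj \<xi>" using infinite_countable_subset[OF inf] by blast
  let ?f = "(a + 1) * b"
  let ?node = "\<lambda>n. (\<xi> (n div b), \<xi> n)"
  define \<B> where "\<B> = {B. B \<subseteq> {..<?f} \<and> card B = p + 1}"
  have fB: "finite \<B>" unfolding \<B>_def by simp
  have cB: "card \<B> = ?f choose (p + 1)" unfolding \<B>_def using n_subsets[of "{..<?f}" "p + 1"] by simp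
  define I1 where "I1 = (SIGMA B:\<B>. B - {Max B})"
  define \<tau>1 where "\<tau>1 = (\<lambda>(B, n). (?node n, ?node (Max B), map ?node (sorted_list_of_set (B - {n, Max B}))))"
  have fin1: "finite B" "Max B \<in> B" if "B \<in> \<B>" for B
  proof -
    show "finite B" using that finite_subset unfolding \<B>_def by blast
    moreover have "B \<noteq> {}" using that unfolding \<B>_def by auto
    ultimately show "Max B \<in> B" by (rule Max_in)
  qed
  have "card I1 = (\<Sum>B\<in>\<B>. card (B - {Max B}))"
    unfolding I1_def using fB fin1 by (intro card_SigmaI) auto
  also have "\<dots> = (\<Sum>B\<in>\<B>. p)"
  proof (rule sum.cong)
    fix B assume B: "B \<in> \<B>"
    then have "card B = p + 1" unfolding \<B>_def by blast
    then show "card (B - {Max B}) = p" using card_Diff_singleton[OF fin1(2)[OF B]] by simp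
  qed simp
  finally have cI1: "card I1 = p * (?f choose (p + 1))" using cB by simp
  have fI1: "finite I1" unfolding I1_def using fB fin1 by auto
  define L where "L = sorted_list_of_multiset (replicate_mset (a - 2) 0 + (\<Sum>l\<in>{1..b}. replicate_mset a l))"
  \<comment> \<open>The value number \<open>n\<close> of \<open>p\<close> values is left out and the
    others are dealt to the labels in sorted order.\<close>
  define E where "E n = zip (take n (map \<xi> [0..<p]) @ drop (Suc n) (map \<xi> [0..<p])) L" for n
  define \<tau>2 where "\<tau>2 n = ((\<xi> p, \<xi> 0), (\<xi> (p + 1), \<xi> 0),
    map (\<lambda>v. (v, \<xi> 0)) (map fst (filter (\<lambda>e. snd e = 0) (E n))) @
    map (\<lambda>e. (fst e, \<xi> (snd e))) (filter (\<lambda>e. snd e \<noteq> 0) (E n)))" for n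
  define I2 where "I2 = (if p + 1 = a * b + a then {..<p} else {})"
  let ?Tr = "\<tau>1 ` I1 \<union> \<tau>2 ` I2"
  have "card ?Tr \<le> card I1 + card I2"
    by (rule order.trans[OF card_Un_le]) (intro add_mono card_image_le fI1, simp add: I2_def)
  also have "\<dots> = p * (?f choose (p + 1)) + (if p + 1 = a * b + a then p else 0)"
    unfolding cI1 I2_def by simp
  finally have card: "card ?Tr \<le> p * (?f choose (p + 1)) + (if p + 1 = a * b + a then p else 0)" .
  have main: "defect a b c (P, Q, A) = 0"
    if c: "koszul_array a b p c" and zero: "\<forall>\<tau>\<in>?Tr. defect a b c \<tau> = 0" and len: "length A + 1 = p" for c P Q A
  proof -
    have ppos: "0 < p" using p a3 by (cases p) auto
    interpret koszul_cycle a b p c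
      by unfold_locales (use inf a3 b ppos c koszul_array_cycle[OF c] in \<open>auto simp: koszul_array_def\<close>)
    have D: "defect a b c (P, Q, A) = Df P Q A" for P Q A unfolding defect_def Df_def by simp
    have scroll_cycle
    proof (cases "p + 1 = a * b + a")
      case True
      interpret koszul_cycle_top a b p c \<xi>
        by unfold_locales (use inj a3 True in auto)
      have c0: "conf (\<xi> p) (\<xi> (p + 1)) (E n) = 0" if "n < p" for n
      proof -
        have "\<tau>2 n \<in> ?Tr" using that True unfolding I2_def by auto
        then have "defect a b c (\<tau>2 n) = 0" using zero by blast
        then show ?thesis unfolding \<tau>2_def D conf_def dd_def .
      qed
      have dt: "distinct (\<xi> p # \<xi> (p + 1) # map \<xi> [0..<p])"
        by (auto simp: distinct_map inj_eq[OF inj] inj_on_def)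
      show ?thesis
      proof (rule scroll_cycle_top[OF _ _ dt])
        show "L = sorted_list_of_multiset labels" unfolding L_def labels_def ..
        show "conf (\<xi> p) (\<xi> (p + 1)) (zip (take n (map \<xi> [0..<p]) @ drop (Suc n) (map \<xi> [0..<p])) L) = 0"
          if "n < p" for n using c0[OF that] unfolding E_def .
      qed simp
    next
      case False
      \<comment> \<open>Now \<open>a b + a < p + 1\<close>, so the degree count succeeds for every
        \<open>m < a\<close>.\<close>
      have "line_vanish {} {} 1"
      proof (rule line_vanish_down[OF line_vanish_full])
        fix m assume m: "0 < m" "m < a"
        have "(m + 1) * b \<le> a * b" using m by (intro mult_le_mono1) simp
        then show "(m + 1) * b < p - m" using m p False by linarith
      qed (use a3 in auto)
      then show ?thesis by (rule scroll_cycleI) auto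
    qed
    moreover have "Df (node \<xi> n) (node \<xi> (Max B)) (map (node \<xi>) (sorted_list_of_set (B - {n, Max B}))) = 0"
      if "B \<subseteq> {..<?f}" "card B = p + 1" "n \<in> B" "n \<noteq> Max B" for B n
    proof -
      have "\<tau>1 (B, n) \<in> ?Tr" using that unfolding I1_def \<B>_def by auto
      then have "defect a b c (\<tau>1 (B, n)) = 0" using zero by blast
      then show ?thesis unfolding \<tau>1_def prod.case D node_def[abs_def] .
    qed
    ultimately have "Df P Q A = 0"
      using Df_all_zero[OF inj _ Df_nodes_zero[OF inj] len] by blast
    then show ?thesis unfolding D .
  qed
  show ?thesis
  proof (intro exI conjI allI impI)
    show "finite ?Tr" using fI1 unfolding I2_def by auto
    show "card ?Tr \<le> p * (?f choose (p + 1)) + (if p + 1 = a * b + a then p else 0)" by (rule card)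
  qed (rule main)
qed

section \<open>Forms of low degree\<close>

abbreviation var1 :: "'v \<Rightarrow> 'v \<Rightarrow>\<^sub>0 nat" where
  "var1 v \<equiv> Poly_Mapping.single v 1"

definition Var :: "'v \<Rightarrow> ('v \<Rightarrow>\<^sub>0 nat) \<Rightarrow>\<^sub>0 'k::field" where
  "Var v = Poly_Mapping.single (var1 v) 1"

definition Cst :: "'k \<Rightarrow> ('v \<Rightarrow>\<^sub>0 nat) \<Rightarrow>\<^sub>0 'k::field" where
  "Cst x = Poly_Mapping.single 0 x"

lemma Cst_simps [simp]: "Cst 0 = 0" "Cst 1 = 1" "Cst (x + y) = Cst x + Cst y" "Cst (x * y) = Cst x * Cst y"
  "Cst (- x) = - Cst x"
  unfolding Cst_def by (simp_all add: single_add mult_single single_uminus)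

lemma Cst_sum: "Cst (\<Sum>i\<in>I. f i) = (\<Sum>i\<in>I. Cst (f i))"
  by (induction I rule: infinite_finite_induct) auto

lemma poly_mapping_sum_singles: "f = (\<Sum>k\<in>Poly_Mapping.keys f. Poly_Mapping.single k (Poly_Mapping.lookup f k))"
  by (rule poly_mapping_eqI) (auto simp: lookup_sum lookup_single when_def in_keys_iff)

lemma lookup_single_mult:
  fixes f :: "('v \<Rightarrow>\<^sub>0 nat) \<Rightarrow>\<^sub>0 'k::field"
  shows "Poly_Mapping.lookup (Poly_Mapping.single m x * f) n
    = (\<Sum>k\<in>Poly_Mapping.keys f. if m + k = n then x * Poly_Mapping.lookup f k else 0)"
proof -
  have "Poly_Mapping.single m x * f
      = (\<Sum>k\<in>Poly_Mapping.keys f. Poly_Mapping.single (m + k) (x * Poly_Mapping.lookup f k))"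
    by (subst (1) poly_mapping_sum_singles[of f]) (simp add: sum_distrib_left mult_single)
  then show ?thesis by (simp add: lookup_sum lookup_single when_def)
qed

lemma lookup_single_mult_add:
  "Poly_Mapping.lookup (Poly_Mapping.single m x * f) (m + k) = x * Poly_Mapping.lookup (f :: ('v \<Rightarrow>\<^sub>0 nat) \<Rightarrow>\<^sub>0 'k::field) k"
  unfolding lookup_single_mult by (simp add: in_keys_iff)

lemma lookup_single_mult_not:
  assumes "\<And>k. n \<noteq> m + k"
  shows "Poly_Mapping.lookup (Poly_Mapping.single m x * (f :: ('v \<Rightarrow>\<^sub>0 nat) \<Rightarrow>\<^sub>0 'k::field)) n = 0"
  unfolding lookup_single_mult using assms by (intro sum.neutral) auto

lemma lookup_Cst_mult: "Poly_Mapping.lookup (Cst x * f) k = x * Poly_Mapping.lookup f k"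
  using lookup_single_mult_add[of 0 x f k] unfolding Cst_def by simp

lemma lookup_Var_mult:
  "Poly_Mapping.lookup (Var u * f) n = (if 0 < Poly_Mapping.lookup n u then Poly_Mapping.lookup f (n - var1 u) else 0)"
proof (cases "0 < Poly_Mapping.lookup n u")
  case True
  have "n = var1 u + (n - var1 u)"
    by (rule poly_mapping_eqI) (use True in \<open>auto simp: lookup_add lookup_minus lookup_single when_def\<close>)
  then have "Poly_Mapping.lookup (Var u * f) n = Poly_Mapping.lookup f (n - var1 u)"
    unfolding Var_def by (metis lookup_single_mult_add mult_1)
  then show ?thesis using True by simp
next
  case False
  have "n \<noteq> var1 u + k" for k
  proof
    assume "n = var1 u + k"
    then have "Poly_Mapping.lookup n u = 1 + Poly_Mapping.lookup k u" by (simp add: lookup_add lookup_single)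
    then show False using False by simp
  qed
  from lookup_single_mult_not[OF this] show ?thesis unfolding Var_def using False by simp
qed

lemma var1_pair_eq:
  "var1 v + var1 w = var1 x + var1 y \<longleftrightarrow> (v = x \<and> w = y) \<or> (v = y \<and> w = x)"
proof
  assume "var1 v + var1 w = var1 x + var1 y"
  then have eq: "Poly_Mapping.lookup (var1 v + var1 w) z = Poly_Mapping.lookup (var1 x + var1 y) z" for z by simp
  then have *: "(if v = z then 1 else 0) + (if w = z then 1 else 0)
      = (if x = z then 1 else 0) + (if y = z then (1::nat) else 0)" for z
    using eq[of z] by (simp only: lookup_add lookup_single when_def)
  show "(v = x \<and> w = y) \<or> (v = y \<and> w = x)"
  proof (cases "v = x")
    case True
    then have "y = w" using *[of w] by (simp split: if_split_asm)
    then show ?thesis using True by simp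
  next
    case False
    then have y: "y = v" using *[of v] by (simp split: if_split_asm)
    then have "x = w" using *[of w] by (simp split: if_split_asm)
    then show ?thesis using y by simp
  qed
qed (auto simp: add.commute)

lemma lookup_quadric:
  fixes B :: "'v \<Rightarrow> 'v \<Rightarrow> 'k::field"
  assumes "finite V" "x \<in> V" "y \<in> V"
  shows "Poly_Mapping.lookup (\<Sum>v\<in>V. \<Sum>w\<in>V. Cst (B v w) * Var v * Var w) (var1 x + var1 y)
    = (if x = y then B x x else B x y + B y x)"
proof -
  have "Cst (B v w) * Var v * Var w = Poly_Mapping.single (var1 v + var1 w) (B v w)" for v w
    unfolding Cst_def Var_def by (simp add: mult_single)
  then have "Poly_Mapping.lookup (\<Sum>v\<in>V. \<Sum>w\<in>V. Cst (B v w) * Var v * Var w) (var1 x + var1 y)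
      = (\<Sum>v\<in>V. \<Sum>w\<in>V. if (v = x \<and> w = y) \<or> (v = y \<and> w = x) then B v w else 0)"
    by (simp only: lookup_sum lookup_single when_def var1_pair_eq)
  also have "\<dots> = (\<Sum>v\<in>V. (if v = x then B x y else 0) + (if v = y \<and> x \<noteq> y then B y x else 0))"
  proof (rule sum.cong)
    fix v assume "v \<in> V"
    have "(\<Sum>w\<in>V. if (v = x \<and> w = y) \<or> (v = y \<and> w = x) then B v w else 0)
        = (\<Sum>w\<in>V. (if w = y then if v = x then B x y else 0 else 0) +
            (if w = x then if v = y \<and> x \<noteq> y then B y x else 0 else 0))"
      by (intro sum.cong) auto
    then show "(\<Sum>w\<in>V. if (v = x \<and> w = y) \<or> (v = y \<and> w = x) then B v w else 0)
        = (if v = x then B x y else 0) + (if v = y \<and> x \<noteq> y then B y x else 0)"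
      using assms by (simp add: sum.distrib)
  qed simp
  also have "\<dots> = (if x = y then B x x else B x y + B y x)"
    using assms by (auto simp: sum.distrib)
  finally show ?thesis .
qed

lemma quadric_alternating:
  fixes B :: "'v \<Rightarrow> 'v \<Rightarrow> 'k::field"
  assumes "finite V" "(\<Sum>v\<in>V. \<Sum>w\<in>V. Cst (B v w) * Var v * Var w) = 0" "x \<in> V" "y \<in> V"
  shows "B x y + B y x = 0" "B x x = 0"
proof -
  show d: "B x x = 0" using lookup_quadric[OF assms(1,3,3), of B] assms(2) by simp
  show "B x y + B y x = 0" using lookup_quadric[OF assms(1,3,4), of B] assms(2) d by (cases "x = y") auto
qed

lemma mono_degree_add: "mono_degree (m + n) = mono_degree m + mono_degree n"
proof -
  let ?K = "Poly_Mapping.keys m \<union> Poly_Mapping.keys n"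
  have e: "mono_degree k = (\<Sum>v\<in>?K. Poly_Mapping.lookup k v)" if "Poly_Mapping.keys k \<subseteq> ?K" for k
    unfolding mono_degree_def using that by (intro sum.mono_neutral_left) (auto simp: in_keys_iff)
  have "Poly_Mapping.keys (m + n) \<subseteq> ?K" by (rule keys_add)
  then show ?thesis by (simp add: e lookup_add sum.distrib)
qed

lemma mono_degree_zero [simp]: "mono_degree 0 = 0"
  by (simp add: mono_degree_def)

lemma mono_degree_var1: "mono_degree (var1 v) = 1"
proof -
  have "mono_degree (var1 v) = (\<Sum>u\<in>{v}. Poly_Mapping.lookup (var1 v) u)"
    unfolding mono_degree_def by (rule sum.cong) (simp_all only: keys_single one_neq_zero if_False)
  then show ?thesis by simp
qed

lemma mono_degree_0_iff: "mono_degree m = 0 \<longleftrightarrow> m = 0"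
  unfolding mono_degree_def by (auto simp: in_keys_iff intro: poly_mapping_eqI)

lemma mono_degree_Suc:
  assumes "mono_degree m = Suc n"
  obtains v m' where "m = var1 v + m'" "mono_degree m' = n" "v \<in> Poly_Mapping.keys m"
proof -
  have "m \<noteq> 0" using assms by auto
  then obtain v where v: "v \<in> Poly_Mapping.keys m" by (metis keys_eq_empty ex_in_conv)
  have m: "m = var1 v + (m - var1 v)"
    by (rule poly_mapping_eqI) (use v in \<open>auto simp: lookup_add lookup_minus lookup_single when_def in_keys_iff\<close>)
  have "mono_degree m = 1 + mono_degree (m - var1 v)" by (subst m) (simp only: mono_degree_add mono_degree_var1)
  then show thesis using that[OF m] v assms by simp
qed

lemma keys_add_nat: "Poly_Mapping.keys (m + n) = Poly_Mapping.keys m \<union> Poly_Mapping.keys (n :: 'v \<Rightarrow>\<^sub>0 nat)"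
  by (auto simp: in_keys_iff lookup_add)

lemma poly_componentD:
  assumes "f \<in> poly_component V n" "Poly_Mapping.lookup f m \<noteq> 0"
  shows "Poly_Mapping.keys m \<subseteq> V" "int (mono_degree m) = n"
  using assms unfolding poly_component_def poly_ring_def by (auto simp: in_keys_iff)

lemma poly_component_2_eqI:
  assumes f: "f \<in> poly_component V 2" and g: "g \<in> poly_component V 2"
    and eq: "\<And>x y. x \<in> V \<Longrightarrow> y \<in> V \<Longrightarrow>
      Poly_Mapping.lookup f (var1 x + var1 y) = Poly_Mapping.lookup g (var1 x + var1 y)"
  shows "f = g"
proof (rule poly_mapping_eqI)
  fix m
  show "Poly_Mapping.lookup f m = Poly_Mapping.lookup g m"
  proof (cases "Poly_Mapping.keys m \<subseteq> V \<and> int (mono_degree m) = 2")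
    case False
    then show ?thesis using poly_componentD[OF f, of m] poly_componentD[OF g, of m] by metis
  next
    case True
    then have "mono_degree m = Suc 1" by simp
    then obtain x m' where x: "m = var1 x + m'" "mono_degree m' = 1" by (rule mono_degree_Suc)
    then obtain y m'' where y: "m' = var1 y + m''" "mono_degree m'' = 0"
      using mono_degree_Suc[of m' 0] by (metis One_nat_def)
    have "m = var1 x + var1 y" using x y mono_degree_0_iff by auto
    moreover have "x \<in> V" "y \<in> V" using True unfolding calculation keys_add_nat by auto
    ultimately show ?thesis using eq by simp
  qed
qed

lemma quadric_component:
  assumes "finite V"
  shows "(\<Sum>v\<in>V. \<Sum>w\<in>V. Cst (B v w) * Var v * Var w) \<in> poly_component V 2"
proof -
  have e: "Cst (B v w) * Var v * Var w = Poly_Mapping.single (var1 v + var1 w) (B v w)" for v w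
    unfolding Cst_def Var_def by (simp add: mult_single)
  have *: "\<exists>v\<in>V. \<exists>w\<in>V. m = var1 v + var1 w"
    if m: "m \<in> Poly_Mapping.keys (\<Sum>v\<in>V. \<Sum>w\<in>V. Cst (B v w) * Var v * Var w)" for m
  proof -
    obtain v where v: "v \<in> V" "m \<in> Poly_Mapping.keys (\<Sum>w\<in>V. Cst (B v w) * Var v * Var w)"
      using subsetD[OF keys_sum m] by blast
    then obtain w where "w \<in> V" "m \<in> Poly_Mapping.keys (Cst (B v w) * Var v * Var w)"
      using subsetD[OF keys_sum v(2)] by blast
    then show ?thesis using v(1) unfolding e by (auto split: if_splits)
  qed
  have "Poly_Mapping.keys m \<subseteq> V \<and> int (mono_degree m) = 2"
    if m: "m \<in> Poly_Mapping.keys (\<Sum>v\<in>V. \<Sum>w\<in>V. Cst (B v w) * Var v * Var w)" for m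
  proof -
    obtain v w where "v \<in> V" "w \<in> V" "m = var1 v + var1 w" using *[OF m] by blast
    then show ?thesis by (auto simp: keys_add_nat mono_degree_add mono_degree_var1[unfolded One_nat_def])
  qed
  then show ?thesis unfolding poly_component_def poly_ring_def by simp
qed

section \<open>Exactness of the Koszul complex in degree two\<close>

lemma alternating_wed:
  fixes h :: "'a \<Rightarrow> 'a list \<Rightarrow> 'r::ab_group_add"
  assumes "\<And>v. alternating (h v)"
  shows "alternating (wed h)"
proof (rule alternatingI)
  have neg: "wed (\<lambda>x A. - h x A) B = - wed h B" for h :: "'a \<Rightarrow> 'a list \<Rightarrow> 'r" and B
    by (induction B arbitrary: h) auto
  have nil: "wed (\<lambda>x A. 0) B = (0 :: 'r)" for B :: "'a list" by (induction B) auto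
  fix xs u v ys
  show "wed h (xs @ u # v # ys) = - wed h (xs @ v # u # ys)"
    using assms
  proof (induction xs arbitrary: h)
    case Nil
    have "(\<lambda>x A. h x (u # v # A)) = (\<lambda>x A. - h x (v # u # A))"
      using alternating_swap0[OF Nil] by blast
    then show ?case using neg[of "\<lambda>x A. h x (v # u # A)" ys] by simp
  next
    case (Cons z xs)
    have "h z (xs @ u # v # ys) = - h z (xs @ v # u # ys)" by (rule alternating_swap[OF Cons.prems])
    moreover have "wed (\<lambda>x A. h x (z # A)) (xs @ u # v # ys) = - wed (\<lambda>x A. h x (z # A)) (xs @ v # u # ys)"
      by (rule Cons.IH) (rule alternating_Cons[OF Cons.prems])
    ultimately show ?case by simp
  qed
  show "wed h (xs @ u # u # ys) = 0"
    using assms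
  proof (induction xs arbitrary: h)
    case Nil
    have "(\<lambda>x A. h x (u # u # A)) = (\<lambda>x A. 0)"
      using alternating_same0[OF Nil] by blast
    then show ?case using nil by simp
  next
    case (Cons z xs)
    have "h z (xs @ u # u # ys) = 0" by (rule alternating_same[OF Cons.prems])
    moreover have "wed (\<lambda>x A. h x (z # A)) (xs @ u # u # ys) = 0"
      by (rule Cons.IH) (rule alternating_Cons[OF Cons.prems])
    ultimately show ?case by simp
  qed
qed

text \<open>The contracting homotopy moves the largest variable of a monomial into the exterior part
  if it exceeds everything there.\<close>

definition lift :: "('v::linorder list \<Rightarrow> ('v \<Rightarrow>\<^sub>0 nat) \<Rightarrow>\<^sub>0 'k::field) \<Rightarrow> 'v list \<Rightarrow> 'k" where
  "lift t = (\<lambda>is. case is of [] \<Rightarrow> 0 | w # B \<Rightarrow> wed (\<lambda>v A.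
     if w \<le> v \<and> (\<forall>x\<in>set A. x < v) then Poly_Mapping.lookup (t A) (var1 v + var1 w) else 0) B)"

lemma lift_alternating:
  assumes "alternating t"
  shows "alternating (\<lambda>B. lift t (w # B))"
proof -
  have "alternating (\<lambda>A. if w \<le> v \<and> (\<forall>x\<in>set A. x < v) then Poly_Mapping.lookup (t A) (var1 v + var1 w) else 0)" for v
  proof (rule alternatingI)
    fix xs u u' ys
    show "(if w \<le> v \<and> (\<forall>x\<in>set (xs @ u # u' # ys). x < v) then Poly_Mapping.lookup (t (xs @ u # u' # ys)) (var1 v + var1 w) else 0)
      = - (if w \<le> v \<and> (\<forall>x\<in>set (xs @ u' # u # ys). x < v) then Poly_Mapping.lookup (t (xs @ u' # u # ys)) (var1 v + var1 w) else 0)"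
      using alternating_swap[OF assms, of xs u u' ys] by auto
    show "(if w \<le> v \<and> (\<forall>x\<in>set (xs @ u # u # ys). x < v) then Poly_Mapping.lookup (t (xs @ u # u # ys)) (var1 v + var1 w) else 0) = 0"
      using alternating_same[OF assms, of xs u ys] by simp
  qed
  then have "alternating (wed (\<lambda>v A. if w \<le> v \<and> (\<forall>x\<in>set A. x < v) then Poly_Mapping.lookup (t A) (var1 v + var1 w) else 0))"
    by (rule alternating_wed)
  then show ?thesis unfolding lift_def by simp
qed

text \<open>Coefficients of \<open>var1 x + var1 y\<close> with \<open>x \<le> y\<close> are
  compared. If \<open>y\<close> exceeds all of \<open>A\<close>, the first term of
  \<open>lift\<close> reproduces the coefficient. Otherwise the maximum \<open>z\<close> of
  \<open>A\<close> takes over, and the Koszul condition at the cubic monomial \<open>z x y\<close>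
  expresses the coefficient through the terms of \<open>lift\<close>.\<close>

lemma lift_eq:
  fixes t :: "'v::linorder list \<Rightarrow> ('v \<Rightarrow>\<^sub>0 nat) \<Rightarrow>\<^sub>0 'k::field"
  assumes fin: "finite V" and alt: "alternating t" and comp: "\<And>A. t A \<in> poly_component V 2"
    and cyc: "\<And>A. (\<Sum>u\<in>V. Var u * t (u # A)) = 0" and AV: "set A \<subseteq> V"
  shows "(\<Sum>v\<in>V. \<Sum>w\<in>V. Cst (lift t (w # v # A)) * Var v * Var w) = t A"
proof (rule poly_component_2_eqI[OF quadric_component[OF fin] comp])
  define c where "c A x y = Poly_Mapping.lookup (t A) (var1 x + var1 y)" for A x y
  have c_sym: "c A x y = c A y x" for A x y unfolding c_def by (simp add: add.commute)
  define H where "H w v A = (if w \<le> v \<and> (\<forall>x\<in>set A. x < v) then c A v w else 0)" for w v A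
  have L: "lift t (w # v # A) = H w v A - wed (\<lambda>z B. H w z (v # B)) A" for w v A
    unfolding lift_def H_def c_def by simp
  have key: "(if x = y then lift t (x # x # A) else lift t (y # x # A) + lift t (x # y # A)) = c A x y"
    if xy: "x \<le> y" "x \<in> V" "y \<in> V" for x y
  proof (cases "distinct A")
    case False
    have "t A = 0" by (rule alternating_not_distinct[OF alt False])
    moreover have "lift t (w # v # A) = 0" for w v
      using alternating_not_distinct[OF lift_alternating[OF alt], of "v # A" w] False by simp
    ultimately show ?thesis unfolding c_def by simp
  next
    case dA: True
    show ?thesis
    proof (cases "\<forall>z\<in>set A. z < y")
      case True
      \<comment> \<open>A nonzero term would need an entry of \<open>A\<close> that is at least
        \<open>y\<close>.\<close>
      have w0: "wed (\<lambda>z B. H w z (v # B)) A = 0" if "max w v = y" for w v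
        unfolding wed_eq_sum
      proof (intro sum.neutral ballI)
        fix i assume "i \<in> {..<length A}"
        then have "A ! i < y" using True by simp
        then have "\<not> (w \<le> A ! i \<and> v < A ! i)" using that by (auto simp: max_def split: if_splits)
        then show "(- 1) ^ i * H w (A ! i) (v # take i A @ drop (Suc i) A) = 0" unfolding H_def by auto
      qed
      have "H x y A = c A y x" unfolding H_def using True xy(1) by simp
      moreover have "H y x A = 0" if "x \<noteq> y" unfolding H_def using that xy(1) by auto
      ultimately show ?thesis unfolding L using w0 xy(1) c_sym by (auto simp: max_def)
    next
      case False
      then have A0: "A \<noteq> []" by auto
      define z where "z = Max (set A)"
      have zA: "z \<in> set A" unfolding z_def using A0 by (intro Max_in) auto
      have zmax: "\<And>u. u \<in> set A \<Longrightarrow> u \<le> z" unfolding z_def by simp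
      have yz: "y \<le> z" using False zmax by (meson le_less_trans not_less)
      obtain B1 B2 where A: "A = B1 @ z # B2" using zA by (meson split_list)
      define i where "i = length B1"
      define A' where "A' = B1 @ B2"
      have zA': "\<And>u. u \<in> set A' \<Longrightarrow> u < z" using dA zmax unfolding A A'_def by (auto simp: less_le)
      have H0: "H w v A = 0" if "v \<le> z" for w v
        unfolding H_def using zA that by auto
      \<comment> \<open>Only the split at the maximum \<open>z\<close> survives, since any other
        entry has \<open>z\<close> in its complement.\<close>
      have wd: "wed (\<lambda>z B. H w z (v # B)) A = (- 1) ^ i * (if w \<le> z \<and> v < z then c (v # A') z w else 0)" for w v
      proof -
        have "wed (\<lambda>z B. H w z (v # B)) A = (\<Sum>j<length A. if j = i then (- 1) ^ i * H w z (v # A') else 0)"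
          unfolding wed_eq_sum
        proof (rule sum.cong)
          fix j assume "j \<in> {..<length A}"
          then have j: "j < length A" by simp
          show "(- 1) ^ j * H w (A ! j) (v # take j A @ drop (Suc j) A)
              = (if j = i then (- 1) ^ i * H w z (v # A') else 0)"
          proof (cases "j = i")
            case True
            then show ?thesis unfolding i_def A A'_def by simp
          next
            case False
            have "A ! i = z" "i < length A" unfolding i_def A by simp_all
            then have "z \<in> set (take j A @ drop (Suc j) A)"
            proof (cases "i < j")
              case True
              then have "take j A ! i = z" "i < length (take j A)" using \<open>A ! i = z\<close> j by auto
              then show ?thesis by (metis Un_iff nth_mem set_append)
            next
              case f: False
              then have "drop (Suc j) A ! (i - Suc j) = z" "i - Suc j < length (drop (Suc j) A)"
                using \<open>A ! i = z\<close> \<open>i < length A\<close> False by auto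
              then show ?thesis by (metis Un_iff nth_mem set_append)
            qed
            moreover have "A ! j \<le> z" using zmax j by simp
            ultimately have "\<not> (\<forall>x\<in>set (take j A @ drop (Suc j) A). x < A ! j)" by (meson not_less)
            then have "H w (A ! j) (v # take j A @ drop (Suc j) A) = 0" unfolding H_def by auto
            then show ?thesis using False by simp
          qed
        qed simp
        also have "\<dots> = (- 1) ^ i * H w z (v # A')" unfolding i_def A by simp
        finally show ?thesis unfolding H_def using zA' by auto
      qed
      have tA: "c A x y = (- 1) ^ i * c (z # A') x y" for x y
      proof -
        have "t A = (- 1) ^ i * t (z # A')" unfolding A A'_def i_def by (rule alternating_move0[OF alt])
        moreover have "(- 1) ^ i * g = (if even i then g else - g)" for g :: "('v \<Rightarrow>\<^sub>0 nat) \<Rightarrow>\<^sub>0 'k"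
          by (auto simp: minus_one_power_iff)
        ultimately show ?thesis unfolding c_def by (auto simp: minus_one_power_iff)
      qed
      have zV: "z \<in> V" using zA AV by blast
      have cyc3: "(\<Sum>u\<in>V. if u = x1 \<or> u = x2 \<or> u = x3
          then Poly_Mapping.lookup (t (u # A')) (var1 x1 + var1 x2 + var1 x3 - var1 u) else 0) = 0" for x1 x2 x3
      proof -
        have "0 = Poly_Mapping.lookup (\<Sum>u\<in>V. Var u * t (u # A')) (var1 x1 + var1 x2 + var1 x3)"
          unfolding cyc by simp
        also have "\<dots> = (\<Sum>u\<in>V. if u = x1 \<or> u = x2 \<or> u = x3
          then Poly_Mapping.lookup (t (u # A')) (var1 x1 + var1 x2 + var1 x3 - var1 u) else 0)"
          unfolding lookup_sum by (intro sum.cong refl) (auto simp: lookup_Var_mult lookup_add lookup_single when_def)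
        finally show ?thesis by simp
      qed
      have r: "var1 x1 + var1 x2 + var1 x3 - var1 x1 = var1 x2 + var1 x3"
        "var1 x1 + var1 x2 + var1 x3 - var1 x2 = var1 x1 + var1 x3"
        "var1 x1 + var1 x2 + var1 x3 - var1 x3 = var1 x1 + var1 x2" for x1 x2 x3 :: 'v
        by (rule poly_mapping_eqI; simp add: lookup_add lookup_minus)+
      have sumV: "(\<Sum>u\<in>V. if u = x1 \<or> u = x2 \<or> u = x3 then F u else 0) = (\<Sum>u\<in>{x1, x2, x3}. F u)"
        if "x1 \<in> V" "x2 \<in> V" "x3 \<in> V" for x1 x2 x3 and F :: "'v \<Rightarrow> 'k"
        using fin that by (intro sum.mono_neutral_cong_right) auto
      have C: "(\<Sum>u\<in>{z, x, y}. Poly_Mapping.lookup (t (u # A')) (var1 z + var1 x + var1 y - var1 u)) = 0"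
        using cyc3[of z x y] sumV[OF zV xy(2,3)] by simp
      \<comment> \<open>When variables coincide, the three terms of \<open>C\<close> collapse to two
        or one.\<close>
      consider "x = y" "y < z" | "x = y" "y = z" | "x < y" "y < z" | "x < y" "y = z"
        using xy(1) yz by fastforce
      then show ?thesis
      proof cases
        case 1
        have "c (z # A') x x + c (x # A') z x = 0"
          using C 1 unfolding c_def by (simp add: r[unfolded One_nat_def])
        then have "c (z # A') x x = - c (x # A') z x" by (simp add: eq_neg_iff_add_eq_0)
        then show ?thesis unfolding L tA wd using 1 H0 by (simp add: less_imp_le)
      next
        case 2
        have "c (z # A') z z = 0" using C 2 unfolding c_def by (simp add: r[unfolded One_nat_def])
        then show ?thesis unfolding L tA wd using 2 H0 by simp
      next
        case 3
        have "c (z # A') x y + (c (x # A') z y + c (y # A') z x) = 0"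
        proof -
          have "z \<noteq> x" "z \<noteq> y" "x \<noteq> y" using 3 by auto
          then show ?thesis using C unfolding c_def by (simp add: r[unfolded One_nat_def])
        qed
        then have e: "c (z # A') x y = - c (x # A') z y - c (y # A') z x" by (simp add: eq_neg_iff_add_eq_0 algebra_simps)
        have "x < z" "x \<le> z" "y \<le> z" "x \<noteq> y" using 3 by auto
        then show ?thesis unfolding L tA wd e using 3(2) H0 by (simp add: algebra_simps)
      next
        case 4
        have "c (z # A') x z + c (x # A') z z = 0"
        proof -
          have "z \<noteq> x" "{z, x, y} = {z, x}" using 4 by auto
          then show ?thesis using C 4(2) c_sym[of "z # A'" x z] unfolding c_def by (simp add: r[unfolded One_nat_def])
        qed
        then have e: "c (z # A') x y = - c (x # A') z z" using 4(2) by (simp add: eq_neg_iff_add_eq_0)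
        have "x < z" "x \<le> z" "x \<noteq> z" using 4 by auto
        then show ?thesis unfolding L tA wd e using 4(2) H0 by simp
      qed
    qed
  qed
  fix x y assume xy: "x \<in> V" "y \<in> V"
  have q: "Poly_Mapping.lookup (\<Sum>v\<in>V. \<Sum>w\<in>V. Cst (lift t (w # v # A)) * Var v * Var w) (var1 x + var1 y)
      = (if x = y then lift t (x # x # A) else lift t (y # x # A) + lift t (x # y # A))"
    by (rule lookup_quadric[OF fin xy])
  show "Poly_Mapping.lookup (\<Sum>v\<in>V. \<Sum>w\<in>V. Cst (lift t (w # v # A)) * Var v * Var w) (var1 x + var1 y)
      = Poly_Mapping.lookup (t A) (var1 x + var1 y)"
  proof (cases "x \<le> y")
    case True
    then show ?thesis unfolding q using key[OF True xy] unfolding c_def by simp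
  next
    case False
    then have "y \<le> x" by simp
    then show ?thesis unfolding q using key[OF _ xy(2,1)] False c_sym[of A x y] unfolding c_def
      by (auto simp: add.commute)
  qed
qed

section \<open>The linear strand as alternating families of quadrics\<close>

text \<open>\<open>J p\<close> indexes the generators of degree \<open>p + 1\<close> of the \<open>p\<close>-th free module, \<open>Dc p j i v\<close> is the
  coefficient of the variable \<open>v\<close> in the entry of the differential from generator \<open>j\<close> of the
  \<open>(p + 1)\<close>-st module to generator \<open>i\<close> of the \<open>p\<close>-th one, and \<open>Q j\<close> is the quadric of generator \<open>j\<close>.\<close>

locale linear_strand =
  fixes V :: "'v set" and J :: "nat \<Rightarrow> nat set" and Dc :: "nat \<Rightarrow> nat \<Rightarrow> nat \<Rightarrow> 'v \<Rightarrow> 'k::field"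
    and Q :: "nat \<Rightarrow> ('v \<Rightarrow>\<^sub>0 nat) \<Rightarrow>\<^sub>0 'k" and I2 :: "(('v \<Rightarrow>\<^sub>0 nat) \<Rightarrow>\<^sub>0 'k) set"
  assumes finV: "finite V" and finJ: "finite (J p)"
    and Q_I2: "(\<Sum>j\<in>J 1. Cst (\<alpha> j) * Q j) \<in> I2"
    and inj1: "(\<Sum>j\<in>J 1. Cst (\<alpha> j) * Q j) = 0 \<Longrightarrow> j \<in> J 1 \<Longrightarrow> \<alpha> j = 0"
    and injS: "1 \<le> p \<Longrightarrow> (\<And>i v. i \<in> J p \<Longrightarrow> v \<in> V \<Longrightarrow> (\<Sum>j\<in>J (p + 1). \<alpha> j * Dc p j i v) = 0) \<Longrightarrow>
      j \<in> J (p + 1) \<Longrightarrow> \<alpha> j = 0"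
    and rel: "1 \<le> p \<Longrightarrow> j \<in> J (p + 2) \<Longrightarrow> i \<in> J p \<Longrightarrow>
      (\<Sum>m\<in>J (p + 1). Dc (p + 1) j m v * Dc p m i w) = - (\<Sum>m\<in>J (p + 1). Dc (p + 1) j m w * Dc p m i v)"
    and rel_same: "1 \<le> p \<Longrightarrow> j \<in> J (p + 2) \<Longrightarrow> i \<in> J p \<Longrightarrow> (\<Sum>m\<in>J (p + 1). Dc (p + 1) j m v * Dc p m i v) = 0"
    and rel1: "j \<in> J 2 \<Longrightarrow> (\<Sum>v\<in>V. Var v * (\<Sum>m\<in>J 1. Cst (Dc 1 j m v) * Q m)) = 0"
    and surj1: "q \<in> I2 \<Longrightarrow> \<exists>\<alpha>. q = (\<Sum>j\<in>J 1. Cst (\<alpha> j) * Q j)"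
    and surj2: "(\<Sum>v\<in>V. Var v * (\<Sum>m\<in>J 1. Cst (\<beta> v m) * Q m)) = 0 \<Longrightarrow>
      \<exists>\<alpha>. \<forall>v\<in>V. \<forall>i\<in>J 1. \<beta> v i = (\<Sum>j\<in>J 2. \<alpha> j * Dc 1 j i v)"
    and surjS: "1 \<le> p \<Longrightarrow>
      (\<And>i v w. i \<in> J p \<Longrightarrow> v \<in> V \<Longrightarrow> w \<in> V \<Longrightarrow>
        (\<Sum>m\<in>J (p + 1). \<beta> v m * Dc p m i w) = - (\<Sum>m\<in>J (p + 1). \<beta> w m * Dc p m i v)) \<Longrightarrow>
      (\<And>i v. i \<in> J p \<Longrightarrow> v \<in> V \<Longrightarrow> (\<Sum>m\<in>J (p + 1). \<beta> v m * Dc p m i v) = 0) \<Longrightarrow>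
      \<exists>\<alpha>. \<forall>v\<in>V. \<forall>i\<in>J (p + 1). \<beta> v i = (\<Sum>j\<in>J (p + 2). \<alpha> j * Dc (p + 1) j i v)"
begin

text \<open>Following the linear coefficients of the differentials along \<open>A\<close> leads from
  generator \<open>j\<close> down to a quadric. These families identify the span of
  \<open>J p\<close> with the alternating families of \<open>p - 1\<close> entries and values in
  \<open>I2\<close> that satisfy the Koszul condition; see \<open>comb_inj\<close> and
  \<open>comb_surj\<close>.\<close>

fun ts :: "'v list \<Rightarrow> nat \<Rightarrow> ('v \<Rightarrow>\<^sub>0 nat) \<Rightarrow>\<^sub>0 'k" where
  "ts [] j = Q j"
| "ts (v # A) j = (\<Sum>i\<in>J (length A + 1). Cst (Dc (length A + 1) j i v) * ts A i)"

definition comb :: "nat \<Rightarrow> (nat \<Rightarrow> 'k) \<Rightarrow> 'v list \<Rightarrow> ('v \<Rightarrow>\<^sub>0 nat) \<Rightarrow>\<^sub>0 'k" where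
  "comb p \<alpha> A = (\<Sum>j\<in>J p. Cst (\<alpha> j) * ts A j)"

lemma comb_Cons:
  "comb (length A + 2) \<alpha> (v # A)
    = comb (length A + 1) (\<lambda>i. \<Sum>j\<in>J (length A + 2). \<alpha> j * Dc (length A + 1) j i v) A"
  unfolding comb_def
  by (simp add: Cst_sum sum_distrib_left sum_distrib_right mult.assoc) (rule sum.swap)

lemma comb_linear: "comb p (\<lambda>j. x * \<alpha> j + y * \<beta> j) A = Cst x * comb p \<alpha> A + Cst y * comb p \<beta> A"
  unfolding comb_def by (simp add: sum_distrib_left sum.distrib algebra_simps)

lemma ts_two:
  "ts (u # v # ys) j = (\<Sum>i\<in>J (length ys + 1).
     Cst (\<Sum>m\<in>J (length ys + 2). Dc (length ys + 2) j m u * Dc (length ys + 1) m i v) * ts ys i)"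
  by (simp add: Cst_sum sum_distrib_left sum_distrib_right mult.assoc numeral_2_eq_2) (rule sum.swap)

lemma ts_alternating:
  "j \<in> J (length (xs @ u # v # ys) + 1) \<Longrightarrow> ts (xs @ u # v # ys) j = - ts (xs @ v # u # ys) j"
  "j \<in> J (length (xs @ u # u # ys) + 1) \<Longrightarrow> ts (xs @ u # u # ys) j = 0"
proof (induction xs arbitrary: j)
  case Nil
  { case 1
    then have j: "j \<in> J (length ys + 1 + 2)" by (simp add: numeral_eq_Suc)
    show ?case unfolding append_Nil ts_two sum_negf[symmetric]
    proof (intro sum.cong refl)
      fix i assume i: "i \<in> J (length ys + 1)"
      have *: "length ys + 1 + 1 = length ys + 2" by simp
      show "Cst (\<Sum>m\<in>J (length ys + 2). Dc (length ys + 2) j m u * Dc (length ys + 1) m i v) * ts ys i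
        = - (Cst (\<Sum>m\<in>J (length ys + 2). Dc (length ys + 2) j m v * Dc (length ys + 1) m i u) * ts ys i)"
        using rel[OF _ j i, of u v] unfolding * by simp
    qed }
  { case 2
    then have j: "j \<in> J (length ys + 1 + 2)" by (simp add: numeral_eq_Suc)
    show ?case unfolding append_Nil ts_two
    proof (intro sum.neutral ballI)
      fix i assume i: "i \<in> J (length ys + 1)"
      have *: "length ys + 1 + 1 = length ys + 2" by simp
      show "Cst (\<Sum>m\<in>J (length ys + 2). Dc (length ys + 2) j m u * Dc (length ys + 1) m i u) * ts ys i = 0"
        using rel_same[OF _ j i, of u] unfolding * by simp
    qed }
next
  case (Cons x xs)
  { case 1
    show ?case unfolding append_Cons ts.simps sum_negf[symmetric]
      by (rule sum.cong) (use Cons.IH(1) in \<open>simp_all\<close>) }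
  { case 2
    show ?case unfolding append_Cons ts.simps
      by (rule sum.neutral) (use Cons.IH(2) in \<open>simp\<close>) }
qed

lemma comb_I2: "comb (length A + 1) \<alpha> A \<in> I2"
proof (induction A arbitrary: \<alpha>)
  case Nil then show ?case unfolding comb_def using Q_I2 by simp
next
  case (Cons v A)
  then show ?case using comb_Cons[of A \<alpha> v] by simp
qed

lemma ts_cycle: "j \<in> J (length A + 2) \<Longrightarrow> (\<Sum>v\<in>V. Var v * ts (A @ [v]) j) = 0"
proof (induction A arbitrary: j)
  case Nil then show ?case using rel1[of j] by (simp add: numeral_2_eq_2)
next
  case (Cons x A)
  have "(\<Sum>v\<in>V. Var v * ts ((x # A) @ [v]) j)
      = (\<Sum>i\<in>J (length A + 2). Cst (Dc (length A + 2) j i x) * (\<Sum>v\<in>V. Var v * ts (A @ [v]) i))"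
    by (simp add: sum_distrib_left mult.left_commute) (rule sum.swap)
  also have "\<dots> = 0" using Cons.IH by simp
  finally show ?case .
qed

lemma comb_inj:
  "(\<And>A. set A \<subseteq> V \<Longrightarrow> length A = n \<Longrightarrow> comb (n + 1) \<alpha> A = 0) \<Longrightarrow> j \<in> J (n + 1) \<Longrightarrow> \<alpha> j = 0"
proof (induction n arbitrary: \<alpha> j)
  case 0
  then show ?case using inj1[of \<alpha> j] 0(1)[of "[]"] unfolding comb_def by simp
next
  case (Suc n)
  have z: "(\<Sum>j\<in>J (n + 1 + 1). \<alpha> j * Dc (n + 1) j i v) = 0" if v: "v \<in> V" and i: "i \<in> J (n + 1)" for i v
  proof (rule Suc.IH[OF _ i])
    fix A assume A: "set A \<subseteq> V" "length A = n"
    show "comb (n + 1) (\<lambda>i. \<Sum>j\<in>J (n + 1 + 1). \<alpha> j * Dc (n + 1) j i v) A = 0"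
      using comb_Cons[of A \<alpha> v] Suc.prems(1)[of "v # A"] A v by simp
  qed
  show ?case by (rule injS[of "n + 1"]) (use z Suc.prems(2) in auto)
qed

text \<open>Fixing the first entry \<open>v\<close> gives, by induction, coefficients
  \<open>\<beta> v\<close> one step lower. Alternation of \<open>t\<close> in its first two entries,
  read back through \<open>comb_inj\<close>, is what \<open>surjS\<close> requires of
  \<open>\<beta>\<close>; with a single entry the Koszul condition feeds
  \<open>surj2\<close>.\<close>

lemma comb_surj:
  assumes "alternating t" "\<And>A. set A \<subseteq> V \<Longrightarrow> length A = n \<Longrightarrow> t A \<in> I2"
    and "\<And>A. set A \<subseteq> V \<Longrightarrow> length A + 1 = n \<Longrightarrow> (\<Sum>v\<in>V. Var v * t (A @ [v])) = 0"
  shows "\<exists>\<alpha>. \<forall>A. set A \<subseteq> V \<longrightarrow> length A = n \<longrightarrow> comb (n + 1) \<alpha> A = t A"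
  using assms
proof (induction n arbitrary: t)
  case 0
  obtain \<alpha> where "t [] = (\<Sum>j\<in>J 1. Cst (\<alpha> j) * Q j)" using surj1 0(2)[of "[]"] by auto
  then show ?case unfolding comb_def by (intro exI[of _ \<alpha>]) simp
next
  case (Suc n)
  have "\<exists>\<alpha>. \<forall>A. set A \<subseteq> V \<longrightarrow> length A = n \<longrightarrow> comb (n + 1) \<alpha> A = t (v # A)" if v: "v \<in> V" for v
  proof (rule Suc.IH)
    show "alternating (\<lambda>A. t (v # A))" by (rule alternating_Cons[OF Suc.prems(1)])
    show "t (v # A) \<in> I2" if "set A \<subseteq> V" "length A = n" for A using Suc.prems(2)[of "v # A"] that v by simp
    show "(\<Sum>w\<in>V. Var w * t (v # A @ [w])) = 0" if "set A \<subseteq> V" "length A + 1 = n" for A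
      using Suc.prems(3)[of "v # A"] that v by simp
  qed
  then obtain \<beta> where \<beta>: "\<And>v A. v \<in> V \<Longrightarrow> set A \<subseteq> V \<Longrightarrow> length A = n \<Longrightarrow> comb (n + 1) (\<beta> v) A = t (v # A)"
    by metis
  have "\<exists>\<alpha>. \<forall>v\<in>V. \<forall>i\<in>J (n + 1). \<beta> v i = (\<Sum>j\<in>J (n + 2). \<alpha> j * Dc (n + 1) j i v)"
  proof (cases n)
    case 0
    have "(\<Sum>v\<in>V. Var v * (\<Sum>m\<in>J 1. Cst (\<beta> v m) * Q m)) = (\<Sum>v\<in>V. Var v * t ([] @ [v]))"
      by (intro sum.cong refl) (use \<beta>[of _ "[]"] 0 in \<open>simp add: comb_def\<close>)
    also have "\<dots> = 0" by (rule Suc.prems(3)) (simp_all add: 0)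
    finally show ?thesis using surj2[of \<beta>] unfolding 0 by (simp add: numeral_2_eq_2)
  next
    case (Suc k)
    let ?\<delta> = "\<lambda>v w i. \<Sum>m\<in>J (k + 1 + 1). \<beta> v m * Dc (k + 1) m i w"
    have c: "comb (k + 1) (?\<delta> v w) A = t (v # w # A)"
      if "v \<in> V" "w \<in> V" "set A \<subseteq> V" "length A = k" for v w A
      using comb_Cons[of A "\<beta> v" w] \<beta>[of v "w # A"] that Suc by simp
    have s1: "?\<delta> v w i = - ?\<delta> w v i" if "i \<in> J (k + 1)" "v \<in> V" "w \<in> V" for i v w
    proof -
      have "1 * ?\<delta> v w i + 1 * ?\<delta> w v i = 0"
      proof (rule comb_inj[OF _ that(1)])
        fix A assume A: "set A \<subseteq> V" "length A = k"
        show "comb (k + 1) (\<lambda>i. 1 * ?\<delta> v w i + 1 * ?\<delta> w v i) A = 0"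
          unfolding comb_linear c[OF that(2,3) A] c[OF that(3,2) A]
          using alternating_swap0[OF Suc.prems(1), of v w A] by simp
      qed
      then show ?thesis by (simp add: eq_neg_iff_add_eq_0)
    qed
    have s2: "?\<delta> v v i = 0" if "i \<in> J (k + 1)" "v \<in> V" for i v
    proof (rule comb_inj[OF _ that(1)])
      fix A assume A: "set A \<subseteq> V" "length A = k"
      show "comb (k + 1) (?\<delta> v v) A = 0"
        unfolding c[OF that(2,2) A] by (rule alternating_same0[OF Suc.prems(1)])
    qed
    have "\<exists>\<alpha>. \<forall>v\<in>V. \<forall>i\<in>J (k + 1 + 1). \<beta> v i = (\<Sum>j\<in>J (k + 1 + 2). \<alpha> j * Dc (k + 1 + 1) j i v)"
      by (rule surjS[of "k + 1" \<beta>, OF _ s1 s2]) simp_all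
    then show ?thesis unfolding Suc by simp
  qed
  then obtain \<alpha> where \<alpha>: "\<And>v i. v \<in> V \<Longrightarrow> i \<in> J (n + 1) \<Longrightarrow> \<beta> v i = (\<Sum>j\<in>J (n + 2). \<alpha> j * Dc (n + 1) j i v)"
    by blast
  have "comb (Suc n + 1) \<alpha> A = t A" if A: "set A \<subseteq> V" "length A = Suc n" for A
  proof -
    obtain v B where B: "A = v # B" "v \<in> V" "set B \<subseteq> V" "length B = n" using A by (cases A) auto
    have "comb (n + 2) \<alpha> (v # B) = comb (n + 1) (\<beta> v) B"
      using comb_Cons[of B \<alpha> v] B(4) \<alpha>[OF B(2)] unfolding comb_def by simp
    then show ?thesis using \<beta>[OF B(2-4)] B(1) by simp
  qed
  then show ?case by blast
qed

end

section \<open>The linear strand of a minimal resolution\<close>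

definition unit_vec :: "nat \<Rightarrow> nat \<Rightarrow> ('v \<Rightarrow>\<^sub>0 nat) \<Rightarrow>\<^sub>0 'k::field" where
  "unit_vec j = (\<lambda>i. if i = j then 1 else 0)"

abbreviation PR :: "'v set \<Rightarrow> (('v \<Rightarrow>\<^sub>0 nat) \<Rightarrow>\<^sub>0 'k::field) set" where
  "PR V \<equiv> carrier (poly_ring V)"

lemma PR_iff: "f \<in> PR V \<longleftrightarrow> (\<forall>m \<in> Poly_Mapping.keys f. Poly_Mapping.keys m \<subseteq> V)"
  by (simp add: poly_ring_def)

lemma PR_zero [simp]: "0 \<in> PR V"
  unfolding PR_iff by simp

lemma PR_Cst [simp]: "Cst x \<in> PR V"
  unfolding PR_iff Cst_def by simp

lemma PR_one [simp]: "1 \<in> PR V"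
  using PR_Cst[of 1 V] by simp

lemma PR_Var: "v \<in> V \<Longrightarrow> Var v \<in> PR V"
  unfolding PR_iff Var_def by simp

lemma PR_add: "f \<in> PR V \<Longrightarrow> g \<in> PR V \<Longrightarrow> f + g \<in> PR V"
  unfolding PR_iff using keys_add[of f g] by blast

lemma PR_uminus: "f \<in> PR V \<Longrightarrow> - f \<in> PR V"
  unfolding PR_iff by simp

lemma PR_mult: "f \<in> PR V \<Longrightarrow> g \<in> PR V \<Longrightarrow> f * g \<in> PR V"
  unfolding PR_iff
proof
  fix m assume fg: "\<forall>m\<in>Poly_Mapping.keys f. Poly_Mapping.keys m \<subseteq> V"
    "\<forall>m\<in>Poly_Mapping.keys g. Poly_Mapping.keys m \<subseteq> V" "m \<in> Poly_Mapping.keys (f * g)"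
  then obtain k l where "k \<in> Poly_Mapping.keys f" "l \<in> Poly_Mapping.keys g" "m = k + l"
    using subsetD[OF keys_mult fg(3)] by blast
  then show "Poly_Mapping.keys m \<subseteq> V" using fg by (auto simp: keys_add_nat)
qed

lemma PR_sum: "(\<And>i. i \<in> I \<Longrightarrow> f i \<in> PR V) \<Longrightarrow> (\<Sum>i\<in>I. f i) \<in> PR V"
  by (induction I rule: infinite_finite_induct) (auto intro: PR_add)

lemma component_PR: "f \<in> poly_component V n \<Longrightarrow> f \<in> PR V"
  unfolding poly_component_def by blast

text \<open>Exactness yields preimages that need not be homogeneous. In the lowest degree only their
  constant terms count, so they need not be split into components.\<close>

lemma lookup_mult_low:
  fixes f g :: "('v \<Rightarrow>\<^sub>0 nat) \<Rightarrow>\<^sub>0 'k::field"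
  assumes g: "g \<in> poly_component V n" and m: "int (mono_degree m) \<le> n"
  shows "Poly_Mapping.lookup (f * g) m = Poly_Mapping.lookup f 0 * Poly_Mapping.lookup g m"
proof -
  let ?s = "\<lambda>k. Poly_Mapping.single k (Poly_Mapping.lookup f k)"
  have "f * g = (\<Sum>k\<in>Poly_Mapping.keys f. ?s k * g)"
    by (subst (1) poly_mapping_sum_singles[of f]) (simp add: sum_distrib_right)
  then have "Poly_Mapping.lookup (f * g) m = (\<Sum>k\<in>Poly_Mapping.keys f. Poly_Mapping.lookup (?s k * g) m)"
    by (simp add: lookup_sum)
  also have "\<dots> = (\<Sum>k\<in>Poly_Mapping.keys f. if k = 0 then Poly_Mapping.lookup f 0 * Poly_Mapping.lookup g m else 0)"
  proof (rule sum.cong)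
    fix k
    show "Poly_Mapping.lookup (?s k * g) m = (if k = 0 then Poly_Mapping.lookup f 0 * Poly_Mapping.lookup g m else 0)"
    proof (cases "k = 0")
      case True
      then show ?thesis using lookup_single_mult_add[of 0 "Poly_Mapping.lookup f 0" g m] by simp
    next
      case False
      have "k + l \<noteq> m" if "l \<in> Poly_Mapping.keys g" for l
      proof
        assume "k + l = m"
        then have "mono_degree m = mono_degree k + mono_degree l" using mono_degree_add by blast
        moreover have "int (mono_degree l) = n" using poly_componentD[OF g, of l] that by (simp add: in_keys_iff)
        ultimately show False using m False mono_degree_0_iff[of k] by simp
      qed
      then show ?thesis unfolding lookup_single_mult using False by (auto intro!: sum.neutral)
    qed
  qed simp
  also have "\<dots> = Poly_Mapping.lookup f 0 * Poly_Mapping.lookup g m"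
    by (cases "0 \<in> Poly_Mapping.keys f") (simp_all add: sum.delta in_keys_iff)
  finally show ?thesis .
qed

lemma component_nonpos_zero:
  assumes "f \<in> poly_component V n" "n \<le> 0" "Poly_Mapping.lookup f 0 = 0"
  shows "f = 0"
proof (rule poly_mapping_eqI)
  fix m
  show "Poly_Mapping.lookup f m = Poly_Mapping.lookup 0 m"
  proof (rule ccontr)
    assume "Poly_Mapping.lookup f m \<noteq> Poly_Mapping.lookup 0 m"
    then have nz: "Poly_Mapping.lookup f m \<noteq> 0" by simp
    then have "int (mono_degree m) \<le> 0" using poly_componentD[OF assms(1) nz] assms(2) by simp
    then show False using assms(3) nz mono_degree_0_iff[of m] by simp
  qed
qed

lemma component_one_sum:
  fixes f :: "('v \<Rightarrow>\<^sub>0 nat) \<Rightarrow>\<^sub>0 'k::field"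
  assumes fin: "finite V" and f: "f \<in> poly_component V 1"
  shows "f = (\<Sum>v\<in>V. Cst (Poly_Mapping.lookup f (var1 v)) * Var v)"
proof (rule poly_mapping_eqI)
  fix m
  have e: "Cst x * Var v = Poly_Mapping.single (var1 v) x" for x :: 'k and v :: 'v
    unfolding Cst_def Var_def by (simp add: mult_single)
  have inj: "var1 v = var1 w \<longleftrightarrow> v = w" for v w :: 'v
    by (metis keys_single one_neq_zero singleton_inject)
  show "Poly_Mapping.lookup f m = Poly_Mapping.lookup (\<Sum>v\<in>V. Cst (Poly_Mapping.lookup f (var1 v)) * Var v) m"
  proof (cases "\<exists>w\<in>V. m = var1 w")
    case True
    then obtain w where w: "w \<in> V" "m = var1 w" by blast
    have "Poly_Mapping.lookup (\<Sum>v\<in>V. Cst (Poly_Mapping.lookup f (var1 v)) * Var v) m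
        = (\<Sum>v\<in>V. if v = w then Poly_Mapping.lookup f (var1 w) else 0)"
      unfolding e lookup_sum lookup_single when_def w(2) inj by (intro sum.cong) auto
    then show ?thesis using w fin by simp
  next
    case False
    have "Poly_Mapping.lookup f m = 0"
    proof (rule ccontr)
      assume nz: "Poly_Mapping.lookup f m \<noteq> 0"
      have k: "Poly_Mapping.keys m \<subseteq> V" and "mono_degree m = Suc 0" using poly_componentD[OF f nz] by auto
      then obtain v m' where v: "m = var1 v + m'" "mono_degree m' = 0" "v \<in> Poly_Mapping.keys m"
        using mono_degree_Suc by blast
      then show False using False k mono_degree_0_iff[of m'] by auto
    qed
    moreover have "Poly_Mapping.lookup (\<Sum>v\<in>V. Cst (Poly_Mapping.lookup f (var1 v)) * Var v) m = 0"
      unfolding e lookup_sum lookup_single when_def using False by (intro sum.neutral) auto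
    ultimately show ?thesis by simp
  qed
qed

subsection \<open>The coordinate ring\<close>

definition wt :: "(nat \<times> nat \<Rightarrow>\<^sub>0 nat) \<Rightarrow> nat \<times> nat \<times> nat" where
  "wt m = (\<Sum>v\<in>Poly_Mapping.keys m. (Poly_Mapping.lookup m v, Poly_Mapping.lookup m v * fst v, Poly_Mapping.lookup m v * snd v))"

lemma wt_add: "wt (m + n) = wt m + wt n"
proof -
  let ?K = "Poly_Mapping.keys m \<union> Poly_Mapping.keys n"
  have e: "wt k = (\<Sum>v\<in>?K. (Poly_Mapping.lookup k v, Poly_Mapping.lookup k v * fst v, Poly_Mapping.lookup k v * snd v))"
    if "Poly_Mapping.keys k \<subseteq> ?K" for k
    unfolding wt_def using that by (intro sum.mono_neutral_left) (auto simp: in_keys_iff zero_prod_def)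
  show ?thesis unfolding e[OF keys_add] e[of m, OF Un_upper1] e[of n, OF Un_upper2]
    by (simp add: sum.distrib[symmetric] lookup_add algebra_simps)
qed

lemma wt_zero [simp]: "wt 0 = 0"
  by (simp add: wt_def)

lemma wt_var1: "wt (var1 v) = (1, fst v, snd v)"
proof -
  have k: "Poly_Mapping.keys (var1 v) = {v}" by simp
  show ?thesis unfolding wt_def k by simp
qed

lemma fst_wt: "fst (wt m) = mono_degree m"
  unfolding wt_def mono_degree_def by (simp add: fst_sum)

lemma coord_eval_eq:
  fixes f :: "(nat \<times> nat \<Rightarrow>\<^sub>0 nat) \<Rightarrow>\<^sub>0 'a::field"
  shows "coord_eval f = (\<Sum>m\<in>Poly_Mapping.keys f. Poly_Mapping.single (wt m) (Poly_Mapping.lookup f m))"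
proof -
  have pw: "coord_basis n i j ^ k = (Poly_Mapping.single (k * n, k * i, k * j) 1 :: _ \<Rightarrow>\<^sub>0 'a)" for n i j k
    unfolding coord_basis_def by (induction k) (simp_all add: mult_single zero_prod_def[symmetric] flip: single_one)
  have "(\<Prod>v\<in>K. Poly_Mapping.single (g v) 1) = (Poly_Mapping.single (\<Sum>v\<in>K. g v) 1 :: (nat \<times> nat \<times> nat) \<Rightarrow>\<^sub>0 'a)"
    for K and g :: "nat \<times> nat \<Rightarrow> nat \<times> nat \<times> nat"
    by (induction K rule: infinite_finite_induct) (simp_all add: mult_single flip: single_one)
  then show ?thesis unfolding coord_eval_def pw wt_def by (simp add: mult_single)
qed

lemma lookup_coord_eval:
  "Poly_Mapping.lookup (coord_eval f) z = (\<Sum>m\<in>Poly_Mapping.keys f. if wt m = z then Poly_Mapping.lookup f m else 0)"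
  unfolding coord_eval_eq by (simp add: lookup_sum lookup_single when_def)

lemma coord_eval_single: "coord_eval (Poly_Mapping.single m x) = Poly_Mapping.single (wt m) x"
  unfolding coord_eval_eq by (cases "x = 0") simp_all

lemma coord_eval_superset:
  assumes "finite K" "Poly_Mapping.keys f \<subseteq> K"
  shows "coord_eval f = (\<Sum>m\<in>K. Poly_Mapping.single (wt m) (Poly_Mapping.lookup f m))"
  unfolding coord_eval_eq using assms by (intro sum.mono_neutral_left) (auto simp: in_keys_iff)

lemma coord_eval_add: "coord_eval (f + g) = coord_eval f + coord_eval g"
proof -
  let ?K = "Poly_Mapping.keys f \<union> Poly_Mapping.keys g"
  have "coord_eval h = (\<Sum>m\<in>?K. Poly_Mapping.single (wt m) (Poly_Mapping.lookup h m))"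
    if "Poly_Mapping.keys h \<subseteq> ?K" for h using that by (intro coord_eval_superset) auto
  note e = this
  show ?thesis unfolding e[OF keys_add] e[of f, OF Un_upper1] e[of g, OF Un_upper2]
    by (simp add: lookup_add single_add sum.distrib)
qed

lemma coord_eval_uminus: "coord_eval (- f) = - coord_eval f"
  unfolding coord_eval_eq by (simp add: single_uminus sum_negf)

lemma coord_eval_sum:
  fixes f :: "'i \<Rightarrow> (nat \<times> nat \<Rightarrow>\<^sub>0 nat) \<Rightarrow>\<^sub>0 'a::field"
  shows "coord_eval (\<Sum>i\<in>I. f i) = (\<Sum>i\<in>I. coord_eval (f i))"
proof -
  have "coord_eval (0 :: (nat \<times> nat \<Rightarrow>\<^sub>0 nat) \<Rightarrow>\<^sub>0 'a::field) = 0" by (simp add: coord_eval_eq)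
  then show ?thesis by (induction I rule: infinite_finite_induct) (simp_all add: coord_eval_add)
qed

text \<open>Greedy choice: each factor takes as much of \<open>i\<close> and of \<open>j\<close> as
  the grid allows.\<close>

lemma monomial_of_weight:
  assumes "i \<le> n * a" "j \<le> n * b"
  shows "\<exists>m. Poly_Mapping.keys m \<subseteq> grid a b \<and> wt m = (n, i, j)"
  using assms
proof (induction n arbitrary: i j)
  case 0 then show ?case by (intro exI[of _ 0]) (simp add: zero_prod_def)
next
  case (Suc n)
  let ?v = "(min i a, min j b)"
  have "i - min i a \<le> n * a" "j - min j b \<le> n * b" using Suc.prems by auto
  from Suc.IH[OF this] obtain m where m: "Poly_Mapping.keys m \<subseteq> grid a b"
    "wt m = (n, i - min i a, j - min j b)" by blast
  have "Poly_Mapping.keys (var1 ?v + m) \<subseteq> grid a b" unfolding keys_add_nat using m(1) by (auto simp: grid_def)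
  moreover have "wt (var1 ?v + m) = (Suc n, i, j)" unfolding wt_add m(2) wt_var1 by simp
  ultimately show ?case by blast
qed

lemma coord_eval_surj:
  assumes "r \<in> carrier (coord_ring a b)"
  shows "\<exists>s\<in>PR (grid a b). coord_eval s = r"
proof -
  have "\<exists>m. Poly_Mapping.keys m \<subseteq> grid a b \<and> wt m = z" if "z \<in> Poly_Mapping.keys r" for z
  proof -
    obtain n i j where z: "z = (n, i, j)" by (cases z) auto
    then have "i \<le> n * a \<and> j \<le> n * b" using assms that unfolding coord_ring_def by (auto simp: Let_def)
    then show ?thesis using monomial_of_weight[of i n a j b] z by blast
  qed
  then obtain \<mu> where \<mu>: "\<And>z. z \<in> Poly_Mapping.keys r \<Longrightarrow> Poly_Mapping.keys (\<mu> z) \<subseteq> grid a b \<and> wt (\<mu> z) = z" by metis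
  define s where "s = (\<Sum>z\<in>Poly_Mapping.keys r. Poly_Mapping.single (\<mu> z) (Poly_Mapping.lookup r z))"
  have "s \<in> PR (grid a b)" unfolding s_def by (rule PR_sum) (use \<mu> in \<open>simp add: PR_iff\<close>)
  moreover have "coord_eval s = r"
    unfolding s_def coord_eval_sum coord_eval_single
    by (subst (3) poly_mapping_sum_singles[of r]) (intro sum.cong refl, use \<mu> in simp)
  ultimately show ?thesis by blast
qed

text \<open>Distinct variables have distinct weights, so the images of the variables are distinct
  basis elements.\<close>

lemma coord_eval_linear_inj:
  assumes f: "f \<in> poly_component V 1" and z: "coord_eval f = 0"
  shows "f = 0"
proof (rule poly_mapping_eqI)
  fix m
  show "Poly_Mapping.lookup f m = Poly_Mapping.lookup 0 m"
  proof (rule ccontr)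
    assume "Poly_Mapping.lookup f m \<noteq> Poly_Mapping.lookup 0 m"
    then have nz: "Poly_Mapping.lookup f m \<noteq> 0" by simp
    have one: "\<exists>v. n = var1 v" if "Poly_Mapping.lookup f n \<noteq> 0" for n
    proof -
      have "mono_degree n = Suc 0" using poly_componentD[OF f that] by simp
      then obtain v n' where v: "n = var1 v + n'" "mono_degree n' = 0" using mono_degree_Suc by blast
      then have "n' = 0" using mono_degree_0_iff[of n'] by blast
      then have "n = var1 v" using v(1) by simp
      then show ?thesis by blast
    qed
    have "0 = Poly_Mapping.lookup (coord_eval f) (wt m)" using z by simp
    also have "\<dots> = (\<Sum>n\<in>Poly_Mapping.keys f. if n = m then Poly_Mapping.lookup f m else 0)"
      unfolding lookup_coord_eval
    proof (rule sum.cong)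
      fix n assume "n \<in> Poly_Mapping.keys f"
      then obtain v w where vw: "n = var1 v" "m = var1 w" using one nz by (metis in_keys_iff)
      have inj: "var1 v = var1 w \<longleftrightarrow> v = w" by (metis keys_single one_neq_zero singleton_inject)
      show "(if wt n = wt m then Poly_Mapping.lookup f n else 0) = (if n = m then Poly_Mapping.lookup f m else 0)"
      proof (cases "v = w")
        case True then show ?thesis unfolding vw by simp
      next
        case False
        then have "wt n \<noteq> wt m" "n \<noteq> m" unfolding vw wt_var1 inj by (auto simp: prod_eq_iff)
        then show ?thesis by simp
      qed
    qed simp
    also have "\<dots> = Poly_Mapping.lookup f m" using nz by (simp add: in_keys_iff)
    finally show False using nz by simp
  qed
qed

lemma lookup_mult_0:
  fixes f g :: "('v \<Rightarrow>\<^sub>0 nat) \<Rightarrow>\<^sub>0 'k::field"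
  shows "Poly_Mapping.lookup (f * g) 0 = Poly_Mapping.lookup f 0 * Poly_Mapping.lookup g 0"
proof -
  let ?s = "\<lambda>k. Poly_Mapping.single k (Poly_Mapping.lookup f k)"
  have "f * g = (\<Sum>k\<in>Poly_Mapping.keys f. ?s k * g)"
    by (subst (1) poly_mapping_sum_singles[of f]) (simp add: sum_distrib_right)
  then have "Poly_Mapping.lookup (f * g) 0 = (\<Sum>k\<in>Poly_Mapping.keys f. Poly_Mapping.lookup (?s k * g) 0)"
    by (simp add: lookup_sum)
  also have "\<dots> = (\<Sum>k\<in>Poly_Mapping.keys f. if k = 0 then Poly_Mapping.lookup f 0 * Poly_Mapping.lookup g 0 else 0)"
  proof (rule sum.cong)
    fix k
    show "Poly_Mapping.lookup (?s k * g) 0 = (if k = 0 then Poly_Mapping.lookup f 0 * Poly_Mapping.lookup g 0 else 0)"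
    proof (cases "k = 0")
      case True
      then show ?thesis using lookup_single_mult_add[of 0 "Poly_Mapping.lookup f 0" g 0] by simp
    next
      case False
      have "0 \<noteq> k + l" for l
      proof
        assume "0 = k + l"
        then have "mono_degree k + mono_degree l = 0" by (metis mono_degree_add mono_degree_zero)
        then show False using False mono_degree_0_iff by auto
      qed
      from lookup_single_mult_not[OF this] show ?thesis using False by simp
    qed
  qed simp
  also have "\<dots> = Poly_Mapping.lookup f 0 * Poly_Mapping.lookup g 0"
    by (cases "0 \<in> Poly_Mapping.keys f") (simp_all add: sum.delta in_keys_iff)
  finally show ?thesis .
qed

lemma graded_homD:
  assumes "h \<in> graded_hom R M N"
  shows "x \<in> carrier M \<Longrightarrow> h x \<in> carrier N"
    and "x \<in> carrier M \<Longrightarrow> y \<in> carrier M \<Longrightarrow> h (x \<oplus>\<^bsub>M\<^esub> y) = h x \<oplus>\<^bsub>N\<^esub> h y"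
    and "r \<in> carrier R \<Longrightarrow> x \<in> carrier M \<Longrightarrow> h (r \<odot>\<^bsub>M\<^esub> x) = r \<odot>\<^bsub>N\<^esub> h x"
    and "x \<in> component M n \<Longrightarrow> h x \<in> component N n"
  using assms unfolding graded_hom_def by (auto simp: Pi_iff image_subset_iff)

section \<open>Generator degrees and linear strand of the given resolution\<close>

locale resolution =
  fixes a b :: nat and e :: "nat \<Rightarrow> int list"
    and d :: "nat \<Rightarrow> (nat \<Rightarrow> (nat \<times> nat \<Rightarrow>\<^sub>0 nat) \<Rightarrow>\<^sub>0 'k::field) \<Rightarrow> (nat \<Rightarrow> (nat \<times> nat \<Rightarrow>\<^sub>0 nat) \<Rightarrow>\<^sub>0 'k)"
    and aug :: "(nat \<Rightarrow> (nat \<times> nat \<Rightarrow>\<^sub>0 nat) \<Rightarrow>\<^sub>0 'k) \<Rightarrow> ((nat \<times> nat \<times> nat) \<Rightarrow>\<^sub>0 'k)"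
  assumes res: "minimal_graded_free_resolution (grid a b) (coord_ring a b) e d aug"
begin

abbreviation V :: "(nat \<times> nat) set" where "V \<equiv> grid a b"

lemma finV: "finite V" by (simp add: grid_def)

definition car :: "nat \<Rightarrow> (nat \<Rightarrow> (nat \<times> nat \<Rightarrow>\<^sub>0 nat) \<Rightarrow>\<^sub>0 'k) set" where
  "car p = {x. (\<forall>j < length (e p). x j \<in> PR V) \<and> (\<forall>j \<ge> length (e p). x j = 0)}"

lemma carI: "(\<And>j. j < length (e p) \<Longrightarrow> x j \<in> PR V) \<Longrightarrow> (\<And>j. length (e p) \<le> j \<Longrightarrow> x j = 0) \<Longrightarrow> x \<in> car p"
  unfolding car_def by blast

lemma car_PR: "x \<in> car p \<Longrightarrow> x j \<in> PR V"
  unfolding car_def by (cases "j < length (e p)") auto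

lemma car_out: "x \<in> car p \<Longrightarrow> length (e p) \<le> j \<Longrightarrow> x j = 0"
  unfolding car_def by blast

lemmas res_parts = res[unfolded minimal_graded_free_resolution_def Let_def, THEN conjunct2]
lemmas res_aug = res_parts[THEN conjunct1]
lemmas res_d = res_parts[THEN conjunct2, THEN conjunct1, THEN spec]
lemmas res_surj = res_parts[THEN conjunct2, THEN conjunct2, THEN conjunct1]
lemmas res_ker0 = res_parts[THEN conjunct2, THEN conjunct2, THEN conjunct2, THEN conjunct1]
lemmas res_kerS = res_parts[THEN conjunct2, THEN conjunct2, THEN conjunct2, THEN conjunct2, THEN conjunct1, THEN spec]
lemmas res_min = res_parts[THEN conjunct2, THEN conjunct2, THEN conjunct2, THEN conjunct2, THEN conjunct2, THEN spec]

lemma free_module_simps: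
  shows free_carrier: "carrier (free_module V (e q)) = (car q :: (nat \<Rightarrow> (nat \<times> nat \<Rightarrow>\<^sub>0 nat) \<Rightarrow>\<^sub>0 'k) set)"
    and free_zero: "\<zero>\<^bsub>free_module V (e q)\<^esub> = (\<lambda>_. 0 :: (nat \<times> nat \<Rightarrow>\<^sub>0 nat) \<Rightarrow>\<^sub>0 'k)"
    and free_add: "x \<oplus>\<^bsub>free_module V (e q)\<^esub> y = (\<lambda>j. x j + y j :: (nat \<times> nat \<Rightarrow>\<^sub>0 nat) \<Rightarrow>\<^sub>0 'k)"
    and free_smult: "f \<odot>\<^bsub>free_module V (e q)\<^esub> x = (\<lambda>j. f * x j :: (nat \<times> nat \<Rightarrow>\<^sub>0 nat) \<Rightarrow>\<^sub>0 'k)"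
  unfolding free_module_def car_def by simp_all

lemma coord_ring_simps:
  shows coord_zero: "\<zero>\<^bsub>coord_ring a b\<^esub> = (0 :: (nat \<times> nat \<times> nat) \<Rightarrow>\<^sub>0 'k)"
    and coord_add: "r \<oplus>\<^bsub>coord_ring a b\<^esub> r' = (r + r' :: (nat \<times> nat \<times> nat) \<Rightarrow>\<^sub>0 'k)"
    and coord_smult: "f \<odot>\<^bsub>coord_ring a b\<^esub> r = (coord_eval f * r :: (nat \<times> nat \<times> nat) \<Rightarrow>\<^sub>0 'k)"
  unfolding coord_ring_def Let_def by simp_all

lemma hom_d:
  shows d_car: "x \<in> car (Suc p) \<Longrightarrow> d p x \<in> car p"
    and d_add: "x \<in> car (Suc p) \<Longrightarrow> y \<in> car (Suc p) \<Longrightarrow> d p (\<lambda>j. x j + y j) = (\<lambda>j. d p x j + d p y j)"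
    and d_smult: "f \<in> PR V \<Longrightarrow> x \<in> car (Suc p) \<Longrightarrow> d p (\<lambda>j. f * x j) = (\<lambda>j. f * d p x j)"
    and d_comp: "x \<in> component (free_module V (e (Suc p))) n \<Longrightarrow> d p x \<in> component (free_module V (e p)) n"
  using graded_homD[OF res_d[of p]] unfolding free_module_simps by simp_all

lemma hom_aug:
  shows aug_car: "x \<in> car 0 \<Longrightarrow> aug x \<in> carrier (coord_ring a b)"
    and aug_add: "x \<in> car 0 \<Longrightarrow> y \<in> car 0 \<Longrightarrow> aug (\<lambda>j. x j + y j) = aug x + aug y"
    and aug_smult: "f \<in> PR V \<Longrightarrow> x \<in> car 0 \<Longrightarrow> aug (\<lambda>j. f * x j) = coord_eval f * aug x"
    and aug_comp: "x \<in> component (free_module V (e 0)) n \<Longrightarrow> aug x \<in> component (coord_ring a b) n"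
  using graded_homD[OF res_aug] unfolding free_module_simps coord_ring_simps by simp_all

lemma aug_surj: "r \<in> carrier (coord_ring a b) \<Longrightarrow> \<exists>x\<in>car 0. aug x = r"
  using res_surj unfolding free_module_simps by (metis imageE)

lemma kernels:
  shows ker0: "x \<in> car 0 \<Longrightarrow> aug x = 0 \<Longrightarrow> \<exists>u\<in>car 1. d 0 u = x"
    and im0: "u \<in> car 1 \<Longrightarrow> aug (d 0 u) = 0"
    and kerS: "x \<in> car (Suc p) \<Longrightarrow> d p x = (\<lambda>_. 0) \<Longrightarrow> \<exists>u\<in>car (Suc (Suc p)). d (Suc p) u = x"
    and imS: "u \<in> car (Suc (Suc p)) \<Longrightarrow> d p (d (Suc p) u) = (\<lambda>_. 0)"
    and minimal: "x \<in> car (Suc p) \<Longrightarrow> Poly_Mapping.lookup (d p x j) 0 = 0"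
proof -
  have k0: "d 0 ` car 1 = {x \<in> car 0. aug x = 0}"
    using res_ker0 unfolding a_kernel_def' free_module_simps coord_ring_simps .
  have kS: "d (Suc p) ` car (Suc (Suc p)) = {x \<in> car (Suc p). d p x = (\<lambda>_. 0)}" for p
    using res_kerS[of p] unfolding a_kernel_def' free_module_simps .
  have m: "\<forall>x \<in> car (Suc p). \<forall>j < length (e p). d p x j \<in> irrelevant_ideal V" for p
    using res_min[of p] unfolding free_module_simps .
  show "\<exists>u\<in>car 1. d 0 u = x" if "x \<in> car 0" "aug x = 0"
  proof -
    have "x \<in> d 0 ` car 1" unfolding k0 using that by simp
    then show ?thesis by auto
  qed
  show "aug (d 0 u) = 0" if "u \<in> car 1"
    using imageI[OF that, of "d 0"] unfolding k0 by simp
  show "\<exists>u\<in>car (Suc (Suc p)). d (Suc p) u = x" if "x \<in> car (Suc p)" "d p x = (\<lambda>_. 0)"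
  proof -
    have "x \<in> d (Suc p) ` car (Suc (Suc p))" unfolding kS using that by simp
    then show ?thesis by auto
  qed
  show "d p (d (Suc p) u) = (\<lambda>_. 0)" if "u \<in> car (Suc (Suc p))"
    using imageI[OF that, of "d (Suc p)"] unfolding kS by simp
  show "x \<in> car (Suc p) \<Longrightarrow> Poly_Mapping.lookup (d p x j) 0 = 0"
  proof (cases "j < length (e p)")
    case True
    assume "x \<in> car (Suc p)"
    then show ?thesis using m True unfolding irrelevant_ideal_def by blast
  next
    case False
    assume "x \<in> car (Suc p)"
    then show ?thesis using car_out[OF d_car, of x p j] False by simp
  qed
qed

lemma unit_car: "j < length (e p) \<Longrightarrow> unit_vec j \<in> car p"
  unfolding unit_vec_def by (rule carI) auto

definition D :: "nat \<Rightarrow> nat \<Rightarrow> nat \<Rightarrow> (nat \<times> nat \<Rightarrow>\<^sub>0 nat) \<Rightarrow>\<^sub>0 'k" where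
  "D p j i = d p (unit_vec j) i"

lemma d_expand:
  assumes "x \<in> car (Suc p)"
  shows "d p x i = (\<Sum>j<length (e (Suc p)). x j * D p j i)"
proof -
  have "(\<lambda>j. if j < k then x j else 0) \<in> car (Suc p) \<and>
      d p (\<lambda>j. if j < k then x j else 0) = (\<lambda>i. \<Sum>j<k. x j * D p j i)" if "k \<le> length (e (Suc p))" for k
    using that
  proof (induction k)
    case 0
    have z: "(\<lambda>j. 0) \<in> car (Suc p)" by (rule carI) auto
    have "d p (\<lambda>j. 0 * 0) = (\<lambda>j. 0 * d p (\<lambda>j. 0) j)" by (rule d_smult[OF _ z]) simp
    then show ?case using z by simp
  next
    case (Suc k)
    let ?x = "\<lambda>j. if j < k then x j else 0"
    have u: "unit_vec k \<in> car (Suc p)" using Suc.prems by (intro unit_car) simp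
    have xk: "x k \<in> PR V" by (rule car_PR[OF assms])
    have y: "(\<lambda>j. x k * unit_vec k j) \<in> car (Suc p)"
      by (rule carI) (use xk u Suc.prems in \<open>auto simp: unit_vec_def\<close>)
    have IH: "?x \<in> car (Suc p)" "d p ?x = (\<lambda>i. \<Sum>j<k. x j * D p j i)" using Suc by auto
    have eq: "(\<lambda>j. if j < Suc k then x j else 0) = (\<lambda>j. ?x j + x k * unit_vec k j)"
      by (rule ext) (auto simp: unit_vec_def less_Suc_eq)
    have "d p (\<lambda>j. ?x j + x k * unit_vec k j) = (\<lambda>i. d p ?x i + d p (\<lambda>j. x k * unit_vec k j) i)"
      by (rule d_add[OF IH(1) y])
    also have "\<dots> = (\<lambda>i. \<Sum>j<Suc k. x j * D p j i)"
      unfolding IH(2) d_smult[OF xk u] by (simp add: D_def)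
    moreover have "(\<lambda>j. if j < Suc k then x j else 0) \<in> car (Suc p)"
      by (rule carI) (use assms Suc.prems car_PR in auto)
    ultimately show ?case unfolding eq by simp
  qed
  from this[of "length (e (Suc p))"]
  have "d p (\<lambda>j. if j < length (e (Suc p)) then x j else 0) i = (\<Sum>j<length (e (Suc p)). x j * D p j i)" by simp
  moreover have "(\<lambda>j. if j < length (e (Suc p)) then x j else 0) = x"
    by (rule ext) (use car_out[OF assms] in auto)
  ultimately show ?thesis by simp
qed

lemma D_component:
  assumes "j < length (e (Suc p))" "i < length (e p)"
  shows "D p j i \<in> poly_component V (e (Suc p) ! j - e p ! i)"
proof -
  have one: "1 \<in> poly_component V 0" "\<And>n. 0 \<in> poly_component V n"
    using PR_one PR_zero by (auto simp: poly_component_def keys_one simp del: PR_one PR_zero)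
  have "unit_vec j \<in> component (free_module V (e (Suc p))) (e (Suc p) ! j)"
    unfolding free_module_def unit_vec_def using assms(1) one by auto
  then have "d p (unit_vec j) \<in> component (free_module V (e p)) (e (Suc p) ! j)" by (rule d_comp)
  then show ?thesis using assms(2) unfolding free_module_def D_def by simp
qed

lemma D_zero: "j < length (e (Suc p)) \<Longrightarrow> Poly_Mapping.lookup (D p j i) 0 = 0"
  unfolding D_def by (rule minimal) (rule unit_car)

text \<open>Let \<open>g\<close> be mapped to 1. Each unit vector differs from a multiple of
  \<open>g\<close> by an element of the kernel of \<open>aug\<close>, whose constant terms vanish by
  minimality. So the constant terms of all unit vectors are multiples of those of \<open>g\<close>,
  which leaves room for one generator only.\<close>

lemma e0: "e 0 = [0]" and aug_kernel: "x \<in> car 0 \<Longrightarrow> aug x = 0 \<longleftrightarrow> coord_eval (x 0) = 0"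
proof -
  let ?l = "\<lambda>f. Poly_Mapping.lookup f (0 :: nat \<times> nat \<Rightarrow>\<^sub>0 nat) :: 'k"
  have "1 \<in> carrier (coord_ring a b)" by (auto simp: coord_ring_def Let_def keys_one zero_prod_def)
  then obtain g where g: "g \<in> car 0" "aug g = 1" using aug_surj by blast
  have key: "\<exists>s\<in>PR V. coord_eval s = aug (unit_vec j) \<and> (\<forall>i. ?l (unit_vec j i) = ?l s * ?l (g i))"
    if j: "j < length (e 0)" for j
  proof -
    have u: "unit_vec j \<in> car 0" by (rule unit_car[OF j])
    obtain s where s: "s \<in> PR V" "coord_eval s = aug (unit_vec j)" using coord_eval_surj[OF aug_car[OF u]] by blast
    have sg: "(\<lambda>i. - s * g i) \<in> car 0"
    proof (rule carI)
      show "- s * g i \<in> PR V" for i by (rule PR_mult[OF PR_uminus[OF s(1)] car_PR[OF g(1)]])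
      show "- s * g i = 0" if "length (e 0) \<le> i" for i using car_out[OF g(1) that] by simp
    qed
    let ?y = "\<lambda>i. unit_vec j i + - s * g i"
    have y: "?y \<in> car 0"
    proof (rule carI)
      show "?y i \<in> PR V" for i by (rule PR_add[OF car_PR[OF u] car_PR[OF sg]])
      show "?y i = 0" if "length (e 0) \<le> i" for i using car_out[OF u that] car_out[OF g(1) that] by simp
    qed
    have "aug ?y = aug (unit_vec j) + coord_eval (- s) * aug g"
      unfolding aug_add[OF u sg] aug_smult[OF PR_uminus[OF s(1)] g(1)] ..
    then have "aug ?y = 0" unfolding g(2) coord_eval_uminus s(2) by simp
    then obtain w where "w \<in> car 1" "d 0 w = ?y" using ker0[OF y] by blast
    then have "?l (?y i) = 0" for i using minimal[of w 0 i] by simp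
    then have "?l (unit_vec j i) = ?l s * ?l (g i)" for i
      by (simp add: lookup_add lookup_mult_0 lookup_minus)
    then show ?thesis using s by blast
  qed
  have lu: "?l (unit_vec j i) = (if i = j then 1 else 0)" for i j
    unfolding unit_vec_def by (simp add: lookup_one)
  have "length (e 0) \<noteq> 0"
  proof
    assume l: "length (e 0) = 0"
    have "g = (\<lambda>i. 0 * g i)" using car_out[OF g(1)] l by (intro ext) simp
    then have "aug g = coord_eval 0 * aug g" using aug_smult[OF PR_zero g(1)] by metis
    then show False using g(2) by (simp add: coord_eval_eq)
  qed
  moreover have "\<not> 1 < length (e 0)"
  proof
    assume l: "1 < length (e 0)"
    have l0: "0 < length (e 0)" using l by linarith
    obtain s where s: "\<And>i. ?l (unit_vec 0 i) = ?l s * ?l (g i)" using key[OF l0] by blast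
    obtain s' where s': "\<And>i. ?l (unit_vec 1 i) = ?l s' * ?l (g i)" using key[OF l] by blast
    have "?l s * ?l (g 0) = 1" "?l s * ?l (g 1) = 0" "?l s' * ?l (g 1) = 1"
      using s[of 0] s[of 1] s'[of 1] unfolding lu by simp_all
    then show False by auto
  qed
  ultimately have l1: "length (e 0) = 1" by linarith
  have u: "unit_vec 0 \<in> car 0" using l1 by (intro unit_car) simp
  have l0: "0 < length (e 0)" using l1 by simp
  obtain s where s1: "coord_eval s = aug (unit_vec 0)" "\<And>i. ?l (unit_vec 0 i) = ?l s * ?l (g i)"
    using key[OF l0] by blast
  have s2: "1 = ?l s * ?l (g 0)" using s1(2)[of 0] unfolding lu by simp
  note s = s1(1) s2
  have s0: "?l s \<noteq> 0" using s(2) by auto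
  have "Poly_Mapping.lookup (coord_eval s) 0 = (\<Sum>m\<in>Poly_Mapping.keys s. if m = 0 then ?l s else 0)"
    unfolding lookup_coord_eval
  proof (intro sum.cong refl)
    fix m
    have "wt m = 0 \<longleftrightarrow> m = 0"
      using fst_wt[of m] mono_degree_0_iff[of m] by (metis fst_zero wt_zero)
    then show "(if wt m = 0 then Poly_Mapping.lookup s m else 0) = (if m = 0 then ?l s else 0)" by simp
  qed
  then have a0: "Poly_Mapping.lookup (aug (unit_vec 0)) 0 = ?l s" using s0 unfolding s(1) by (simp add: in_keys_iff)
  have "(1 :: (nat \<times> nat \<Rightarrow>\<^sub>0 nat) \<Rightarrow>\<^sub>0 'k) \<in> poly_component V 0"
    using PR_one by (auto simp: poly_component_def keys_one simp del: PR_one)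
  then have "(unit_vec 0 :: nat \<Rightarrow> (nat \<times> nat \<Rightarrow>\<^sub>0 nat) \<Rightarrow>\<^sub>0 'k) \<in> component (free_module V (e 0)) (e 0 ! 0)"
    unfolding free_module_def unit_vec_def using l1 by simp
  then have ac: "aug (unit_vec 0) \<in> component (coord_ring a b) (e 0 ! 0)" by (rule aug_comp)
  have k0: "0 \<in> Poly_Mapping.keys (aug (unit_vec 0))" using a0 s0 by (simp add: in_keys_iff)
  then have e00: "e 0 ! 0 = 0" using ac unfolding coord_ring_def Let_def by (auto simp: zero_prod_def)
  show "e 0 = [0]" using l1 e00 by (metis One_nat_def length_0_conv length_Suc_conv nth_Cons_0)
  have "Poly_Mapping.keys (aug (unit_vec 0)) \<subseteq> {0}"
    using ac unfolding e00 coord_ring_def Let_def by (fastforce simp: zero_prod_def)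
  then have as: "aug (unit_vec 0) = Poly_Mapping.single 0 (?l s)"
    unfolding a0[symmetric] by (intro poly_mapping_eqI) (auto simp: lookup_single when_def in_keys_iff subset_iff)
  show "aug x = 0 \<longleftrightarrow> coord_eval (x 0) = 0" if x: "x \<in> car 0"
  proof -
    have "x = (\<lambda>j. x 0 * unit_vec 0 j)"
      by (rule ext) (use car_out[OF x] l1 in \<open>auto simp: unit_vec_def\<close>)
    then have "aug x = coord_eval (x 0) * aug (unit_vec 0)" using aug_smult[OF car_PR[OF x] u] by metis
    also have "\<dots> = Poly_Mapping.single 0 (?l s) * coord_eval (x 0)" unfolding as by (rule mult.commute)
    finally have ax: "aug x = Poly_Mapping.single 0 (?l s) * coord_eval (x 0)" .
    show ?thesis
    proof
      assume "aug x = 0"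
      then have "Poly_Mapping.single 0 (1 / ?l s) * (Poly_Mapping.single 0 (?l s) * coord_eval (x 0)) = 0"
        unfolding ax[symmetric] by simp
      then show "coord_eval (x 0) = 0" unfolding mult.assoc[symmetric] mult_single using s0 by simp
    qed (simp add: ax)
  qed
qed

text \<open>A generator of smaller degree would be mapped to 0: for degree reasons and, in the first
  step, because no linear form vanishes on the surface. By exactness it would lie in an image, and
  by minimality it would have no constant term.\<close>

lemma e_lower: "1 \<le> p \<Longrightarrow> j < length (e p) \<Longrightarrow> int p + 1 \<le> e p ! j"
proof (induction p arbitrary: j rule: nat_induct_at_least)
  case base
  show ?case
  proof (rule ccontr)
    assume "\<not> int 1 + 1 \<le> e 1 ! j"
    then have le: "e 1 ! j \<le> 1" by simp
    have u: "unit_vec j \<in> car 1" by (rule unit_car[OF base])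
    have comp: "D 0 j 0 \<in> poly_component V (e 1 ! j)" using D_component[of j 0 0] base e0 by simp
    have "D 0 j 0 = 0"
    proof (cases "e 1 ! j = 1")
      case True
      have "coord_eval (D 0 j 0) = 0"
        using aug_kernel[OF d_car[of "unit_vec j" 0]] im0[OF u] u unfolding D_def by simp
      then show ?thesis using comp coord_eval_linear_inj unfolding True by blast
    next
      case False
      then show ?thesis using component_nonpos_zero[OF comp] le D_zero[of j 0 0] base by simp
    qed
    moreover have "d 0 (unit_vec j) i = 0" if "i \<noteq> 0" for i
      using car_out[OF d_car[of "unit_vec j" 0], of i] u that e0 by simp
    ultimately have "d 0 (unit_vec j) = (\<lambda>_. 0)" unfolding D_def by (intro ext) metis
    then obtain w where w: "w \<in> car (Suc (Suc 0))" "d (Suc 0) w = unit_vec j" using kerS[of "unit_vec j" 0] u by auto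
    show False using minimal[OF w(1), of j] unfolding w(2) by (simp add: unit_vec_def lookup_one)
  qed
next
  case (Suc p)
  show ?case
  proof (rule ccontr)
    assume "\<not> int (Suc p) + 1 \<le> e (Suc p) ! j"
    then have le: "e (Suc p) ! j \<le> int p + 1" by simp
    have u: "unit_vec j \<in> car (Suc p)" by (rule unit_car[OF Suc.prems])
    have "d p (unit_vec j) i = 0" for i
    proof (cases "i < length (e p)")
      case True
      have "D p j i = 0"
        using component_nonpos_zero[OF D_component[OF Suc.prems True]] D_zero[OF Suc.prems] Suc.IH[OF True] le by simp
      then show ?thesis unfolding D_def .
    next
      case False
      then show ?thesis using car_out[OF d_car[OF u]] by simp
    qed
    then obtain w where w: "w \<in> car (Suc (Suc p))" "d (Suc p) w = unit_vec j" using kerS[OF u] by auto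
    show False using minimal[OF w(1), of j] unfolding w(2) by (simp add: unit_vec_def lookup_one)
  qed
qed

definition J :: "nat \<Rightarrow> nat set" where
  "J p = {j. j < length (e p) \<and> e p ! j = int p + 1}"

definition Dc :: "nat \<Rightarrow> nat \<Rightarrow> nat \<Rightarrow> nat \<times> nat \<Rightarrow> 'k" where
  "Dc p j i v = Poly_Mapping.lookup (D p j i) (var1 v)"

definition I2 :: "((nat \<times> nat \<Rightarrow>\<^sub>0 nat) \<Rightarrow>\<^sub>0 'k) set" where
  "I2 = {q \<in> poly_component V 2. coord_eval q = 0}"

lemma finJ: "finite (J p)"
  unfolding J_def by simp

lemma betti_J: "betti_entry e p 1 = card (J p)"
  unfolding betti_entry_def J_def by (rule arg_cong[where f = card]) auto

text \<open>A generator outside \<open>J p\<close> has larger degree, so the entry has degree at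
  most 0 and, by minimality, no constant term.\<close>

lemma D_linear:
  assumes "1 \<le> p" "j \<in> J (p + 1)"
  shows "D p j i = (if i \<in> J p then (\<Sum>v\<in>V. Cst (Dc p j i v) * Var v) else 0)"
proof (cases "i < length (e p)")
  case False
  then show ?thesis using assms(2) car_out[OF d_car[OF unit_car]] unfolding D_def J_def by auto
next
  case True
  have j: "j < length (e (Suc p))" "e (Suc p) ! j = int p + 2" using assms(2) unfolding J_def by auto
  note c = D_component[OF j(1) True]
  show ?thesis
  proof (cases "i \<in> J p")
    case T: True
    then have "D p j i \<in> poly_component V 1" using c j(2) unfolding J_def by simp
    then show ?thesis using component_one_sum[OF finV] T unfolding Dc_def by simp
  next
    case F: False
    then have "int p + 1 < e p ! i" using e_lower[OF assms(1) True] True unfolding J_def by fastforce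
    then have "D p j i = 0" using component_nonpos_zero[OF c] D_zero[OF j(1)] j(2) by simp
    then show ?thesis using F by simp
  qed
qed

definition vec :: "nat \<Rightarrow> (nat \<Rightarrow> 'k) \<Rightarrow> nat \<Rightarrow> (nat \<times> nat \<Rightarrow>\<^sub>0 nat) \<Rightarrow>\<^sub>0 'k" where
  "vec p \<alpha> j = (if j \<in> J p then Cst (\<alpha> j) else 0)"

lemma vec_car: "vec p \<alpha> \<in> car p"
  unfolding vec_def by (rule carI) (auto simp: J_def)

lemma d_sum_J:
  assumes "x \<in> car (Suc p)" "\<And>j. j \<notin> J (Suc p) \<Longrightarrow> x j = 0"
  shows "d p x i = (\<Sum>j\<in>J (Suc p). x j * D p j i)"
  unfolding d_expand[OF assms(1)] using assms(2)
  by (intro sum.mono_neutral_right) (auto simp: J_def)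

lemma sum_Var:
  "(\<Sum>j\<in>K. (x j :: (nat \<times> nat \<Rightarrow>\<^sub>0 nat) \<Rightarrow>\<^sub>0 'k) * (\<Sum>v\<in>V. Cst (f j v) * Var v)) = (\<Sum>v\<in>V. Var v * (\<Sum>j\<in>K. Cst (f j v) * x j))"
  by (simp add: sum_distrib_left mult_ac) (rule sum.swap)

lemma vec_zero:
  assumes "d p (vec (Suc p) \<alpha>) = (\<lambda>_. 0)" "j \<in> J (Suc p)"
  shows "\<alpha> j = 0"
proof -
  obtain w where w: "w \<in> car (Suc (Suc p))" "d (Suc p) w = vec (Suc p) \<alpha>" using kerS[OF vec_car assms(1)] by blast
  show ?thesis using minimal[OF w(1), of j] assms(2) unfolding w(2) vec_def Cst_def by simp
qed

lemma D0: "j \<in> J 1 \<Longrightarrow> D 0 j 0 \<in> I2" and D0_out: "j < length (e 1) \<Longrightarrow> i \<noteq> 0 \<Longrightarrow> D 0 j i = 0"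
proof -
  show "D 0 j i = 0" if "j < length (e 1)" "i \<noteq> 0" for j i
    using car_out[OF d_car[OF unit_car, of j 0], of i] that e0 unfolding D_def by simp
  assume j: "j \<in> J 1"
  then have l: "j < length (e (Suc 0))" "e (Suc 0) ! j = 2" unfolding J_def by auto
  have "coord_eval (D 0 j 0) = 0"
    using aug_kernel[OF d_car[OF unit_car[OF l(1)]]] im0[of "unit_vec j"] unit_car[OF l(1)] unfolding D_def by simp
  then show "D 0 j 0 \<in> I2" using D_component[OF l(1), of 0] l(2) e0 unfolding I2_def by simp
qed

lemma I2_sum: "(\<And>j. j \<in> K \<Longrightarrow> q j \<in> I2) \<Longrightarrow> (\<Sum>j\<in>K. Cst (\<alpha> j) * q j) \<in> I2"
proof (induction K rule: infinite_finite_induct)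
  case (insert j K)
  have c: "f + g \<in> poly_component V 2" if "f \<in> poly_component V 2" "g \<in> poly_component V 2"
    for f g :: "(nat \<times> nat \<Rightarrow>\<^sub>0 nat) \<Rightarrow>\<^sub>0 'k"
    using that PR_add[of f V g] keys_add[of f g] unfolding poly_component_def by blast
  have s: "Cst x * f \<in> poly_component V 2" if "f \<in> poly_component V 2" for x and f :: "(nat \<times> nat \<Rightarrow>\<^sub>0 nat) \<Rightarrow>\<^sub>0 'k"
  proof -
    have "Poly_Mapping.keys (Cst x * f) \<subseteq> Poly_Mapping.keys f"
      by (auto simp: in_keys_iff lookup_Cst_mult)
    then show ?thesis using that unfolding poly_component_def PR_iff by blast
  qed
  have e: "coord_eval (Cst x * f) = 0" if "coord_eval f = 0" for x and f :: "(nat \<times> nat \<Rightarrow>\<^sub>0 nat) \<Rightarrow>\<^sub>0 'k"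
  proof -
    have "coord_eval (Cst x * f) = Poly_Mapping.single 0 x * coord_eval f"
    proof -
      have "Poly_Mapping.keys (Cst x * f) \<subseteq> Poly_Mapping.keys f"
        by (auto simp: in_keys_iff lookup_Cst_mult)
      then have "coord_eval (Cst x * f) = (\<Sum>m\<in>Poly_Mapping.keys f. Poly_Mapping.single (wt m) (x * Poly_Mapping.lookup f m))"
        using coord_eval_superset[of "Poly_Mapping.keys f" "Cst x * f"] by (simp add: lookup_Cst_mult)
      then show ?thesis unfolding coord_eval_eq[of f] by (simp add: sum_distrib_left mult_single)
    qed
    then show ?thesis using that by simp
  qed
  show ?case using insert c s e unfolding I2_def by (auto simp: coord_eval_add)
qed (auto simp: I2_def poly_component_def coord_eval_eq)

text \<open>The relations express that consecutive differentials compose to 0. Injectivity is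
  minimality by way of \<open>vec_zero\<close>. Surjectivity lifts by exactness and keeps the
  constant terms of the preimage.\<close>

lemma strand: "linear_strand V J Dc (\<lambda>j. D 0 j 0) I2"
proof
  show "finite V" by (rule finV)
  show "finite (J p)" for p by (rule finJ)
  show "(\<Sum>j\<in>J 1. Cst (\<alpha> j) * D 0 j 0) \<in> I2" for \<alpha> by (rule I2_sum) (rule D0)
  have dv: "d p (vec (Suc p) \<alpha>) i = (\<Sum>j\<in>J (Suc p). Cst (\<alpha> j) * D p j i)" for p \<alpha> i
    by (subst d_sum_J[OF vec_car]) (auto simp: vec_def)
  show "\<alpha> j = 0" if "(\<Sum>j\<in>J 1. Cst (\<alpha> j) * D 0 j 0) = 0" "j \<in> J 1" for \<alpha> j
  proof (rule vec_zero[of 0])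
    have "d 0 (vec (Suc 0) \<alpha>) i = 0" for i
      unfolding dv by (cases "i = 0") (use that D0_out in \<open>auto simp: J_def intro!: sum.neutral\<close>)
    then show "d 0 (vec (Suc 0) \<alpha>) = (\<lambda>_. 0)" by blast
  qed (use that in simp)
  show "\<alpha> j = 0" if p: "1 \<le> p" and z: "\<And>i v. i \<in> J p \<Longrightarrow> v \<in> V \<Longrightarrow> (\<Sum>j\<in>J (p + 1). \<alpha> j * Dc p j i v) = 0"
    and j: "j \<in> J (p + 1)" for p \<alpha> j
  proof (rule vec_zero[of p])
    have "d p (vec (Suc p) \<alpha>) i = 0" for i
    proof (cases "i \<in> J p")
      case True
      have "d p (vec (Suc p) \<alpha>) i = (\<Sum>j\<in>J (p + 1). Cst (\<alpha> j) * (\<Sum>v\<in>V. Cst (Dc p j i v) * Var v))"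
        unfolding dv by (intro sum.cong) (use D_linear[OF p] True in auto)
      also have "\<dots> = (\<Sum>v\<in>V. Var v * Cst (\<Sum>j\<in>J (p + 1). \<alpha> j * Dc p j i v))"
        unfolding sum_Var Cst_sum by (simp add: mult.commute)
      finally show ?thesis using z[OF True] by simp
    next
      case False
      then show ?thesis unfolding dv using D_linear[OF p] by (auto intro!: sum.neutral)
    qed
    then show "d p (vec (Suc p) \<alpha>) = (\<lambda>_. 0)" by blast
  qed (use j in simp)
  have comp: "(\<Sum>m<length (e (Suc p)). D (Suc p) j m * D p m i) = 0" if "j < length (e (Suc (Suc p)))" for p j i
  proof -
    have u: "unit_vec j \<in> car (Suc (Suc p))" by (rule unit_car[OF that])
    have "d p (d (Suc p) (unit_vec j)) i = 0" using imS[OF u] by simp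
    then show ?thesis unfolding d_expand[OF d_car[OF u]] D_def[symmetric] .
  qed
  have quad: "(\<Sum>v\<in>V. \<Sum>w\<in>V. Cst (\<Sum>m\<in>K. f m v * f' m w) * Var v * Var w)
      = (\<Sum>m\<in>K. (\<Sum>v\<in>V. Cst (f m v) * Var v) * (\<Sum>w\<in>V. Cst (f' m w) * Var w))"
    for K :: "nat set" and f f' :: "nat \<Rightarrow> nat \<times> nat \<Rightarrow> 'k"
  proof -
    have "(\<Sum>m\<in>K. (\<Sum>v\<in>V. Cst (f m v) * Var v) * (\<Sum>w\<in>V. Cst (f' m w) * Var w))
        = (\<Sum>m\<in>K. \<Sum>v\<in>V. \<Sum>w\<in>V. Cst (f m v * f' m w) * Var v * Var w)"
      unfolding sum_product by (intro sum.cong refl) (simp add: mult_ac)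
    also have "\<dots> = (\<Sum>v\<in>V. \<Sum>w\<in>V. \<Sum>m\<in>K. Cst (f m v * f' m w) * Var v * Var w)"
      by (subst sum.swap, rule sum.cong[OF refl], rule sum.swap)
    finally show ?thesis by (simp only: Cst_sum sum_distrib_right)
  qed
  have rels: "(\<Sum>v\<in>V. \<Sum>w\<in>V. Cst (\<Sum>m\<in>J (p + 1). Dc (p + 1) j m v * Dc p m i w) * Var v * Var w) = 0"
    if p: "1 \<le> p" and j: "j \<in> J (p + 2)" and i: "i \<in> J p" for p j i
  proof -
    have "0 = (\<Sum>m<length (e (Suc p)). D (Suc p) j m * D p m i)"
      by (rule comp[symmetric]) (use j in \<open>simp add: J_def\<close>)
    also have "\<dots> = (\<Sum>m\<in>J (p + 1). D (Suc p) j m * D p m i)"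
      using D_linear[of "Suc p" j] j by (intro sum.mono_neutral_right) (auto simp: J_def)
    also have "\<dots> = (\<Sum>m\<in>J (p + 1). (\<Sum>v\<in>V. Cst (Dc (p + 1) j m v) * Var v) * (\<Sum>w\<in>V. Cst (Dc p m i w) * Var w))"
      by (intro sum.cong refl) (use D_linear[of "Suc p" j] D_linear[OF p] j i in simp)
    finally show ?thesis unfolding quad by simp
  qed
  have out: "Dc p j i v = 0" if "v \<notin> V" "1 \<le> p" "j \<in> J (p + 1)" "i \<in> J p" for p j i v
  proof -
    have l: "j < length (e (Suc p))" "i < length (e p)" using that unfolding J_def by auto
    have "\<not> Poly_Mapping.keys (var1 v) \<subseteq> V" using that(1) by simp
    then show ?thesis unfolding Dc_def using poly_componentD(1)[OF D_component[OF l]] by blast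
  qed
  show "(\<Sum>m\<in>J (p + 1). Dc (p + 1) j m v * Dc p m i w) = - (\<Sum>m\<in>J (p + 1). Dc (p + 1) j m w * Dc p m i v)"
    if p: "1 \<le> p" and j: "j \<in> J (p + 2)" and i: "i \<in> J p" for p j i v w
  proof (cases "v \<in> V \<and> w \<in> V")
    case True
    then show ?thesis using quadric_alternating(1)[OF finV rels[OF that]] by (simp add: eq_neg_iff_add_eq_0)
  next
    case False
    have z: "Dc (p + 1) j m v * Dc p m i w = 0" "Dc (p + 1) j m w * Dc p m i v = 0" if "m \<in> J (p + 1)" for m
      using out[of v "p + 1" j m] out[of w "p + 1" j m] out[of v p m i] out[of w p m i] False that p j i by auto
    have "(\<Sum>m\<in>J (p + 1). Dc (p + 1) j m v * Dc p m i w) = 0" by (intro sum.neutral ballI) (rule z(1))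
    moreover have "(\<Sum>m\<in>J (p + 1). Dc (p + 1) j m w * Dc p m i v) = 0" by (intro sum.neutral ballI) (rule z(2))
    ultimately show ?thesis by simp
  qed
  show "(\<Sum>m\<in>J (p + 1). Dc (p + 1) j m v * Dc p m i v) = 0"
    if p: "1 \<le> p" and j: "j \<in> J (p + 2)" and i: "i \<in> J p" for p j i v
  proof (cases "v \<in> V")
    case True
    then show ?thesis using quadric_alternating(2)[OF finV rels[OF that]] by simp
  next
    case False
    then show ?thesis using out[of v p _ i] p i by (intro sum.neutral) simp
  qed
  show "(\<Sum>v\<in>V. Var v * (\<Sum>m\<in>J 1. Cst (Dc 1 j m v) * D 0 m 0)) = 0" if j: "j \<in> J 2" for j
  proof -
    have "0 = (\<Sum>m<length (e (Suc 0)). D (Suc 0) j m * D 0 m 0)"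
      by (rule comp[symmetric]) (use j in \<open>simp add: J_def numeral_2_eq_2\<close>)
    also have "\<dots> = (\<Sum>m\<in>J 1. D (Suc 0) j m * D 0 m 0)"
      using D_linear[of "Suc 0" j] j by (intro sum.mono_neutral_right) (auto simp: J_def numeral_2_eq_2)
    also have "\<dots> = (\<Sum>m\<in>J 1. D 0 m 0 * (\<Sum>v\<in>V. Cst (Dc 1 j m v) * Var v))"
      by (intro sum.cong refl) (use D_linear[of "Suc 0" j] j in \<open>simp add: numeral_2_eq_2 mult.commute\<close>)
    finally show ?thesis unfolding sum_Var by simp
  qed
  show "\<exists>\<alpha>. q = (\<Sum>j\<in>J 1. Cst (\<alpha> j) * D 0 j 0)" if q: "q \<in> I2" for q
  proof -
    let ?x = "\<lambda>i. if i = 0 then q else 0"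
    have x: "?x \<in> car 0" by (rule carI) (use q e0 in \<open>auto simp: I2_def intro: component_PR\<close>)
    have "aug ?x = 0" using aug_kernel[OF x] q unfolding I2_def by simp
    then obtain u where u: "u \<in> car 1" "d 0 u = ?x" using ker0[OF x] by blast
    let ?a = "\<lambda>j. Poly_Mapping.lookup (u j) 0"
    have "q = (\<Sum>j<length (e 1). u j * D 0 j 0)" using d_expand[of u 0 0] u by simp
    then have l: "Poly_Mapping.lookup q m = (\<Sum>j<length (e 1). Poly_Mapping.lookup (u j * D 0 j 0) m)" for m
      by (simp add: lookup_sum)
    have "q = (\<Sum>j\<in>J 1. Cst (?a j) * D 0 j 0)"
    proof (rule poly_component_2_eqI)
      show "q \<in> poly_component V 2" using q unfolding I2_def by blast
      have "(\<Sum>j\<in>J 1. Cst (?a j) * D 0 j 0) \<in> I2" by (rule I2_sum) (rule D0)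
      then show "(\<Sum>j\<in>J 1. Cst (?a j) * D 0 j 0) \<in> poly_component V 2" unfolding I2_def by blast
      fix x y assume "x \<in> V" "y \<in> V"
      let ?m = "var1 x + var1 y"
      have deg: "int (mono_degree ?m) = 2" unfolding mono_degree_add mono_degree_var1 by simp
      have "Poly_Mapping.lookup (u j * D 0 j 0) ?m = (if j \<in> J 1 then ?a j * Poly_Mapping.lookup (D 0 j 0) ?m else 0)"
        if j: "j < length (e 1)" for j
      proof -
        have c: "D 0 j 0 \<in> poly_component V (e 1 ! j)" using D_component[of j 0 0] j e0 by simp
        have ge: "2 \<le> e 1 ! j" using e_lower[of 1 j] j by simp
        have "Poly_Mapping.lookup (u j * D 0 j 0) ?m = ?a j * Poly_Mapping.lookup (D 0 j 0) ?m"
          by (rule lookup_mult_low[OF c]) (use ge deg in linarith)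
        moreover have "Poly_Mapping.lookup (D 0 j 0) ?m = 0" if "j \<notin> J 1"
          using poly_componentD(2)[OF c, of ?m] that j deg unfolding J_def by auto
        ultimately show ?thesis by auto
      qed
      then have "Poly_Mapping.lookup q ?m = (\<Sum>j<length (e 1). if j \<in> J 1 then ?a j * Poly_Mapping.lookup (D 0 j 0) ?m else 0)"
        unfolding l by (intro sum.cong) auto
      also have "\<dots> = (\<Sum>j\<in>J 1. ?a j * Poly_Mapping.lookup (D 0 j 0) ?m)"
        by (intro sum.mono_neutral_cong_right) (auto simp: J_def)
      finally show "Poly_Mapping.lookup q ?m = Poly_Mapping.lookup (\<Sum>j\<in>J 1. Cst (?a j) * D 0 j 0) ?m"
        by (simp add: lookup_sum lookup_Cst_mult)
    qed
    then show ?thesis by (intro exI[of _ "\<lambda>j. Poly_Mapping.lookup (u j) 0"])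
  qed
  have lift: "\<exists>\<alpha>. \<forall>v\<in>V. \<forall>i\<in>J p. \<beta> v i = (\<Sum>j\<in>J (Suc p). \<alpha> j * Dc p j i v)"
    if p: "1 \<le> p" and u: "u \<in> car (Suc p)" "d p u = (\<lambda>i. if i \<in> J p then \<Sum>v\<in>V. Cst (\<beta> v i) * Var v else 0)" for p \<beta> u
  proof (intro exI ballI)
    fix v i assume v: "v \<in> V" and i: "i \<in> J p"
    let ?a = "\<lambda>j. Poly_Mapping.lookup (u j) 0"
    have il: "i < length (e p)" "e p ! i = int p + 1" using i unfolding J_def by auto
    have vv: "Cst x * Var w = Poly_Mapping.single (var1 w) x" for x :: 'k and w :: "nat \<times> nat"
      unfolding Cst_def Var_def by (simp add: mult_single)
    have inj: "var1 w = var1 v \<longleftrightarrow> w = v" for w by (metis keys_single one_neq_zero singleton_inject)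
    have "\<beta> v i = Poly_Mapping.lookup (d p u i) (var1 v)"
      unfolding u(2) using i v finV by (simp add: vv[unfolded One_nat_def] lookup_sum lookup_single when_def inj[unfolded One_nat_def])
    also have "\<dots> = (\<Sum>j<length (e (Suc p)). Poly_Mapping.lookup (u j * D p j i) (var1 v))"
      unfolding d_expand[OF u(1)] lookup_sum ..
    also have "\<dots> = (\<Sum>j<length (e (Suc p)). if j \<in> J (Suc p) then ?a j * Dc p j i v else 0)"
    proof (rule sum.cong)
      fix j assume "j \<in> {..<length (e (Suc p))}"
      then have j: "j < length (e (Suc p))" by simp
      note c = D_component[OF j il(1)]
      have m1: "int (mono_degree (var1 v)) = 1" unfolding mono_degree_var1 by simp
      have ge: "int p + 2 \<le> e (Suc p) ! j" using e_lower[of "Suc p" j] j by simp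
      have "Poly_Mapping.lookup (u j * D p j i) (var1 v) = ?a j * Poly_Mapping.lookup (D p j i) (var1 v)"
        by (rule lookup_mult_low[OF c]) (use ge il m1 in linarith)
      moreover have "Poly_Mapping.lookup (D p j i) (var1 v) = 0" if "j \<notin> J (Suc p)"
        using poly_componentD(2)[OF c, of "var1 v"] that j il mono_degree_var1[of v] unfolding J_def by auto
      ultimately show "Poly_Mapping.lookup (u j * D p j i) (var1 v) = (if j \<in> J (Suc p) then ?a j * Dc p j i v else 0)"
        unfolding Dc_def by auto
    qed simp
    also have "\<dots> = (\<Sum>j\<in>J (Suc p). ?a j * Dc p j i v)"
      by (intro sum.mono_neutral_cong_right) (auto simp: J_def)
    finally show "\<beta> v i = (\<Sum>j\<in>J (Suc p). ?a j * Dc p j i v)" .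
  qed
  have yc: "(\<lambda>i. if i \<in> J p then \<Sum>v\<in>V. Cst (\<beta> v i) * Var v else 0) \<in> car p" for p and \<beta> :: "nat \<times> nat \<Rightarrow> nat \<Rightarrow> 'k"
    by (rule carI) (auto simp: J_def intro!: PR_sum PR_mult PR_Var)
  have dy: "d p (\<lambda>i. if i \<in> J (Suc p) then \<Sum>v\<in>V. Cst (\<beta> v i) * Var v else 0) i
      = (\<Sum>m\<in>J (Suc p). (\<Sum>v\<in>V. Cst (\<beta> v m) * Var v) * D p m i)" for p \<beta> i
    by (subst d_sum_J[OF yc]) auto
  show "\<exists>\<alpha>. \<forall>v\<in>V. \<forall>i\<in>J 1. \<beta> v i = (\<Sum>j\<in>J 2. \<alpha> j * Dc 1 j i v)"
    if z: "(\<Sum>v\<in>V. Var v * (\<Sum>m\<in>J 1. Cst (\<beta> v m) * D 0 m 0)) = 0" for \<beta>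
  proof -
    let ?y = "\<lambda>i. if i \<in> J (Suc 0) then \<Sum>v\<in>V. Cst (\<beta> v i) * Var v else 0"
    have "d 0 ?y i = 0" for i
    proof (cases "i = 0")
      case True
      have "d 0 ?y i = (\<Sum>m\<in>J 1. D 0 m 0 * (\<Sum>v\<in>V. Cst (\<beta> v m) * Var v))"
        unfolding dy True by (simp add: mult.commute)
      then show ?thesis unfolding sum_Var z .
    next
      case False
      then show ?thesis using car_out[OF d_car[OF yc]] e0 by simp
    qed
    then have dz: "d 0 ?y = (\<lambda>_. 0)" by blast
    obtain u where "u \<in> car (Suc (Suc 0))" "d (Suc 0) u = ?y" using kerS[OF yc dz] by blast
    from lift[OF _ this] show ?thesis by (simp add: numeral_2_eq_2)
  qed
  show "\<exists>\<alpha>. \<forall>v\<in>V. \<forall>i\<in>J (p + 1). \<beta> v i = (\<Sum>j\<in>J (p + 2). \<alpha> j * Dc (p + 1) j i v)"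
    if p: "1 \<le> p" and s1: "\<And>i v w. i \<in> J p \<Longrightarrow> v \<in> V \<Longrightarrow> w \<in> V \<Longrightarrow>
        (\<Sum>m\<in>J (p + 1). \<beta> v m * Dc p m i w) = - (\<Sum>m\<in>J (p + 1). \<beta> w m * Dc p m i v)"
      and s2: "\<And>i v. i \<in> J p \<Longrightarrow> v \<in> V \<Longrightarrow> (\<Sum>m\<in>J (p + 1). \<beta> v m * Dc p m i v) = 0" for p \<beta>
  proof -
    let ?y = "\<lambda>i. if i \<in> J (Suc p) then \<Sum>v\<in>V. Cst (\<beta> v i) * Var v else 0"
    have "d p ?y i = 0" for i
    proof (cases "i \<in> J p")
      case True
      have "d p ?y i = (\<Sum>m\<in>J (p + 1). (\<Sum>v\<in>V. Cst (\<beta> v m) * Var v) * (\<Sum>w\<in>V. Cst (Dc p m i w) * Var w))"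
        unfolding dy by (intro sum.cong) (use D_linear[OF p] True in auto)
      also have "\<dots> = (\<Sum>v\<in>V. \<Sum>w\<in>V. Cst (\<Sum>m\<in>J (p + 1). \<beta> v m * Dc p m i w) * Var v * Var w)"
        using quad[where K = "J (p + 1)" and f = "\<lambda>m v. \<beta> v m" and f' = "\<lambda>m. Dc p m i"] by simp
      also have "\<dots> = 0"
      proof (rule sum_alternating_pairs[OF finV])
        show "Cst (\<Sum>m\<in>J (p + 1). \<beta> v m * Dc p m i w) * Var v * Var w
            = - (Cst (\<Sum>m\<in>J (p + 1). \<beta> w m * Dc p m i v) * Var w * Var v)" if "v \<in> V" "w \<in> V" for v w
          unfolding s1[OF True that] by (simp add: mult_ac)
        show "Cst (\<Sum>m\<in>J (p + 1). \<beta> v m * Dc p m i v) * Var v * Var v = 0" if "v \<in> V" for v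
          unfolding s2[OF True that] by simp
      qed
      finally show ?thesis .
    next
      case False
      then show ?thesis unfolding dy using D_linear[OF p] by (auto intro!: sum.neutral)
    qed
    then have dz: "d p ?y = (\<lambda>_. 0)" by blast
    obtain u where "u \<in> car (Suc (Suc p))" "d (Suc p) u = ?y" using kerS[OF yc dz] by blast
    from lift[OF _ this] show ?thesis by simp
  qed
qed

end

section \<open>Eagon--Northcott arrays\<close>

fun esym :: "nat \<Rightarrow> 'r::comm_ring_1 list \<Rightarrow> 'r" where
  "esym 0 xs = 1"
| "esym (Suc r) [] = 0"
| "esym (Suc r) (x # xs) = x * esym r xs + esym (Suc r) xs"

lemma esym_large: "length xs < r \<Longrightarrow> esym r xs = 0"
  by (induction r xs rule: esym.induct) auto

lemma esym_sum_Cons: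
  "(\<Sum>r\<le>Suc (length xs). esym r (y # xs) * t r) = (\<Sum>r\<le>length xs. esym r xs * (t r + y * t (Suc r)))"
proof -
  have e1: "(\<Sum>r\<le>Suc (length xs). esym r xs * t r) = (\<Sum>r\<le>length xs. esym r xs * t r)"
    by (simp add: esym_large)
  have e2: "(\<Sum>r\<le>Suc (length xs). esym r xs * t r) = t 0 + (\<Sum>r\<le>length xs. esym (Suc r) xs * t (Suc r))"
    by (subst sum.atMost_Suc_shift) simp
  have "(\<Sum>r\<le>Suc (length xs). esym r (y # xs) * t r) = t 0 + (\<Sum>r\<le>length xs. esym (Suc r) xs * t (Suc r))
      + (\<Sum>r\<le>length xs. esym r xs * (y * t (Suc r)))"
    by (subst sum.atMost_Suc_shift) (simp add: sum.distrib algebra_simps)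
  then show ?thesis unfolding e2[symmetric] e1 by (simp add: sum.distrib distrib_left)
qed

text \<open>The hypothesis makes \<open>t\<close>, read from its end, a geometric sequence of ratio
  \<open>- x\<close>, and the sum becomes the generating polynomial of the
  \<open>esym r xs\<close>.\<close>

lemma esym_eval:
  assumes "\<And>r. r < length xs \<Longrightarrow> t r + x * t (Suc r) = 0"
  shows "(\<Sum>r\<le>length xs. esym r xs * t r) = t (length xs) * (\<Prod>y\<leftarrow>xs. y - x)"
  using assms
proof (induction xs arbitrary: t)
  case Nil then show ?case by simp
next
  case (Cons y xs)
  have IH: "(\<Sum>r\<le>length xs. esym r xs * ((y - x) * t (Suc r))) = ((y - x) * t (Suc (length xs))) * (\<Prod>y\<leftarrow>xs. y - x)"
  proof (rule Cons.IH)
    fix r assume "r < length xs"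
    then have "t (Suc r) + x * t (Suc (Suc r)) = 0" using Cons.prems[of "Suc r"] by simp
    then have "(y - x) * (t (Suc r) + x * t (Suc (Suc r))) = 0" by simp
    then show "(y - x) * t (Suc r) + x * ((y - x) * t (Suc (Suc r))) = 0" by (simp add: algebra_simps)
  qed
  have "(\<Sum>r\<le>length (y # xs). esym r (y # xs) * t r) = (\<Sum>r\<le>length xs. esym r xs * (t r + y * t (Suc r)))"
    unfolding length_Cons by (rule esym_sum_Cons)
  also have "\<dots> = (\<Sum>r\<le>length xs. esym r xs * ((y - x) * t (Suc r)))"
  proof (rule sum.cong)
    fix r assume "r \<in> {..length xs}"
    then have "t r = - (x * t (Suc r))" using Cons.prems[of r] by (simp add: eq_neg_iff_add_eq_0)
    then show "esym r xs * (t r + y * t (Suc r)) = esym r xs * ((y - x) * t (Suc r))" by (simp add: algebra_simps)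
  qed simp
  finally show ?case unfolding IH by (simp add: mult_ac)
qed

text \<open>The elementary symmetric polynomials of \<open>xs\<close> with one entry omitted form a
  square matrix whose determinant is, up to sign, that of Vandermonde. The induction removes
  \<open>x\<close> and leaves a geometric sequence, whose last term is 0 by
  \<open>esym_eval\<close>.\<close>

lemma esym_distinct_zero:
  fixes t :: "nat \<Rightarrow> 'a::field"
  assumes "distinct xs" "\<And>ys y zs. xs = ys @ y # zs \<Longrightarrow> (\<Sum>r<length xs. esym r (ys @ zs) * t r) = 0"
    and "r < length xs"
  shows "t r = 0"
  using assms
proof (induction xs arbitrary: t r)
  case Nil then show ?case by simp
next
  case (Cons x xs)
  have rec: "t r + x * t (Suc r) = 0" if "r < length xs" for r
  proof (rule Cons.IH[of "\<lambda>r. t r + x * t (Suc r)", OF _ _ that])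
    show "distinct xs" using Cons.prems(1) by simp
    fix ys y zs assume xs: "xs = ys @ y # zs"
    have "(\<Sum>r\<le>Suc (length (ys @ zs)). esym r (x # ys @ zs) * t r) = 0"
      using Cons.prems(2)[of "x # ys" y zs] xs by (simp add: lessThan_Suc_atMost del: sum.atMost_Suc sum.lessThan_Suc)
    then show "(\<Sum>r<length xs. esym r (ys @ zs) * (t r + x * t (Suc r))) = 0"
      unfolding esym_sum_Cons using xs by (simp add: lessThan_Suc_atMost del: sum.atMost_Suc sum.lessThan_Suc)
  qed
  have "(\<Sum>r\<le>length xs. esym r xs * t r) = 0"
    using Cons.prems(2)[of "[]" x xs] by (simp add: lessThan_Suc_atMost del: sum.atMost_Suc sum.lessThan_Suc)
  then have "t (length xs) * (\<Prod>y\<leftarrow>xs. y - x) = 0" using esym_eval[of xs t x] rec by simp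
  moreover have "(\<Prod>y\<leftarrow>xs. y - x) \<noteq> 0" using Cons.prems(1) by (auto simp: prod_list_zero_iff)
  ultimately have top: "t (length xs) = 0" by simp
  have "r \<le> length xs" using Cons.prems(3) by simp
  then show ?case
  proof (induction r rule: inc_induct)
    case base show ?case by (rule top)
  next
    case (step n) then show ?case using rec[of n] by simp
  qed
qed

text \<open>\<open>es e r\<close> sums over all ways of lowering \<open>r\<close> of the entries by \<open>e\<close>; on the level of
  evaluations it is multiplication by an elementary symmetric polynomial.\<close>

fun es :: "nat \<times> nat \<Rightarrow> nat \<Rightarrow> ((nat \<times> nat) list \<Rightarrow> 'r::comm_ring_1) \<Rightarrow> (nat \<times> nat) list \<Rightarrow> 'r" where
  "es e 0 g is = g is"
| "es e (Suc r) g [] = 0"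
| "es e (Suc r) g (v # is) =
    (if v - e + e = v then es e r (\<lambda>l. g ((v - e) # l)) is else 0) + es e (Suc r) (\<lambda>l. g (v # l)) is"

lemma es_smult: "es e r (\<lambda>l. x * g l) is = x * es e r g is"
  by (induction e r g "is" rule: es.induct) (simp_all add: distrib_left)

lemma es_zero [simp]: "es e r (\<lambda>_. 0) is = 0"
  using es_smult[of e r 0 "\<lambda>_. 0" "is"] by simp

lemma es_uminus: "es e r (\<lambda>l. - g l) is = - es e r g is"
  using es_smult[of e r "- 1" g "is"] by simp

lemma es_add: "es e r (\<lambda>l. g l + h l) is = es e r g is + es e r h is"
proof (induction e r g "is" arbitrary: h rule: es.induct)
  case (3 e r g v "is")
  have p1: "es e r (\<lambda>l. g ((v - e) # l) + h ((v - e) # l)) is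
      = es e r (\<lambda>l. g ((v - e) # l)) is + es e r (\<lambda>l. h ((v - e) # l)) is" if "v - e + e = v"
    by (rule "3.IH"(1)[OF that])
  have p2: "es e (Suc r) (\<lambda>l. g (v # l) + h (v # l)) is
      = es e (Suc r) (\<lambda>l. g (v # l)) is + es e (Suc r) (\<lambda>l. h (v # l)) is"
    by (rule "3.IH"(2))
  show ?case
  proof (cases "v - e + e = v")
    case True
    show ?thesis unfolding es.simps if_P[OF True] p1[OF True] p2 by (simp only: add_ac)
  next
    case False
    show ?thesis unfolding es.simps if_not_P[OF False] p2 by simp
  qed
qed simp_all

lemma es_sum: "es e r (\<lambda>l. \<Sum>i\<in>I. g i l) is = (\<Sum>i\<in>I. es e r (g i) is)"
  by (induction I rule: infinite_finite_induct) (simp_all add: es_add)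

lemma es_swap:
  assumes "alternating g"
  shows "es e k (\<lambda>l. g (x # y # l)) is = - es e k (\<lambda>l. g (y # x # l)) is"
proof -
  have "(\<lambda>l. g (x # y # l)) = (\<lambda>l. - g (y # x # l))"
    by (rule ext) (rule alternating_swap0[OF assms])
  then show ?thesis by (simp only: es_uminus)
qed

lemma es_same:
  assumes "alternating g"
  shows "es e k (\<lambda>l. g (x # x # l)) is = 0"
  by (simp add: alternating_same0[OF assms])

lemma es_alternating:
  assumes "alternating g"
  shows "alternating (es e r g)"
proof (rule alternatingI)
  fix xs u v ys
  show "es e r g (xs @ u # v # ys) = - es e r g (xs @ v # u # ys)"
    using assms
  proof (induction xs arbitrary: g r)
    case Nil
    note s = es_swap[OF Nil, of e]
    consider "r = 0" | "r = Suc 0" | m where "r = Suc (Suc m)" by (metis not0_implies_Suc)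
    then show ?case
    proof cases
      case 1 then show ?thesis using alternating_swap0[OF Nil, of u v ys] by simp
    next
      case 2
      then show ?thesis
        using s[of 0 "u - e" v ys] s[of 0 u "v - e" ys] s[of "Suc 0" u v ys] by simp
    next
      case 3
      then show ?thesis
        using s[of m "u - e" "v - e" ys] s[of "Suc m" "u - e" v ys] s[of "Suc m" u "v - e" ys] s[of "Suc (Suc m)" u v ys]
        by simp
    qed
  next
    case (Cons x xs)
    note a = alternating_Cons[OF Cons.prems]
    show ?case
    proof (cases r)
      case 0
      then show ?thesis using alternating_swap[OF Cons.prems, of "x # xs" u v ys] by simp
    next
      case (Suc m)
      then show ?thesis using Cons.IH[OF a[of "x - e"], of m] Cons.IH[OF a[of x], of "Suc m"] by simp
    qed
  qed
next
  fix xs u ys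
  show "es e r g (xs @ u # u # ys) = 0"
    using assms
  proof (induction xs arbitrary: g r)
    case Nil
    note s = es_swap[OF Nil, of e] and z = es_same[OF Nil, of e]
    consider "r = 0" | "r = Suc 0" | m where "r = Suc (Suc m)" by (metis not0_implies_Suc)
    then show ?case
    proof cases
      case 1 then show ?thesis using alternating_same0[OF Nil, of u ys] by simp
    next
      case 2
      then show ?thesis using s[of 0 "u - e" u ys] z[of "Suc 0" u ys] by simp
    next
      case 3
      then show ?thesis
        using z[of m "u - e" ys] s[of "Suc m" "u - e" u ys] z[of "Suc (Suc m)" u ys] by simp
    qed
  next
    case (Cons x xs)
    note a = alternating_Cons[OF Cons.prems]
    show ?case
    proof (cases r)
      case 0
      then show ?thesis using alternating_same[OF Cons.prems, of "x # xs" u ys] by simp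
    next
      case (Suc m)
      then show ?thesis using Cons.IH[OF a[of "x - e"], of m] Cons.IH[OF a[of x], of "Suc m"] by simp
    qed
  qed
qed

text \<open>The entries are restricted to \<open>u\<close> with \<open>u + e\<close> in the grid.
  For \<open>e = (0, 1)\<close> these index the \<open>(a + 1) b\<close> columns of the two-rowed
  matrix of the first scroll, for \<open>e = (1, 0)\<close> the \<open>a (b + 1)\<close> columns of
  the second.\<close>

definition supported :: "(nat \<times> nat) set \<Rightarrow> nat \<times> nat \<Rightarrow> ((nat \<times> nat) list \<Rightarrow> 'r::zero) \<Rightarrow> bool" where
  "supported G e g \<longleftrightarrow> (\<forall>l u. u \<in> set l \<longrightarrow> u + e \<notin> G \<longrightarrow> g l = 0)"

lemma supported_Cons: "supported G e g \<Longrightarrow> supported G e (\<lambda>l. g (v # l))"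
  unfolding supported_def by (metis list.set_intros(2))

lemma supportedD: "supported G e g \<Longrightarrow> u + e \<notin> G \<Longrightarrow> u \<in> set l \<Longrightarrow> g l = 0"
  unfolding supported_def by blast

text \<open>\<open>v - e + e = v\<close> says that \<open>e\<close> can be subtracted from
  \<open>v\<close> without truncation; the sum is reindexed by \<open>v - e\<close>.\<close>

lemma shift_sum:
  fixes h :: "nat \<times> nat \<Rightarrow> 'r::comm_monoid_add"
  assumes fin: "finite G" and down: "\<And>u. u + e \<in> G \<Longrightarrow> u \<in> G" and z: "\<And>u. u + e \<notin> G \<Longrightarrow> h u = 0"
  shows "(\<Sum>v\<in>G. if v - e + e = v then h (v - e) else 0) = (\<Sum>u\<in>G. h u)"
proof -
  let ?F = "{u. u + e \<in> G}"
  have F: "?F \<subseteq> G" using down by auto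
  have d: "u + e - e = u" for u :: "nat \<times> nat" by (simp add: prod_eq_iff)
  have "(\<Sum>v\<in>G. if v - e + e = v then h (v - e) else 0) = (\<Sum>v\<in>(\<lambda>u. u + e) ` ?F. h (v - e))"
  proof (rule sum.mono_neutral_cong_right[OF fin])
    show "\<forall>v\<in>G - (\<lambda>u. u + e) ` ?F. (if v - e + e = v then h (v - e) else 0) = 0"
    proof
      fix v assume v: "v \<in> G - (\<lambda>u. u + e) ` ?F"
      have "v - e + e \<noteq> v"
      proof
        assume eq: "v - e + e = v"
        then have "v - e \<in> ?F" using v by simp
        then have "v - e + e \<in> (\<lambda>u. u + e) ` ?F" by (rule imageI)
        then show False using v unfolding eq by blast
      qed
      then show "(if v - e + e = v then h (v - e) else 0) = 0" by simp
    qed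
    show "(if v - e + e = v then h (v - e) else 0) = h (v - e)" if "v \<in> (\<lambda>u. u + e) ` ?F" for v
      using that d by auto
  qed auto
  also have "\<dots> = (\<Sum>u\<in>?F. h u)"
    by (subst sum.reindex) (auto simp: d intro!: inj_onI dest: arg_cong[where f = "\<lambda>x. x - e"])
  also have "\<dots> = (\<Sum>u\<in>G. h u)" by (rule sum.mono_neutral_left[OF fin F]) (use z in auto)
  finally show ?thesis .
qed

lemma ev_es:
  assumes fin: "finite G" and down: "\<And>u. u + e \<in> G \<Longrightarrow> u \<in> G" and "supported G e g"
  shows "ev G (es e r g) ps = esym r (map (\<lambda>P. fst P ^ fst e * snd P ^ snd e) ps) * ev G g ps"
  using assms(3)
proof (induction ps arbitrary: g r)
  case Nil then show ?case by (cases r) (simp_all add: ev.simps)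
next
  case (Cons P ps)
  show ?case
  proof (cases r)
    case 0
    have "es e 0 g = g" by (rule ext) simp
    then show ?thesis using 0 by simp
  next
    case (Suc k)
    let ?m = "\<lambda>v. fst P ^ fst v * snd P ^ snd v"
    let ?x = "map (\<lambda>P. fst P ^ fst e * snd P ^ snd e) ps"
    note IH = Cons.IH[OF supported_Cons[OF Cons.prems]]
    have inner: "ev G (\<lambda>is. es e (Suc k) g (v # is)) ps = (if v - e + e = v then esym k ?x * ev G (\<lambda>l. g ((v - e) # l)) ps else 0)
        + esym (Suc k) ?x * ev G (\<lambda>l. g (v # l)) ps" for v
      by (cases "v - e + e = v") (simp_all add: ev_add IH)
    have mX: "?m (u + e) = ?m u * ?m e" for u by (simp add: power_add mult_ac)
    have mv: "?m v = ?m (v - e) * ?m e" if "v - e + e = v" for v using mX[of "v - e"] unfolding that .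
    have "ev G (es e (Suc k) g) (P # ps) = (\<Sum>v\<in>G. ?m v * ((if v - e + e = v then esym k ?x * ev G (\<lambda>l. g ((v - e) # l)) ps else 0)
        + esym (Suc k) ?x * ev G (\<lambda>l. g (v # l)) ps))"
      unfolding ev.simps(2) inner ..
    also have "\<dots> = (\<Sum>v\<in>G. (if v - e + e = v then ?m (v - e) * ?m e * (esym k ?x * ev G (\<lambda>l. g ((v - e) # l)) ps) else 0)
        + esym (Suc k) ?x * (?m v * ev G (\<lambda>l. g (v # l)) ps))"
    proof (intro sum.cong refl)
      fix v
      show "?m v * ((if v - e + e = v then esym k ?x * ev G (\<lambda>l. g ((v - e) # l)) ps else 0)
        + esym (Suc k) ?x * ev G (\<lambda>l. g (v # l)) ps) = (if v - e + e = v then ?m (v - e) * ?m e * (esym k ?x * ev G (\<lambda>l. g ((v - e) # l)) ps) else 0)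
        + esym (Suc k) ?x * (?m v * ev G (\<lambda>l. g (v # l)) ps)"
      proof (cases "v - e + e = v")
        case True
        show ?thesis unfolding if_P[OF True] mv[OF True, symmetric] by (simp only: distrib_left mult_ac)
      next
        case False
        show ?thesis unfolding if_not_P[OF False] by (simp only: distrib_left mult_ac mult_zero_left mult_zero_right)
      qed
    qed
    also have "\<dots> = (\<Sum>u\<in>G. ?m u * ?m e * (esym k ?x * ev G (\<lambda>l. g (u # l)) ps)) + esym (Suc k) ?x * ev G g (P # ps)"
      unfolding sum.distrib ev.simps(2) sum_distrib_left
    proof (rule arg_cong2[where f = "(+)"])
      show "(\<Sum>v\<in>G. if v - e + e = v then ?m (v - e) * ?m e * (esym k ?x * ev G (\<lambda>l. g ((v - e) # l)) ps) else 0)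
          = (\<Sum>u\<in>G. ?m u * ?m e * (esym k ?x * ev G (\<lambda>l. g (u # l)) ps))"
      proof (rule shift_sum[OF fin down])
        fix u assume "u + e \<notin> G"
        then have "g (u # l) = 0" for l using supportedD[OF Cons.prems, of u "u # l"] by simp
        then show "?m u * ?m e * (esym k ?x * ev G (\<lambda>l. g (u # l)) ps) = 0" by simp
      qed
    qed simp
    also have "(\<Sum>u\<in>G. ?m u * ?m e * (esym k ?x * ev G (\<lambda>l. g (u # l)) ps)) = ?m e * esym k ?x * ev G g (P # ps)"
      unfolding ev.simps(2) sum_distrib_left by (simp only: mult_ac)
    finally show ?thesis using Suc by (simp add: distrib_right)
  qed
qed

text \<open>The elementary symmetric polynomial has degree \<open>r + 1\<close> in the last
  \<open>p\<close> points; degree 0 would give a fully alternating and hence trivial cycle. So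
  \<open>r < p\<close> yields \<open>p\<close> cycles for each \<open>\<theta>\<close>.\<close>

definition EN :: "nat \<times> nat \<Rightarrow> nat \<Rightarrow> ((nat \<times> nat) list \<Rightarrow> 'r::comm_ring_1) \<Rightarrow> (nat \<times> nat) list \<Rightarrow> 'r" where
  "EN e r \<theta> is = (case is of [] \<Rightarrow> 0 | w # B \<Rightarrow> es e (Suc r) (\<lambda>l. \<theta> (w # l)) B)"

lemma EN_Cons: "EN e r \<theta> (w # B) = es e (Suc r) (\<lambda>l. \<theta> (w # l)) B"
  by (simp add: EN_def)

lemma EN_sum_smult: "EN e r (\<lambda>l. \<Sum>i\<in>I. x i * \<theta> i l) is = (\<Sum>i\<in>I. x i * EN e r (\<theta> i) is)"
  by (cases "is") (simp_all add: EN_def es_sum es_smult del: es.simps)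

lemma ev_EN:
  assumes "finite G" "\<And>u. u + e \<in> G \<Longrightarrow> u \<in> G" "supported G e \<theta>"
  shows "ev G (EN e r \<theta>) (Q # A) = esym (Suc r) (map (\<lambda>P. fst P ^ fst e * snd P ^ snd e) A) * ev G \<theta> (Q # A)"
  unfolding ev.simps(2) EN_Cons
  by (subst ev_es[OF assms(1,2) supported_Cons[OF assms(3)]]) (simp_all add: sum_distrib_left mult_ac)

text \<open>The sum is split according to whether the entry next to \<open>w\<close> is lowered by
  \<open>e\<close>. After reindexing, both parts are antisymmetric in the first two entries of
  \<open>\<theta>\<close>.\<close>

lemma koszul_array_EN:
  assumes alt: "alternating \<theta>" and supp: "supported (grid a b) e \<theta>" and e: "e = (0, 1) \<or> e = (1, 0)"
  shows "koszul_array a b p (EN e r \<theta>)"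
  unfolding koszul_array_def
proof (intro conjI allI impI)
  show "alternating (\<lambda>is. EN e r \<theta> (w # is))" for w
    unfolding EN_Cons by (rule es_alternating[OF alternating_Cons[OF alt]])
next
  fix s A
  let ?G = "grid a b"
  have down: "u \<in> ?G" if "u + e \<in> ?G" for u using that e by (cases u) (auto simp: grid_def)
  define H where "H w u = es e r (\<lambda>l. \<theta> (w # u # l)) A" for w u
  define K where "K w u = es e (Suc r) (\<lambda>l. \<theta> (w # u # l)) A" for w u
  define h where "h w u = (if w + u + e = s then H w u else 0)" for w u
  have "(\<Sum>w\<in>?G. \<Sum>v\<in>?G. if w + v = s then EN e r \<theta> (w # v # A) else 0)
      = (\<Sum>w\<in>?G. \<Sum>v\<in>?G. (if v - e + e = v then h w (v - e) else 0) + (if w + v = s then K w v else 0))"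
  proof (intro sum.cong refl)
    fix w v
    show "(if w + v = s then EN e r \<theta> (w # v # A) else 0) = (if v - e + e = v then h w (v - e) else 0) + (if w + v = s then K w v else 0)"
    proof (cases "v - e + e = v")
      case True
      then have "w + (v - e) + e = w + v" by (simp add: add.assoc)
      then show ?thesis using True by (simp add: EN_Cons h_def H_def K_def)
    next
      case False then show ?thesis by (simp add: EN_Cons K_def)
    qed
  qed
  also have "\<dots> = (\<Sum>w\<in>?G. \<Sum>u\<in>?G. h w u) + (\<Sum>w\<in>?G. \<Sum>v\<in>?G. if w + v = s then K w v else 0)"
    unfolding sum.distrib
  proof (rule arg_cong2[where f = "(+)"], rule sum.cong, rule refl)
    fix w
    show "(\<Sum>v\<in>?G. if v - e + e = v then h w (v - e) else 0) = (\<Sum>u\<in>?G. h w u)"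
    proof (rule shift_sum[OF finite_grid down])
      fix u assume "u + e \<notin> ?G"
      then have "\<theta> (w # u # l) = 0" for l using supportedD[OF supp, of u "w # u # l"] by simp
      then show "h w u = 0" by (simp add: h_def H_def)
    qed
  qed simp
  also have "(\<Sum>w\<in>?G. \<Sum>u\<in>?G. h w u) = 0"
  proof (rule sum_alternating_pairs)
    show "h u v = - h v u" for u v
      using es_swap[OF alt, of e r u v A] by (auto simp: h_def H_def add.commute)
    show "h u u = 0" for u using es_same[OF alt] by (simp add: h_def H_def)
  qed simp
  also have "(\<Sum>w\<in>?G. \<Sum>v\<in>?G. if w + v = s then K w v else 0) = 0"
  proof (rule sum_alternating_pairs)
    show "(if u + v = s then K u v else 0) = - (if v + u = s then K v u else 0)" for u v
      using es_swap[OF alt, of e "Suc r" u v A] by (auto simp: K_def add.commute)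
    show "(if u + u = s then K u u else 0) = 0" for u using es_same[OF alt] by (simp add: K_def)
  qed simp
  finally show "(\<Sum>w\<in>?G. \<Sum>v\<in>?G. if w + v = s then EN e r \<theta> (w # v # A) else 0) = 0" by simp
qed

fun sg :: "'a::linorder list \<Rightarrow> 'r::comm_ring_1" where
  "sg [] = 1"
| "sg (x # xs) = (\<Prod>y\<leftarrow>xs. if y < x then - 1 else if y = x then 0 else 1) * sg xs"

lemma sg_alternating: "alternating sg"
proof (rule alternatingI)
  fix xs ys :: "'a list" and u v
  show "sg (xs @ u # v # ys) = - sg (xs @ v # u # ys)"
  proof (induction xs)
    case Nil
    show ?case
    proof (cases u v rule: linorder_cases)
      case less
      then have "\<not> v < u" "u \<noteq> v" "v \<noteq> u" by auto
      then show ?thesis using less by (simp add: mult_ac)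
    next
      case greater
      then have "\<not> u < v" "u \<noteq> v" "v \<noteq> u" by auto
      then show ?thesis using greater by (simp add: mult_ac)
    qed simp
  next
    case (Cons x xs)
    then show ?case by (simp add: mult_ac)
  qed
  show "sg (xs @ u # u # ys) = 0" by (induction xs) simp_all
qed

lemma sg_nonzero: "distinct xs \<Longrightarrow> (sg xs :: 'r::idom) \<noteq> 0"
  by (induction xs) (auto simp: prod_list_zero_iff split: if_splits)

text \<open>The exterior monomial on \<open>B\<close> as an alternating array: \<open>sg\<close> is
  the sign of the sorting permutation, and 0 on lists with repetitions.\<close>

definition theta :: "'a::linorder set \<Rightarrow> 'a list \<Rightarrow> 'r::comm_ring_1" where
  "theta B l = (if set l = B then sg l else 0)"

lemma theta_alternating: "alternating (theta B)"
proof (rule alternatingI)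
  fix xs ys :: "'a list" and u v
  have e: "set (xs @ u # v # ys) = set (xs @ v # u # ys)" by auto
  show "theta B (xs @ u # v # ys) = - theta B (xs @ v # u # ys)"
    unfolding theta_def e alternating_swap[OF sg_alternating, of xs u v ys] by simp
  show "theta B (xs @ u # u # ys) = 0"
    unfolding theta_def alternating_same[OF sg_alternating, of xs u ys] by simp
qed

lemma theta_supported: "(\<And>u. u \<in> B \<Longrightarrow> u + e \<in> G) \<Longrightarrow> supported G e (theta B)"
  unfolding supported_def theta_def by auto

lemma down_grid: "u + e \<in> grid a b \<Longrightarrow> u \<in> grid a b"
  by (cases u; cases e) (auto simp: grid_def)

lemma poly_esym: "poly (esym r qs) t = esym r (map (\<lambda>q. poly q t) qs)"
  by (induction r qs rule: esym.induct) simp_all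

lemma poly_zero_everywhere:
  fixes q :: "'a::field poly"
  assumes "infinite (UNIV :: 'a set)" "\<And>x. poly q x = 0"
  shows "q = 0"
proof (rule ccontr)
  assume "q \<noteq> 0"
  then have "finite {x. poly q x = 0}" by (rule poly_roots_finite)
  then show False using assms by simp
qed

text \<open>Along the line from \<open>C\<close> to \<open>C'\<close> both factors are polynomials in one variable.\<close>

lemma ev_product_zero:
  fixes g :: "(nat \<times> nat) list \<Rightarrow> 'l::field" and C C' :: "('l \<times> 'l) list"
  assumes inf: "infinite (UNIV :: 'l set)"
    and zero: "\<And>C. length C = n \<Longrightarrow> (\<Sum>r<p. x r * esym r (map fst C)) * ev G g C = 0"
    and C': "length C' = n" "ev G g C' \<noteq> 0" and C: "length C = n"
  shows "(\<Sum>r<p. x r * esym r (map fst C)) = 0"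
proof -
  define qs where "qs = map (\<lambda>(P, P'). ([:fst P, fst P' - fst P:], [:snd P, snd P' - snd P:])) (zip C C')"
  define H where "H = (\<Sum>r<p. [:x r:] * esym r (map fst qs))"
  define E where "E = ev G (\<lambda>is. [:g is:]) qs"
  have pH: "poly H t = (\<Sum>r<p. x r * esym r (map fst (map (\<lambda>q. (poly (fst q) t, poly (snd q) t)) qs)))" for t
    unfolding H_def by (simp add: poly_sum poly_esym comp_def)
  have pE: "poly E t = ev G g (map (\<lambda>q. (poly (fst q) t, poly (snd q) t)) qs)" for t
    unfolding E_def by (rule poly_ev)
  have len: "length (map (\<lambda>q. (poly (fst q) t, poly (snd q) t)) qs) = n" for t
    using C C'(1) by (simp add: qs_def)
  have "poly (H * E) t = 0" for t unfolding poly_mult pH pE by (rule zero[OF len])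
  then have "H * E = 0" by (rule poly_zero_everywhere[OF inf])
  moreover have "map (\<lambda>q. (poly (fst q) 1, poly (snd q) 1)) qs = C'"
    unfolding qs_def using C C'(1) by (intro nth_equalityI) auto
  then have "E \<noteq> 0" using C'(2) pE[of 1] by auto
  ultimately have "H = 0" by simp
  moreover have "map (\<lambda>q. (poly (fst q) 0, poly (snd q) 0)) qs = C"
    unfolding qs_def using C C'(1) by (intro nth_equalityI) auto
  ultimately show ?thesis using pH[of 0] by simp
qed

text \<open>A combination \<open>f\<close> of the candidate cycles that is antisymmetric in its
  first two entries; its coefficients are to be shown zero. \<open>T r\<close> combines exterior
  monomials for the first scroll. Where \<open>lam\<close> can be nonzero, the second scroll has
  \<open>a (b + 1) = p + 1\<close> columns, hence one exterior monomial of degree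
  \<open>p + 1\<close> and only a scalar \<open>lam r\<close>.\<close>

locale antisymmetric_strand =
  fixes a b p :: nat and T :: "nat \<Rightarrow> (nat \<times> nat) list \<Rightarrow> 'l::field" and lam :: "nat \<Rightarrow> 'l"
    and f :: "(nat \<times> nat) list \<Rightarrow> 'l"
  assumes inf: "infinite (UNIV :: 'l set)" and a3: "3 \<le> a"
    and altT: "\<And>r. alternating (T r)" and suppT: "\<And>r. supported (grid a b) (0, 1) (T r)"
    and lam: "p + 1 = a * b + a \<or> (\<forall>r<p. lam r = 0)"
    and f: "\<And>is. f is = (\<Sum>r<p. EN (0, 1) r (T r) is)
      + (\<Sum>r<p. lam r * EN (1, 0) r (theta ({0..<a} \<times> {0..b})) is)"
    and anti: "\<And>u v A. u \<in> grid a b \<Longrightarrow> v \<in> grid a b \<Longrightarrow> set A \<subseteq> grid a b \<Longrightarrow> length A + 1 = p \<Longrightarrow>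
      f (u # v # A) + f (v # u # A) = 0"
begin

definition g :: "(nat \<times> nat) list \<Rightarrow> 'l" where
  "g l = theta ({0..<a} \<times> {0..b}) ((0, 0) # (1, 0) # l)"

text \<open>Among the summands of \<open>f\<close> at \<open>(0, 0)\<close> and \<open>(2, 0)\<close> only those survive antisymmetrization
  that lower \<open>(2, 0)\<close> to \<open>(1, 0)\<close>.\<close>

lemma lam_es:
  assumes A: "set A \<subseteq> grid a b" "length A + 1 = p"
  shows "(\<Sum>r<p. lam r * es (1, 0) r g A) = 0"
proof -
  let ?th = "theta ({0..<a} \<times> {0..b}) :: (nat \<times> nat) list \<Rightarrow> 'l"
  have k1: "(2::nat, 0::nat) - (1, 0) = (1, 0)" "(1::nat, 0::nat) + (1, 0) = (2, 0)"
    and k3: "((0::nat, 0::nat) - (1, 0) + (1, 0) = (0, 0)) = False"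
    and k4: "((i::nat, 0::nat) - (0, 1) + (0, 1) = (i, 0)) = False" for i by simp_all
  have eT: "EN (0, 1) r (T r) ((0, 0) # (2, 0) # A) + EN (0, 1) r (T r) ((2, 0) # (0, 0) # A) = 0" for r
    unfolding EN_Cons es.simps k4 if_False es_swap[OF altT, of "(0, 1)" "Suc r" r "(0, 0)" "(2, 0)" A] by simp
  have alt: "alternating ?th" by (rule theta_alternating)
  have gdef: "(\<lambda>l. ?th ((0, 0) # (1, 0) # l)) = g" by (rule ext) (simp only: g_def)
  have eth: "EN (1, 0) r ?th ((0, 0) # (2, 0) # A) + EN (1, 0) r ?th ((2, 0) # (0, 0) # A) = es (1, 0) r g A" for r
    unfolding EN_Cons es.simps k1 k3 if_False if_P[OF refl] gdef
      es_swap[OF alt, of "(1, 0)" "Suc r" "(0, 0)" "(2, 0)" A] by simp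
  have "(0, 0) \<in> grid a b" "(2, 0) \<in> grid a b" using a3 by (simp_all add: grid_def)
  from anti[OF this A]
  have "(\<Sum>r<p. EN (0, 1) r (T r) ((0, 0) # (2, 0) # A) + EN (0, 1) r (T r) ((2, 0) # (0, 0) # A))
      + (\<Sum>r<p. lam r * (EN (1, 0) r ?th ((0, 0) # (2, 0) # A) + EN (1, 0) r ?th ((2, 0) # (0, 0) # A))) = 0"
    unfolding f sum.distrib distrib_left by (simp only: add_ac)
  then show ?thesis unfolding eT eth by simp
qed

text \<open>By \<open>lam_es\<close> the symmetric polynomial with coefficients
  \<open>lam r\<close>, times the function of \<open>g\<close>, vanishes identically. The second
  factor is not zero, so the first one is, and its coefficients are recovered from \<open>p\<close>
  distinct values.\<close>

lemma lam_zero: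
  assumes r: "r < p"
  shows "lam r = 0"
proof (cases "\<forall>r<p. lam r = 0")
  case True then show ?thesis using r by blast
next
  case False
  then have p1: "p + 1 = a * b + a" using lam by blast
  let ?F = "{0..<a} \<times> {0..b}" and ?G = "grid a b"
  have "a \<le> p + 1" using p1 by simp
  then have p2: "2 \<le> p" using a3 by linarith
  obtain l0 where l0: "set l0 = ?F - {(0, 0), (1, 0)}" "distinct l0"
    using finite_distinct_list[of "?F - {(0, 0), (1, 0)}"] by auto
  have sub: "{(0, 0), (1, 0)} \<subseteq> ?F" using a3 by auto
  have "length l0 = card (?F - {(0, 0), (1, 0)})" using l0 distinct_card by metis
  also have "\<dots> = a * (b + 1) - 2" using sub by (subst card_Diff_subset) auto
  finally have len: "length l0 + 1 = p" using p1 p2 by (simp add: algebra_simps)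
  have "set ((0, 0) # (1, 0) # l0) = {(0, 0), (1, 0)} \<union> set l0" by simp
  then have setl: "set ((0, 0) # (1, 0) # l0) = ?F" using l0(1) sub by blast
  have dl: "distinct ((0, 0) # (1, 0) # l0)" using l0(2) by (simp add: l0(1))
  have "(sg ((0, 0) # (1, 0) # l0) :: 'l) \<noteq> 0" by (rule sg_nonzero[OF dl])
  then have gl: "g l0 \<noteq> 0" unfolding g_def theta_def setl by simp
  have "\<exists>C'. length C' = p - 1 \<and> ev ?G g C' \<noteq> 0"
  proof (rule ccontr)
    assume "\<nexists>C'. length C' = p - 1 \<and> ev ?G g C' \<noteq> 0"
    then have z: "\<And>ps. length ps = p - 1 \<Longrightarrow> ev ?G g ps = 0" by blast
    have l: "length l0 = p - 1" using len by simp
    have "set l0 \<subseteq> ?F" unfolding l0(1) by blast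
    moreover have "?F \<subseteq> ?G" by (auto simp: grid_def)
    ultimately have "set l0 \<subseteq> ?G" by blast
    from ev_eq_0_imp[OF inf z l this] show False using gl by simp
  qed
  then obtain C' where C': "length C' = p - 1" "ev ?G g C' \<noteq> 0" by blast
  have supp: "supported ?G (1, 0) g"
  proof -
    have "supported ?G (1, 0) (theta ?F :: _ \<Rightarrow> 'l)" by (rule theta_supported) (auto simp: grid_def)
    then show ?thesis unfolding g_def by (intro supported_Cons)
  qed
  have prod0: "(\<Sum>r<p. lam r * esym r (map fst C)) * ev ?G g C = 0" if C: "length C = p - 1" for C
  proof -
    have d: "u \<in> ?G" if "u + (1, 0) \<in> ?G" for u using down_grid[OF that] .
    have evr: "ev ?G (es (1, 0) r g) C = esym r (map fst C) * ev ?G g C" for r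
      using ev_es[OF finite_grid d supp, of r C] by simp
    have "(\<Sum>r<p. lam r * esym r (map fst C)) * ev ?G g C = (\<Sum>r<p. lam r * ev ?G (es (1, 0) r g) C)"
      unfolding evr sum_distrib_right by (simp only: mult.assoc)
    also have "\<dots> = ev ?G (\<lambda>is. \<Sum>r<p. lam r * es (1, 0) r g is) C"
      by (simp only: ev_sum ev_smult)
    also have "\<dots> = ev ?G (\<lambda>_. 0) C"
      by (rule ev_cong) (rule lam_es, use C p2 in auto)
    finally show ?thesis by simp
  qed
  obtain Z :: "'l set" where Z: "finite Z" "card Z = p" using infinite_arbitrarily_large[OF inf] by blast
  obtain xs where xs: "set xs = Z" "distinct xs" using finite_distinct_list[OF Z(1)] by blast
  have lx: "length xs = p" using distinct_card[OF xs(2)] xs(1) Z(2) by simp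
  show ?thesis
  proof (rule esym_distinct_zero[OF xs(2)])
    fix ys y zs assume e: "xs = ys @ y # zs"
    have "length (map (\<lambda>z. (z, 0)) (ys @ zs) :: ('l \<times> 'l) list) = p - 1" using e lx by simp
    from ev_product_zero[OF inf prod0 C' this]
    have "(\<Sum>r<p. lam r * esym r (ys @ zs)) = 0" by (simp add: comp_def)
    then show "(\<Sum>r<length xs. esym r (ys @ zs) * lam r) = 0" unfolding lx by (simp only: mult.commute)
  qed (use r lx in simp)
qed

text \<open>\<open>T r\<close> changes sign when \<open>P\<close> and \<open>Q\<close> are
  exchanged, and the elementary symmetric polynomials of degree \<open>r + 1\<close> on
  \<open>P # C\<close> and \<open>Q # C\<close> differ by \<open>snd P - snd Q\<close> times the one
  of degree \<open>r\<close> on \<open>C\<close>. This common factor is cancelled.\<close>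

lemma first_syzygy:
  assumes C: "length C + 1 = p" and PQ: "snd P \<noteq> snd Q"
  shows "(\<Sum>r<p. esym r (map snd C) * ev (grid a b) (T r) (Q # P # C)) = 0"
proof -
  let ?G = "grid a b"
  have fT: "f is = (\<Sum>r<p. EN (0, 1) r (T r) is)" for "is" unfolding f using lam_zero by simp
  have evf: "ev ?G f (Q # A) = (\<Sum>r<p. esym (Suc r) (map snd A) * ev ?G (T r) (Q # A))" for Q A
  proof -
    have "f = (\<lambda>is. \<Sum>r<p. EN (0, 1) r (T r) is)" by (rule ext) (rule fT)
    then have "ev ?G f (Q # A) = (\<Sum>r<p. ev ?G (EN (0, 1) r (T r)) (Q # A))" by (simp only: ev_sum)
    then show ?thesis by (simp only: ev_EN[OF finite_grid down_grid suppT]) simp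
  qed
  have "ev ?G f (Q # P # C) + ev ?G f (P # Q # C) = 0"
  proof -
    let ?m = "\<lambda>P v. fst P ^ fst v * snd P ^ snd v"
    have "ev ?G f (P # Q # C) = (\<Sum>v\<in>?G. \<Sum>u\<in>?G. (?m P u * ?m Q v) * ev ?G (\<lambda>is. f (u # v # is)) C)"
      unfolding ev_two by (rule sum.swap)
    then have "ev ?G f (Q # P # C) + ev ?G f (P # Q # C)
        = (\<Sum>u\<in>?G. \<Sum>v\<in>?G. (?m Q u * ?m P v) * ev ?G (\<lambda>is. f (u # v # is) + f (v # u # is)) C)"
      unfolding ev_two ev_add by (simp add: sum.distrib[symmetric] algebra_simps)
    also have "\<dots> = (\<Sum>u\<in>?G. \<Sum>v\<in>?G. (?m Q u * ?m P v) * ev ?G (\<lambda>_. 0) C)"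
    proof (intro sum.cong refl arg_cong2[where f = "(*)"])
      fix u v assume "u \<in> ?G" "v \<in> ?G"
      then show "ev ?G (\<lambda>is. f (u # v # is) + f (v # u # is)) C = ev ?G (\<lambda>_. 0) C"
        by (intro ev_cong anti) (use C in auto)
    qed
    finally show ?thesis by simp
  qed
  moreover have "ev ?G (T r) (P # Q # C) = - ev ?G (T r) (Q # P # C)" for r
    by (rule alternating_swap0[OF alternating_ev[OF finite_grid altT]])
  ultimately have "(\<Sum>r<p. esym (Suc r) (map snd (P # C)) * ev ?G (T r) (Q # P # C)
      - esym (Suc r) (map snd (Q # C)) * ev ?G (T r) (Q # P # C)) = 0"
    unfolding evf by (simp add: sum_subtractf sum_negf)
  moreover have "esym (Suc r) (map snd (P # C)) * e - esym (Suc r) (map snd (Q # C)) * e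
      = (snd P - snd Q) * (esym r (map snd C) * e)" for r e
    by (simp add: algebra_simps)
  ultimately have "(snd P - snd Q) * (\<Sum>r<p. esym r (map snd C) * ev ?G (T r) (Q # P # C)) = 0"
    by (simp only: sum_distrib_left)
  then show ?thesis using PQ by simp
qed

text \<open>Taking each of the \<open>p\<close> points of \<open>A\<close> in turn as
  \<open>P\<close> gives, up to sign, \<open>p\<close> equations \<open>first_syzygy\<close> for the
  same unknowns, the values of the \<open>T r\<close> at \<open>B\<close>. Their matrix is that of
  \<open>esym_distinct_zero\<close>.\<close>

lemma T_zero:
  assumes r: "r < p" and "length is = p + 1" "set is \<subseteq> grid a b"
  shows "T r is = 0"
proof (rule ev_eq_0_imp[OF inf _ assms(2,3)])
  let ?G = "grid a b"
  fix ps :: "('l \<times> 'l) list" assume ps: "length ps = p + 1"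
  show "ev ?G (T r) ps = 0"
  proof (rule vanishing_generic[OF inf, of "{}" "{}" "p + 1"])
    fix B :: "('l \<times> 'l) list" assume B: "length B = p + 1" "distinct (map snd B)"
    obtain Q A where QA: "B = Q # A" using B(1) by (cases B) auto
    have lA: "length A = p" using B(1) QA by simp
    show "ev ?G (T r) B = 0"
    proof (rule esym_distinct_zero[of "map snd A" "\<lambda>r. ev ?G (T r) B" r])
      show "distinct (map snd A)" using B(2) QA by simp
      show "r < length (map snd A)" using r lA by simp
      fix ys y zs assume "map snd A = ys @ y # zs"
      then obtain A1 P A2 where A: "A = A1 @ P # A2" "ys = map snd A1" "y = snd P" "zs = map snd A2"
        by (auto simp: map_eq_append_conv)
      have C: "length (A1 @ A2) + 1 = p" using lA A(1) by simp
      have "snd P \<noteq> snd Q" using B(2) unfolding QA A(1) by auto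
      from first_syzygy[OF C this]
      have "(\<Sum>r<p. esym r (ys @ zs) * ev ?G (T r) (Q # P # A1 @ A2)) = 0" unfolding A by simp
      moreover have altE: "alternating (ev ?G (T r))" for r by (rule alternating_ev[OF finite_grid altT])
      have "ev ?G (T r) B = (- 1) ^ length A1 * ev ?G (T r) (Q # P # A1 @ A2)" for r
        using alternating_move[OF altE[of r], of "[Q]" A1 P A2] unfolding QA A(1) by simp
      then have "(\<Sum>r<p. esym r (ys @ zs) * ev ?G (T r) B)
          = (- 1) ^ length A1 * (\<Sum>r<p. esym r (ys @ zs) * ev ?G (T r) (Q # P # A1 @ A2))"
        by (simp only: sum_distrib_left mult_ac)
      ultimately show "(\<Sum>r<length (map snd A). esym r (ys @ zs) * ev ?G (T r) B) = 0" using lA by simp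
    qed
  next
    show "\<exists>N. polyfun N (\<lambda>z. ev ?G (T r) (xs @ (z, x) # ys))" for xs x ys
      by (rule exI) (rule polyfun_ev_z)
    show "\<exists>N. polyfun N (\<lambda>x. ev ?G (T r) (xs @ (z, x) # ys))" for xs z ys
      by (rule exI) (rule polyfun_ev_x)
  qed (use ps in simp_all)
qed

end

definition strand_index :: "nat \<Rightarrow> nat \<Rightarrow> nat \<Rightarrow> ((nat \<times> nat) \<times> nat \<times> (nat \<times> nat) set) set" where
  "strand_index a b p = {(0, 1)} \<times> {..<p} \<times> {B. B \<subseteq> {0..a} \<times> {0..<b} \<and> card B = p + 1} \<union>
     (if p + 1 = a * b + a then {(1, 0)} \<times> {..<p} \<times> {{0..<a} \<times> {0..b}} else {})"

definition strand_array :: "(nat \<times> nat) \<times> nat \<times> (nat \<times> nat) set \<Rightarrow> (nat \<times> nat) list \<Rightarrow> 'r::comm_ring_1" where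
  "strand_array = (\<lambda>(e, r, B). EN e r (theta B))"

lemma finite_strand_sets: "finite {B. B \<subseteq> {0..a::nat} \<times> {0..<b::nat} \<and> card B = p + 1}"
  by (rule finite_subset[of _ "Pow ({0..a} \<times> {0..<b})"]) auto

lemma finite_strand_index: "finite (strand_index a b p)"
  unfolding strand_index_def using finite_strand_sets[of a b p] by auto

lemma card_strand_index:
  "card (strand_index a b p) = p * (((a + 1) * b) choose (p + 1)) + (if p + 1 = a * b + a then p else 0)"
proof -
  have "card {B. B \<subseteq> {0..a} \<times> {0..<b} \<and> card B = p + 1} = (((a + 1) * b) choose (p + 1))"
    by (subst n_subsets) simp_all
  moreover have "card (strand_index a b p) = card ({(0::nat, 1::nat)} \<times> {..<p} \<times> {B. B \<subseteq> {0..a} \<times> {0..<b} \<and> card B = p + 1})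
      + card (if p + 1 = a * b + a then {(1::nat, 0::nat)} \<times> {..<p} \<times> {{0..<a} \<times> {0..b}} else {})"
    unfolding strand_index_def by (rule card_Un_disjoint) (use finite_strand_sets[of a b p] in auto)
  ultimately show ?thesis by (simp add: card_cartesian_product)
qed

lemma koszul_array_strand: "s \<in> strand_index a b p \<Longrightarrow> koszul_array a b p (strand_array s)"
proof -
  assume s: "s \<in> strand_index a b p"
  obtain e r B where erB: "s = (e, r, B)" by (cases s) auto
  have e: "e = (0, 1) \<or> e = (1, 0)" and B: "\<And>u. u \<in> B \<Longrightarrow> u + e \<in> grid a b"
    using s unfolding erB strand_index_def by (auto simp: grid_def split: if_splits)
  show ?thesis unfolding erB strand_array_def prod.case
    by (rule koszul_array_EN[OF theta_alternating theta_supported e]) (rule B)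
qed

lemma strand_index_sum:
  "(\<Sum>s\<in>strand_index a b p. h s) = (\<Sum>r<p. \<Sum>B | B \<subseteq> {0..a} \<times> {0..<b} \<and> card B = p + 1. h ((0, 1), r, B))
     + (\<Sum>r<p. if p + 1 = a * b + a then h ((1, 0), r, {0..<a} \<times> {0..b}) else 0)"
proof -
  have "(\<Sum>s\<in>strand_index a b p. h s) = (\<Sum>s\<in>{(0, 1)} \<times> {..<p} \<times> {B. B \<subseteq> {0..a} \<times> {0..<b} \<and> card B = p + 1}. h s)
     + (\<Sum>s\<in>(if p + 1 = a * b + a then {(1, 0)} \<times> {..<p} \<times> {{0..<a} \<times> {0..b}} else {}). h s)"
    unfolding strand_index_def by (rule sum.union_disjoint) (use finite_strand_sets[of a b p] in auto)
  then show ?thesis by (simp add: sum.cartesian_product')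
qed

section \<open>Extension of the ground field\<close>

text \<open>The embedding of \<open>k\<close> into \<open>k(t)\<close>, which is infinite even when
  \<open>k\<close> is finite, as the evaluation arguments require.\<close>

definition const_fract :: "'k::field \<Rightarrow> 'k poly fract" where
  "const_fract x = Fraction_Field.Fract [:x:] 1"

lemma const_fract_hom:
  shows const_fract_add: "const_fract (x + y) = const_fract x + const_fract y"
    and const_fract_mult: "const_fract (x * y) = const_fract x * const_fract y"
    and const_fract_0: "const_fract 0 = 0"
    and const_fract_1: "const_fract 1 = 1"
    and const_fract_uminus: "const_fract (- x) = - const_fract x"
  unfolding const_fract_def Zero_fract_def One_fract_def by (simp_all add: one_pCons mult.commute)

lemma const_fract_eq_0: "const_fract x = 0 \<Longrightarrow> x = 0"
  unfolding const_fract_def Zero_fract_def by (simp add: eq_fract)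

lemma const_fract_sum: "const_fract (\<Sum>i\<in>I. f i) = (\<Sum>i\<in>I. const_fract (f i))"
  by (induction I rule: infinite_finite_induct) (simp_all add: const_fract_hom)

lemma infinite_fract: "infinite (UNIV :: 'k::field poly fract set)"
proof -
  have inj: "inj (\<lambda>n. Fraction_Field.Fract (monom (1 :: 'k) n) 1)"
  proof (rule injI)
    fix m n assume "Fraction_Field.Fract (monom (1 :: 'k) m) 1 = Fraction_Field.Fract (monom 1 n) 1"
    then have "monom (1 :: 'k) m = monom 1 n" by (simp add: eq_fract)
    then show "m = n" by (metis degree_monom_eq one_neq_zero)
  qed
  show ?thesis by (rule infinite_super[OF subset_UNIV range_inj_infinite[OF inj]])
qed

lemma fract_clear_denominators:
  fixes x :: "'j \<Rightarrow> 'a::idom fract"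
  assumes "finite J"
  shows "\<exists>d q. d \<noteq> 0 \<and> (\<forall>j\<in>J. x j * Fraction_Field.Fract d 1 = Fraction_Field.Fract (q j) 1)"
proof -
  have "\<exists>n m. m \<noteq> 0 \<and> x j = Fraction_Field.Fract n m" for j by (metis Fract_cases)
  then obtain n m where nm: "\<And>j. m j \<noteq> 0" "\<And>j. x j = Fraction_Field.Fract (n j) (m j)" by metis
  let ?d = "\<Prod>j\<in>J. m j"
  have "x j * Fraction_Field.Fract ?d 1 = Fraction_Field.Fract (n j * (\<Prod>i\<in>J - {j}. m i)) 1" if "j \<in> J" for j
    unfolding nm(2) using prod.remove[OF assms that, of m] nm(1)[of j] by (simp add: eq_fract mult_ac)
  moreover have "?d \<noteq> 0" using nm(1) assms by simp
  ultimately show ?thesis by (intro exI[of _ ?d] exI[of _ "\<lambda>j. n j * (\<Prod>i\<in>J - {j}. m i)"]) auto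
qed

text \<open>A relation over the extension field has coefficients in the ground field among its
  polynomial coefficients, after clearing denominators.\<close>

lemma relation_descends:
  fixes x :: "'j \<Rightarrow> 'k::field poly fract"
  assumes fin: "finite J" and j0: "j0 \<in> J" "x j0 \<noteq> 0"
  shows "\<exists>\<alpha>. \<alpha> j0 \<noteq> 0 \<and> (\<forall>c. (\<Sum>j\<in>J. x j * const_fract (c j)) = 0 \<longrightarrow> (\<Sum>j\<in>J. \<alpha> j * c j) = 0)"
proof -
  obtain d q where d: "d \<noteq> 0" and q: "\<And>j. j \<in> J \<Longrightarrow> x j * Fraction_Field.Fract d 1 = Fraction_Field.Fract (q j) 1"
    using fract_clear_denominators[OF fin, of x] by blast
  have "Fraction_Field.Fract d 1 \<noteq> 0" using d by (simp add: Zero_fract_def eq_fract)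
  then have "Fraction_Field.Fract (q j0) 1 \<noteq> 0" using q[OF j0(1)] j0(2) by (metis mult_eq_0_iff)
  then have q0: "q j0 \<noteq> 0" by (auto simp: Zero_fract_def)
  \<comment> \<open>The coefficients at \<open>t^i\<close> form the relation over the ground field;
    with the degree of \<open>q j0\<close> for \<open>i\<close> the coefficient at \<open>j0\<close>
    is not zero.\<close>
  define i where "i = degree (q j0)"
  have S: "(\<Sum>j\<in>J. Fraction_Field.Fract (y j) 1) = Fraction_Field.Fract (\<Sum>j\<in>J. y j) 1" for y :: "'j \<Rightarrow> 'k poly"
    using fin by (induction J rule: finite_induct) (simp_all add: Zero_fract_def)
  have "(\<Sum>j\<in>J. coeff (q j) i * c j) = 0" if z: "(\<Sum>j\<in>J. x j * const_fract (c j)) = 0" for c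
  proof -
    have "0 = (\<Sum>j\<in>J. x j * const_fract (c j)) * Fraction_Field.Fract d 1" unfolding z by simp
    also have "\<dots> = (\<Sum>j\<in>J. (x j * Fraction_Field.Fract d 1) * const_fract (c j))"
      unfolding sum_distrib_right by (intro sum.cong refl) (simp only: mult_ac)
    also have "\<dots> = (\<Sum>j\<in>J. Fraction_Field.Fract (smult (c j) (q j)) 1)"
      by (intro sum.cong refl) (simp add: q const_fract_def mult.commute)
    finally have "(\<Sum>j\<in>J. smult (c j) (q j)) = 0" unfolding S by (simp add: Zero_fract_def eq_fract)
    then have "coeff (\<Sum>j\<in>J. smult (c j) (q j)) i = 0" by simp
    then show ?thesis by (simp add: coeff_sum mult.commute)
  qed
  moreover have "coeff (q j0) i \<noteq> 0" unfolding i_def using q0 by simp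
  ultimately show ?thesis by (intro exI[of _ "\<lambda>j. coeff (q j) i"]) auto
qed

lemma es_hom:
  assumes "\<And>x y. h (x + y) = h x + h y" "h 0 = 0"
  shows "h (es e r g is) = es e r (\<lambda>l. h (g l)) is"
  by (induction e r g "is" rule: es.induct) (simp_all add: assms)

lemma sg_const_fract:
  fixes xs :: "'a::linorder list"
  shows "const_fract (sg xs :: 'k::field) = sg xs"
proof (induction xs)
  case Nil then show ?case by (simp add: const_fract_hom)
next
  case (Cons x xs)
  have "const_fract (\<Prod>y\<leftarrow>l. if y < x then - 1 else if y = x then 0 else 1 :: 'k)
      = (\<Prod>y\<leftarrow>l. if y < x then - 1 else if y = x then 0 else 1)" for l
    by (induction l) (simp_all add: const_fract_hom)
  from this[of xs] show ?case by (simp add: const_fract_mult Cons)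
qed

lemma strand_array_const_fract: "const_fract (strand_array s is) = strand_array s is"
proof (cases "is")
  case Nil then show ?thesis by (cases s) (simp add: strand_array_def EN_def const_fract_0)
next
  case (Cons w B)
  have th: "const_fract (theta B l) = theta B l" for B and l :: "(nat \<times> nat) list"
    by (simp add: theta_def sg_const_fract const_fract_0)
  obtain e r D where s: "s = (e, r, D)" by (cases s) auto
  show ?thesis unfolding s strand_array_def prod.case Cons EN_Cons
    by (subst es_hom[of const_fract, OF const_fract_add const_fract_0]) (simp only: th)
qed

lemma strand_arrays_independent:
  fixes \<mu> :: "(nat \<times> nat) \<times> nat \<times> (nat \<times> nat) set \<Rightarrow> 'k::field"
  assumes a3: "3 \<le> a"
    and anti: "\<And>u v A. u \<in> grid a b \<Longrightarrow> v \<in> grid a b \<Longrightarrow> set A \<subseteq> grid a b \<Longrightarrow> length A + 1 = p \<Longrightarrow>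
      (\<Sum>s\<in>strand_index a b p. \<mu> s * strand_array s (u # v # A))
      + (\<Sum>s\<in>strand_index a b p. \<mu> s * strand_array s (v # u # A)) = 0"
    and s: "s \<in> strand_index a b p"
  shows "\<mu> s = 0"
proof -
  let ?h = "const_fract :: 'k \<Rightarrow> 'k poly fract" and ?F = "{0..<a} \<times> {0..b}"
  let ?B = "{B. B \<subseteq> {0..a} \<times> {0..<b} \<and> card B = p + 1}"
  define T where "T = (\<lambda>r l. \<Sum>B\<in>?B. ?h (\<mu> ((0, 1), r, B)) * theta B l)"
  define lam where "lam r = (if p + 1 = a * b + a then ?h (\<mu> ((1, 0), r, ?F)) else 0)" for r
  define f where "f is = (\<Sum>r<p. EN (0, 1) r (T r) is) + (\<Sum>r<p. lam r * EN (1, 0) r (theta ?F) is)" for "is"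
  have f_eq: "f is = ?h (\<Sum>s\<in>strand_index a b p. \<mu> s * strand_array s is)" for "is"
  proof -
    have e1: "EN (0, 1) r (T r) is = (\<Sum>B\<in>?B. ?h (\<mu> ((0, 1), r, B)) * EN (0, 1) r (theta B) is)" for r
      unfolding T_def by (rule EN_sum_smult)
    have e2: "lam r * EN (1, 0) r (theta ?F) is
        = (if p + 1 = a * b + a then ?h (\<mu> ((1, 0), r, ?F)) * EN (1, 0) r (theta ?F) is else 0)" for r
      unfolding lam_def by simp
    have "?h (\<Sum>s\<in>strand_index a b p. \<mu> s * strand_array s is)
        = (\<Sum>s\<in>strand_index a b p. ?h (\<mu> s) * strand_array s is)"
      by (simp only: const_fract_sum const_fract_mult strand_array_const_fract)
    also have "\<dots> = f is"
      unfolding strand_index_sum f_def e1 e2 strand_array_def prod.case ..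
    finally show ?thesis ..
  qed
  interpret antisymmetric_strand a b p T lam f
  proof
    show "infinite (UNIV :: 'k poly fract set)" by (rule infinite_fract)
    show "alternating (T r)" for r
      unfolding T_def by (rule alternating_sum_smult) (rule theta_alternating)
    show "supported (grid a b) (0, 1) (T r)" for r
      unfolding supported_def T_def
    proof (intro allI impI sum.neutral ballI)
      fix l B and u :: "nat \<times> nat" assume u: "u \<in> set l" "u + (0, 1) \<notin> grid a b" and B: "B \<in> ?B"
      have "supported (grid a b) (0, 1) (theta B :: _ \<Rightarrow> 'k poly fract)"
        by (rule theta_supported) (use B in \<open>auto simp: grid_def\<close>)
      from supportedD[OF this u(2,1)] show "?h (\<mu> ((0, 1), r, B)) * theta B l = 0" by simp
    qed
    show "p + 1 = a * b + a \<or> (\<forall>r<p. lam r = 0)" unfolding lam_def by auto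
    show "f (u # v # A) + f (v # u # A) = 0"
      if "u \<in> grid a b" "v \<in> grid a b" "set A \<subseteq> grid a b" "length A + 1 = p" for u v A
      unfolding f_eq const_fract_add[symmetric] anti[OF that] by (rule const_fract_0)
  qed (use a3 in \<open>simp_all add: f_def\<close>)
  consider (EN) r B where "s = ((0, 1), r, B)" "r < p" "B \<in> ?B"
    | (extra) r where "s = ((1, 0), r, ?F)" "r < p" "p + 1 = a * b + a"
    using s unfolding strand_index_def by (auto split: if_splits)
  then show ?thesis
  proof cases
    case EN
    have "finite B" using EN(3) by (auto intro: finite_subset[of _ "{0..a} \<times> {0..<b}"])
    then obtain l where l: "set l = B" "distinct l" using finite_distinct_list by blast
    have "length l = p + 1" using l EN(3) distinct_card[OF l(2)] by simp
    moreover have "set l \<subseteq> grid a b" using l EN(3) by (auto simp: grid_def)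
    ultimately have "T r l = 0" by (rule T_zero[OF EN(2)])
    moreover have "T r l = (\<Sum>B'\<in>?B. if B' = B then ?h (\<mu> ((0, 1), r, B)) * sg l else 0)"
      unfolding T_def by (intro sum.cong refl) (auto simp: theta_def l(1))
    then have "T r l = ?h (\<mu> ((0, 1), r, B)) * sg l"
      using EN(3) finite_strand_sets[of a b p] by (simp add: sum.delta)
    moreover have "(sg l :: 'k poly fract) \<noteq> 0" by (rule sg_nonzero[OF l(2)])
    ultimately have "?h (\<mu> ((0, 1), r, B)) = 0" by simp
    then show ?thesis unfolding EN(1) by (rule const_fract_eq_0)
  next
    case extra
    have "lam r = 0" by (rule lam_zero[OF extra(2)])
    then show ?thesis unfolding lam_def extra(1) using extra(3) const_fract_eq_0 by simp
  qed
qed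

section \<open>Comparison of the two bounds\<close>

lemma koszul_array_lincomb:
  assumes "\<And>j. j \<in> I \<Longrightarrow> koszul_array a b p (c j)"
  shows "koszul_array a b p (\<lambda>is. \<Sum>j\<in>I. x j * c j is)"
  unfolding koszul_array_def
proof (intro conjI allI impI)
  show "alternating (\<lambda>is. \<Sum>j\<in>I. x j * c j (w # is))" for w
  proof (rule alternating_sum_smult)
    fix j assume "j \<in> I"
    from assms[OF this] show "alternating (\<lambda>is. c j (w # is))" unfolding koszul_array_def by blast
  qed
next
  fix s A assume A: "set A \<subseteq> grid a b" "length A + 1 = p"
  have "(\<Sum>w\<in>grid a b. \<Sum>v\<in>grid a b. if w + v = s then \<Sum>j\<in>I. x j * c j (w # v # A) else 0)
      = (\<Sum>w\<in>grid a b. \<Sum>v\<in>grid a b. \<Sum>j\<in>I. x j * (if w + v = s then c j (w # v # A) else 0))"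
    by (intro sum.cong refl) simp
  also have "\<dots> = (\<Sum>w\<in>grid a b. \<Sum>j\<in>I. \<Sum>v\<in>grid a b. x j * (if w + v = s then c j (w # v # A) else 0))"
    by (intro sum.cong refl) (rule sum.swap)
  also have "\<dots> = (\<Sum>j\<in>I. \<Sum>w\<in>grid a b. \<Sum>v\<in>grid a b. x j * (if w + v = s then c j (w # v # A) else 0))"
    by (rule sum.swap)
  also have "\<dots> = (\<Sum>j\<in>I. x j * (\<Sum>w\<in>grid a b. \<Sum>v\<in>grid a b. if w + v = s then c j (w # v # A) else 0))"
    by (simp only: sum_distrib_left)
  also have "\<dots> = 0" using koszul_arrayD[OF assms A] by (intro sum.neutral) simp
  finally show "(\<Sum>w\<in>grid a b. \<Sum>v\<in>grid a b. if w + v = s then \<Sum>j\<in>I. x j * c j (w # v # A) else 0) = 0" .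
qed

lemma koszul_array_const_fract:
  assumes "koszul_array a b p c"
  shows "koszul_array a b p (\<lambda>is. const_fract (c is))"
  unfolding koszul_array_def
proof (intro conjI allI impI)
  fix w
  have alt: "alternating (\<lambda>is. c (w # is))" using assms unfolding koszul_array_def by blast
  show "alternating (\<lambda>is. const_fract (c (w # is)))"
  proof (rule alternatingI)
    fix xs u v ys
    show "const_fract (c (w # xs @ u # v # ys)) = - const_fract (c (w # xs @ v # u # ys))"
      unfolding alternating_swap[OF alt, of xs u v ys] by (rule const_fract_uminus)
    show "const_fract (c (w # xs @ u # u # ys)) = 0"
      unfolding alternating_same[OF alt, of xs u ys] by (rule const_fract_0)
  qed
next
  fix s A assume A: "set A \<subseteq> grid a b" "length A + 1 = p"
  have "(if w + v = s then const_fract (c (w # v # A)) else 0) = const_fract (if w + v = s then c (w # v # A) else 0)" for w v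
    by (simp add: const_fract_0)
  then show "(\<Sum>w\<in>grid a b. \<Sum>v\<in>grid a b. if w + v = s then const_fract (c (w # v # A)) else 0) = 0"
    by (simp only: const_fract_sum[symmetric] koszul_arrayD[OF assms A] const_fract_0)
qed

lemma lookup_coord_eval_quadric:
  fixes B :: "nat \<times> nat \<Rightarrow> nat \<times> nat \<Rightarrow> 'k::field"
  shows "Poly_Mapping.lookup (coord_eval (\<Sum>v\<in>V. \<Sum>w\<in>V. Cst (B v w) * Var v * Var w)) (n, i, j)
    = (if n = 2 then \<Sum>v\<in>V. \<Sum>w\<in>V. if v + w = (i, j) then B v w else 0 else 0)"
proof -
  have e: "Cst x * Var v * Var w = Poly_Mapping.single (var1 v + var1 w) x" for x :: 'k and v w :: "nat \<times> nat"
    unfolding Cst_def Var_def by (simp add: mult_single)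
  have w: "wt (var1 v + var1 w) = (2, fst (v + w), snd (v + w))" for v w
    unfolding wt_add wt_var1 by (simp add: numeral_2_eq_2 prod_eq_iff)
  have "Poly_Mapping.lookup (coord_eval (\<Sum>v\<in>V. \<Sum>w\<in>V. Cst (B v w) * Var v * Var w)) (n, i, j)
      = (\<Sum>v\<in>V. \<Sum>w\<in>V. if (2, fst (v + w), snd (v + w)) = (n, i, j) then B v w else 0)"
    unfolding e coord_eval_sum coord_eval_single lookup_sum lookup_single w when_def ..
  also have "\<dots> = (\<Sum>v\<in>V. \<Sum>w\<in>V. if n = 2 \<and> v + w = (i, j) then B v w else 0)"
    by (intro sum.cong refl if_cong) (auto simp: prod_eq_iff)
  finally show ?thesis by (cases "n = 2") simp_all
qed

section \<open>The two inequalities for the number of generators in the first row\<close>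

context resolution
begin

text \<open>Each strand array gives an alternating family of quadrics \<open>t s\<close>, hence by
  \<open>comb_surj\<close> a vector over \<open>J p\<close>. With more arrays than generators some
  nontrivial combination would give zero quadrics and be antisymmetric in its first two entries,
  against \<open>strand_arrays_independent\<close>.\<close>

lemma lower_bound:
  assumes a3: "3 \<le> a" and p: "p = n + 1"
  shows "card (strand_index a b p) \<le> card (J p)"
proof (rule ccontr)
  let ?S = "strand_index a b p"
  assume "\<not> card ?S \<le> card (J p)"
  then have less: "card (J p) < card ?S" by simp
  interpret S: linear_strand V J Dc "\<lambda>j. D 0 j 0" I2 by (rule strand)
  define f where "f s = (strand_array s :: (nat \<times> nat) list \<Rightarrow> 'k)" for s
  define t where "t s A = (\<Sum>v\<in>V. \<Sum>w\<in>V. Cst (f s (w # v # A)) * Var v * Var w)" for s A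
  have ka: "koszul_array a b p (f s)" if "s \<in> ?S" for s unfolding f_def by (rule koszul_array_strand[OF that])
  have alt: "alternating (\<lambda>is. f s (w # is))" if "s \<in> ?S" for s w
    using ka[OF that] unfolding koszul_array_def by blast
  have "\<exists>\<alpha>. \<forall>A. set A \<subseteq> V \<longrightarrow> length A = n \<longrightarrow> S.comb (n + 1) \<alpha> A = t s A" if s: "s \<in> ?S" for s
  proof (rule S.comb_surj)
    note alt2 = alternating_Cons[OF alt[OF s]]
    show "alternating (t s)"
    proof (rule alternatingI)
      fix xs u v ys
      have "f s (w # x # xs @ u # v # ys) = - f s (w # x # xs @ v # u # ys)" for w x
        by (rule alternating_swap[OF alt2])
      then show "t s (xs @ u # v # ys) = - t s (xs @ v # u # ys)" unfolding t_def by (simp add: sum_negf)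
      have "f s (w # x # xs @ u # u # ys) = 0" for w x by (rule alternating_same[OF alt2])
      then show "t s (xs @ u # u # ys) = 0" unfolding t_def by simp
    qed
    show "t s A \<in> I2" if A: "set A \<subseteq> V" "length A = n" for A
    proof -
      have ce: "coord_eval (t s A) = 0"
      proof (rule poly_mapping_eqI)
        fix z :: "nat \<times> nat \<times> nat"
        obtain m i j where z: "z = (m, i, j)" by (cases z) auto
        have "(\<Sum>v\<in>V. \<Sum>w\<in>V. if v + w = (i, j) then f s (w # v # A) else 0)
            = (\<Sum>w\<in>V. \<Sum>v\<in>V. if w + v = (i, j) then f s (w # v # A) else 0)"
          by (subst sum.swap) (simp only: add.commute)
        also have "\<dots> = 0" by (rule koszul_arrayD[OF ka[OF s] A(1)]) (simp add: A(2) p)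
        finally show "Poly_Mapping.lookup (coord_eval (t s A)) z = Poly_Mapping.lookup 0 z"
          unfolding t_def z lookup_coord_eval_quadric by simp
      qed
      have "t s A \<in> poly_component V 2" unfolding t_def by (rule quadric_component[OF finV])
      then show ?thesis unfolding I2_def using ce by simp
    qed
    show "(\<Sum>u\<in>V. Var u * t s (A @ [u])) = 0" for A
    proof -
      have sw: "f s (w # v # A @ [u]) = - f s (w # u # A @ [v])" for w u v
        using alternating_move[OF alt[OF s], of w "[v]" A u "[]"] alternating_move[OF alt[OF s], of w "[u]" A v "[]"]
          alternating_swap0[OF alt[OF s], of w v u A] by simp
      have z: "f s (w # u # A @ [u]) = 0" for w u
        by (rule alternating_not_distinct[OF alt[OF s]]) simp
      have "(\<Sum>u\<in>V. \<Sum>v\<in>V. Var u * (\<Sum>w\<in>V. Cst (f s (w # v # A @ [u])) * Var v * Var w)) = 0"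
      proof (rule sum_alternating_pairs[OF finV])
        fix u v :: "nat \<times> nat"
        show "Var u * (\<Sum>w\<in>V. Cst (f s (w # v # A @ [u])) * Var v * Var w)
            = - (Var v * (\<Sum>w\<in>V. Cst (f s (w # u # A @ [v])) * Var u * Var w))"
          unfolding sw[of _ v u] by (simp add: sum_distrib_left sum_negf mult_ac)
        show "Var u * (\<Sum>w\<in>V. Cst (f s (w # u # A @ [u])) * Var u * Var w) = 0" by (simp add: z)
      qed
      then show ?thesis unfolding t_def by (simp only: sum_distrib_left)
    qed
  qed
  then have "\<forall>s\<in>?S. \<exists>\<alpha>. \<forall>A. set A \<subseteq> V \<longrightarrow> length A = n \<longrightarrow> S.comb (n + 1) \<alpha> A = t s A" by blast
  from bchoice[OF this] obtain \<alpha> where \<alpha>: "\<And>s A. s \<in> ?S \<Longrightarrow> set A \<subseteq> V \<Longrightarrow> length A = n \<Longrightarrow>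
      S.comb (n + 1) (\<alpha> s) A = t s A" by blast
  obtain \<mu> where \<mu>: "\<exists>s\<in>?S. \<mu> s \<noteq> 0" "\<And>i. i \<in> J p \<Longrightarrow> (\<Sum>s\<in>?S. \<alpha> s i * \<mu> s) = 0"
    using homogeneous_system[OF finJ finite_strand_index less, of "\<lambda>i s. \<alpha> s i"] by blast
  define B where "B A v w = (\<Sum>s\<in>?S. \<mu> s * f s (w # v # A))" for A v w
  have z: "(\<Sum>v\<in>V. \<Sum>w\<in>V. Cst (B A v w) * Var v * Var w) = 0" if A: "set A \<subseteq> V" "length A = n" for A
  proof -
    have "(\<Sum>v\<in>V. \<Sum>w\<in>V. Cst (B A v w) * Var v * Var w)
        = (\<Sum>v\<in>V. \<Sum>w\<in>V. \<Sum>s\<in>?S. Cst (\<mu> s) * (Cst (f s (w # v # A)) * Var v * Var w))"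
      unfolding B_def Cst_sum sum_distrib_right by (simp add: mult.assoc)
    also have "\<dots> = (\<Sum>v\<in>V. \<Sum>s\<in>?S. \<Sum>w\<in>V. Cst (\<mu> s) * (Cst (f s (w # v # A)) * Var v * Var w))"
      by (rule sum.cong[OF refl]) (rule sum.swap)
    also have "\<dots> = (\<Sum>s\<in>?S. \<Sum>v\<in>V. \<Sum>w\<in>V. Cst (\<mu> s) * (Cst (f s (w # v # A)) * Var v * Var w))"
      by (rule sum.swap)
    also have "\<dots> = (\<Sum>s\<in>?S. Cst (\<mu> s) * S.comb (n + 1) (\<alpha> s) A)"
      by (rule sum.cong[OF refl]) (simp only: \<alpha> A t_def sum_distrib_left)
    also have "\<dots> = (\<Sum>s\<in>?S. \<Sum>j\<in>J p. Cst (\<alpha> s j * \<mu> s) * S.ts A j)"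
      unfolding S.comb_def p sum_distrib_left by (intro sum.cong refl) (simp add: mult_ac)
    also have "\<dots> = (\<Sum>j\<in>J p. \<Sum>s\<in>?S. Cst (\<alpha> s j * \<mu> s) * S.ts A j)" by (rule sum.swap)
    also have "\<dots> = (\<Sum>j\<in>J p. Cst (\<Sum>s\<in>?S. \<alpha> s j * \<mu> s) * S.ts A j)"
      by (simp only: Cst_sum sum_distrib_right)
    also have "\<dots> = 0" by (rule sum.neutral) (simp add: \<mu>(2))
    finally show ?thesis .
  qed
  have "\<mu> s = 0" if "s \<in> ?S" for s
  proof (rule strand_arrays_independent[OF a3 _ that])
    fix u v A assume uv: "u \<in> V" "v \<in> V" and A: "set A \<subseteq> V" "length A + 1 = p"
    have "B A v u + B A u v = 0" by (rule quadric_alternating(1)[OF finV z uv(2,1)]) (use A p in auto)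
    then show "(\<Sum>s\<in>?S. \<mu> s * strand_array s (u # v # A)) + (\<Sum>s\<in>?S. \<mu> s * strand_array s (v # u # A)) = 0"
      unfolding B_def f_def .
  qed
  then show False using \<mu>(1) by blast
qed

text \<open>Each generator gives a family of quadrics, which \<open>lift\<close> turns into a Koszul
  array. With more generators than tests, some nontrivial combination over \<open>k(t)\<close> would
  pass all tests and so be a trivial cycle. A relation over \<open>k\<close> extracted from it makes
  the quadrics vanish, against \<open>comb_inj\<close>.\<close>

lemma upper_bound:
  assumes a3: "3 \<le> a" and b: "0 < b" and p: "p = n + 1" and large: "a * b + a \<le> p + 1"
  shows "card (J p) \<le> p * (((a + 1) * b) choose (p + 1)) + (if p + 1 = a * b + a then p else 0)"
proof (rule ccontr)
  assume not: "\<not> ?thesis"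
  interpret S: linear_strand V J Dc "\<lambda>j. D 0 j 0" I2 by (rule strand)
  let ?h = "const_fract :: 'k \<Rightarrow> 'k poly fract"
  \<comment> \<open>The family is set to 0 on all other lists because \<open>lift_eq\<close> asks
    for alternation, the component and the Koszul condition on every list.\<close>
  define t where "t j A = (if set A \<subseteq> V \<and> length A = n then S.ts A j else 0)" for j A
  have I2_comp: "q \<in> I2 \<Longrightarrow> q \<in> poly_component V 2" for q unfolding I2_def by blast
  have zero_comp: "(0 :: (nat \<times> nat \<Rightarrow>\<^sub>0 nat) \<Rightarrow>\<^sub>0 'k) \<in> poly_component V 2" by (simp add: poly_component_def)
  have tsI2: "S.ts A j \<in> I2" if "length A = n" "j \<in> J p" for A j
  proof -
    have "S.comb (length A + 1) (\<lambda>i. if i = j then 1 else 0) A = (\<Sum>i\<in>J p. if i = j then S.ts A j else 0)"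
      unfolding S.comb_def that(1) p by (intro sum.cong refl) auto
    also have "\<dots> = S.ts A j" using that(2) finJ[of p] by simp
    finally show ?thesis using S.comb_I2[of A "\<lambda>i. if i = j then 1 else 0"] by simp
  qed
  have tcomp: "t j A \<in> poly_component V 2" if "j \<in> J p" for j A
    unfolding t_def using zero_comp I2_comp[OF tsI2[OF _ that]] by auto
  have talt: "alternating (t j)" if j: "j \<in> J p" for j
  proof (rule alternatingI)
    fix xs ys :: "(nat \<times> nat) list" and u v
    have c: "set (xs @ u # v # ys) = set (xs @ v # u # ys)" "length (xs @ u # v # ys) = length (xs @ v # u # ys)" by auto
    show "t j (xs @ u # v # ys) = - t j (xs @ v # u # ys)"
    proof (cases "set (xs @ v # u # ys) \<subseteq> V \<and> length (xs @ v # u # ys) = n")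
      case True
      have "j \<in> J (length (xs @ u # v # ys) + 1)" unfolding c(2) using True j p by simp
      from S.ts_alternating(1)[OF this] show ?thesis unfolding t_def c if_P[OF True] .
    next
      case False
      show ?thesis unfolding t_def c if_not_P[OF False] by simp
    qed
    show "t j (xs @ u # u # ys) = 0"
    proof (cases "set (xs @ u # u # ys) \<subseteq> V \<and> length (xs @ u # u # ys) = n")
      case True
      then have "j \<in> J (length (xs @ u # u # ys) + 1)" using j p by simp
      from S.ts_alternating(2)[OF this] show ?thesis unfolding t_def by simp
    next
      case False
      show ?thesis unfolding t_def if_not_P[OF False] ..
    qed
  qed
  have tcyc: "(\<Sum>u\<in>V. Var u * t j (u # A)) = 0" if j: "j \<in> J p" for j A
  proof (cases "set A \<subseteq> V \<and> length A + 1 = n")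
    case True
    have "Var u * t j (u # A) = (- 1) ^ length A * (Var u * S.ts (A @ [u]) j)" if "u \<in> V" for u
    proof -
      have "t j (A @ [u]) = (- 1) ^ length A * t j (u # A)" using alternating_move0[OF talt[OF j], of A u "[]"] by simp
      then have "(- 1) ^ length A * t j (A @ [u]) = ((- 1) ^ length A * (- 1) ^ length A) * t j (u # A)"
        by (simp only: mult.assoc)
      also have "(- 1) ^ length A * (- 1) ^ length A = (1 :: (nat \<times> nat \<Rightarrow>\<^sub>0 nat) \<Rightarrow>\<^sub>0 'k)"
        by (simp add: power_mult_distrib[symmetric])
      finally have "t j (u # A) = (- 1) ^ length A * t j (A @ [u])" by simp
      moreover have "t j (A @ [u]) = S.ts (A @ [u]) j" unfolding t_def using True that by simp
      ultimately show ?thesis by (simp only: mult_ac)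
    qed
    then have "(\<Sum>u\<in>V. Var u * t j (u # A)) = (- 1) ^ length A * (\<Sum>u\<in>V. Var u * S.ts (A @ [u]) j)"
      unfolding sum_distrib_left by (intro sum.cong refl) blast
    moreover have "(\<Sum>u\<in>V. Var u * S.ts (A @ [u]) j) = 0"
      by (rule S.ts_cycle) (use True j p in auto)
    ultimately show ?thesis by simp
  next
    case False
    then have "t j (u # A) = 0" for u unfolding t_def by auto
    then show ?thesis by simp
  qed
  define f where "f j = lift (t j)" for j
  have feq: "(\<Sum>v\<in>V. \<Sum>w\<in>V. Cst (f j (w # v # A)) * Var v * Var w) = t j A" if "j \<in> J p" "set A \<subseteq> V" for j A
    unfolding f_def by (rule lift_eq[OF finV talt[OF that(1)] tcomp[OF that(1)] tcyc[OF that(1)] that(2)])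
  have kf: "koszul_array a b p (f j)" if j: "j \<in> J p" for j
    unfolding koszul_array_def
  proof (intro conjI allI impI)
    show "alternating (\<lambda>is. f j (w # is))" for w unfolding f_def by (rule lift_alternating[OF talt[OF j]])
  next
    fix s A assume A: "set A \<subseteq> V" "length A + 1 = p"
    have "t j A \<in> I2" unfolding t_def using A p tsI2[OF _ j] by simp
    then have "Poly_Mapping.lookup (coord_eval (t j A)) (2, fst s, snd s) = 0" unfolding I2_def by simp
    then have "(\<Sum>v\<in>V. \<Sum>w\<in>V. if v + w = s then f j (w # v # A) else 0) = 0"
      unfolding feq[OF j A(1), symmetric] lookup_coord_eval_quadric by simp
    then show "(\<Sum>w\<in>V. \<Sum>v\<in>V. if w + v = s then f j (w # v # A) else 0) = 0"
      by (subst sum.swap) (simp only: add.commute)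
  qed
  from test_points[OF infinite_fract a3 b large]
  obtain Tr :: "(('k poly fract \<times> 'k poly fract) \<times> ('k poly fract \<times> 'k poly fract) \<times> ('k poly fract \<times> 'k poly fract) list) set"
    where Tr: "finite Tr \<and> card Tr \<le> p * (((a + 1) * b) choose (p + 1)) + (if p + 1 = a * b + a then p else 0) \<and>
      (\<forall>c. koszul_array a b p c \<longrightarrow> (\<forall>\<tau>\<in>Tr. defect a b c \<tau> = 0) \<longrightarrow>
        (\<forall>P Q A. length A + 1 = p \<longrightarrow> defect a b c (P, Q, A) = 0))" ..
  note Tr3 = Tr[THEN conjunct2, THEN conjunct2, THEN spec, THEN mp, THEN mp, THEN spec, THEN spec, THEN spec, THEN mp]
  have "card Tr < card (J p)" using Tr[THEN conjunct2, THEN conjunct1] not by linarith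
  from homogeneous_system[OF Tr[THEN conjunct1] finJ this, of "\<lambda>\<tau> j. defect a b (\<lambda>is. ?h (f j is)) \<tau>"]
  obtain x where x0: "(\<exists>j\<in>J p. x j \<noteq> 0) \<and> (\<forall>\<tau>\<in>Tr. (\<Sum>j\<in>J p. defect a b (\<lambda>is. ?h (f j is)) \<tau> * x j) = 0)" ..
  note x = x0[THEN conjunct2, rule_format]
  from x0 obtain j0 where j0: "j0 \<in> J p" "x j0 \<noteq> 0" by blast
  define c where "c = (\<lambda>is. \<Sum>j\<in>J p. x j * ?h (f j is))"
  have kc: "koszul_array a b p c"
    unfolding c_def by (rule koszul_array_lincomb) (rule koszul_array_const_fract[OF kf])
  have "\<forall>\<tau>\<in>Tr. defect a b c \<tau> = 0" unfolding c_def defect_sum using x by blast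
  note triv = defect_zero_imp[OF infinite_fract kc Tr3[OF kc this]]
  \<comment> \<open>One \<open>\<alpha>\<close> serves all relations with values in \<open>k\<close>
    at once, that is, all lists \<open>A\<close> and all monomials.\<close>
  obtain \<alpha> where \<alpha>: "\<alpha> j0 \<noteq> 0"
    "\<And>y. (\<Sum>j\<in>J p. x j * ?h (y j)) = 0 \<Longrightarrow> (\<Sum>j\<in>J p. \<alpha> j * y j) = 0"
    using relation_descends[OF finJ[of p] j0(1), of x, OF j0(2)] by blast
  have "S.comb (n + 1) \<alpha> A = 0" if A: "set A \<subseteq> V" "length A = n" for A
  proof (rule poly_component_2_eqI[OF _ zero_comp])
    show "S.comb (n + 1) \<alpha> A \<in> poly_component V 2" using I2_comp[OF S.comb_I2[of A \<alpha>]] A(2) by simp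
    fix u v assume uv: "u \<in> V" "v \<in> V"
    have A1: "length A + 1 = p" using A(2) p by simp
    have look: "Poly_Mapping.lookup (t j A) (var1 u + var1 v) = (if u = v then f j (u # u # A) else f j (v # u # A) + f j (u # v # A))"
      if "j \<in> J p" for j
      unfolding feq[OF that A(1), symmetric] by (rule lookup_quadric[OF finV uv])
    have "(\<Sum>j\<in>J p. \<alpha> j * (if u = v then f j (u # u # A) else f j (v # u # A) + f j (u # v # A))) = 0"
    proof (rule \<alpha>(2), cases "u = v")
      case True
      then show "(\<Sum>j\<in>J p. x j * ?h (if u = v then f j (u # u # A) else f j (v # u # A) + f j (u # v # A))) = 0"
        using triv(2)[OF _ A1 A(1) uv(1) uv(1)] unfolding c_def by simp
    next
      case False
      then show "(\<Sum>j\<in>J p. x j * ?h (if u = v then f j (u # u # A) else f j (v # u # A) + f j (u # v # A))) = 0"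
        using triv(1)[OF _ A1 A(1) uv(2) uv(1)] unfolding c_def
        by (simp add: const_fract_add distrib_left sum.distrib)
    qed
    then have "(\<Sum>j\<in>J p. \<alpha> j * Poly_Mapping.lookup (t j A) (var1 u + var1 v)) = 0" by (simp only: look cong: sum.cong)
    moreover have "t j A = S.ts A j" for j unfolding t_def using A by simp
    ultimately show "Poly_Mapping.lookup (S.comb (n + 1) \<alpha> A) (var1 u + var1 v) = Poly_Mapping.lookup 0 (var1 u + var1 v)"
      unfolding S.comb_def lookup_sum lookup_Cst_mult p by simp
  qed
  from S.comb_inj[OF this] show False using \<alpha>(1) j0(1) p by blast
qed

lemma betti_first_row:
  assumes "3 \<le> a" "0 < b" "a * b + a \<le> p + 1"
  shows "betti_entry e p 1 = p * (((a + 1) * b) choose (p + 1)) + (if p + 1 = a * b + a then p else 0)"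
proof -
  have "p = (p - 1) + 1" using assms by (cases p) auto
  then show ?thesis
    using lower_bound[OF assms(1), of p] upper_bound[OF assms(1,2) _ assms(3)]
    unfolding betti_J card_strand_index by (metis le_antisym)
qed

end

theorem theorem1:
  fixes a b :: nat
    and e :: "nat \<Rightarrow> int list"
    and d :: "nat \<Rightarrow> (nat \<Rightarrow> (nat \<times> nat \<Rightarrow>\<^sub>0 nat) \<Rightarrow>\<^sub>0 'k::field)
                  \<Rightarrow> (nat \<Rightarrow> (nat \<times> nat \<Rightarrow>\<^sub>0 nat) \<Rightarrow>\<^sub>0 'k)"
    and aug :: "(nat \<Rightarrow> (nat \<times> nat \<Rightarrow>\<^sub>0 nat) \<Rightarrow>\<^sub>0 'k) \<Rightarrow> ((nat \<times> nat \<times> nat) \<Rightarrow>\<^sub>0 'k)"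
  assumes "3 \<le> a" and "a \<le> b"
    and "minimal_graded_free_resolution (grid a b) (coord_ring a b) e d aug"
  shows "(\<forall>p \<ge> a * b + a. betti_entry e p 1 = p * (((a + 1) * b) choose (p + 1))) \<and>
         (\<forall>p. p = a * b + a - 1 \<longrightarrow>
              betti_entry e p 1 = p * (((a + 1) * b) choose (p + 1)) + p)"
proof -
  interpret resolution a b e d aug by (rule resolution.intro) (rule assms(3))
  have b: "0 < b" using assms(1,2) by linarith
  show ?thesis
  proof (intro conjI allI impI)
    fix p assume "a * b + a \<le> p"
    then show "betti_entry e p 1 = p * (((a + 1) * b) choose (p + 1))"
      using betti_first_row[OF assms(1) b, of p] by simp
  next
    fix p assume "p = a * b + a - 1"
    then have "p + 1 = a * b + a" using assms(1) by simp
    then show "betti_entry e p 1 = p * (((a + 1) * b) choose (p + 1)) + p"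
      using betti_first_row[OF assms(1) b, of p] by simp
  qed
qed

end
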